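(* Let $\lambda$ be an $\ell$-multipartition of $n$, let $\kappa\in\mathbb Z^\ell$ satisfy $\kappa_l-\kappa_{l+1}>n$ for $1\le l<\ell$, and let $\mathcal O=\mathbb Z[t,t^{-1}]$ with $t$ an indeterminate. Then the Gram determinant of the Specht module $S^\lambda$ of $\mathscr H_n(\mathcal O,t,\kappa)$ with respect to the Murphy basis is $$\det\mathcal G^\lambda=t^{\ell(\lambda)}\prod_{e\ge2}\Phi_e(t)^{\deg_e(\lambda)},$$ where $\ell(\lambda)=\sum_{\mathfrak t\in\mathrm{Std}(\lambda)}\ell(d(\mathfrak t))$ and $\Phi_e(t)$ is the $e$th cyclotomic polynomial.
   Context: Quantum integers: $[d]=1+t+\dots+t^{d-1}$ for $d\ge0$, $[d]=-(t^{-1}+\dots+t^{d})$ for $d<0$. The cyclotomic Hecke algebra $\mathscr H_n(\mathcal O,t,\kappa)$ is the unital $\mathcal O$-algebra with generators $L_1,\dots,L_n,T_1,\dots,T_{n-1}$ and relations $\prod_{l=1}^\ell(L_1-[\kappa_l])=0$, $(T_r+1)(T_r-t)=0$, $L_rL_s=L_sL_r$, $T_rT_s=T_sT_r$ ($|r-s|>1$), $T_sT_{s+1}T_s=T_{s+1}T_sT_{s+1}$, $T_rL_s=L_sT_r$ ($s\ne r,r+1$), $L_{r+1}(T_r-t+1)=T_rL_r+1$. For $w\in\mathfrak S_n$ with reduced expression $w=s_{r_1}\cdots s_{r_k}$ ($s_r=(r,r+1)$), $T_w=T_{r_1}\cdots T_{r_k}$ and $\ell(w)=k$. An $\ell$-multipartition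 $\lambda=(\lambda^{(1)},\dots,\lambda^{(\ell)})$ of $n$ has diagram the nodes $(l,r,c)$ with $1\le c\le\lambda^{(l)}_r$; a $\lambda$-tableau is a bijection from the diagram to $\{1,\dots,n\}$, standard if entries increase along rows and down columns in each component; $\mathrm{Std}(\lambda)$ is the set of these. Dominance: $\lambda\trianglerighteq\mu$ iff $\sum_{k<l}|\lambda^{(k)}|+\sum_{j\le i}\lambda^{(l)}_j\ge\sum_{k<l}|\mu^{(k)}|+\sum_{j\le i}\mu^{(l)}_j$ for all $l,i$. $\mathfrak t^\lambda$ is the tableau with $1,\dots,n$ entered in order along the rows of component 1, then component 2, etc.; $\mathfrak S_n$ acts on tableaux on the right by permuting entries, and $d(\mathfrak t)$ is defined by $\mathfrak t=\mathfrak t^\lambda d(\mathfrak t)$. $\mathfrak S_\lambda$ is the row stabiliser of $\mathfrak t^\lambda$. Set $u_\lambda=\prod_{1\le l<\ell}\prod_{r=1}^{|\lambda^{(1)}|+\dots+|\lambda^{(l)}|}t^{-\kappa_{l+1}}(L_r-[\kappa_{l+1}])$, $x_\lambda=\sum_{w\in\mathfrak S_\lambda}T_w$, $m_\lambda=u_\lambda x_\lambda$ and $m_{\mathfrak s\mathfrak t}=T_{d(\mathfrak s)^{-1}}m_\lambda T_{d(\mathfrak t)}$ for $\mathfrak s,\mathfrak t\in\mathrm{Std}(\lambda)$ (the Murphy basis, a cellular basis of $\mathscr H_n$). Let $\mathscr H^{\rhd\lambda}$ be the $\mathcal O$-span of $m_{\mathfrak u\mathfrak v}$ with $\mathfrak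 u,\mathfrak v\in\mathrm{Std}(\mu)$, $\mu\rhd\lambda$. The Gram matrix is $\mathcal G^\lambda=(\langle m_{\mathfrak s},m_{\mathfrak t}\rangle)_{\mathfrak s,\mathfrak t\in\mathrm{Std}(\lambda)}$ where $\langle m_{\mathfrak s},m_{\mathfrak t}\rangle\in\mathcal O$ is determined by $m_{\mathfrak t^\lambda\mathfrak s}m_{\mathfrak t\mathfrak t^\lambda}\equiv\langle m_{\mathfrak s},m_{\mathfrak t}\rangle m_{\mathfrak t^\lambda\mathfrak t^\lambda}\pmod{\mathscr H^{\rhd\lambda}}$. Degrees: for $e\ge2$ the residue of node $(l,r,c)$ is $\kappa_l+c-r\bmod e$. Node $\beta=(l',r',c')$ is below $\alpha=(l,r,c)$ if $(l,r,c)<(l',r',c')$ lexicographically. A node $A\notin\mu$ is addable if $\mu\cup\{A\}$ is a multipartition; $B\in\mu$ is removable if $\mu\setminus\{B\}$ is a multipartition. For an $i$-node $A$ (residue $i$), $d_A(\mu)$ = #(addable $i$-nodes of $\mu$ strictly below $A$) $-$ #(removable $i$-nodes of $\mu$ strictly below $A$). For a standard $\mu$-tableau $\mathfrak t$ with $m$ entries, $\deg_e(\mathfrak t)=0$ if $m=0$, else $\deg_e(\mathfrak t)=\deg_e(\mathfrak t_{\downarrow(m-1)})+d_A(\mu)$ with $A=\mathfrak t^{-1}(m)$ and $\mathfrak t_{\downarrow(m-1)}$ the subtableau containing $1,\dots,m-1$. $\deg_e(\lambda)=\sum_{\mathfrak t\in\mathrm{Std}(\lambda)}\deg_e(\mathfrak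 t)$. *)

theory Defs
  imports "HOL-Computational_Algebra.Computational_Algebra"
          "HOL-Combinatorics.Combinatorics"
begin

section \<open>Base ring O = Z[t,t^-1], realised inside rat fls\<close>

type_synonym laurent = "rat fls"

definition laurent_ring :: "laurent set" where
  "laurent_ring = {f. finite {k. fls_nth f k \<noteq> 0} \<and> (\<forall>k. fls_nth f k \<in> \<int>)}"

abbreviation tt :: laurent where "tt \<equiv> fls_X"

definition qint :: "int \<Rightarrow> laurent" where
  "qint d = (if d \<ge> 0 then (\<Sum>i<nat d. tt ^ i)
             else - (\<Sum>i\<in>{1..nat (-d)}. tt powi (- int i)))"

function cyclo :: "nat \<Rightarrow> rat poly" where
  "cyclo e = (if e = 0 then 1
     else (monom 1 e - 1) div (\<Prod>d\<in>{d. d dvd e \<and> d < e}. cyclo d))"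
  by auto
termination
  by (relation "measure id") auto

definition cyclo_t :: "nat \<Rightarrow> laurent" where
  "cyclo_t e = fps_to_fls (fps_of_poly (cyclo e))"

section \<open>Multipartitions and tableaux (components, rows, columns 0-based)\<close>

type_synonym node = "nat \<times> nat \<times> nat"   \<comment> \<open>(component, row, column)\<close>
type_synonym mpart = "nat list list"
type_synonym tableau = "node \<Rightarrow> nat"

definition is_partition :: "nat list \<Rightarrow> bool" where
  "is_partition p \<longleftrightarrow> sorted (rev p) \<and> 0 \<notin> set p"

definition multipartition :: "nat \<Rightarrow> nat \<Rightarrow> mpart \<Rightarrow> bool" where
  "multipartition ell n lam \<longleftrightarrow> length lam = ell \<and> (\<forall>p\<in>set lam. is_partition p)
      \<and> sum_list (map sum_list lam) = n"

definition diagram :: "mpart \<Rightarrow> node set" where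
  "diagram lam = {(l, r, c). l < length lam \<and> r < length (lam ! l) \<and> c < lam ! l ! r}"

definition std :: "nat \<Rightarrow> mpart \<Rightarrow> tableau set" where
  "std n lam = {t. bij_betw t (diagram lam) {1..n} \<and> (\<forall>x. x \<notin> diagram lam \<longrightarrow> t x = 0)
      \<and> (\<forall>l r c. (l, r, c + 1) \<in> diagram lam \<longrightarrow> t (l, r, c) < t (l, r, c + 1))
      \<and> (\<forall>l r c. (l, r + 1, c) \<in> diagram lam \<longrightarrow> t (l, r, c) < t (l, r + 1, c))}"

definition tlam :: "mpart \<Rightarrow> tableau" where
  "tlam lam = (\<lambda>(l, r, c). if (l, r, c) \<in> diagram lam then
      sum_list (map sum_list (take l lam)) + sum_list (take r (lam ! l)) + c + 1 else 0)"

definition dominates :: "mpart \<Rightarrow> mpart \<Rightarrow> bool" where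
  "dominates lam mu \<longleftrightarrow> (\<forall>l < length lam. \<forall>i.
      sum_list (map sum_list (take l lam)) + sum_list (take i (lam ! l))
      \<ge> sum_list (map sum_list (take l mu)) + sum_list (take i (mu ! l)))"

definition strictly_dominates :: "mpart \<Rightarrow> mpart \<Rightarrow> bool" where
  "strictly_dominates lam mu \<longleftrightarrow> dominates lam mu \<and> lam \<noteq> mu"

section \<open>Symmetric group: permutations act on the right, w1 w2 = first w1 then w2\<close>

definition word_perm :: "nat list \<Rightarrow> nat \<Rightarrow> nat" where
  "word_perm rs = fold (\<lambda>r f. Transposition.transpose r (r + 1) \<circ> f) rs id"

definition perm_length :: "nat \<Rightarrow> (nat \<Rightarrow> nat) \<Rightarrow> nat" where
  "perm_length n w = (LEAST k. \<exists>rs. length rs = k \<and> set rs \<subseteq> {1..<n} \<and> word_perm rs = w)"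

definition reduced_word :: "nat \<Rightarrow> (nat \<Rightarrow> nat) \<Rightarrow> nat list \<Rightarrow> bool" where
  "reduced_word n w rs \<longleftrightarrow> set rs \<subseteq> {1..<n} \<and> word_perm rs = w \<and> length rs = perm_length n w"

definition dperm :: "nat \<Rightarrow> mpart \<Rightarrow> tableau \<Rightarrow> nat \<Rightarrow> nat" where
  "dperm n lam t = (THE d. d permutes {1..n} \<and> (\<forall>x\<in>diagram lam. d (tlam lam x) = t x))"

definition row_stab :: "nat \<Rightarrow> mpart \<Rightarrow> (nat \<Rightarrow> nat) set" where
  "row_stab n lam = {w. w permutes {1..n} \<and> (\<forall>x\<in>diagram lam. \<exists>y\<in>diagram lam.
      fst y = fst x \<and> fst (snd y) = fst (snd x) \<and> w (tlam lam x) = tlam lam y)}"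

section \<open>Free O-algebra on the generators, as coefficient functions on words\<close>

datatype gen = L nat | T nat

type_synonym falg = "gen list \<Rightarrow> laurent"

definition fa_monom :: "gen list \<Rightarrow> falg" where
  "fa_monom w = (\<lambda>v. if v = w then 1 else 0)"

definition fa_one :: falg where "fa_one = fa_monom []"
definition fa_zero :: falg where "fa_zero = (\<lambda>v. 0)"
definition fa_add :: "falg \<Rightarrow> falg \<Rightarrow> falg" where "fa_add f g = (\<lambda>v. f v + g v)"
definition fa_sub :: "falg \<Rightarrow> falg \<Rightarrow> falg" where "fa_sub f g = (\<lambda>v. f v - g v)"
definition fa_smult :: "laurent \<Rightarrow> falg \<Rightarrow> falg" where "fa_smult c f = (\<lambda>v. c * f v)"
definition fa_mult :: "falg \<Rightarrow> falg \<Rightarrow> falg" where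
  "fa_mult f g = (\<lambda>w. \<Sum>(u, v)\<in>{(u, v). u @ v = w}. f u * g v)"

definition fa_prod :: "falg list \<Rightarrow> falg" where
  "fa_prod xs = foldr fa_mult xs fa_one"

definition fa_sum :: "('a \<Rightarrow> falg) \<Rightarrow> 'a set \<Rightarrow> falg" where
  "fa_sum F S = (\<lambda>v. \<Sum>x\<in>S. F x v)"

abbreviation gL :: "nat \<Rightarrow> falg" where "gL r \<equiv> fa_monom [L r]"
abbreviation gT :: "nat \<Rightarrow> falg" where "gT r \<equiv> fa_monom [T r]"
abbreviation scal :: "laurent \<Rightarrow> falg" where "scal c \<equiv> fa_smult c fa_one"

definition valid_gen :: "nat \<Rightarrow> gen \<Rightarrow> bool" where
  "valid_gen n g = (case g of L r \<Rightarrow> 1 \<le> r \<and> r \<le> n | T r \<Rightarrow> 1 \<le> r \<and> r < n)"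

text \<open>Defining relations of H_n(O,t,kappa) (kappa is a list of length ell, 0-indexed)\<close>
definition hecke_relators :: "nat \<Rightarrow> int list \<Rightarrow> falg set" where
  "hecke_relators n kappa =
     {fa_prod (map (\<lambda>k. fa_sub (gL 1) (scal (qint k))) kappa)}
   \<union> {fa_mult (fa_add (gT r) fa_one) (fa_sub (gT r) (scal tt)) | r. 1 \<le> r \<and> r < n}
   \<union> {fa_sub (fa_mult (gL r) (gL s)) (fa_mult (gL s) (gL r)) | r s. 1 \<le> r \<and> r \<le> n \<and> 1 \<le> s \<and> s \<le> n}
   \<union> {fa_sub (fa_mult (gT r) (gT s)) (fa_mult (gT s) (gT r)) | r s.
        1 \<le> r \<and> r < n \<and> 1 \<le> s \<and> s < n \<and> (r + 1 < s \<or> s + 1 < r)}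
   \<union> {fa_sub (fa_prod [gT s, gT (s+1), gT s]) (fa_prod [gT (s+1), gT s, gT (s+1)]) | s.
        1 \<le> s \<and> s + 1 < n}
   \<union> {fa_sub (fa_mult (gT r) (gL s)) (fa_mult (gL s) (gT r)) | r s.
        1 \<le> r \<and> r < n \<and> 1 \<le> s \<and> s \<le> n \<and> s \<noteq> r \<and> s \<noteq> r + 1}
   \<union> {fa_sub (fa_mult (gL (r+1)) (fa_add (fa_sub (gT r) (scal tt)) fa_one))
             (fa_add (fa_mult (gT r) (gL r)) fa_one) | r. 1 \<le> r \<and> r < n}"

inductive_set fa_ideal :: "nat \<Rightarrow> falg set \<Rightarrow> falg set" for n R where
  zero: "fa_zero \<in> fa_ideal n R"
| base: "r \<in> R \<Longrightarrow> r \<in> fa_ideal n R"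
| add: "a \<in> fa_ideal n R \<Longrightarrow> b \<in> fa_ideal n R \<Longrightarrow> fa_add a b \<in> fa_ideal n R"
| smult: "a \<in> fa_ideal n R \<Longrightarrow> c \<in> laurent_ring \<Longrightarrow> fa_smult c a \<in> fa_ideal n R"
| lmult: "a \<in> fa_ideal n R \<Longrightarrow> valid_gen n g \<Longrightarrow> fa_mult (fa_monom [g]) a \<in> fa_ideal n R"
| rmult: "a \<in> fa_ideal n R \<Longrightarrow> valid_gen n g \<Longrightarrow> fa_mult a (fa_monom [g]) \<in> fa_ideal n R"

inductive_set fa_span :: "falg set \<Rightarrow> falg set" for S where
  zero: "fa_zero \<in> fa_span S"
| base: "s \<in> S \<Longrightarrow> s \<in> fa_span S"
| add: "a \<in> fa_span S \<Longrightarrow> b \<in> fa_span S \<Longrightarrow> fa_add a b \<in> fa_span S"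
| smult: "a \<in> fa_span S \<Longrightarrow> c \<in> laurent_ring \<Longrightarrow> fa_smult c a \<in> fa_span S"

definition Tw :: "nat \<Rightarrow> (nat \<Rightarrow> nat) \<Rightarrow> falg" where
  "Tw n w = fa_monom (map T (SOME rs. reduced_word n w rs))"

definition u_lam :: "int list \<Rightarrow> mpart \<Rightarrow> falg" where
  "u_lam kappa lam = fa_prod (concat (map (\<lambda>l.
       map (\<lambda>r. fa_smult (tt powi (- kappa ! (l + 1))) (fa_sub (gL r) (scal (qint (kappa ! (l + 1))))))
           [1..<sum_list (map sum_list (take (l + 1) lam)) + 1])
     [0..<length lam - 1]))"

definition x_lam :: "nat \<Rightarrow> mpart \<Rightarrow> falg" where
  "x_lam n lam = fa_sum (Tw n) (row_stab n lam)"

definition m_lam :: "nat \<Rightarrow> int list \<Rightarrow> mpart \<Rightarrow> falg" where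
  "m_lam n kappa lam = fa_mult (u_lam kappa lam) (x_lam n lam)"

definition murphy :: "nat \<Rightarrow> int list \<Rightarrow> mpart \<Rightarrow> tableau \<Rightarrow> tableau \<Rightarrow> falg" where
  "murphy n kappa lam s t =
     fa_prod [Tw n (inv (dperm n lam s)), m_lam n kappa lam, Tw n (dperm n lam t)]"

definition hecke_above :: "nat \<Rightarrow> int list \<Rightarrow> mpart \<Rightarrow> falg set" where
  "hecke_above n kappa lam = fa_span {murphy n kappa mu u v | mu u v.
      multipartition (length lam) n mu \<and> strictly_dominates mu lam \<and> u \<in> std n mu \<and> v \<in> std n mu}"

definition cong_above :: "nat \<Rightarrow> int list \<Rightarrow> mpart \<Rightarrow> falg \<Rightarrow> falg \<Rightarrow> bool" where
  "cong_above n kappa lam a b \<longleftrightarrow> (\<exists>i\<in>fa_ideal n (hecke_relators n kappa).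
      \<exists>h\<in>hecke_above n kappa lam. fa_sub a b = fa_add i h)"

definition gram :: "nat \<Rightarrow> int list \<Rightarrow> mpart \<Rightarrow> tableau \<Rightarrow> tableau \<Rightarrow> laurent" where
  "gram n kappa lam s t = (THE c. c \<in> laurent_ring \<and>
     cong_above n kappa lam
       (fa_mult (murphy n kappa lam (tlam lam) s) (murphy n kappa lam t (tlam lam)))
       (fa_smult c (murphy n kappa lam (tlam lam) (tlam lam))))"

definition det_on :: "'a set \<Rightarrow> ('a \<Rightarrow> 'a \<Rightarrow> 'b::comm_ring_1) \<Rightarrow> 'b" where
  "det_on S G = (\<Sum>p\<in>{p. p permutes S}. of_int (sign p) * (\<Prod>s\<in>S. G s (p s)))"

definition gram_det :: "nat \<Rightarrow> int list \<Rightarrow> mpart \<Rightarrow> laurent" where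
  "gram_det n kappa lam = det_on (std n lam) (gram n kappa lam)"

definition len_lam :: "nat \<Rightarrow> mpart \<Rightarrow> nat" where
  "len_lam n lam = (\<Sum>t\<in>std n lam. perm_length n (dperm n lam t))"

definition residue :: "nat \<Rightarrow> int list \<Rightarrow> node \<Rightarrow> int" where
  "residue e kappa = (\<lambda>(l, r, c). (kappa ! l + int c - int r) mod int e)"

definition node_below :: "node \<Rightarrow> node \<Rightarrow> bool" where
  "node_below b a \<longleftrightarrow> (case a of (l, r, c) \<Rightarrow> case b of (l', r', c') \<Rightarrow>
      l < l' \<or> (l = l' \<and> (r < r' \<or> (r = r' \<and> c < c'))))"

definition is_mp_diagram :: "nat \<Rightarrow> node set \<Rightarrow> bool" where
  "is_mp_diagram ell D \<longleftrightarrow> (\<exists>nu. length nu = ell \<and> (\<forall>p\<in>set nu. is_partition p) \<and> diagram nu = D)"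

definition addable :: "nat \<Rightarrow> node set \<Rightarrow> node set" where
  "addable ell D = {A. A \<notin> D \<and> is_mp_diagram ell (insert A D)}"

definition removable :: "nat \<Rightarrow> node set \<Rightarrow> node set" where
  "removable ell D = {B. B \<in> D \<and> is_mp_diagram ell (D - {B})}"

definition d_node :: "nat \<Rightarrow> int list \<Rightarrow> node \<Rightarrow> node set \<Rightarrow> int" where
  "d_node e kappa A D =
     int (card {B\<in>addable (length kappa) D. residue e kappa B = residue e kappa A \<and> node_below B A})
   - int (card {B\<in>removable (length kappa) D. residue e kappa B = residue e kappa A \<and> node_below B A})"

fun deg_sub :: "nat \<Rightarrow> int list \<Rightarrow> tableau \<Rightarrow> nat \<Rightarrow> int" where
  "deg_sub e kappa t 0 = 0"
| "deg_sub e kappa t (Suc m) = deg_sub e kappa t m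
     + d_node e kappa (THE A. t A = Suc m) {x. 1 \<le> t x \<and> t x \<le> Suc m}"

definition deg_lam :: "nat \<Rightarrow> nat \<Rightarrow> int list \<Rightarrow> mpart \<Rightarrow> int" where
  "deg_lam e n kappa lam = (\<Sum>t\<in>std n lam. deg_sub e kappa t n)"

end

theory Submission
 imports Defs "HOL-Computational_Algebra.Field_as_Ring"
begin

text \<open>The algebra acts on the seminormal module of each shape: functions on the standard tableaux, with
explicit rational matrices. There \<open>mm mu\<close> acts as zero unless the shape dominates \<open>mu\<close>, and for the shape itself
it is \<open>gam\<close> times the projection to the initial tableau. Since the Murphy elements span the right ideal
of \<open>m_lam\<close> up to larger shapes, comparing actions turns the Gram form into \<open>gam\<close> times an
explicit diagonal form, evaluated at vectors which are triangular in the seminormal basis. So the determinant is a product of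
quotients of quantum integers over tableaux; telescoping along the rows of each subtableau identifies the exponent
of every cyclotomic polynomial with the degree.\<close>

text \<open>The Gram entry is a definite description, so a coefficient modulo larger shapes must be
  shown to exist and to be unique, while neither linear independence nor cellularity of the Murphy
  elements is given beforehand. Existence over \<open>O\<close> needs straightening: Garnir
  relations for \<open>T\<close>, and for \<open>L\<close> a rule that moves a node to an earlier
  component. Straightening controls only a lexicographic order on shapes. Dominance is recovered
  afterwards by induction over shapes, from the module of each shape that occurs in a straightened
  product; the rank one operators by which the \<open>m_st\<close> act are linearly independent, so
  coefficients can be read off. The gap between consecutive entries of \<open>kappa\<close> keeps
  denominators nonzero and makes the content difference \<open>d\<close> of every inverted pair at
  least 2, so only quantum integers of positive argument occur. A pair contributes
  \<open>[d + 1] [d - 1]\<close> over the square of \<open>[d]\<close>. Its exponent at a cyclotomic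
  polynomial is a second difference of a divisibility indicator, which is why sums over rows
  collapse to their ends, that is, to addable and removable nodes.\<close>

section \<open>Permutations, inversions and reduced words\<close>

definition sr :: "nat => nat => nat" where "sr r = Transposition.transpose r (Suc r)"

lemma sr_apply: "sr r i = (if i = r then Suc r else if i = Suc r then r else i)"
 by (simp add: sr_def Transposition.transpose_def)

definition invs :: "nat => (nat => nat) => (nat \<times> nat) set" where
 "invs n w = {(i, j). 1 <= i \<and> i < j \<and> j <= n \<and> w j < w i}"

lemma finite_invs [simp]: "finite (invs n w)"
 by (rule finite_subset[of _ "{..n} \<times> {..n}"]) (auto simp: invs_def)

lemma sr_permutes: "1 <= r ==> r < n ==> sr r permutes {1..n}"
 unfolding sr_def by (rule permutes_swap_id) auto

lemma sr_sr [simp]: "sr r \<circ> sr r = id" "w \<circ> sr r \<circ> sr r = w" "sr r \<circ> (sr r \<circ> w) = w"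
 by (auto simp: fun_eq_iff sr_apply)

lemma word_perm_Nil [simp]: "word_perm [] = id"
 by (simp add: word_perm_def)

lemma word_perm_snoc: "word_perm (rs @ [r]) = sr r \<circ> word_perm rs"
 by (simp add: word_perm_def sr_def)

lemma invs_id [simp]: "invs n id = {}"
 by (auto simp: invs_def)

lemma word_perm_append: "word_perm (rs @ ss) = word_perm ss \<circ> word_perm rs"
 by (induction ss rule: rev_induct)
  (simp_all add: append_assoc[symmetric] word_perm_snoc o_assoc del: append_assoc)

text \<open>The first letter acts first, in keeping with the right action. As \<open>\<circ>\<close>
  applies its right argument first, products in the algebra correspond to compositions in the
  opposite order.\<close>

lemma word_perm_Cons: "word_perm (r # rs) = word_perm rs \<circ> sr r"
 using word_perm_append[of "[r]" rs] word_perm_snoc[of "[]" r] by (simp only: append_Cons append_Nil word_perm_Nil comp_id)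

lemma word_perm_permutes: "set rs \<subseteq> {1..<n} ==> word_perm rs permutes {1..n}"
proof (induction rs rule: rev_induct)
 case (snoc r rs)
 then show ?case
  unfolding word_perm_snoc by (intro permutes_compose sr_permutes) auto
qed (simp only: word_perm_Nil permutes_id)

text \<open>Applying \<open>sr r\<close> to both members of a pair keeps their order unless the pair
  is \<open>(r, Suc r)\<close>. This matches the inversions of \<open>w\<close> with those of
  \<open>w \<circ> sr r\<close> other than that one pair.\<close>

lemma card_invs_up:
 assumes w: "w permutes {1..n}" and r: "1 <= r" "r < n" and up: "w r < w (Suc r)"
 shows "card (invs n (w \<circ> sr r)) = Suc (card (invs n w))"
proof -
 define f where "f = (\<lambda>(i, j). (sr r i, sr r j))"
 have ss: "sr r (sr r i) = i" for i by (simp add: sr_apply)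
 have lt: "sr r i < sr r j" if "i < j" "(i, j) ~= (r, Suc r)" for i j
  using that by (auto simp: sr_apply)
 have rng: "1 <= sr r i \<longleftrightarrow> 1 <= i" "sr r i <= n \<longleftrightarrow> i <= n" for i
  using r by (auto simp: sr_apply)
 have eq: "invs n (w \<circ> sr r) = insert (r, Suc r) (f ` invs n w)"
 proof (intro set_eqI iffI)
  fix p assume p: "p \<in> invs n (w \<circ> sr r)"
  obtain i j where ij: "p = (i, j)" by fastforce
  show "p \<in> insert (r, Suc r) (f ` invs n w)"
  proof (cases "(i, j) = (r, Suc r)")
   case False
   then have "(sr r i, sr r j) \<in> invs n w"
    using p lt[of i j] rng by (auto simp: invs_def ij)
   moreover have "p = f (sr r i, sr r j)" by (simp add: f_def ij ss)
   ultimately show ?thesis by blast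
  qed (simp add: ij)
 next
  fix p assume "p \<in> insert (r, Suc r) (f ` invs n w)"
  then consider "p = (r, Suc r)" | i j where "(i, j) \<in> invs n w" "p = (sr r i, sr r j)"
   by (auto simp: f_def)
  then show "p \<in> invs n (w \<circ> sr r)"
  proof cases
   case 1
   then show ?thesis using r up by (auto simp: invs_def sr_apply)
  next
   case 2
   then have "(i, j) ~= (r, Suc r)" using up by (auto simp: invs_def)
   then show ?thesis using 2 lt[of i j] rng by (auto simp: invs_def ss)
  qed
 qed
 have "inj_on f (invs n w)"
  by (rule inj_on_inverseI[of _ f]) (auto simp: f_def ss)
 moreover have "(r, Suc r) \<notin> f ` invs n w"
  using up by (auto simp: f_def invs_def sr_apply split: if_splits)
 ultimately show ?thesis
  by (simp add: eq card_image)
qed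

lemma card_invs_down:
 assumes w: "w permutes {1..n}" and r: "1 <= r" "r < n" and down: "w r > w (Suc r)"
 shows "card (invs n w) = Suc (card (invs n (w \<circ> sr r)))"
proof -
 have "(w \<circ> sr r) permutes {1..n}"
  using w r by (intro permutes_compose sr_permutes)
 from card_invs_up[OF this r] have "card (invs n (w \<circ> sr r \<circ> sr r)) = Suc (card (invs n (w \<circ> sr r)))"
  using down by (simp add: sr_apply)
 then show ?thesis unfolding sr_sr .
qed

lemma card_invs_inv:
 assumes w: "w permutes {1..n}"
 shows "card (invs n (inv w)) = card (invs n w)"
proof -
 define f where "f = (\<lambda>(i, j). (w j, w i))"
 have inj: "inj w" using w by (rule permutes_inj)
 have inr: "\<And>i. w i \<in> {1..n} \<longleftrightarrow> i \<in> {1..n}"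
  using permutes_in_image[OF w] .
 have "invs n (inv w) = f ` invs n w"
 proof (intro set_eqI iffI)
  fix p assume p: "p \<in> invs n (inv w)"
  obtain i j where ij: "p = (i, j)" by fastforce
  have "inv w i \<in> {1..n}" "inv w j \<in> {1..n}"
   using p unfolding ij permutes_in_image[OF permutes_inv[OF w]] by (simp_all add: invs_def)
  then have "(inv w j, inv w i) \<in> invs n w"
   using p unfolding ij by (simp add: invs_def permutes_inverses(1)[OF w])
  moreover have "p = f (inv w j, inv w i)"
   by (simp add: f_def ij permutes_inverses[OF w])
  ultimately show "p \<in> f ` invs n w" by blast
 next
  fix p assume "p \<in> f ` invs n w"
  then obtain i j where ij: "(i, j) \<in> invs n w" "p = (w j, w i)"
   by (auto simp: f_def)
  have "w i \<in> {1..n}" "w j \<in> {1..n}"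
   using ij(1) unfolding inr by (simp_all add: invs_def)
  then show "p \<in> invs n (inv w)"
   using ij(1) unfolding ij(2) by (simp add: invs_def permutes_inverses(2)[OF w])
 qed
 moreover have "inj_on f (invs n w)"
  using inj by (auto simp: inj_on_def f_def)
 ultimately show ?thesis by (simp add: card_image)
qed

lemma bij_sr: "bij (sr r)" and inv_sr: "inv (sr r) = sr r"
 by (simp_all add: sr_def)

lemma inv_comp_sr:
 assumes "w permutes S"
 shows "inv (w \<circ> sr r) = sr r \<circ> inv w" "inv (sr r \<circ> w) = inv w \<circ> sr r"
 using assms by (simp_all add: o_inv_distrib permutes_bij bij_sr inv_sr)

text \<open>An increasing map satisfies \<open>i <= w i\<close> by upward induction; downward
  induction from \<open>n\<close> then forces equality.\<close>

lemma increasing_permutes_id: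
 fixes w :: "nat => nat"
 assumes w: "w permutes {1..n}" and emp: "invs n w = {}"
 shows "w = id"
proof -
 have inr: "\<And>i. w i \<in> {1..n} \<longleftrightarrow> i \<in> {1..n}"
  using permutes_in_image[OF w] .
 have mono: "w i < w j" if "1 <= i" "i < j" "j <= n" for i j
  using emp that permutes_inj[OF w] by (force simp: invs_def inj_def not_less_iff_gr_or_eq)
 have ge: "i <= w i" if "1 <= i" "i <= n" for i
  using that
 proof (induction i rule: nat_induct_at_least)
  case base then show ?case using inr[of 1] by auto
 next
  case (Suc i) then show ?case using mono[of i "Suc i"] by auto
 qed
 have "w i = i" if "1 <= i" "i <= n" for i
  using that
 proof (induction "n - i" arbitrary: i)
  case 0 then show ?case using ge[of i] inr[of i] by auto
 next
  case (Suc k)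
  then have "w (Suc i) = Suc i" by auto
  then show ?case using mono[of i "Suc i"] ge[of i] Suc(2-) inr[of i]
   by (cases "i = n") auto
 qed
 moreover have "w i = i" if "i \<notin> {1..n}" for i using w that by (simp add: permutes_def)
 ultimately show ?thesis by (auto simp: fun_eq_iff)
qed

lemma descent_exists:
 fixes w :: "nat => nat"
 assumes w: "w permutes {1..n}" and ij: "1 <= i" "i < j" "j <= n" "w j < w i"
 obtains r where "i <= r" "r < j" "w (Suc r) < w r"
proof -
 have "\<exists>r. i <= r \<and> r < j \<and> w (Suc r) < w r"
 proof (rule ccontr)
  assume *: "\<not> ?thesis"
  have "w i <= w k" if "i <= k" "k <= j" for k
   using that
  proof (induction k rule: nat_induct_at_least)
   case (Suc k)
   then show ?case using * by (force simp: not_less)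
  qed simp
  from this[of j] ij show False by simp
 qed
 with that show ?thesis by blast
qed

lemma exists_word:
 assumes "w permutes {1..n}"
 shows "\<exists>rs. set rs \<subseteq> {1..<n} \<and> word_perm rs = w \<and> length rs = card (invs n w)"
 using assms
proof (induction "card (invs n w)" arbitrary: w)
 case 0
 then have "w = id" by (intro increasing_permutes_id) auto
 with 0 show ?case by (intro exI[of _ "[]"]) auto
next
 case (Suc k)
 then have "invs n w ~= {}" by (metis card.empty nat.simps(3))
 then obtain i j where ij: "1 <= i" "i < j" "j <= n" "w j < w i"
  unfolding invs_def by blast
 obtain r where r': "i <= r" "r < j" "w (Suc r) < w r"
  using descent_exists[OF Suc.prems ij] by blast
 then have r: "1 <= r" "r < n" "w (Suc r) < w r" using ij by linarith+
 have c: "card (invs n w) = Suc (card (invs n (w \<circ> sr r)))"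
  by (rule card_invs_down) (use Suc r in auto)
 have p: "(w \<circ> sr r) permutes {1..n}"
  using Suc.prems r by (intro permutes_compose sr_permutes)
 obtain rs where "set rs \<subseteq> {1..<n}" "word_perm rs = w \<circ> sr r" "length rs = card (invs n (w \<circ> sr r))"
  using Suc.hyps(1)[of "w \<circ> sr r"] c p Suc.hyps(2) by auto
 then show ?case
  using r c by (intro exI[of _ "r # rs"]) (auto simp: word_perm_Cons)
qed

lemma card_invs_le_length:
 assumes "set rs \<subseteq> {1..<n}"
 shows "card (invs n (word_perm rs)) <= length rs"
 using assms
proof (induction rs)
 case Nil
 have "invs n (word_perm []) = {}" by (auto simp: invs_def)
 then show ?case by (simp only: card.empty le0)
next
 case (Cons r rs)
 have p: "word_perm rs permutes {1..n}" using Cons.prems by (intro word_perm_permutes) auto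
 have r: "1 <= r" "r < n" using Cons.prems by auto
 have ne: "word_perm rs r ~= word_perm rs (Suc r)"
  using permutes_inj[OF p] by (metis injD n_not_Suc_n)
 show ?case
 proof (cases "word_perm rs r < word_perm rs (Suc r)")
  case True
  then show ?thesis using card_invs_up[OF p r True] Cons unfolding word_perm_Cons by (simp add: comp_def)
 next
  case False
  then show ?thesis using card_invs_down[OF p r] ne Cons unfolding word_perm_Cons by (simp add: comp_def)
 qed
qed

text \<open>Each letter changes the number of inversions by one, so a word has at least that many
  letters; cancelling adjacent descents produces a word with exactly that many.\<close>

lemma perm_length_eq:
 assumes w: "w permutes {1..n}"
 shows "perm_length n w = card (invs n w)"
 unfolding perm_length_def
proof (rule Least_equality)
 show "\<exists>rs. length rs = card (invs n w) \<and> set rs \<subseteq> {1..<n} \<and> word_perm rs = w"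
  using exists_word[OF w] by blast
next
 fix k assume "\<exists>rs. length rs = k \<and> set rs \<subseteq> {1..<n} \<and> word_perm rs = w"
 then show "card (invs n w) <= k" using card_invs_le_length by blast
qed

lemma reduced_word_iff:
 assumes "w permutes {1..n}"
 shows "reduced_word n w rs \<longleftrightarrow> set rs \<subseteq> {1..<n} \<and> word_perm rs = w \<and> length rs = card (invs n w)"
 by (simp add: reduced_word_def perm_length_eq[OF assms])

lemma reduced_word_exists:
 assumes "w permutes {1..n}"
 shows "\<exists>rs. reduced_word n w rs"
 using exists_word[OF assms] by (simp add: reduced_word_iff[OF assms])

lemma reduced_word_some:
 assumes "w permutes {1..n}"
 shows "reduced_word n w (SOME rs. reduced_word n w rs)"
 using reduced_word_exists[OF assms] by (rule someI_ex)

lemma reduced_word_Cons_down: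
 assumes w: "w permutes {1..n}" and r: "1 <= r" "r < n" and down: "w r > w (Suc r)"
 shows "reduced_word n w (r # rs) \<longleftrightarrow> reduced_word n (w \<circ> sr r) rs"
proof -
 have p: "(w \<circ> sr r) permutes {1..n}"
  using w r by (intro permutes_compose sr_permutes)
 have "word_perm rs \<circ> sr r = w \<longleftrightarrow> word_perm rs = w \<circ> sr r"
  by (metis sr_sr(2))
 then show ?thesis
  using card_invs_down[OF w r down] r
  unfolding reduced_word_iff[OF p] reduced_word_iff[OF w] word_perm_Cons by auto
qed

text \<open>Without the descent, \<open>w \<circ> sr r\<close> would have more inversions than the
  remaining word \<open>rs\<close> has letters.\<close>

lemma reduced_word_Cons_imp:
 assumes w: "w permutes {1..n}" and red: "reduced_word n w (r # rs)"
 shows "1 <= r" "r < n" "w r > w (Suc r)"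
proof -
 show r: "1 <= r" "r < n" using red by (auto simp: reduced_word_def)
 have rs: "set rs \<subseteq> {1..<n}" "word_perm rs \<circ> sr r = w" "Suc (length rs) = card (invs n w)"
  using red unfolding reduced_word_iff[OF w] word_perm_Cons by auto
 have w1: "word_perm rs = w \<circ> sr r" using rs(2) by (metis sr_sr(2))
 show "w r > w (Suc r)"
 proof (rule ccontr)
  assume "\<not> ?thesis"
  moreover have "w r ~= w (Suc r)" using permutes_inj[OF w] by (metis injD n_not_Suc_n)
  ultimately have "w r < w (Suc r)" by simp
  from card_invs_up[OF w r this] card_invs_le_length[OF rs(1)] rs(3) show False
   unfolding w1 by simp
 qed
qed

lemma reduced_word_rev:
 assumes w: "w permutes {1..n}" and red: "reduced_word n w rs"
 shows "reduced_word n (inv w) (rev rs)"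
proof -
 have "word_perm (rev rs) = inv (word_perm rs)" if "set rs \<subseteq> {1..<n}" for rs
  using that
 proof (induction rs)
  case (Cons r rs)
  then show ?case
   using inv_comp_sr(1)[OF word_perm_permutes[of rs n]] by (simp add: word_perm_Cons word_perm_snoc comp_def)
 qed (simp only: rev.simps word_perm_Nil inv_id)
 then show ?thesis
  using red card_invs_inv[OF w] permutes_inv[OF w]
  unfolding reduced_word_iff[OF w] reduced_word_iff[OF permutes_inv[OF w]] by auto
qed

section \<open>Iwahori-Hecke algebras and Matsumoto's theorem\<close>

text \<open>Scalars enter only through the central element \<open>q\<close>, because the quotient
  algebra and the operator rings that instantiate this locale embed their scalars differently. The
  sort \<open>{ring, monoid_mult}\<close> leaves open whether \<open>0 = 1\<close>, which is not
  decided for the quotient.\<close>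

locale iwahori =
 fixes n :: nat and q :: "'a::{ring,monoid_mult}" and T :: "nat => 'a"
 assumes q_central: "q * x = x * q"
  and T_quad: "[|1 <= r; r < n|] ==> T r * T r = (q - 1) * T r + q"
  and T_comm: "[|1 <= r; Suc r < s; s < n|] ==> T r * T s = T s * T r"
  and T_braid: "[|1 <= r; Suc r < n|] ==> T r * T (Suc r) * T r = T (Suc r) * T r * T (Suc r)"
begin

definition TT :: "nat list => 'a" where "TT rs = prod_list (map T rs)"

lemma TT_simps [simp]: "TT [] = 1" "TT (r # rs) = T r * TT rs" "TT (rs @ ss) = TT rs * TT ss"
 by (simp_all add: TT_def)

text \<open>Matsumoto's theorem: if the first letters differ, both words are compared with words that
 start with the longest element of the rank two parabolic subgroup they generate.\<close>
lemma matsumoto: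
 assumes "w permutes {1..n}" "reduced_word n w rs" "reduced_word n w ss"
 shows "TT rs = TT ss"
 using assms
proof (induction "length rs" arbitrary: w rs ss)
 case 0
 then have "rs = []" "length ss = length rs" unfolding reduced_word_def by auto
 then show ?case by simp
next
 case (Suc k)
 have len: "length ss = Suc k" using Suc unfolding reduced_word_def by auto
 obtain r rs' where rs: "rs = r # rs'" using Suc by (cases rs) auto
 obtain s ss' where ss: "ss = s # ss'" using len by (cases ss) auto
 note w = Suc.prems(1)
 have r: "1 <= r" "r < n" "w r > w (Suc r)"
  using reduced_word_Cons_imp[OF w] Suc.prems(2) rs by auto
 have s: "1 <= s" "s < n" "w s > w (Suc s)"
  using reduced_word_Cons_imp[OF w] Suc.prems(3) ss by auto
 have perm: "(f \<circ> sr i) permutes {1..n}" if "f permutes {1..n}" "1 <= i" "i < n" for f i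
  using that by (intro permutes_compose sr_permutes)
 have rs': "reduced_word n (w \<circ> sr r) rs'" and ss': "reduced_word n (w \<circ> sr s) ss'"
  using Suc.prems reduced_word_Cons_down[OF w] r s by (auto simp: rs ss)
 have IHr: "TT rs' = TT zs" if "reduced_word n (w \<circ> sr r) zs" for zs
  using Suc.hyps(1)[OF _ perm[OF w r(1,2)] rs' that] Suc.hyps(2) rs by simp
 have IHs: "TT ss' = TT zs" if "reduced_word n (w \<circ> sr s) zs" for zs
  using Suc.hyps(1)[OF _ perm[OF w s(1,2)] ss' that] len ss by simp
 have adj: "T r * TT rs' = T (Suc r) * TT ss'"
  if *: "1 <= r" "Suc r < n" "w r > w (Suc r)" "w (Suc r) > w (Suc r + 1)"
   "\<And>zs. reduced_word n (w \<circ> sr r) zs ==> TT rs' = TT zs"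
   "\<And>zs. reduced_word n (w \<circ> sr (Suc r)) zs ==> TT ss' = TT zs" for r rs' ss'
 proof -
  have e: "w \<circ> sr r \<circ> sr (Suc r) \<circ> sr r = w \<circ> sr (Suc r) \<circ> sr r \<circ> sr (Suc r)"
   by (auto simp: fun_eq_iff sr_apply)
  obtain zs where zs: "reduced_word n (w \<circ> sr r \<circ> sr (Suc r) \<circ> sr r) zs"
   using reduced_word_exists[of "w \<circ> sr r \<circ> sr (Suc r) \<circ> sr r" n] perm w * by auto
  have "reduced_word n (w \<circ> sr r \<circ> sr (Suc r)) (r # zs)"
   using zs * w by (subst reduced_word_Cons_down) (simp_all add: sr_apply perm perm[simplified])
  then have 1: "reduced_word n (w \<circ> sr r) ((Suc r) # r # zs)"
   using * w by (subst reduced_word_Cons_down) (simp_all add: sr_apply perm perm[simplified])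
  have "reduced_word n (w \<circ> sr (Suc r) \<circ> sr r) ((Suc r) # zs)"
   using zs * w e by (subst reduced_word_Cons_down) (simp_all add: sr_apply perm perm[simplified])
  then have 2: "reduced_word n (w \<circ> sr (Suc r)) (r # (Suc r) # zs)"
   using * w by (subst reduced_word_Cons_down) (simp_all add: sr_apply perm perm[simplified])
  show ?thesis
   using *(5)[OF 1] *(6)[OF 2] T_braid[of r] * by (simp add: mult.assoc[symmetric])
 qed
 have far: "T r * TT rs' = T s * TT ss'" if *: "Suc r < s \<or> Suc s < r"
 proof -
  have e: "w \<circ> sr r \<circ> sr s = w \<circ> sr s \<circ> sr r"
   using * by (auto simp: fun_eq_iff sr_apply)
  obtain zs where zs: "reduced_word n (w \<circ> sr r \<circ> sr s) zs"
   using reduced_word_exists[of "w \<circ> sr r \<circ> sr s" n] perm w r s by auto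
  have 1: "reduced_word n (w \<circ> sr r) (s # zs)"
   using zs r s w * by (subst reduced_word_Cons_down) (use * in \<open>auto simp: sr_apply perm perm[simplified]\<close>)
  have 2: "reduced_word n (w \<circ> sr s) (r # zs)"
   using zs r s w * e by (subst reduced_word_Cons_down) (use * in \<open>auto simp: sr_apply perm perm[simplified]\<close>)
  have "T r * T s = T s * T r"
   using T_comm[of r s] T_comm[of s r] r s * by auto
  then show ?thesis using IHr[OF 1] IHs[OF 2] by (simp add: mult.assoc[symmetric])
 qed
 consider "r = s" | "s = Suc r" | "r = Suc s" | "Suc r < s \<or> Suc s < r" by linarith
 then show ?case
 proof cases
  case 1
  then show ?thesis using IHr ss' by (simp add: rs ss)
 next
  case 2
  then show ?thesis using adj[of r rs' ss'] r s IHr IHs by (simp add: rs ss)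
 next
  case 3
  then show ?thesis using adj[of s ss' rs'] r s IHr IHs by (simp add: rs ss)
 next
  case 4
  then show ?thesis using far by (simp add: rs ss)
 qed
qed

text \<open>The same choice of reduced word as in \<open>Tw\<close>, so that an evaluation sends
  \<open>Tw n w\<close> to \<open>TW w\<close> by unfolding.\<close>

definition TW :: "(nat => nat) => 'a" where
 "TW w = TT (SOME rs. reduced_word n w rs)"

lemma TW_eq: "w permutes {1..n} ==> reduced_word n w rs ==> TW w = TT rs"
 unfolding TW_def by (rule matsumoto[OF _ reduced_word_some])

lemma TW_id [simp]: "TW id = 1"
proof -
 have "invs n id = {}" by (auto simp: invs_def)
 then have "reduced_word n id []"
  unfolding reduced_word_iff[OF permutes_id] by simp
 from TW_eq[OF permutes_id this] show ?thesis by simp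
qed

lemma TW_left:
 assumes w: "w permutes {1..n}" and r: "1 <= r" "r < n" and down: "w r > w (Suc r)"
 shows "TW w = T r * TW (w \<circ> sr r)"
proof -
 have p: "(w \<circ> sr r) permutes {1..n}"
  using w r by (intro permutes_compose sr_permutes)
 obtain rs where rs: "reduced_word n (w \<circ> sr r) rs" using reduced_word_exists[OF p] by blast
 then have "reduced_word n w (r # rs)" using reduced_word_Cons_down[OF w r down] by simp
 from TW_eq[OF w this] TW_eq[OF p rs] show ?thesis by simp
qed

lemma TW_right:
 assumes w: "w permutes {1..n}" and r: "1 <= r" "r < n" and down: "inv w r > inv w (Suc r)"
 shows "TW w = TW (sr r \<circ> w) * T r"
proof -
 have p: "(sr r \<circ> w) permutes {1..n}"
  using w r by (intro permutes_compose sr_permutes)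
 obtain rs where rs: "reduced_word n (sr r \<circ> w) rs" using reduced_word_exists[OF p] by blast
 have "reduced_word n (inv w \<circ> sr r) (rev rs)"
  using reduced_word_rev[OF p rs] unfolding inv_comp_sr[OF w] .
 then have "reduced_word n (inv w) (r # rev rs)"
  using reduced_word_Cons_down[OF permutes_inv[OF w] r down] by simp
 from reduced_word_rev[OF permutes_inv[OF w] this] have "reduced_word n w (rs @ [r])"
  unfolding permutes_inv_inv[OF w] by simp
 from TW_eq[OF w this] TW_eq[OF p rs] show ?thesis by simp
qed

lemma TW_sr: "1 <= r ==> r < n ==> TW (sr r) = T r"
 using TW_left[of "sr r" r] sr_permutes[of r n] by (simp add: sr_apply)

end

section \<open>Young subgroups, minimal coset representatives and symmetrizers\<close>

text \<open>A Young subgroup is given by a labelling of the points whose fibres are intervals.\<close>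

definition convex_lab :: "nat => (nat => 'b) => bool" where
 "convex_lab n b \<longleftrightarrow> (\<forall>i j k. 1 <= i --> i <= j --> j <= k --> k <= n --> b i = b k --> b j = b i)"

definition young :: "nat => (nat => 'b) => (nat => nat) set" where
 "young n b = {w. w permutes {1..n} \<and> (\<forall>i\<in>{1..n}. b (w i) = b i)}"

text \<open>These are the minimal length representatives of the cosets formed by all
  \<open>d \<circ> v\<close> with \<open>v\<close> in the Young subgroup.\<close>

definition incr :: "nat => (nat => 'b) => (nat => nat) => bool" where
 "incr n b d \<longleftrightarrow> (\<forall>i j. 1 <= i --> i < j --> j <= n --> b i = b j --> d i < d j)"

lemma convex_labD: "convex_lab n b ==> 1 <= i ==> i <= j ==> j <= k ==> k <= n ==> b i = b k ==> b j = b i"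
 unfolding convex_lab_def by blast

lemma incrD: "incr n b d ==> 1 <= i ==> i < j ==> j <= n ==> b i = b j ==> d i < d j"
 unfolding incr_def by blast

lemma youngD: "w \<in> young n b ==> w permutes {1..n}"
 "w \<in> young n b ==> 1 <= i ==> i <= n ==> b (w i) = b i"
 unfolding young_def by auto

lemma finite_young [simp]: "finite (young n b)"
 by (rule finite_subset[of _ "{w. w permutes {1..n}}"]) (auto simp: young_def finite_permutations)

lemma perm_range:
 assumes "w permutes {1..n}" "1 <= i" "i <= n"
 shows "1 <= w i" "w i <= n"
 using permutes_in_image[OF assms(1), of i] assms(2,3) by simp_all

lemma perm_inv_range:
 assumes "w permutes {1..n}" "1 <= i" "i <= n"
 shows "1 <= inv w i" "inv w i <= n"
 using perm_range[OF permutes_inv[OF assms(1)] assms(2,3)] .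

lemma young_id: "id \<in> young n b"
 unfolding young_def by (simp add: permutes_id)

lemma young_comp: "v \<in> young n b ==> w \<in> young n b ==> v \<circ> w \<in> young n b"
 unfolding young_def mem_Collect_eq
 by (auto intro: permutes_compose simp del: atLeastAtMost_iff simp: permutes_in_image)

lemma young_inv: assumes w: "w \<in> young n b" shows "inv w \<in> young n b"
proof -
 note p = youngD(1)[OF w]
 have "b (inv w i) = b i" if "i \<in> {1..n}" for i
  using youngD(2)[OF w, of "inv w i"] that perm_inv_range[OF p, of i]
  by (simp add: permutes_inverses(1)[OF p])
 then show ?thesis unfolding young_def using permutes_inv[OF p] by simp
qed

lemma young_sr: "1 <= r ==> r < n ==> b r = b (Suc r) ==> sr r \<in> young n b"
 unfolding young_def using sr_permutes[of r n] by (auto simp: sr_apply)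

text \<open>Both fibres are intervals preserved by \<open>u\<close>. If \<open>u j < u i\<close>,
  then either \<open>i\<close> lies between \<open>u j\<close> and \<open>j\<close>, or
  \<open>u j\<close> lies between \<open>i\<close> and \<open>u i\<close>, and convexity merges the
  two fibres.\<close>

lemma young_bounds:
 assumes b: "convex_lab n b" and u: "u \<in> young n b" and ij: "1 <= i" "i < j" "j <= n" "b i ~= b j"
 shows "u i < u j"
proof (rule ccontr)
 assume "\<not> u i < u j"
 moreover have "u i ~= u j" using ij injD[OF permutes_inj[OF youngD(1)[OF u]], of i j] by auto
 ultimately have lt: "u j < u i" by simp
 have bi: "b (u i) = b i" and bj: "b (u j) = b j" using youngD(2)[OF u] ij by auto
 have ri: "1 <= u i" "u i <= n" "1 <= u j" "u j <= n"
  using perm_range[OF youngD(1)[OF u]] ij by simp_all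
 consider "u j < i" | "i <= u j" by linarith
 then show False
 proof cases
  case 1
  then have "b i = b (u j)" using convex_labD[OF b, of "u j" i j] ij ri bj by simp
  then show ?thesis using bj ij by simp
 next
  case 2
  then have "b (u j) = b i" using convex_labD[OF b, of i "u j" "u i"] ij ri bi lt by simp
  then show ?thesis using bj ij by simp
 qed
qed

lemma invs_young:
 assumes b: "convex_lab n b" and u: "u \<in> young n b" and ij: "(i, j) \<in> invs n u"
 shows "b i = b j"
 using young_bounds[OF b u, of i j] ij unfolding invs_def by force

lemma young_incr_id:
 assumes b: "convex_lab n b" and u: "u \<in> young n b" and inc: "incr n b u"
 shows "u = id"
proof (rule increasing_permutes_id[OF youngD(1)[OF u]])
 show "invs n u = {}"
 proof (rule equals0I)
  fix p assume p: "p \<in> invs n u"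
  obtain i j where ij: "p = (i, j)" by (cases p)
  have "b i = b j" using invs_young[OF b u] p ij by blast
  with inc p ij show False unfolding invs_def incr_def by force
 qed
qed

lemma incr_descent:
 assumes b: "convex_lab n b" and d: "d permutes {1..n}" and "\<not> incr n b d"
 obtains r where "1 <= r" "r < n" "b r = b (Suc r)" "d (Suc r) < d r"
proof -
 obtain i j where ij: "1 <= i" "i < j" "j <= n" "b i = b j" "\<not> d i < d j"
  using assms(3) unfolding incr_def by blast
 have "d i ~= d j" using ij injD[OF permutes_inj[OF d], of i j] by auto
 then have "d j < d i" using ij by simp
 from descent_exists[OF d ij(1-3) this]
 obtain r where r: "i <= r" "r < j" "d (Suc r) < d r" by blast
 have "b r = b i" "b (Suc r) = b i"
  using convex_labD[OF b ij(1), of r j] convex_labD[OF b ij(1), of "Suc r" j] r ij by simp_all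
 with r ij that[of r] show ?thesis by simp
qed

text \<open>Each descent inside a fibre is removed by a simple reflection of the Young subgroup;
  this lowers the number of inversions, and the removed reflections multiply to
  \<open>v\<close>.\<close>

lemma young_factor:
 assumes b: "convex_lab n b" and w: "w permutes {1..n}"
 shows "\<exists>v d. v \<in> young n b \<and> d permutes {1..n} \<and> incr n b d \<and> w = d \<circ> v"
 using w
proof (induction "card (invs n w)" arbitrary: w rule: less_induct)
 case less
 show ?case
 proof (cases "incr n b w")
  case True
  then show ?thesis using less.prems young_id[of n b] by (intro exI[of _ id] exI[of _ w]) simp
 next
  case False
  then obtain r where r: "1 <= r" "r < n" "b r = b (Suc r)" "w (Suc r) < w r"
   using incr_descent[OF b less.prems] by blast
  have p: "w \<circ> sr r permutes {1..n}" using r less.prems by (intro permutes_compose sr_permutes)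
  have "card (invs n (w \<circ> sr r)) < card (invs n w)"
   using card_invs_down[OF less.prems r(1,2,4)] by simp
  from less.hyps[OF this p] obtain v d where
   vd: "v \<in> young n b" "d permutes {1..n}" "incr n b d" "w \<circ> sr r = d \<circ> v" by blast
  then have "w = d \<circ> (v \<circ> sr r)" using sr_sr(2)[of w r] by (simp add: o_assoc)
  then show ?thesis using vd young_comp[OF vd(1) young_sr[OF r(1-3)]] by blast
 qed
qed

text \<open>The quotient \<open>v \<circ> inv v'\<close> lies in the Young subgroup and increases on
  fibres, hence is trivial.\<close>

lemma young_factor_unique:
 assumes b: "convex_lab n b" and v: "v \<in> young n b" "v' \<in> young n b"
  and d: "d permutes {1..n}" "d' permutes {1..n}" "incr n b d" "incr n b d'"
  and eq: "d \<circ> v = d' \<circ> v'"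
 shows "d = d' \<and> v = v'"
proof -
 define u where "u = v \<circ> inv v'"
 have u: "u \<in> young n b" unfolding u_def using v by (intro young_comp young_inv)
 have d': "d' = d \<circ> u"
  unfolding u_def o_assoc eq
  using permutes_inv_o(1)[OF youngD(1)[OF v(2)]] by (simp add: o_assoc[symmetric])
 have "incr n b u"
  unfolding incr_def
 proof (intro allI impI)
  fix i j assume ij: "1 <= i" "i < j" "j <= n" "b i = b j"
  have lt: "d (u i) < d (u j)" using incrD[OF d(4) ij] by (simp add: d')
  have r: "1 <= u i" "u i <= n" "1 <= u j" "u j <= n"
   using perm_range[OF youngD(1)[OF u]] ij by simp_all
  have "b (u j) = b (u i)" using youngD(2)[OF u] ij by simp
  then show "u i < u j" using incrD[OF d(3), of "u j" "u i"] r lt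
   by (metis less_asym not_less_iff_gr_or_eq)
 qed
 then have "u = id" using young_incr_id[OF b u] by blast
 then have dd: "d = d'" using d' by simp
 have "v = v'"
  using eq permutes_inj[OF d(2)] unfolding dd by (metis fun.inj_map_strong injD inj_compose o_assoc ext comp_apply)
 with dd show ?thesis by blast
qed

text \<open>Equal inversion sets mean that \<open>d \<circ> inv d'\<close> preserves the order of
  every pair. In the Garnir argument this makes a containment of inversion sets strict.\<close>

lemma invs_eq_imp_eq:
 assumes d: "d permutes {1..n}" "d' permutes {1..n}" and eq: "invs n d = invs n d'"
 shows "d = d'"
proof -
 have p: "d \<circ> inv d' permutes {1..n}" using d by (intro permutes_compose permutes_inv)
 have iff: "d j < d i \<longleftrightarrow> d' j < d' i" if "1 <= i" "i < j" "j <= n" for i j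
  using eq that unfolding invs_def by auto
 have "invs n (d \<circ> inv d') = {}"
 proof (rule equals0I)
  fix p assume p: "p \<in> invs n (d \<circ> inv d')"
  obtain a b where ab: "p = (a, b)" by (cases p)
  define i j where "i = inv d' a" "j = inv d' b"
  have h: "1 <= a" "a < b" "b <= n" "d j < d i"
   using p unfolding ab invs_def i_j_def by simp_all
  have a: "a = d' i" "b = d' j" unfolding i_j_def by (simp_all add: permutes_inverses(1)[OF d(2)])
  have r: "1 <= i" "i <= n" "1 <= j" "j <= n"
   unfolding i_j_def using perm_inv_range[OF d(2)] h by simp_all
  consider "i < j" | "j < i" | "i = j" by linarith
  then show False
  proof cases
   case 1 then show ?thesis using iff[of i j] h a r by simp
  next
   case 2
   then have "\<not> d i < d j \<longleftrightarrow> \<not> d' i < d' j" using iff[of j i] r by simp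
   then show ?thesis using h a by simp
  next
   case 3 then show ?thesis using h by simp
  qed
 qed
 then have "d \<circ> inv d' = id" by (rule increasing_permutes_id[OF p])
 then have "d \<circ> (inv d' \<circ> d') = d'" by (simp add: o_assoc)
 then show ?thesis by (simp add: permutes_inv_o(2)[OF d(2)])
qed

context iwahori
begin

text \<open>With \<open>b = rowl mu\<close> this is the image of \<open>x_lam n mu\<close>.\<close>

definition XX :: "(nat => 'b) => 'a" where "XX b = (\<Sum>w\<in>young n b. TW w)"

text \<open>A descent of \<open>v\<close> inside a fibre is a descent of \<open>d \<circ> v\<close>
  as well, since \<open>d\<close> preserves the order there. So letters can be stripped from both in
  step.\<close>

lemma TW_comp_incr:
 assumes b: "convex_lab n b" and v: "v \<in> young n b" and d: "d permutes {1..n}" "incr n b d"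
 shows "TW v * TW d = TW (d \<circ> v) \<and> card (invs n (d \<circ> v)) = card (invs n v) + card (invs n d)"
 using v
proof (induction "card (invs n v)" arbitrary: v rule: less_induct)
 case less
 show ?case
 proof (cases "v = id")
  case True
  then show ?thesis by (simp only: invs_id TW_id comp_id card.empty add_0 mult_1_left simp_thms)
 next
  case False
  then have "\<not> incr n b v" using young_incr_id[OF b less.prems] by blast
  then obtain r where r: "1 <= r" "r < n" "b r = b (Suc r)" "v (Suc r) < v r"
   using incr_descent[OF b youngD(1)[OF less.prems]] by blast
  have v1: "v \<circ> sr r \<in> young n b" using young_comp[OF less.prems young_sr[OF r(1-3)]] .
  have c: "card (invs n v) = Suc (card (invs n (v \<circ> sr r)))"
   using card_invs_down[OF youngD(1)[OF less.prems] r(1,2,4)] .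
  have IH: "TW (v \<circ> sr r) * TW d = TW (d \<circ> (v \<circ> sr r))"
   "card (invs n (d \<circ> (v \<circ> sr r))) = card (invs n (v \<circ> sr r)) + card (invs n d)"
   using less.hyps[OF _ v1] c by simp_all
  have ra: "1 <= v r" "v r <= n" "1 <= v (Suc r)" "v (Suc r) <= n"
   using perm_range[OF youngD(1)[OF less.prems]] r by simp_all
  have "b (v (Suc r)) = b (v r)" using youngD(2)[OF less.prems] r by simp
  then have lt: "(d \<circ> v) (Suc r) < (d \<circ> v) r"
   using incrD[OF d(2), of "v (Suc r)" "v r"] r(4) ra by simp
  have p: "d \<circ> v permutes {1..n}" using d youngD(1)[OF less.prems] by (intro permutes_compose)
  have "TW v * TW d = T r * (TW (v \<circ> sr r) * TW d)"
   using TW_left[OF youngD(1)[OF less.prems] r(1,2,4)] by (simp add: mult.assoc)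
  also have "\<dots> = TW (d \<circ> v)"
   unfolding IH o_assoc by (rule TW_left[OF p r(1,2) lt, symmetric])
  finally show ?thesis
   using c IH(2) card_invs_down[OF p r(1,2) lt] unfolding o_assoc by linarith
 qed
qed

lemma T_mult_TW:
 assumes w: "w permutes {1..n}" and r: "1 <= r" "r < n"
 shows "w r < w (Suc r) ==> T r * TW w = TW (w \<circ> sr r)"
  and "w r > w (Suc r) ==> T r * TW w = (q - 1) * TW w + q * TW (w \<circ> sr r)"
proof -
 have p: "w \<circ> sr r permutes {1..n}" using w r by (intro permutes_compose sr_permutes)
 show "T r * TW w = TW (w \<circ> sr r)" if "w r < w (Suc r)"
  using TW_left[OF p r] that by (simp add: sr_apply)
 show "T r * TW w = (q - 1) * TW w + q * TW (w \<circ> sr r)" if lt: "w r > w (Suc r)"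
  unfolding TW_left[OF w r lt] mult.assoc[symmetric] T_quad[OF r] by (simp add: algebra_simps)
qed

lemma TW_mult_T:
 assumes w: "w permutes {1..n}" and r: "1 <= r" "r < n"
 shows "inv w r < inv w (Suc r) ==> TW w * T r = TW (sr r \<circ> w)"
  and "inv w r > inv w (Suc r) ==> TW w * T r = (q - 1) * TW w + q * TW (sr r \<circ> w)"
proof -
 have p: "sr r \<circ> w permutes {1..n}" using w r by (intro permutes_compose sr_permutes)
 show "TW w * T r = TW (sr r \<circ> w)" if "inv w r < inv w (Suc r)"
  using TW_right[OF p r] that unfolding inv_comp_sr[OF w] by (simp add: sr_apply)
 show "TW w * T r = (q - 1) * TW w + q * TW (sr r \<circ> w)" if lt: "inv w r > inv w (Suc r)"
 proof -
  have "TW w * T r = TW (sr r \<circ> w) * (T r * T r)"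
   by (subst TW_right[OF w r lt]) (simp add: mult.assoc)
  also have "\<dots> = TW (sr r \<circ> w) * (T r * (q - 1)) + TW (sr r \<circ> w) * q"
   using q_central[of "T r"] by (simp add: T_quad[OF r] algebra_simps)
  also have "\<dots> = TW w * (q - 1) + TW (sr r \<circ> w) * q"
   using TW_right[OF w r lt] by (simp add: mult.assoc[symmetric])
  finally show ?thesis using q_central by (simp add: algebra_simps)
 qed
qed

text \<open>Pairing \<open>w\<close> with \<open>w \<circ> sr r\<close> extracts a left factor
  \<open>1 + T r\<close>, and the quadratic relation gives
  \<open>T r * (1 + T r) = q * (1 + T r)\<close>.\<close>

lemma T_mult_XX:
 assumes b: "convex_lab n b" and r: "1 <= r" "r < n" "b r = b (Suc r)"
 shows "T r * XX b = q * XX b"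
proof -
 let ?U = "{w \<in> young n b. w r < w (Suc r)}"
 have img: "young n b = ?U \<union> (\<lambda>w. w \<circ> sr r) ` ?U"
 proof (intro equalityI subsetI)
  fix w assume w: "w \<in> young n b"
  have ws: "w \<circ> sr r \<in> young n b" using young_comp[OF w young_sr[OF r]] .
  have "w r ~= w (Suc r)" using injD[OF permutes_inj[OF youngD(1)[OF w]], of r "Suc r"] by auto
  then consider "w r < w (Suc r)" | "w (Suc r) < w r" by linarith
  then show "w \<in> ?U \<union> (\<lambda>w. w \<circ> sr r) ` ?U"
  proof cases
   case 2
   then have "w \<circ> sr r \<in> ?U" using ws by (simp add: sr_apply)
   then have "w \<circ> sr r \<circ> sr r \<in> (\<lambda>w. w \<circ> sr r) ` ?U" by blast
   then show ?thesis by simp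
  qed (use w in simp)
 next
  fix w assume "w \<in> ?U \<union> (\<lambda>w. w \<circ> sr r) ` ?U"
  then show "w \<in> young n b" using young_comp[OF _ young_sr[OF r]] by auto
 qed
 have disj: "?U \<inter> (\<lambda>w. w \<circ> sr r) ` ?U = {}" by (auto simp: sr_apply)
 have inj: "inj_on (\<lambda>w. w \<circ> sr r) ?U" by (rule inj_onI) (metis sr_sr(2))
 have fin: "finite ?U" by (rule finite_subset[OF _ finite_young[of n b]]) auto
 have "XX b = (\<Sum>w\<in>?U. TW w) + (\<Sum>w\<in>?U. TW (w \<circ> sr r))"
  unfolding XX_def by (subst img, subst sum.union_disjoint) (use fin disj in \<open>simp_all add: sum.reindex[OF inj]\<close>)
 also have "(\<Sum>w\<in>?U. TW (w \<circ> sr r)) = (\<Sum>w\<in>?U. T r * TW w)"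
  by (rule sum.cong) (auto simp: T_mult_TW(1)[OF youngD(1) r(1,2)])
 finally have X: "XX b = (1 + T r) * (\<Sum>w\<in>?U. TW w)"
  by (simp add: sum_distrib_left distrib_right sum.distrib)
 have "T r * (1 + T r) = q * (1 + T r)" using T_quad[OF r(1,2)] by (simp add: algebra_simps)
 then show ?thesis unfolding X by (simp add: mult.assoc[symmetric])
qed

text \<open>Right factor of the Poincare-type factorisation along a refinement of the labelling.\<close>
lemma XX_factor:
 assumes b: "convex_lab n b" "convex_lab n b'"
  and fin: "\<And>i j. 1 <= i ==> i <= n ==> 1 <= j ==> j <= n ==> b' i = b' j ==> b i = b j"
 shows "XX b = XX b' * (\<Sum>d\<in>{d \<in> young n b. incr n b' d}. TW d)"
proof -
 have sub: "v \<in> young n b" if v: "v \<in> young n b'" for v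
  using youngD[OF v] perm_range[OF youngD(1)[OF v]] fin unfolding young_def by auto
 let ?D = "{d \<in> young n b. incr n b' d}"
 have bij: "bij_betw (\<lambda>(v, d). d \<circ> v) (young n b' \<times> ?D) (young n b)"
 proof (rule bij_betwI')
  fix x y assume x: "x \<in> young n b' \<times> ?D" and y: "y \<in> young n b' \<times> ?D"
  obtain v d v' d' where xy: "x = (v, d)" "y = (v', d')" by (cases x, cases y)
  show "((\<lambda>(v, d). d \<circ> v) x = (\<lambda>(v, d). d \<circ> v) y) = (x = y)"
   using x y young_factor_unique[OF b(2), of v v' d d'] youngD(1)[of d n b] youngD(1)[of d' n b]
   unfolding xy by auto
 next
  fix x assume "x \<in> young n b' \<times> ?D"
  then show "(\<lambda>(v, d). d \<circ> v) x \<in> young n b" by (auto intro: young_comp sub)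
 next
  fix w assume w: "w \<in> young n b"
  obtain v d where vd: "v \<in> young n b'" "d permutes {1..n}" "incr n b' d" "w = d \<circ> v"
   using young_factor[OF b(2) youngD(1)[OF w]] by blast
  have "d = w \<circ> inv v"
   using permutes_inv_o(1)[OF youngD(1)[OF vd(1)]] unfolding vd(4) by (simp add: o_assoc[symmetric])
  then have "d \<in> young n b" using young_comp[OF w young_inv[OF sub[OF vd(1)]]] by simp
  then show "\<exists>x\<in>young n b' \<times> ?D. w = (\<lambda>(v, d). d \<circ> v) x"
   using vd by (intro bexI[of _ "(v, d)"]) auto
 qed
 have "XX b = (\<Sum>(v, d)\<in>young n b' \<times> ?D. TW (d \<circ> v))"
  unfolding XX_def using sum.reindex_bij_betw[OF bij, of TW] by (simp add: split_def)
 also have "\<dots> = (\<Sum>(v, d)\<in>young n b' \<times> ?D. TW v * TW d)"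
  using TW_comp_incr[OF b(2)] youngD(1)[of _ n b] by (intro sum.cong) auto
 also have "\<dots> = XX b' * (\<Sum>d\<in>?D. TW d)"
  unfolding XX_def sum_product sum.cartesian_product ..
 finally show ?thesis .
qed

text \<open>Applied with \<open>z = uu mu\<close>, which commutes with \<open>T r\<close> whenever
  \<open>r\<close> and \<open>Suc r\<close> lie in one component.\<close>

lemma TW_commute:
 assumes g: "convex_lab n g" and w: "w \<in> young n g"
  and z: "\<And>r. 1 <= r ==> r < n ==> g r = g (Suc r) ==> T r * z = z * T r"
 shows "TW w * z = z * TW w"
 using w
proof (induction "card (invs n w)" arbitrary: w rule: less_induct)
 case less
 show ?case
 proof (cases "w = id")
  case False
  then have "\<not> incr n g w" using young_incr_id[OF g less.prems] by blast
  then obtain r where r: "1 <= r" "r < n" "g r = g (Suc r)" "w (Suc r) < w r"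
   using incr_descent[OF g youngD(1)[OF less.prems]] by blast
  have v1: "w \<circ> sr r \<in> young n g" using young_comp[OF less.prems young_sr[OF r(1-3)]] .
  have c: "card (invs n w) = Suc (card (invs n (w \<circ> sr r)))"
   using card_invs_down[OF youngD(1)[OF less.prems] r(1,2,4)] .
  have IH: "TW (w \<circ> sr r) * z = z * TW (w \<circ> sr r)" using less.hyps[OF _ v1] c by simp
  have "TW w * z = T r * (TW (w \<circ> sr r) * z)"
   using TW_left[OF youngD(1)[OF less.prems] r(1,2,4)] by (simp add: mult.assoc)
  also have "\<dots> = (T r * z) * TW (w \<circ> sr r)" unfolding IH by (simp add: mult.assoc)
  also have "\<dots> = z * (T r * TW (w \<circ> sr r))" unfolding z[OF r(1-3)] by (simp add: mult.assoc)
  finally show ?thesis using TW_left[OF youngD(1)[OF less.prems] r(1,2,4)] by simp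
 qed simp
qed

end

text \<open>An anti-automorphism fixing the generators.\<close>

locale iwahori_star = iwahori n q T for n and q :: "'a::{ring,monoid_mult}" and T +
 fixes star :: "'a => 'a"
 assumes star_add: "star (x + y) = star x + star y"
  and star_mult: "star (x * y) = star y * star x"
  and star_one [simp]: "star 1 = 1"
  and star_q [simp]: "star q = q"
  and star_T: "[|1 <= r; r < n|] ==> star (T r) = T r"
begin

lemma star_zero [simp]: "star 0 = 0"
 using star_add[of 0 0] by simp

lemma star_minus: "star (- x) = - star x"
 using star_add[of x "- x"] by (simp add: eq_neg_iff_add_eq_0 add.commute)

lemma star_sum: "star (sum f A) = (\<Sum>x\<in>A. star (f x))"
 by (induction A rule: infinite_finite_induct) (simp_all add: star_add)

lemma star_TT: "set rs \<subseteq> {1..<n} ==> star (TT rs) = TT (rev rs)"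
 by (induction rs) (simp_all add: star_mult star_T)

lemma star_TW: assumes w: "w permutes {1..n}" shows "star (TW w) = TW (inv w)"
proof -
 obtain rs where rs: "reduced_word n w rs" using reduced_word_exists[OF w] by blast
 have "star (TW w) = TT (rev rs)"
  using TW_eq[OF w rs] star_TT[of rs] rs unfolding reduced_word_def by simp
 also have "\<dots> = TW (inv w)" using TW_eq[OF permutes_inv[OF w] reduced_word_rev[OF w rs]] by simp
 finally show ?thesis .
qed

lemma star_XX: "star (XX b) = XX b"
proof -
 have "bij_betw inv (young n b) (young n b)"
  by (rule bij_betw_byWitness[of _ inv])
   (auto intro: young_inv simp: permutes_inv_inv dest: youngD(1))
 from sum.reindex_bij_betw[OF this, of TW] show ?thesis
  unfolding XX_def star_sum by (simp add: star_TW[OF youngD(1)] cong: sum.cong)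
qed

lemma XX_mult_T:
 assumes "convex_lab n b" "1 <= r" "r < n" "b r = b (Suc r)"
 shows "XX b * T r = q * XX b"
proof -
 have "star (T r * XX b) = star (q * XX b)" using T_mult_XX[OF assms] by simp
 then show ?thesis unfolding star_mult star_XX star_T[OF assms(2,3)] star_q by (simp add: q_central)
qed

lemma XX_mult_TW:
 assumes b: "convex_lab n b" and v: "v \<in> young n b"
 shows "XX b * TW v = q ^ card (invs n v) * XX b"
 using v
proof (induction "card (invs n v)" arbitrary: v rule: less_induct)
 case less
 show ?case
 proof (cases "v = id")
  case True
  show ?thesis unfolding True by (simp only: invs_id card.empty power_0 TW_id mult_1_left mult_1_right)
 next
  case False
  then have "\<not> incr n b v" using young_incr_id[OF b less.prems] by blast
  then obtain r where r: "1 <= r" "r < n" "b r = b (Suc r)" "v (Suc r) < v r"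
   using incr_descent[OF b youngD(1)[OF less.prems]] by blast
  have v1: "v \<circ> sr r \<in> young n b" using young_comp[OF less.prems young_sr[OF r(1-3)]] .
  have c: "card (invs n v) = Suc (card (invs n (v \<circ> sr r)))"
   using card_invs_down[OF youngD(1)[OF less.prems] r(1,2,4)] .
  have "XX b * TW v = XX b * T r * TW (v \<circ> sr r)"
   using TW_left[OF youngD(1)[OF less.prems] r(1,2,4)] by (simp add: mult.assoc)
  also have "\<dots> = q * (XX b * TW (v \<circ> sr r))"
   unfolding XX_mult_T[OF b r(1-3)] by (simp add: mult.assoc)
  finally show ?thesis using less.hyps[OF _ v1] c by (simp add: mult.assoc)
 qed
qed

lemma XX_factor_left:
 assumes b: "convex_lab n b" "convex_lab n b'"
  and fin: "\<And>i j. 1 <= i ==> i <= n ==> 1 <= j ==> j <= n ==> b' i = b' j ==> b i = b j"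
 shows "XX b = (\<Sum>d\<in>{d \<in> young n b. incr n b' d}. TW (inv d)) * XX b'"
proof -
 let ?D = "{d \<in> young n b. incr n b' d}"
 have "star (XX b) = star (XX b' * (\<Sum>d\<in>?D. TW d))"
  by (rule arg_cong[OF XX_factor[OF b]]) (rule fin)
 then show ?thesis
  unfolding star_XX star_mult star_sum
  by (elim trans, intro arg_cong[where f = "\<lambda>x. x * XX b'"] sum.cong)
   (auto simp: star_TW[OF youngD(1)])
qed

text \<open>\<open>d\<close> carries the fibres of \<open>b\<close> to those of \<open>b'\<close>
  and is minimal for both Young subgroups, so lengths add on either side. Both products are the sum
  of all \<open>TW (d \<circ> v)\<close>; conjugation by \<open>d\<close> matches the two
  indexings.\<close>

lemma XX_conj:
 assumes b: "convex_lab n b" and b': "convex_lab n b'" and d: "d permutes {1..n}"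
  and incs: "incr n b d" "incr n b' (inv d)"
  and lab: "\<And>i j. 1 <= i ==> i <= n ==> 1 <= j ==> j <= n ==> b i = b j \<longleftrightarrow> b' (d i) = b' (d j)"
 shows "XX b * TW d = TW d * XX b'"
proof -
 note di = permutes_inv[OF d]
 have iv [simp]: "d (inv d i) = i" "inv d (d i) = i" for i by (simp_all add: permutes_inverses[OF d])
 have 1: "TW v * TW d = TW (d \<circ> v)" if "v \<in> young n b" for v
  using TW_comp_incr[OF b that d incs(1)] by blast
 have 2: "TW d * TW v = TW (v \<circ> d)" if v: "v \<in> young n b'" for v
 proof -
  have "TW (inv v) * TW (inv d) = TW (inv d \<circ> inv v)"
   using TW_comp_incr[OF b' young_inv[OF v] di incs(2)] by blast
  then have "star (TW (inv v) * TW (inv d)) = star (TW (inv d \<circ> inv v))" by simp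
  moreover have "inv (inv d \<circ> inv v) = v \<circ> d"
   using permutes_bij[OF di] permutes_bij[OF permutes_inv[OF youngD(1)[OF v]]]
   by (simp add: o_inv_distrib permutes_inv_inv[OF d] permutes_inv_inv[OF youngD(1)[OF v]])
  ultimately show ?thesis
   unfolding star_mult star_TW[OF permutes_compose[OF permutes_inv[OF youngD(1)[OF v]] di]]
    star_TW[OF di] star_TW[OF permutes_inv[OF youngD(1)[OF v]]]
    permutes_inv_inv[OF d] permutes_inv_inv[OF youngD(1)[OF v]] by simp
 qed
 have bij: "bij_betw (\<lambda>v. d \<circ> v \<circ> inv d) (young n b) (young n b')"
 proof (rule bij_betw_byWitness[of _ "\<lambda>v. inv d \<circ> v \<circ> d"])
  show "(\<lambda>v. d \<circ> v \<circ> inv d) ` young n b \<subseteq> young n b'"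
  proof (intro image_subsetI)
   fix v assume v: "v \<in> young n b"
   have "b' ((d \<circ> v \<circ> inv d) i) = b' i" if "i \<in> {1..n}" for i
   proof -
    have i: "1 <= inv d i" "inv d i <= n" using perm_inv_range[OF d] that by simp_all
    show ?thesis
     using lab[of "v (inv d i)" "inv d i"] youngD(2)[OF v i] perm_range[OF youngD(1)[OF v] i] i
     by simp
   qed
   moreover have "d \<circ> v \<circ> inv d permutes {1..n}"
    using d di youngD(1)[OF v] by (intro permutes_compose)
   ultimately show "d \<circ> v \<circ> inv d \<in> young n b'" unfolding young_def by simp
  qed
  show "(\<lambda>v. inv d \<circ> v \<circ> d) ` young n b' \<subseteq> young n b"
  proof (intro image_subsetI)
   fix v assume v: "v \<in> young n b'"
   have "b ((inv d \<circ> v \<circ> d) i) = b i" if "i \<in> {1..n}" for i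
   proof -
    have i: "1 <= i" "i <= n" using that by simp_all
    have di': "1 <= d i" "d i <= n" using perm_range[OF d i] .
    have r: "1 <= inv d (v (d i))" "inv d (v (d i)) <= n"
     using perm_inv_range[OF d perm_range[OF youngD(1)[OF v] di']] .
    show ?thesis
     using lab[OF r i] youngD(2)[OF v di'] by simp
   qed
   moreover have "inv d \<circ> v \<circ> d permutes {1..n}"
    using d di youngD(1)[OF v] by (intro permutes_compose)
   ultimately show "inv d \<circ> v \<circ> d \<in> young n b" unfolding young_def by simp
  qed
 qed (auto simp: fun_eq_iff)
 have "XX b * TW d = (\<Sum>v\<in>young n b. TW (d \<circ> v))"
  unfolding XX_def sum_distrib_right by (rule sum.cong) (auto simp: 1)
 also have "\<dots> = (\<Sum>v\<in>young n b. TW (d \<circ> v \<circ> inv d \<circ> d))"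
  by (simp add: o_assoc[symmetric] permutes_inv_o(2)[OF d])
 also have "\<dots> = (\<Sum>v\<in>young n b'. TW (v \<circ> d))"
  using sum.reindex_bij_betw[OF bij, of "\<lambda>v. TW (v \<circ> d)"] by simp
 also have "\<dots> = TW d * XX b'"
  unfolding XX_def sum_distrib_left by (rule sum.cong) (auto simp: 2)
 finally show ?thesis .
qed

end

section \<open>Diagrams of multicompositions and the initial tableau\<close>

definition msize :: "mpart => nat" where "msize mu = sum_list (map sum_list mu)"
definition csum :: "mpart => nat => nat" where "csum mu l = sum_list (map sum_list (take l mu))"
text \<open>The number of nodes preceding row \<open>r\<close> of component \<open>l\<close> in
  reading order. These numbers describe the initial tableau and are also the partial sums compared
  by dominance. Rows may have any lengths here, since straightening passes through
  compositions.\<close>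

definition off :: "mpart => nat => nat => nat" where
 "off mu l r = csum mu l + sum_list (take r (mu ! l))"

lemma tlam_eq: "(l, r, c) \<in> diagram mu ==> tlam mu (l, r, c) = off mu l r + c + 1"
 by (simp add: tlam_def off_def csum_def)

lemma dominates_iff: "dominates lam mu \<longleftrightarrow> (\<forall>l<length lam. \<forall>i. off mu l i <= off lam l i)"
 by (simp add: dominates_def off_def csum_def)

lemma diagram_iff: "(l, r, c) \<in> diagram mu \<longleftrightarrow> l < length mu \<and> r < length (mu ! l) \<and> c < mu ! l ! r"
 by (simp add: diagram_def)

lemma sum_list_take: "i <= length xs ==> sum_list (take i xs) = (\<Sum>k<i. xs ! k)" for xs :: "nat list"
 by (simp add: sum_list_sum_nth atLeast0LessThan min_def)

lemma csum_Suc: "l < length mu ==> csum mu (Suc l) = csum mu l + sum_list (mu ! l)"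
 by (simp add: csum_def take_Suc_conv_app_nth)

lemma csum_mono: "l <= l' ==> csum mu l <= csum mu l'"
 unfolding csum_def by (metis le_add1 le_Suc_ex map_append sum_list_append take_add)

lemma csum_le: "csum mu l <= msize mu"
 unfolding csum_def msize_def by (metis append_take_drop_id le_add1 map_append sum_list_append)

lemma csum_length: "csum mu (length mu) = msize mu"
 by (simp add: csum_def msize_def)

lemma sum_take_mono: "r <= r' ==> sum_list (take r xs) <= sum_list (take r' (xs :: nat list))"
 by (metis le_add1 le_Suc_ex sum_list_append take_add)

lemma sum_take_le: "sum_list (take r xs) <= sum_list (xs :: nat list)"
 by (metis append_take_drop_id le_add1 sum_list_append)

lemma sum_take_Suc: "r < length xs ==> sum_list (take (Suc r) xs) = sum_list (take r xs) + xs ! r" for xs :: "nat list"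
 by (simp add: take_Suc_conv_app_nth)

lemma off_row_le:
 assumes "r < length (mu ! l)" "r < r'"
 shows "off mu l r + mu ! l ! r <= off mu l r'"
 using sum_take_mono[of "Suc r" r' "mu ! l"] assms by (simp add: off_def sum_take_Suc)

lemma off_le_csum: "l < length mu ==> off mu l r <= csum mu (Suc l)"
 using sum_take_le[of r "mu ! l"] by (simp add: off_def csum_Suc)

lemma off_row_le_csum: "l < length mu ==> r < length (mu ! l) ==> off mu l r + mu ! l ! r <= csum mu (Suc l)"
 using off_row_le[of r mu l "Suc r"] off_le_csum[of l mu "Suc r"] by simp

lemma off_ge_csum: "csum mu l <= off mu l r"
 by (simp add: off_def)

lemma tlam_mono:
 assumes x: "x \<in> diagram mu" and y: "y \<in> diagram mu" and lt: "node_below y x"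
 shows "tlam mu x < tlam mu y"
proof -
 obtain l r c l' r' c' where xy: "x = (l, r, c)" "y = (l', r', c')" by (cases x, cases y)
 have dx: "l < length mu" "r < length (mu ! l)" "c < mu ! l ! r"
  and dy: "l' < length mu" "r' < length (mu ! l')" "c' < mu ! l' ! r'"
  using x y unfolding xy diagram_iff by simp_all
 have t: "tlam mu x = off mu l r + c + 1" "tlam mu y = off mu l' r' + c' + 1"
  using x y unfolding xy by (simp_all add: tlam_eq)
 consider "l < l'" | "l = l'" "r < r'" | "l = l'" "r = r'" "c < c'"
  using lt unfolding xy node_below_def by auto
 then show ?thesis
 proof cases
  case 1
  have "off mu l r + mu ! l ! r <= csum mu (Suc l)" using off_row_le_csum dx by blast
  also have "\<dots> <= csum mu l'" using 1 by (intro csum_mono) simp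
  also have "\<dots> <= off mu l' r'" by (rule off_ge_csum)
  finally show ?thesis using dx t by simp
 next
  case 2
  then show ?thesis using off_row_le[of r mu l r'] dx t by simp
 qed (use t in simp)
qed

lemma node_below_total: "x = y \<or> node_below x y \<or> node_below y x"
 by (cases x; cases y) (auto simp: node_below_def)

lemma node_below_asym: "node_below x y ==> \<not> node_below y x"
 by (cases x; cases y) (auto simp: node_below_def)

lemma tlam_less_iff:
 assumes "x \<in> diagram mu" "y \<in> diagram mu"
 shows "tlam mu x < tlam mu y \<longleftrightarrow> node_below y x"
 using tlam_mono[OF assms] tlam_mono[OF assms(2,1)] node_below_total[of x y] by (metis less_asym less_irrefl)

lemma tlam_inj: "inj_on (tlam mu) (diagram mu)"
 by (rule inj_onI) (metis tlam_mono node_below_total less_irrefl)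

lemma diagram_Sigma: "diagram mu = Sigma {..<length mu} (\<lambda>l. Sigma {..<length (mu ! l)} (\<lambda>r. {..<mu ! l ! r}))"
 by (auto simp: diagram_def)

lemma finite_diagram [simp]: "finite (diagram mu)"
 unfolding diagram_Sigma by (intro finite_SigmaI) auto

lemma card_diagram: "card (diagram mu) = msize mu"
 unfolding diagram_Sigma
 by (simp add: card_SigmaI finite_SigmaI msize_def sum_list_sum_nth atLeast0LessThan)

lemma tlam_range: assumes x: "x \<in> diagram mu" shows "1 <= tlam mu x" "tlam mu x <= msize mu"
proof -
 obtain l r c where xx: "x = (l, r, c)" by (cases x)
 have dx: "l < length mu" "r < length (mu ! l)" "c < mu ! l ! r" using x unfolding xx diagram_iff by simp_all
 show "1 <= tlam mu x" using x unfolding xx by (simp add: tlam_eq)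
 show "tlam mu x <= msize mu"
  using x off_row_le_csum[OF dx(1,2)] dx(3) csum_le[of mu "Suc l"] unfolding xx by (simp add: tlam_eq)
qed

lemma tlam_bij: "bij_betw (tlam mu) (diagram mu) {1..msize mu}"
proof -
 have "tlam mu ` diagram mu = {1..msize mu}"
  using tlam_range[of _ mu]
  by (intro card_subset_eq) (auto simp: card_image[OF tlam_inj] card_diagram)
 then show ?thesis using tlam_inj by (simp add: bij_betw_def)
qed

definition nd :: "mpart => nat => node" where "nd mu i = inv_into (diagram mu) (tlam mu) i"

lemma nd_tlam [simp]: "x \<in> diagram mu ==> nd mu (tlam mu x) = x"
 unfolding nd_def by (rule inv_into_f_f[OF tlam_inj])

lemma nd_in: "1 <= i ==> i <= msize mu ==> nd mu i \<in> diagram mu"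
 and tlam_nd [simp]: "1 <= i ==> i <= msize mu ==> tlam mu (nd mu i) = i"
 unfolding nd_def using tlam_bij[of mu]
 by (auto simp: bij_betw_def intro!: inv_into_into f_inv_into_f)

lemma nd_below:
 "1 <= i ==> i <= msize mu ==> 1 <= j ==> j <= msize mu ==> node_below (nd mu j) (nd mu i) \<longleftrightarrow> i < j"
 using tlam_less_iff[OF nd_in nd_in, of i mu j] by simp

text \<open>Labels of positions whose fibres are the rows, respectively the components, of the
  initial tableau. The Young subgroup of \<open>rowl mu\<close> is the row stabiliser; for
  \<open>w\<close> in that of \<open>compl mu\<close>, \<open>TW w\<close> commutes with
  \<open>uu mu\<close>.\<close>

definition rowl :: "mpart => nat => nat \<times> nat" where "rowl mu i = (fst (nd mu i), fst (snd (nd mu i)))"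
definition compl :: "mpart => nat => nat" where "compl mu i = fst (nd mu i)"

lemma nd_le_convex:
 assumes "1 <= i" "i <= j" "j <= k" "k <= msize mu"
 shows "nd mu j = nd mu i \<or> node_below (nd mu j) (nd mu i)" "nd mu j = nd mu k \<or> node_below (nd mu k) (nd mu j)"
proof -
 show "nd mu j = nd mu i \<or> node_below (nd mu j) (nd mu i)"
  by (cases "i = j") (use assms nd_below[of i mu j] in auto)
 show "nd mu j = nd mu k \<or> node_below (nd mu k) (nd mu j)"
  by (cases "k = j") (use assms nd_below[of j mu k] in auto)
qed

lemma convex_rowl: "convex_lab (msize mu) (rowl mu)"
 unfolding convex_lab_def
proof (intro allI impI)
 fix i j k assume a: "1 <= i" "i <= j" "j <= k" "k <= msize mu" and eq: "rowl mu i = rowl mu k"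
 obtain l r c l' r' c' l'' r'' c'' where n: "nd mu i = (l, r, c)" "nd mu j = (l', r', c')" "nd mu k = (l'', r'', c'')"
  by (metis prod_cases3)
 show "rowl mu j = rowl mu i"
  using nd_le_convex[OF a] eq unfolding rowl_def n node_below_def by auto
qed

lemma convex_compl: "convex_lab (msize mu) (compl mu)"
 unfolding convex_lab_def
proof (intro allI impI)
 fix i j k assume a: "1 <= i" "i <= j" "j <= k" "k <= msize mu" and eq: "compl mu i = compl mu k"
 obtain l r c l' r' c' l'' r'' c'' where n: "nd mu i = (l, r, c)" "nd mu j = (l', r', c')" "nd mu k = (l'', r'', c'')"
  by (metis prod_cases3)
 show "compl mu j = compl mu i"
  using nd_le_convex[OF a] eq unfolding compl_def n node_below_def by auto
qed

lemma rowl_tlam: "(l, r, c) \<in> diagram mu ==> rowl mu (tlam mu (l, r, c)) = (l, r)"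
 by (simp add: rowl_def)

lemma comp_less_iff:
 assumes "(l', r, c) \<in> diagram mu"
 shows "l' < l \<longleftrightarrow> tlam mu (l', r, c) <= csum mu l"
proof -
 have d: "l' < length mu" "r < length (mu ! l')" "c < mu ! l' ! r" using assms unfolding diagram_iff by simp_all
 have t: "tlam mu (l', r, c) = off mu l' r + c + 1" using assms by (rule tlam_eq)
 show ?thesis
 proof
  assume "l' < l"
  then have "csum mu (Suc l') <= csum mu l" by (intro csum_mono) simp
  then show "tlam mu (l', r, c) <= csum mu l" using off_row_le_csum[OF d(1,2)] d(3) t by linarith
 next
  assume a: "tlam mu (l', r, c) <= csum mu l"
  show "l' < l"
  proof (rule ccontr)
   assume "\<not> l' < l"
   then have "csum mu l <= csum mu l'" by (intro csum_mono) simp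
   then show False using off_ge_csum[of mu l' r] t a by linarith
  qed
 qed
qed

text \<open>The product of the first \<open>a\<close> factors with \<open>L\<close> commutes with
  \<open>T r\<close> for \<open>r ~= a\<close>, and the numbers \<open>csum mu l\<close> are the
  values of \<open>a\<close> that occur in \<open>uu mu\<close>.\<close>

lemma compl_boundary:
 assumes "1 <= r" "r < msize mu" "compl mu r = compl mu (Suc r)"
 shows "r ~= csum mu l"
proof
 assume r: "r = csum mu l"
 obtain a b c a' b' c' where n: "nd mu r = (a, b, c)" "nd mu (Suc r) = (a', b', c')" by (metis prod_cases3)
 have d: "(a, b, c) \<in> diagram mu" "(a', b', c') \<in> diagram mu"
  using nd_in[of r mu] nd_in[of "Suc r" mu] assms n by simp_all
 have t: "tlam mu (a, b, c) = r" "tlam mu (a', b', c') = Suc r"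
  using tlam_nd[of r mu] tlam_nd[of "Suc r" mu] assms n by simp_all
 have "a < l" "\<not> a' < l" using comp_less_iff[OF d(1), of l] comp_less_iff[OF d(2), of l] t r by simp_all
 then show False using assms(3) unfolding compl_def n by simp
qed

lemma tlam_Suc: "(l, r, Suc c) \<in> diagram mu ==> tlam mu (l, r, Suc c) = Suc (tlam mu (l, r, c))"
 using tlam_eq[of l r "Suc c" mu] tlam_eq[of l r c mu] by (simp add: diagram_iff)

lemma rowl_compl: "rowl mu i = rowl mu j ==> compl mu i = compl mu j"
 by (simp add: rowl_def compl_def)

lemma row_stab_young:
 assumes n: "msize mu = n"
 shows "row_stab n mu = young n (rowl mu)"
proof -
 have iff: "(\<forall>x\<in>diagram mu. \<exists>y\<in>diagram mu. fst y = fst x \<and> fst (snd y) = fst (snd x) \<and> w (tlam mu x) = tlam mu y)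
   \<longleftrightarrow> (\<forall>i\<in>{1..n}. rowl mu (w i) = rowl mu i)" if w: "w permutes {1..n}" for w
 proof
  assume L: "\<forall>x\<in>diagram mu. \<exists>y\<in>diagram mu. fst y = fst x \<and> fst (snd y) = fst (snd x) \<and> w (tlam mu x) = tlam mu y"
  show "\<forall>i\<in>{1..n}. rowl mu (w i) = rowl mu i"
  proof
   fix i assume i: "i \<in> {1..n}"
   then have x: "nd mu i \<in> diagram mu" "tlam mu (nd mu i) = i" using nd_in[of i mu] n by simp_all
   obtain y where "y \<in> diagram mu" "fst y = fst (nd mu i)" "fst (snd y) = fst (snd (nd mu i))" "w i = tlam mu y"
    using L x by metis
   then show "rowl mu (w i) = rowl mu i" by (simp add: rowl_def)
  qed
 next
  assume R: "\<forall>i\<in>{1..n}. rowl mu (w i) = rowl mu i"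
  show "\<forall>x\<in>diagram mu. \<exists>y\<in>diagram mu. fst y = fst x \<and> fst (snd y) = fst (snd x) \<and> w (tlam mu x) = tlam mu y"
  proof
   fix x assume x: "x \<in> diagram mu"
   have t: "1 <= tlam mu x" "tlam mu x <= n" using tlam_range[OF x] n by simp_all
   have wt: "1 <= w (tlam mu x)" "w (tlam mu x) <= msize mu" using perm_range[OF w t] n by simp_all
   have "rowl mu (w (tlam mu x)) = rowl mu (tlam mu x)" using R t by simp
   then show "\<exists>y\<in>diagram mu. fst y = fst x \<and> fst (snd y) = fst (snd x) \<and> w (tlam mu x) = tlam mu y"
    using nd_in[OF wt] tlam_nd[OF wt] x by (intro bexI[of _ "nd mu (w (tlam mu x))"]) (auto simp: rowl_def)
  qed
 qed
 show ?thesis unfolding row_stab_def young_def using iff by blast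
qed

definition tab_of :: "mpart => (nat => nat) => tableau" where
 "tab_of lam w = (\<lambda>x. if x \<in> diagram lam then w (tlam lam x) else 0)"

lemma dperm_spec:
 assumes n: "msize lam = n" and t: "bij_betw t (diagram lam) {1..n}"
 shows "dperm n lam t permutes {1..n}" "x \<in> diagram lam ==> dperm n lam t (tlam lam x) = t x"
proof -
 let ?P = "\<lambda>d. d permutes {1..n} \<and> (\<forall>x\<in>diagram lam. d (tlam lam x) = t x)"
 define d where "d = (\<lambda>i. if i \<in> {1..n} then t (nd lam i) else i)"
 have "bij_betw (nd lam) {1..n} (diagram lam)"
  unfolding nd_def n[symmetric] by (rule bij_betw_inv_into[OF tlam_bij])
 then have "bij_betw (t \<circ> nd lam) {1..n} {1..n}" using t by (rule bij_betw_trans)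
 then have "bij_betw d {1..n} {1..n}"
  by (rule iffD1[OF bij_betw_cong, rotated]) (simp add: d_def)
 then have "d permutes {1..n}" by (rule bij_imp_permutes) (auto simp: d_def)
 moreover have "d (tlam lam x) = t x" if "x \<in> diagram lam" for x
  using tlam_range[OF that] n that by (simp add: d_def)
 ultimately have ex: "?P d" by blast
 have "d' = d" if d': "?P d'" for d'
 proof
  fix i
  show "d' i = d i"
  proof (cases "i \<in> {1..n}")
   case True
   then show ?thesis using d' ex nd_in[of i lam] tlam_nd[of i lam] n by (metis atLeastAtMost_iff)
  next
   case False
   then show ?thesis using d' ex by (metis permutes_not_in)
  qed
 qed
 then have "?P (dperm n lam t)" unfolding dperm_def by (rule theI[of ?P, OF ex])
 then show "dperm n lam t permutes {1..n}" "x \<in> diagram lam ==> dperm n lam t (tlam lam x) = t x" by blast+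
qed

lemma perm_eqI:
 assumes n: "msize lam = n" and "d permutes {1..n}" "d' permutes {1..n}"
  and "\<And>x. x \<in> diagram lam ==> d (tlam lam x) = d' (tlam lam x)"
 shows "d = d'"
proof
 fix i show "d i = d' i"
 proof (cases "i \<in> {1..n}")
  case True
  then show ?thesis using assms(4)[of "nd lam i"] nd_in[of i lam] tlam_nd[of i lam] n by simp
 next
  case False
  then show ?thesis using assms(2,3) by (metis permutes_not_in)
 qed
qed

lemma tab_of_bij:
 assumes n: "msize lam = n" and w: "w permutes {1..n}"
 shows "bij_betw (tab_of lam w) (diagram lam) {1..n}"
proof -
 have "bij_betw (w \<circ> tlam lam) (diagram lam) {1..n}"
  using bij_betw_trans[OF tlam_bij[of lam] permutes_imp_bij[OF w, folded n]] n by simp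
 then show ?thesis by (rule iffD1[OF bij_betw_cong, rotated]) (simp add: tab_of_def)
qed

lemma dperm_tab_of:
 assumes n: "msize lam = n" and w: "w permutes {1..n}"
 shows "dperm n lam (tab_of lam w) = w"
 by (rule perm_eqI[OF n dperm_spec(1)[OF n tab_of_bij[OF n w]] w])
  (simp only: dperm_spec(2)[OF n tab_of_bij[OF n w]], simp add: tab_of_def)

lemma dperm_tlam: assumes n: "msize lam = n" shows "dperm n lam (tlam lam) = id"
proof -
 have "tab_of lam id = tlam lam" by (auto simp: tab_of_def tlam_def fun_eq_iff)
 then show ?thesis using dperm_tab_of[OF n permutes_id] by simp
qed

text \<open>A bijection between diagrams induces a permutation of the positions.\<close>
lemma diagram_move:
 assumes n: "msize mu = n" "msize nu = n"
  and G: "inj_on G (diagram mu)" "\<And>x. x \<in> diagram mu ==> G x \<in> diagram nu"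
 obtains d where "d permutes {1..n}"
  "\<And>x. x \<in> diagram mu ==> d (tlam mu x) = tlam nu (G x)"
  "\<And>i. 1 <= i ==> i <= n ==> nd nu (d i) = G (nd mu i)"
proof -
 have "G ` diagram mu = diagram nu"
  using G n by (intro card_subset_eq) (auto simp: card_image card_diagram)
 then have "bij_betw G (diagram mu) (diagram nu)" using G by (simp add: bij_betw_def)
 from bij_betw_trans[OF this tlam_bij] have b: "bij_betw (tlam nu \<circ> G) (diagram mu) {1..n}"
  unfolding n .
 let ?d = "dperm n mu (tlam nu \<circ> G)"
 have d: "?d permutes {1..n}" "\<And>x. x \<in> diagram mu ==> ?d (tlam mu x) = tlam nu (G x)"
  using dperm_spec[OF n(1) b] by simp_all
 have "nd nu (?d i) = G (nd mu i)" if "1 <= i" "i <= n" for i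
  using d(2)[of "nd mu i"] nd_in[of i mu] that n G(2)[of "nd mu i"] by simp
 with d that show ?thesis by blast
qed

lemma young_cong:
 assumes "\<And>i j. 1 <= i ==> i <= n ==> 1 <= j ==> j <= n ==> b i = b j \<longleftrightarrow> b' i = b' j"
 shows "young n b = young n b'"
proof -
 have "(\<forall>i\<in>{1..n}. b (w i) = b i) \<longleftrightarrow> (\<forall>i\<in>{1..n}. b' (w i) = b' i)" if "w permutes {1..n}" for w
  using perm_range[OF that] assms by (intro ball_cong refl) simp
 then show ?thesis unfolding young_def by blast
qed

section \<open>Dominance, sorting of compositions and a lexicographic order\<close>

lemma multipartitionD:
 assumes "multipartition ell n lam"
 shows "length lam = ell" "msize lam = n" "\<And>l. l < ell ==> is_partition (lam ! l)"
 using assms unfolding multipartition_def msize_def by auto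

lemma partition_antimono:
 assumes "is_partition p" "r <= r'" "r' < length p"
 shows "p ! r' <= p ! r"
proof -
 have "sorted_wrt (\<ge>) p" using assms(1) by (simp add: is_partition_def sorted_wrt_rev)
 then show ?thesis using assms by (cases "r = r'") (auto simp: sorted_wrt_iff_nth_less)
qed

lemma dominates_trans: "length lam = length mu ==> dominates lam mu ==> dominates mu nu ==> dominates lam nu"
 unfolding dominates_iff by (metis le_trans)

text \<open>Entries are positive, so prefix sums grow up to the end of the list and then stop; they
  determine the length and then each entry.\<close>

lemma prefix_sums_eq:
 fixes xs ys :: "nat list"
 assumes "0 \<notin> set xs" "0 \<notin> set ys" and eq: "\<And>i. sum_list (take i xs) = sum_list (take i ys)"
 shows "xs = ys"
proof -
 have le: "length ys <= length xs" if "0 \<notin> set ys" and eq: "\<And>i. sum_list (take i xs) = sum_list (take i ys)"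
  for xs ys :: "nat list"
 proof (rule ccontr)
  assume "\<not> ?thesis"
  then have l: "length xs < length ys" by simp
  then have "ys ! length xs ~= 0" using that(1) nth_mem[OF l] by metis
  then show False using eq[of "length xs"] eq[of "Suc (length xs)"] sum_take_Suc[OF l] by simp
 qed
 have len: "length xs = length ys" using le[of ys xs] le[of xs ys] assms by (simp add: eq)
 show ?thesis
 proof (rule nth_equalityI[OF len])
  fix i assume "i < length xs"
  then show "xs ! i = ys ! i" using eq[of i] eq[of "Suc i"] len by (simp add: sum_take_Suc)
 qed
qed

lemma off_eq_imp_eq:
 assumes "multipartition ell n lam" "multipartition ell n mu"
  and eq: "\<And>l i. l < ell ==> off lam l i = off mu l i"
 shows "lam = mu"
proof (rule nth_equalityI)
 show "length lam = length mu" using multipartitionD(1)[OF assms(1)] multipartitionD(1)[OF assms(2)] by simp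
 fix l assume "l < length lam"
 then have l: "l < ell" using multipartitionD(1)[OF assms(1)] by simp
 have c: "csum lam l = csum mu l" using eq[OF l, of 0] by (simp add: off_def)
 show "lam ! l = mu ! l"
  using multipartitionD(3)[OF assms(1) l] multipartitionD(3)[OF assms(2) l] eq[OF l] c
  by (intro prefix_sums_eq) (auto simp: is_partition_def off_def)
qed

lemma dominates_antisym:
 assumes "multipartition ell n lam" "multipartition ell n mu" "dominates lam mu" "dominates mu lam"
 shows "lam = mu"
 by (rule off_eq_imp_eq[OF assms(1,2)])
  (use assms multipartitionD(1)[OF assms(1)] multipartitionD(1)[OF assms(2)] in \<open>auto simp: dominates_iff intro!: antisym\<close>)

text \<open>A numerical measure that grows strictly with dominance; it drives the induction over
  shapes in \<open>cong_above_exists\<close>. Indices up to \<open>n\<close> suffice, as a component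
  has at most \<open>n\<close> rows.\<close>

definition dweight :: "nat => mpart => nat" where
 "dweight n lam = (\<Sum>l<length lam. \<Sum>i\<le>n. off lam l i)"

lemma partition_length_le: assumes "0 \<notin> set xs" shows "length xs <= sum_list (xs :: nat list)"
 using assms by (induction xs) auto

lemma part_length_le:
 assumes "multipartition ell n lam" "l < ell"
 shows "length (lam ! l) <= n"
proof -
 have "length (lam ! l) <= sum_list (lam ! l)"
  using multipartitionD(3)[OF assms] by (intro partition_length_le) (simp add: is_partition_def)
 also have "\<dots> <= n"
  using csum_Suc[of l lam] csum_le[of lam "Suc l"] multipartitionD[OF assms(1)] assms(2) by simp
 finally show ?thesis .
qed

lemma dweight_strict:
 assumes "multipartition ell n lam" "multipartition ell n mu" "strictly_dominates mu lam"
 shows "dweight n lam < dweight n mu"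
proof (rule ccontr)
 assume neg: "\<not> ?thesis"
 have len: "length lam = ell" "length mu = ell" using assms multipartitionD(1) by blast+
 have le: "off lam l i <= off mu l i" if "l < ell" for l i
  using assms(3) that len by (simp add: strictly_dominates_def dominates_iff)
 have le1: "(\<Sum>i\<le>n. off lam l i) <= (\<Sum>i\<le>n. off mu l i)" if "l < ell" for l
  using le[OF that] by (intro sum_mono)
 have "(\<Sum>l<ell. \<Sum>i\<le>n. off lam l i) = (\<Sum>l<ell. \<Sum>i\<le>n. off mu l i)"
  using neg sum_mono[of "{..<ell}", OF le1] unfolding dweight_def len by force
 then have eq1: "(\<Sum>i\<le>n. off lam l i) = (\<Sum>i\<le>n. off mu l i)" if "l < ell" for l
  using sum_mono_inv[of "\<lambda>l. \<Sum>i\<le>n. off lam l i" "{..<ell}" "\<lambda>l. \<Sum>i\<le>n. off mu l i" l] le1 that by auto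
 have eq2: "off lam l i = off mu l i" if "l < ell" "i <= n" for l i
  using sum_mono_inv[of "off lam l" "{..n}" "off mu l" i] le eq1 that by auto
 have "off lam l i = off mu l i" if l: "l < ell" for l i
 proof (cases "i <= n")
  case False
  have "off lam l i = off lam l n" "off mu l i = off mu l n"
   using part_length_le[OF assms(1) l] part_length_le[OF assms(2) l] False by (simp_all add: off_def)
  then show ?thesis using eq2[OF l] by simp
 qed (use eq2 l in blast)
 then show False using off_eq_imp_eq[OF assms(1,2)] assms(3) by (simp add: strictly_dominates_def)
qed

lemma off_le_msize: "l < length mu ==> off mu l r <= msize mu"
 using off_le_csum[of l mu r] csum_le[of mu "Suc l"] by linarith

definition sortd :: "nat list => nat list" where "sortd xs = rev (sort xs)"
definition sortm :: "mpart => mpart" where "sortm mu = map (\<lambda>xs. filter (\<lambda>x. 0 < x) (sortd xs)) mu"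

text \<open>The maximum of \<open>F\<close> is at least \<open>card F - 1\<close>, so its term is at
  most the last term on the right; remove it and induct.\<close>

lemma antimono_sum_le:
 fixes g :: "nat => nat"
 assumes "finite F" and g: "\<And>i j. i <= j ==> g j <= g i"
 shows "sum g F <= (\<Sum>k<card F. g k)"
 using assms(1)
proof (induction "card F" arbitrary: F)
 case (Suc k)
 then have ne: "F ~= {}" by auto
 let ?M = "Max F"
 have M: "?M \<in> F" using Suc.prems ne by simp
 have "F \<subseteq> {..?M}" using Suc.prems by auto
 then have "card F <= card {..?M}" by (intro card_mono) simp_all
 then have kM: "k <= ?M" using Suc.hyps(2) by simp
 have "sum g F = g ?M + sum g (F - {?M})" using Suc.prems M by (simp add: sum.remove)
 also have "\<dots> <= g k + (\<Sum>k<card (F - {?M}). g k)"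
  using g[OF kM] Suc.hyps(1)[of "F - {?M}"] Suc.prems Suc.hyps(2) M by (simp add: add_mono)
 also have "\<dots> = (\<Sum>k<card F. g k)" using Suc.hyps(2)[symmetric] Suc.prems M by simp
 finally show ?case .
qed simp

lemma sortd_antimono: "i <= j ==> j < length xs ==> sortd xs ! j <= sortd xs ! i"
 unfolding sortd_def by (simp add: rev_nth sorted_nth_mono)

lemma length_sortd [simp]: "length (sortd xs) = length xs"
 and mset_sortd [simp]: "mset (sortd xs) = mset xs"
 by (simp_all add: sortd_def)

lemma sum_take_sortd: "sum_list (take i xs) <= sum_list (take i (sortd xs))"
proof (cases "i <= length xs")
 case True
 obtain f where f: "bij_betw f {..<length xs} {..<length (sortd xs)}" "\<And>k. k < length xs ==> xs ! k = sortd xs ! f k"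
  using permutation_Ex_bij[of xs "sortd xs"] by auto
 define g where "g k = (if k < length xs then sortd xs ! k else 0)" for k
 have inj: "inj_on f {..<i}" using f(1) True by (auto simp: bij_betw_def inj_on_def)
 have fl: "f k < length xs" if "k < length xs" for k using f(1) that by (auto simp: bij_betw_def)
 have "sum_list (take i xs) = (\<Sum>k<i. g (f k))"
  unfolding sum_list_take[OF True] using f(2) fl True by (intro sum.cong) (auto simp: g_def)
 also have "\<dots> = sum g (f ` {..<i})" using inj by (simp add: sum.reindex)
 also have "\<dots> <= (\<Sum>k<card (f ` {..<i}). g k)"
  by (rule antimono_sum_le) (auto simp: g_def sortd_antimono)
 also have "\<dots> = (\<Sum>k<i. sortd xs ! k)"
  using True by (simp add: card_image[OF inj] g_def)
 also have "\<dots> = sum_list (take i (sortd xs))" using True by (simp add: sum_list_take)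
 finally show ?thesis .
next
 case False
 then show ?thesis using mset_sortd[of xs] by (simp flip: sum_mset_sum_list)
qed

lemma sorted_filter_zeros:
 assumes "sorted_wrt (\<ge>) (ys :: nat list)"
 shows "\<exists>k. ys = filter (\<lambda>x. 0 < x) ys @ replicate k 0"
 using assms
proof (induction ys)
 case (Cons y ys)
 show ?case
 proof (cases "y = 0")
  case True
  then have z: "\<forall>x\<in>set ys. x = 0" using Cons.prems by simp
  then have "filter (\<lambda>x. 0 < x) (y # ys) = []" using True by simp
  moreover have "y # ys = replicate (Suc (length ys)) 0"
   using z True by (simp add: replicate_length_same)
  ultimately show ?thesis by (metis append_Nil)
 next
  case False
  then show ?thesis using Cons by auto
 qed
qed simp

lemma sortd_decomp: "\<exists>k. sortd xs = filter (\<lambda>x. 0 < x) (sortd xs) @ replicate k 0"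
proof (rule sorted_filter_zeros)
 show "sorted_wrt (\<ge>) (sortd xs)" by (simp add: sortd_def sorted_wrt_rev)
qed

lemma take_sortd: "sum_list (take i (filter (\<lambda>x. 0 < x) (sortd xs))) = sum_list (take i (sortd xs))"
proof -
 obtain k where k: "sortd xs = filter (\<lambda>x. 0 < x) (sortd xs) @ replicate k 0"
  using sortd_decomp by blast
 from arg_cong[OF k, of "\<lambda>z. sum_list (take i z)"] show ?thesis by (simp add: sum_list_replicate)
qed

lemma nth_sortd:
 assumes "r < length xs" "sortd xs ! r ~= 0"
 shows "r < length (filter (\<lambda>x. 0 < x) (sortd xs))" "filter (\<lambda>x. 0 < x) (sortd xs) ! r = sortd xs ! r"
proof -
 obtain k where k: "sortd xs = filter (\<lambda>x. 0 < x) (sortd xs) @ replicate k 0" (is "_ = ?f @ _")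
  using sortd_decomp by blast
 have len: "length xs = length ?f + k" using arg_cong[OF k, of length] by simp
 show l: "r < length ?f"
 proof (rule ccontr)
  assume "\<not> ?thesis"
  then have "sortd xs ! r = 0"
   using arg_cong[OF k, of "\<lambda>z. z ! r"] assms(1) len by (simp add: nth_append)
  then show False using assms(2) by simp
 qed
 show "?f ! r = sortd xs ! r" using arg_cong[OF k, of "\<lambda>z. z ! r"] l by (simp add: nth_append)
qed

lemma sum_list_sortd [simp]: "sum_list (sortd xs) = sum_list xs"
 by (metis mset_sortd sum_mset_sum_list)

lemma csum_sortm: "csum (sortm mu) l = csum mu l"
proof -
 have "sum_list (filter (\<lambda>x. 0 < x) (sortd xs)) = sum_list xs" for xs
  using take_sortd[of "length xs" xs] length_filter_le[of "\<lambda>x. x ~= 0" "sortd xs"] by simp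
 then show ?thesis by (simp add: csum_def sortm_def take_map o_def)
qed

lemma length_sortm [simp]: "length (sortm mu) = length mu"
 by (simp add: sortm_def)

lemma msize_sortm: "msize (sortm mu) = msize mu"
 using csum_sortm[of mu "length mu"] csum_length[of mu] csum_length[of "sortm mu"] by simp

lemma sortm_multipartition: "multipartition (length mu) (msize mu) (sortm mu)"
proof -
 have "is_partition (filter (\<lambda>x. 0 < x) (sortd xs))" for xs
  by (simp add: is_partition_def sortd_def rev_filter sorted_wrt_filter)
 then show ?thesis
  using msize_sortm[of mu] unfolding multipartition_def msize_def by (auto simp: sortm_def)
qed

lemma dominates_sortm: "dominates (sortm mu) mu"
 unfolding dominates_iff
proof (intro allI impI)
 fix l i assume "l < length (sortm mu)"
 then show "off mu l i <= off (sortm mu) l i"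
  using sum_take_sortd[of i "mu ! l"] take_sortd[of i "mu ! l"] unfolding off_def csum_sortm by (simp add: sortm_def)
qed

text \<open>Rows are matched with rows of equal length. Nodes exist only in nonempty rows, so the
  matched row survives the removal of zeros.\<close>

lemma sortm_row_map:
 obtains G where "inj_on (\<lambda>(l, r, c). (l, G l r, c)) (diagram mu)"
  "\<And>l r c. (l, r, c) \<in> diagram mu ==> (l, G l r, c) \<in> diagram (sortm mu)"
proof -
 have "\<exists>f. bij_betw f {..<length xs} {..<length (sortd xs)} \<and> (\<forall>k<length xs. xs ! k = sortd xs ! f k)" for xs
  using permutation_Ex_bij[of xs "sortd xs"] by auto
 then obtain F where F: "\<And>xs. bij_betw (F xs) {..<length xs} {..<length (sortd xs)}"
  "\<And>xs k. k < length xs ==> xs ! k = sortd xs ! F xs k"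
  by metis
 define G where "G l r = F (mu ! l) r" for l r
 show ?thesis
 proof (rule that[of G])
  show "inj_on (\<lambda>(l, r, c). (l, G l r, c)) (diagram mu)"
  proof (rule inj_onI, clarsimp simp: diagram_iff)
   fix l r c r' assume "r < length (mu ! l)" "r' < length (mu ! l)" "G l r = G l r'"
   then show "r = r'" using F(1)[of "mu ! l"] unfolding G_def bij_betw_def inj_on_def by blast
  qed
  fix l r c assume d: "(l, r, c) \<in> diagram mu"
  then have h: "l < length mu" "r < length (mu ! l)" "c < mu ! l ! r" by (simp_all add: diagram_iff)
  have f: "F (mu ! l) r < length (mu ! l)" using F(1)[of "mu ! l"] h(2) by (auto simp: bij_betw_def)
  have "sortd (mu ! l) ! F (mu ! l) r = mu ! l ! r" using F(2)[OF h(2)] by simp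
  then show "(l, G l r, c) \<in> diagram (sortm mu)"
   using nth_sortd[OF f] h by (simp add: diagram_iff sortm_def G_def)
 qed
qed

text \<open>The pair \<open>(l, i)\<close> is encoded as \<open>l * (n + 2) + i\<close>. Index
  \<open>n + 1\<close> is included because prefix sums are compared one step past the last of up to
  \<open>n\<close> rows.\<close>

definition offk :: "nat => mpart => nat => nat" where
 "offk n lam k = off lam (k div (n + 2)) (k mod (n + 2))"

text \<open>By \<open>gtlexI_dom\<close> this refines dominance. It also registers the growth of an
  early row when later prefix sums shrink, as can happen for the shapes created by a Garnir
  relation.\<close>

definition gtlex :: "nat => nat => mpart => mpart => bool" where
 "gtlex ell n mu lam \<longleftrightarrow> (\<exists>k<ell * (n + 2). offk n lam k < offk n mu k \<and> (\<forall>j<k. offk n lam j = offk n mu j))"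

lemma gtlex_irrefl: "\<not> gtlex ell n lam lam"
 by (simp add: gtlex_def)

lemma gtlex_trans:
 assumes "gtlex ell n nu mu" "gtlex ell n mu lam"
 shows "gtlex ell n nu lam"
proof -
 obtain a where a: "a < ell * (n + 2)" "offk n mu a < offk n nu a" "\<And>j. j < a ==> offk n mu j = offk n nu j"
  using assms(1) unfolding gtlex_def by blast
 obtain b where b: "b < ell * (n + 2)" "offk n lam b < offk n mu b" "\<And>j. j < b ==> offk n lam j = offk n mu j"
  using assms(2) unfolding gtlex_def by blast
 show ?thesis
  unfolding gtlex_def
 proof (intro exI[of _ "min a b"] conjI allI impI)
  show "min a b < ell * (n + 2)" using a(1) by simp
  show "offk n lam (min a b) < offk n nu (min a b)"
   using a(2) b(2) a(3)[of b] b(3)[of a] by (cases a b rule: linorder_cases) (simp_all add: min_def)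
  show "offk n lam j = offk n nu j" if "j < min a b" for j using a(3) b(3) that by simp
 qed
qed

lemma gtlexI:
 assumes "l < ell" "i < n + 2" "off lam l i < off mu l i"
  and "\<And>l' i'. l' < l ==> off lam l' i' = off mu l' i'" "\<And>i'. i' < i ==> off lam l i' = off mu l i'"
 shows "gtlex ell n mu lam"
 unfolding gtlex_def
proof (intro exI[of _ "l * (n + 2) + i"] conjI allI impI)
 have "l * (n + 2) + i < Suc l * (n + 2)" using assms(2) by simp
 also have "\<dots> <= ell * (n + 2)" using assms(1) by (intro mult_le_mono1) simp
 finally show "l * (n + 2) + i < ell * (n + 2)" .
 have dm: "(l * (n + 2) + i) div (n + 2) = l" "(l * (n + 2) + i) mod (n + 2) = i"
  using assms(2) by (metis add.commute div_mult_self3 div_less add_0_right zero_less_Suc add_2_eq_Suc' neq0_conv nat.simps(3), metis mod_mult_self3 mod_less)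
 then show "offk n lam (l * (n + 2) + i) < offk n mu (l * (n + 2) + i)"
  using assms(3) unfolding offk_def by metis
 fix j assume j: "j < l * (n + 2) + i"
 have "j div (n + 2) <= l" using div_le_mono[of j "l * (n + 2) + i" "n + 2"] j dm by simp
 then consider "j div (n + 2) < l" | "j div (n + 2) = l" by linarith
 then show "offk n lam j = offk n mu j"
 proof cases
  case 1 then show ?thesis unfolding offk_def by (rule assms(4))
 next
  case 2
  then have "j mod (n + 2) < i" using j div_mult_mod_eq[of j "n + 2"] by (metis nat_add_left_cancel_less)
  then show ?thesis unfolding offk_def using assms(5) 2 by simp
 qed
qed

text \<open>Passes from a composition to its sorted shape, whose prefix sums are at least as large.
  The first index where \<open>nu\<close> exceeds \<open>lam\<close> comes no later than the first
  one where \<open>mu\<close> does.\<close>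

lemma gtlex_ge:
 assumes "gtlex ell n mu lam" and "\<And>l i. l < ell ==> off mu l i <= off nu l i"
 shows "gtlex ell n nu lam"
proof -
 obtain b where b: "b < ell * (n + 2)" "offk n lam b < offk n mu b" "\<And>j. j < b ==> offk n lam j = offk n mu j"
  using assms(1) unfolding gtlex_def by blast
 have le: "offk n mu j <= offk n nu j" if "j <= b" for j
  unfolding offk_def using that b(1)
  by (intro assms(2)) (metis add_gr_0 less_mult_imp_div_less order_le_less_trans zero_less_numeral)
 let ?P = "\<lambda>j. j <= b \<and> offk n lam j < offk n nu j"
 define k where "k = (LEAST j. ?P j)"
 have "?P b" using b(2) le[of b] by simp
 then have k: "?P k" unfolding k_def by (rule LeastI)
 show ?thesis
  unfolding gtlex_def
 proof (intro exI[of _ k] conjI allI impI)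
  fix j assume j: "j < k"
  then have "\<not> ?P j" unfolding k_def by (rule not_less_Least)
  then show "offk n lam j = offk n nu j" using j k b(3)[of j] le[of j] by auto
 qed (use k b in auto)
qed

lemma gtlexI_dom:
 assumes "l < ell" "i < n + 2" "off lam l i < off mu l i"
  and le: "\<And>l' i'. l' < ell ==> off lam l' i' <= off mu l' i'"
 shows "gtlex ell n mu lam"
proof -
 let ?P = "\<lambda>k. k < ell * (n + 2) \<and> offk n lam k < offk n mu k"
 have "l * (n + 2) + i < Suc l * (n + 2)" using assms(2) by simp
 also have "\<dots> <= ell * (n + 2)" using assms(1) by (intro mult_le_mono1) simp
 finally have lt: "l * (n + 2) + i < ell * (n + 2)" .
 have dm: "(l * (n + 2) + i) div (n + 2) = l" "(l * (n + 2) + i) mod (n + 2) = i"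
  using assms(2) by (metis add.commute div_mult_self3 div_less add_0_right zero_less_Suc add_2_eq_Suc' neq0_conv nat.simps(3), metis mod_mult_self3 mod_less)
 have P: "?P (l * (n + 2) + i)" using lt assms(3) dm unfolding offk_def by metis
 define k where "k = (LEAST j. ?P j)"
 have k: "?P k" unfolding k_def by (rule LeastI[of ?P, OF P])
 show ?thesis
  unfolding gtlex_def
 proof (intro exI[of _ k] conjI allI impI)
  fix j assume j: "j < k"
  then have "\<not> ?P j" unfolding k_def by (rule not_less_Least)
  moreover have "j div (n + 2) < ell"
   using j k by (metis less_mult_imp_div_less order.strict_trans)
  ultimately show "offk n lam j = offk n mu j" using le[of "j div (n + 2)" "j mod (n + 2)"] j k
   unfolding offk_def by force
 qed (use k in auto)
qed

lemma finite_multipartitions: "finite {lam. multipartition ell n lam}"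
proof -
 let ?A = "{p. set p \<subseteq> {..n} \<and> length p <= n}"
 have "finite {lam. set lam \<subseteq> ?A \<and> length lam = ell}"
  by (intro finite_lists_length_eq finite_lists_length_le) simp
 moreover have "{lam. multipartition ell n lam} \<subseteq> {lam. set lam \<subseteq> ?A \<and> length lam = ell}"
 proof (clarify)
  fix lam assume mp: "multipartition ell n lam"
  have "p \<in> ?A" if p: "p \<in> set lam" for p
  proof -
   obtain l where l: "l < ell" "p = lam ! l" using p multipartitionD(1)[OF mp] by (auto simp: in_set_conv_nth)
   have "sum_list p <= n"
    using csum_Suc[of l lam] csum_le[of lam "Suc l"] multipartitionD[OF mp] l by simp
   then have "set p \<subseteq> {..n}" using elem_le_sum_list[of _ p] by (force simp: in_set_conv_nth)
   then show ?thesis using part_length_le[OF mp l(1)] l(2) by simp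
  qed
  then show "set lam \<subseteq> ?A \<and> length lam = ell" using multipartitionD(1)[OF mp] by blast
 qed
 ultimately show ?thesis by (rule rev_finite_subset)
qed

text \<open>Induction from the largest shapes downwards, well founded because \<open>n\<close> has
  finitely many multipartitions with \<open>ell\<close> components.\<close>

lemma gtlex_induct [consumes 1, case_names step]:
 assumes "multipartition ell n lam"
  and "\<And>lam. multipartition ell n lam ==>
   (\<And>mu. multipartition ell n mu ==> gtlex ell n mu lam ==> P mu) ==> P lam"
 shows "P lam"
 using assms(1)
proof (induction "card {mu. multipartition ell n mu \<and> gtlex ell n mu lam}" arbitrary: lam rule: less_induct)
 case less
 show ?case
 proof (rule assms(2)[OF less.prems])
  fix mu assume mu: "multipartition ell n mu" "gtlex ell n mu lam"
  have "{nu. multipartition ell n nu \<and> gtlex ell n nu mu} \<subset> {nu. multipartition ell n nu \<and> gtlex ell n nu lam}"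
   using gtlex_trans mu gtlex_irrefl by blast
  then have "card {nu. multipartition ell n nu \<and> gtlex ell n nu mu} < card {nu. multipartition ell n nu \<and> gtlex ell n nu lam}"
   by (intro psubset_card_mono finite_subset[OF _ finite_multipartitions[of ell n]]) auto
  from less.hyps[OF this mu(1)] show "P mu" .
 qed
qed

lemma sortd_cong: "mset xs = mset ys ==> sortd xs = sortd ys"
 unfolding sortd_def by (metis properties_for_sort sorted_sort mset_sort)

section \<open>Jucys-Murphy elements and the elements attached to a composition\<close>

text \<open>Closure under \<open>q\<close>, its inverse \<open>qi\<close> and negation amounts to
  closure under Laurent polynomials in \<open>q\<close> with integer coefficients.\<close>

inductive_set ospan :: "'a::{ring,monoid_mult} => 'a => 'a set => 'a set" for q qi S where
 zero: "0 \<in> ospan q qi S"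
| base: "s \<in> S ==> s \<in> ospan q qi S"
| add: "x \<in> ospan q qi S ==> y \<in> ospan q qi S ==> x + y \<in> ospan q qi S"
| neg: "x \<in> ospan q qi S ==> - x \<in> ospan q qi S"
| q: "x \<in> ospan q qi S ==> q * x \<in> ospan q qi S"
| qi: "x \<in> ospan q qi S ==> qi * x \<in> ospan q qi S"

lemma ospan_diff: "x \<in> ospan q qi S ==> y \<in> ospan q qi S ==> x - y \<in> ospan q qi S"
 using ospan.add[OF _ ospan.neg] by fastforce

lemma ospan_sum: "(\<And>i. i \<in> A ==> f i \<in> ospan q qi S) ==> sum f A \<in> ospan q qi S"
 by (induction A rule: infinite_finite_induct) (auto intro: ospan.intros)

lemma ospan_subset: "S \<subseteq> ospan q qi S' ==> ospan q qi S \<subseteq> ospan q qi S'"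
proof
 fix x assume "S \<subseteq> ospan q qi S'" "x \<in> ospan q qi S"
 from this(2,1) show "x \<in> ospan q qi S'" by induction (auto intro: ospan.intros)
qed

lemma ospan_mono: "S \<subseteq> S' ==> ospan q qi S \<subseteq> ospan q qi S'"
 by (rule ospan_subset) (auto intro: ospan.base)

lemma ospan_qpower: "x \<in> ospan q qi S ==> q ^ k * x \<in> ospan q qi S"
 and ospan_qipower: "x \<in> ospan q qi S ==> qi ^ k * x \<in> ospan q qi S"
 by (induction k) (auto simp: mult.assoc intro: ospan.q ospan.qi)

lemma mult_commutes:
 fixes a b t :: "'a::semigroup_mult"
 shows "a * t = t * a ==> b * t = t * b ==> a * b * t = t * (a * b)"
 by (metis mult.assoc)

lemma prod_list_commute:
 fixes z :: "'a::monoid_mult"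
 assumes "\<And>x. x \<in> set xs ==> x * z = z * x"
 shows "prod_list xs * z = z * prod_list xs"
 using assms
proof (induction xs)
 case (Cons x xs)
 have IH: "prod_list xs * z = z * prod_list xs" and xz: "x * z = z * x" using Cons by simp_all
 show ?case unfolding prod_list.Cons mult.assoc IH unfolding mult.assoc[symmetric] xz ..
qed simp

lemma prod_list_rev_commute:
 fixes xs :: "'a::monoid_mult list"
 assumes "\<And>x y. x \<in> set xs ==> y \<in> set xs ==> x * y = y * x"
 shows "prod_list (rev xs) = prod_list xs"
 using assms
proof (induction xs)
 case (Cons x xs)
 then show ?case using prod_list_commute[of xs x] by simp
qed simp

text \<open>Serves to enlarge one of the commuting factors of \<open>uu\<close> when one component
  size grows.\<close>

lemma prod_list_update_commute:
 fixes f :: "'b => 'a::monoid_mult"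
 assumes "distinct xs" "k \<in> set xs" "\<And>x. x \<in> set xs ==> f x * z = z * f x"
  and "f' k = f k * z" "\<And>x. x \<in> set xs ==> x ~= k ==> f' x = f x"
 shows "prod_list (map f' xs) = prod_list (map f xs) * z"
 using assms
proof (induction xs)
 case (Cons x xs)
 show ?case
 proof (cases "x = k")
  case True
  then have eq: "map f' xs = map f xs" using Cons.prems by auto
  moreover have "prod_list (map f xs) * z = z * prod_list (map f xs)"
   using Cons.prems(3) by (intro prod_list_commute) auto
  ultimately show ?thesis unfolding list.map prod_list.Cons eq unfolding True Cons.prems(4)
   by (simp add: mult.assoc)
 next
  case False
  then show ?thesis using Cons by (simp add: mult.assoc)
 qed
qed simp

text \<open>The relations without the cyclotomic one, a level shared by the quotient algebra and the
  seminormal operators.\<close>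

locale cyclo0 = iwahori n q T for n and q :: "'a::{ring,monoid_mult}" and T +
 fixes qi :: 'a and L :: "nat => 'a" and kappa :: "int list"
 assumes q_qi: "q * qi = 1"
  and L_comm: "[|1 <= r; r <= n; 1 <= s; s <= n|] ==> L r * L s = L s * L r"
  and TL_comm: "[|1 <= r; r < n; 1 <= s; s <= n; s ~= r; s ~= Suc r|] ==> T r * L s = L s * T r"
  and LT: "[|1 <= r; r < n|] ==> L (Suc r) * (T r - q + 1) = T r * L r + 1"
begin

definition qpow :: "int => 'a" where
 "qpow d = (if d \<ge> 0 then q ^ nat d else qi ^ nat (- d))"
definition qn :: "int => 'a" where
 "qn d = (if d \<ge> 0 then \<Sum>i<nat d. q ^ i else - (\<Sum>i\<in>{1..nat (- d)}. qi ^ i))"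

lemma qi_central: "qi * x = x * qi"
proof -
 have "qi * x = qi * x * (q * qi)" by (simp add: q_qi)
 also have "\<dots> = (q * qi) * x * qi" using q_central[of "qi * x"] by (simp add: mult.assoc)
 finally show ?thesis by (simp add: q_qi)
qed

lemma qi_q: "qi * q = 1"
 using q_qi q_central[of qi] by simp

lemma central_power: "(\<And>x. z * x = x * (z::'a)) ==> z ^ k * x = x * z ^ k"
 by (induction k) (simp_all add: mult.assoc, metis mult.assoc)

lemma qpow_central: "qpow d * x = x * qpow d"
 unfolding qpow_def using central_power q_central qi_central by simp

lemma qn_central: "qn d * x = x * qn d"
 unfolding qn_def using central_power[OF q_central] central_power[OF qi_central]
 by (simp add: sum_distrib_left sum_distrib_right)

lemma qpow_unit: "qpow (- d) * qpow d = 1"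
proof -
 have pw: "x ^ k * y ^ k = 1" if "x * y = 1" for x y :: 'a and k
 proof (induction k)
  case (Suc k)
  have "x ^ Suc k * y ^ Suc k = x * (x ^ k * y ^ k) * y"
   unfolding power_Suc[of x] power_Suc2[of y] by (simp only: mult.assoc)
  then show ?case using Suc that by simp
 qed simp
 note pw[OF qi_q] pw[OF q_qi]
 then show ?thesis by (cases d "0 :: int" rule: linorder_cases) (simp_all add: qpow_def)
qed

lemma ospan_qn: "x \<in> ospan q qi S ==> qn d * x \<in> ospan q qi S"
 unfolding qn_def by (auto simp: sum_distrib_right ospan_qpower ospan_qipower intro!: ospan_sum ospan.neg)

lemma ospan_lmult:
 assumes "x \<in> ospan q qi S" and "\<And>s. s \<in> S ==> z * s \<in> ospan q qi S'"
 shows "z * x \<in> ospan q qi S'"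
 using assms(1)
proof induction
 case (q x)
 have "z * (q * x) = q * (z * x)" by (metis mult.assoc q_central)
 then show ?case using ospan.q[OF q.IH] by simp
next
 case (qi x)
 have "z * (qi * x) = qi * (z * x)" by (metis mult.assoc qi_central)
 then show ?case using ospan.qi[OF qi.IH] by simp
qed (auto simp: distrib_left intro: ospan.intros assms(2))

lemma ospan_rmult:
 assumes "x \<in> ospan q qi S" and "\<And>s. s \<in> S ==> s * z \<in> ospan q qi S'"
 shows "x * z \<in> ospan q qi S'"
 using assms(1)
proof induction
qed (auto simp: distrib_right mult.assoc intro: ospan.intros assms(2))

text \<open>The power of \<open>q\<close> normalises the factor: where \<open>L r\<close> has
  eigenvalue \<open>[c]\<close>, \<open>FF k r\<close> has eigenvalue
  \<open>[c - k]\<close>.\<close>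

definition FF :: "int => nat => 'a" where "FF k r = qpow (- k) * (L r - qn k)"
definition UU :: "int => nat => 'a" where "UU k a = prod_list (map (FF k) [1..<a + 1])"
definition uu :: "mpart => 'a" where
 "uu mu = prod_list (map (\<lambda>l. UU (kappa ! (l + 1)) (csum mu (l + 1))) [0..<length mu - 1])"
definition mm :: "mpart => 'a" where "mm mu = uu mu * XX (rowl mu)"
definition mst :: "mpart => tableau => tableau => 'a" where
 "mst mu s t = TW (inv (dperm n mu s)) * (mm mu * TW (dperm n mu t))"

lemma q_lc: "x * (q * y) = q * (x * y)"
 by (metis mult.assoc q_central)

lemma TL1: "1 <= r ==> r < n ==> T r * L r = L (Suc r) * T r - (q - 1) * L (Suc r) - 1"
 using LT[of r] q_central[of "L (Suc r)"] by (simp add: algebra_simps)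

lemma T_inverse: "1 <= r ==> r < n ==> T r * (qi * (T r - q + 1)) = 1" "1 <= r ==> r < n ==> (qi * (T r - q + 1)) * T r = 1"
proof -
 assume r: "1 <= r" "r < n"
 have e: "T r * (T r - q + 1) = q" "(T r - q + 1) * T r = q"
  using T_quad[OF r] q_central[of "T r"] by (simp_all add: algebra_simps)
 show "T r * (qi * (T r - q + 1)) = 1" "(qi * (T r - q + 1)) * T r = 1"
  using e qi_q qi_central[of "T r"] by (metis mult.assoc)+
qed

text \<open>Multiply \<open>LT\<close> by \<open>T r\<close> on both sides, replace
  \<open>(T r - q + 1) * T r\<close> by \<open>q\<close>, and cancel one factor \<open>q\<close>
  with \<open>qi\<close>. This is the mirror image of \<open>LT\<close> under reversal of
  words.\<close>

lemma TL2:
 assumes r: "1 <= r" "r < n"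
 shows "T r * L (Suc r) = L r * T r + (q - 1) * L (Suc r) + 1"
proof -
 have s1: "T r * T r = q + (q - 1) * T r" using T_quad[OF r] by simp
 have "T r * (L (Suc r) * (T r - q + 1)) * T r = T r * L (Suc r) * q"
 proof -
  have "(T r - q + 1) * T r = q" using T_quad[OF r] by (simp add: algebra_simps)
  then show ?thesis by (simp add: mult.assoc)
 qed
 moreover have "T r * (T r * L r + 1) * T r = q * (L r * T r + (q - 1) * L (Suc r) + 1)"
 proof -
  have "T r * (T r * L r + 1) * T r = (T r * T r) * L r * T r + T r * T r"
   by (simp add: algebra_simps)
  also have "\<dots> = q * (L r * T r) + (q - 1) * (T r * L r) * T r + q + (q - 1) * T r"
   unfolding s1 by (simp add: algebra_simps)
  also have "(q - 1) * (T r * L r) * T r = (q - 1) * (L (Suc r) * ((T r - q + 1) * T r)) - (q - 1) * T r"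
   unfolding TL1[OF r] by (simp add: algebra_simps q_lc[of "L (Suc r)"] q_central[of "L (Suc r)", symmetric])
  also have "(T r - q + 1) * T r = q" using T_quad[OF r] by (simp add: algebra_simps)
  finally show ?thesis
   by (simp add: algebra_simps q_lc[of "L (Suc r)"] q_central[of "L (Suc r)", symmetric])
 qed
 ultimately have "q * (T r * L (Suc r)) = q * (L r * T r + (q - 1) * L (Suc r) + 1)"
  using LT[OF r] q_central[of "T r * L (Suc r)"] by simp
 then have "qi * (q * (T r * L (Suc r))) = qi * (q * (L r * T r + (q - 1) * L (Suc r) + 1))" by simp
 then show ?thesis using qi_q by (simp add: mult.assoc[symmetric])
qed

lemma T_LL:
 assumes r: "1 <= r" "r < n"
 shows "T r * (L r * L (Suc r)) = L r * L (Suc r) * T r"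
proof -
 have c: "L r * L (Suc r) = L (Suc r) * L r" using L_comm[of r "Suc r"] r by simp
 have "T r * (L r * L (Suc r)) = L (Suc r) * (T r * L (Suc r)) - (q - 1) * L (Suc r) * L (Suc r) - L (Suc r)"
  using TL1[OF r] by (simp add: mult.assoc[symmetric] left_diff_distrib)
 also have "\<dots> = L (Suc r) * L r * T r"
  unfolding TL2[OF r] by (simp add: algebra_simps q_lc[of "L (Suc r)"] q_central[of "L (Suc r)", symmetric])
 finally show ?thesis using c by simp
qed

lemma qpow_lc: "x * (qpow d * y) = qpow d * (x * y)"
 using qpow_central[of d x] by (simp only: mult.assoc[symmetric])

lemma FF_comm: "1 <= r ==> r <= n ==> 1 <= s ==> s <= n ==> FF k r * FF k' s = FF k' s * FF k r"
proof -
 assume a: "1 <= r" "r <= n" "1 <= s" "s <= n"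
 have l: "(L r - qn k) * (L s - qn k') = (L s - qn k') * (L r - qn k)"
  using L_comm[OF a] qn_central[of k "L s"] qn_central[of k' "L r"] qn_central[of k "qn k'"]
  by (simp add: algebra_simps)
 have "FF k r * FF k' s = qpow (- k) * qpow (- k') * ((L r - qn k) * (L s - qn k'))"
  unfolding FF_def by (simp only: mult.assoc qpow_lc[of "L r - qn k"])
 also have "\<dots> = qpow (- k') * qpow (- k) * ((L s - qn k') * (L r - qn k))"
  using qpow_central[of "- k'" "qpow (- k)"] l by simp
 also have "\<dots> = FF k' s * FF k r"
  unfolding FF_def by (simp only: mult.assoc qpow_lc[of "L s - qn k'"])
 finally show ?thesis .
qed

lemma FF_L_comm: "1 <= r ==> r <= n ==> 1 <= s ==> s <= n ==> FF k r * L s = L s * FF k r"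
proof -
 assume a: "1 <= r" "r <= n" "1 <= s" "s <= n"
 have "(L r - qn k) * L s = L s * (L r - qn k)" using L_comm[OF a] qn_central[of k "L s"] by (simp add: algebra_simps)
 then show ?thesis unfolding FF_def by (intro mult_commutes qpow_central)
qed

lemma FF_T_comm: "1 <= r ==> r < n ==> 1 <= s ==> s <= n ==> s ~= r ==> s ~= Suc r ==> FF k s * T r = T r * FF k s"
proof -
 assume a: "1 <= r" "r < n" "1 <= s" "s <= n" "s ~= r" "s ~= Suc r"
 have "(L s - qn k) * T r = T r * (L s - qn k)" using TL_comm[OF a] qn_central[of k "T r"] by (simp add: algebra_simps)
 then show ?thesis unfolding FF_def by (intro mult_commutes qpow_central)
qed

text \<open>\<open>T r\<close> commutes with the sum and with the product of \<open>L r\<close> and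
  \<open>L (Suc r)\<close>, hence with this symmetric polynomial in them.\<close>

lemma FF2_T_comm:
 assumes r: "1 <= r" "r < n"
 shows "FF k r * FF k (Suc r) * T r = T r * (FF k r * FF k (Suc r))"
proof -
 have s: "T r * (L r + L (Suc r)) = (L r + L (Suc r)) * T r"
  unfolding distrib_left distrib_right TL1[OF r] TL2[OF r] by (simp add: algebra_simps)
 have e: "(L r - qn k) * (L (Suc r) - qn k) = L r * L (Suc r) - qn k * (L r + L (Suc r)) + qn k * qn k"
  using qn_central[of k "L r"] by (simp add: algebra_simps)
 have c: "(L r - qn k) * (L (Suc r) - qn k) * T r = T r * ((L r - qn k) * (L (Suc r) - qn k))"
 proof -
  have "qn k * (L r + L (Suc r)) * T r = T r * (qn k * (L r + L (Suc r)))"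
   using s[symmetric] by (intro mult_commutes qn_central)
  moreover have "qn k * qn k * T r = T r * (qn k * qn k)" by (intro mult_commutes qn_central)
  ultimately show ?thesis unfolding e using T_LL[OF r] by (simp add: distrib_left distrib_right left_diff_distrib right_diff_distrib)
 qed
 have "FF k r * FF k (Suc r) = qpow (- k) * qpow (- k) * ((L r - qn k) * (L (Suc r) - qn k))"
  unfolding FF_def by (simp only: mult.assoc qpow_lc[of "L r - qn k"])
 moreover have "qpow (- k) * qpow (- k) * T r = T r * (qpow (- k) * qpow (- k))"
  by (intro mult_commutes qpow_central)
 ultimately show ?thesis using mult_commutes[OF _ c, of "qpow (- k) * qpow (- k)"] by (simp only:)
qed

lemma UU_Suc: "UU k (Suc a) = UU k a * FF k (Suc a)"
 by (simp add: UU_def)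

text \<open>For \<open>r ~= a\<close> the product contains both or neither of the factors with
  indices \<open>r\<close> and \<open>Suc r\<close>.\<close>

lemma UU_T_comm: "1 <= r ==> r < n ==> a <= n ==> r ~= a ==> UU k a * T r = T r * UU k a"
proof (induction a rule: less_induct)
 case (less a)
 show ?case
 proof (cases a)
  case (Suc b)
  show ?thesis
  proof (cases "r = b")
   case True
   obtain c where c: "b = Suc c" using less.prems True by (cases b) auto
   have "UU k c * T r = T r * UU k c" using less c Suc True by simp
   then show ?thesis
    using mult_commutes[OF _ FF2_T_comm[OF less.prems(1,2), of k], of "UU k c"]
    unfolding Suc UU_Suc c True[unfolded c] by (simp only: mult.assoc)
  next
   case False
   have "UU k b * T r = T r * UU k b" using less False Suc by simp
   moreover have "FF k (Suc b) * T r = T r * FF k (Suc b)"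
    using less.prems Suc False by (intro FF_T_comm) auto
   ultimately show ?thesis unfolding Suc UU_Suc by (rule mult_commutes)
  qed
 qed (simp add: UU_def)
qed

lemma UU_FF_comm: "a <= n ==> 1 <= s ==> s <= n ==> UU k a * FF k' s = FF k' s * UU k a"
 unfolding UU_def by (intro prod_list_commute) (auto intro: FF_comm)

lemma UU_L_comm: "a <= n ==> 1 <= s ==> s <= n ==> UU k a * L s = L s * UU k a"
 unfolding UU_def by (intro prod_list_commute) (auto intro: FF_L_comm)

lemma UU_comm: "a <= n ==> b <= n ==> UU k a * UU k' b = UU k' b * UU k a"
 unfolding UU_def[of k a] by (intro prod_list_commute) (auto simp: UU_FF_comm)

context
 fixes mu assumes mu: "msize mu = n"
begin

lemma uu_T_comm:
 assumes "1 <= r" "r < n" "compl mu r = compl mu (Suc r)"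
 shows "uu mu * T r = T r * uu mu"
proof -
 have "r ~= csum mu l" for l using compl_boundary[of r mu l] assms mu by simp
 then show ?thesis unfolding uu_def
  using assms csum_le[of mu] mu by (intro prod_list_commute) (auto intro!: UU_T_comm)
qed

lemma uu_L_comm: "1 <= s ==> s <= n ==> uu mu * L s = L s * uu mu"
 unfolding uu_def using csum_le[of mu] mu by (intro prod_list_commute) (auto intro!: UU_L_comm)

lemma uu_TW_comm: assumes w: "w \<in> young n (compl mu)" shows "uu mu * TW w = TW w * uu mu"
 using TW_commute[OF convex_compl[of mu, unfolded mu] w, of "uu mu"] uu_T_comm by simp

lemma young_rowl_compl: "w \<in> young n (rowl mu) ==> w \<in> young n (compl mu)"
 unfolding young_def by (blast intro: rowl_compl)

lemma mm_alt: "mm mu = XX (rowl mu) * uu mu"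
 unfolding mm_def XX_def sum_distrib_left sum_distrib_right
 by (intro sum.cong refl uu_TW_comm young_rowl_compl)

end

end

text \<open>The cyclotomic relation is asked for \<open>1 <= n\<close> only, since the quotient for
  \<open>n = 0\<close> is formed with no relators.\<close>

locale cyclo_star = cyclo0 n q T qi L kappa + iwahori_star n q T star
 for n and q :: "'a::{ring,monoid_mult}" and T qi L kappa star +
 assumes star_L: "1 <= r ==> r <= n ==> star (L r) = L r"
  and L1_zero: "1 <= n ==> prod_list (map (\<lambda>k. L 1 - qn k) kappa) = 0"
begin

lemma star_qi [simp]: "star qi = qi"
proof -
 have "star qi * q = 1" using star_mult[of q qi] q_qi by simp
 then have "star qi * q * qi = qi" by simp
 then show ?thesis by (simp add: mult.assoc q_qi)
qed

lemma star_power: "star (x ^ k) = star x ^ k"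
 by (induction k) (simp_all add: star_mult power_commutes)

lemma star_qpow: "star (qpow k) = qpow k" by (simp add: qpow_def star_power)
lemma star_qn: "star (qn k) = qn k" by (simp add: qn_def star_power star_sum star_minus)

lemma star_diff: "star (x - y) = star x - star y"
 using star_add[of x "- y"] by (simp add: star_minus)

lemma star_FF: "1 <= r ==> r <= n ==> star (FF k r) = FF k r"
 unfolding FF_def star_mult star_qpow star_diff star_qn star_L by (simp add: qpow_central star_L)

lemma star_prod_list: "star (prod_list xs) = prod_list (rev (map star xs))"
 by (induction xs) (simp_all add: star_mult)

lemma star_UU: assumes "a <= n" shows "star (UU k a) = UU k a"
proof -
 have "map star (map (FF k) [1..<a + 1]) = map (FF k) [1..<a + 1]" using assms by (auto simp: star_FF)
 then show ?thesis
  unfolding UU_def star_prod_list using assms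
  by (simp only:) (rule prod_list_rev_commute, auto intro: FF_comm)
qed

lemma star_uu: assumes "msize mu = n" shows "star (uu mu) = uu mu"
proof -
 let ?xs = "map (\<lambda>l. UU (kappa ! (l + 1)) (csum mu (l + 1))) [0..<length mu - 1]"
 have le: "csum mu l <= n" for l using csum_le[of mu l] assms by simp
 have "map star ?xs = ?xs" using le by (simp add: star_UU)
 then show ?thesis
  unfolding uu_def star_prod_list using le
  by (simp only:) (rule prod_list_rev_commute, auto intro: UU_comm)
qed

lemma star_mm: "msize mu = n ==> star (mm mu) = mm mu"
 using mm_alt by (simp add: mm_def star_mult star_uu star_XX)

end

lemma rowlI:
 assumes "l < length mu" "r < length (mu ! l)" "off mu l r < i" "i <= off mu l r + mu ! l ! r"
 shows "rowl mu i = (l, r)"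
proof -
 have d: "(l, r, i - off mu l r - 1) \<in> diagram mu" using assms by (auto simp: diagram_iff)
 have "tlam mu (l, r, i - off mu l r - 1) = i" using tlam_eq[OF d] assms by simp
 then show ?thesis using rowl_tlam[OF d] by simp
qed

lemma rowlD:
 assumes "1 <= i" "i <= msize mu" "rowl mu i = (l, r)"
 shows "l < length mu" "r < length (mu ! l)" "off mu l r < i" "i <= off mu l r + mu ! l ! r"
proof -
 obtain c where n: "nd mu i = (l, r, c)" using assms(3) by (metis rowl_def prod.collapse fst_conv snd_conv)
 have d: "(l, r, c) \<in> diagram mu" "tlam mu (l, r, c) = i"
  using nd_in[OF assms(1,2)] tlam_nd[OF assms(1,2)] n by simp_all
 show "l < length mu" "r < length (mu ! l)" using d(1) by (simp_all add: diagram_iff)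
 show "off mu l r < i" "i <= off mu l r + mu ! l ! r"
  using d(2) d(1)[unfolded diagram_iff] tlam_eq[OF d(1)] by linarith+
qed

text \<open>Rows increase by \<open>inc\<close>, so standardness fails in a column; the partition
  property puts the upper node of the failing pair into the diagram.\<close>

lemma not_std_descent:
 assumes lam: "multipartition ell n lam" and w: "w permutes {1..n}" and inc: "incr n (rowl lam) w"
  and "tab_of lam w \<notin> std n lam"
 obtains l r c where "(l, Suc r, c) \<in> diagram lam" "(l, r, c) \<in> diagram lam"
  "w (tlam lam (l, Suc r, c)) < w (tlam lam (l, r, c))"
proof -
 have n: "msize lam = n" using multipartitionD(2)[OF lam] .
 have row: "tab_of lam w (l, r, c) < tab_of lam w (l, r, c + 1)" if d: "(l, r, c + 1) \<in> diagram lam" for l r c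
 proof -
  have d': "(l, r, c) \<in> diagram lam" using d by (simp add: diagram_iff)
  have "rowl lam (tlam lam (l, r, c)) = rowl lam (tlam lam (l, r, c + 1))"
   using rowl_tlam[OF d] rowl_tlam[OF d'] by simp
  then show ?thesis
   using incrD[OF inc, of "tlam lam (l, r, c)" "tlam lam (l, r, c + 1)"] tlam_range[OF d] tlam_range[OF d']
    tlam_Suc[of l r c lam] d d' n by (simp add: tab_of_def)
 qed
 have "\<exists>l r c. (l, r + 1, c) \<in> diagram lam \<and> \<not> tab_of lam w (l, r, c) < tab_of lam w (l, r + 1, c)"
 proof (rule ccontr)
  assume "\<not> ?thesis"
  then have "tab_of lam w \<in> std n lam"
   using tab_of_bij[OF n w] row unfolding std_def by (simp add: tab_of_def)
  then show False using assms(4) by contradiction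
 qed
 then obtain l r c where d: "(l, Suc r, c) \<in> diagram lam"
  and nl: "\<not> tab_of lam w (l, r, c) < tab_of lam w (l, Suc r, c)" by auto
 have "is_partition (lam ! l)" using d multipartitionD[OF lam] by (simp add: diagram_iff)
 then have d': "(l, r, c) \<in> diagram lam"
  using d partition_antimono[of "lam ! l" r "Suc r"] by (simp add: diagram_iff)
 have "tlam lam (l, r, c) ~= tlam lam (l, Suc r, c)"
  using inj_onD[OF tlam_inj _ d' d] by auto
 then have "w (tlam lam (l, r, c)) ~= w (tlam lam (l, Suc r, c))"
  using permutes_inj[OF w] by (simp add: inj_eq)
 then show ?thesis using that[OF d d'] nl d d' by (simp add: tab_of_def)
qed

section \<open>The generated subalgebra, the finite Hecke algebra, and moving L past T\<close>

context cyclo0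
begin

text \<open>The ideal of larger shapes is required to absorb elements of this subalgebra; in the
  quotient algebra it is everything, by \<open>hcl_alg\<close>.\<close>

inductive_set alg :: "'a set" where
 one: "1 \<in> alg"
| T: "1 <= r ==> r < n ==> T r \<in> alg"
| L: "1 <= r ==> r <= n ==> L r \<in> alg"
| q: "q \<in> alg"
| qi: "qi \<in> alg"
| add: "x \<in> alg ==> y \<in> alg ==> x + y \<in> alg"
| neg: "x \<in> alg ==> - x \<in> alg"
| mult: "x \<in> alg ==> y \<in> alg ==> x * y \<in> alg"

lemma alg_zero: "0 \<in> alg"
 using alg.add[OF alg.one alg.neg[OF alg.one]] by simp

lemma alg_diff: "x \<in> alg ==> y \<in> alg ==> x - y \<in> alg"
 using alg.add[OF _ alg.neg] by fastforce

lemma alg_sum: "(\<And>i. i \<in> A ==> f i \<in> alg) ==> sum f A \<in> alg"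
 by (induction A rule: infinite_finite_induct) (auto intro: alg.intros alg_zero)

lemma alg_power: "x \<in> alg ==> x ^ k \<in> alg"
 by (induction k) (auto intro: alg.intros)

lemma alg_prod_list: "(\<And>x. x \<in> set xs ==> x \<in> alg) ==> prod_list xs \<in> alg"
 by (induction xs) (auto intro: alg.intros)

lemma alg_TT: "set rs \<subseteq> {1..<n} ==> TT rs \<in> alg"
 unfolding TT_def by (rule alg_prod_list) (force intro!: alg.T)

lemma alg_TW: assumes w: "w permutes {1..n}" shows "TW w \<in> alg"
proof -
 obtain rs where rs: "reduced_word n w rs" using reduced_word_exists[OF w] by blast
 then have "set rs \<subseteq> {1..<n}" unfolding reduced_word_def by blast
 then show ?thesis using alg_TT TW_eq[OF w rs] by simp
qed

lemma alg_qn: "qn k \<in> alg" and alg_qpow: "qpow k \<in> alg"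
 unfolding qn_def qpow_def by (auto intro!: alg_sum alg_power alg.neg alg.q alg.qi)

lemma TW_invertible:
 assumes w: "w permutes {1..n}"
 shows "\<exists>y\<in>alg. TW w * y = 1"
proof -
 obtain rs where rs: "reduced_word n w rs" using reduced_word_exists[OF w] by blast
 have "\<exists>y\<in>alg. TT rs * y = 1" if "set rs \<subseteq> {1..<n}" for rs
  using that
 proof (induction rs)
  case (Cons r rs)
  then obtain y where y: "y \<in> alg" "TT rs * y = 1" by auto
  have r: "1 <= r" "r < n" using Cons.prems by auto
  let ?z = "qi * (T r - q + 1)"
  have "TT (r # rs) * (y * ?z) = T r * (TT rs * y) * ?z" by (simp only: TT_simps mult.assoc)
  also have "\<dots> = 1" using y(2) T_inverse(1)[OF r] by simp
  finally show ?case using y(1) r by (intro bexI[of _ "y * ?z"]) (auto intro!: alg.intros alg_diff)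
 qed (auto intro: alg.one)
 from this[of rs] show ?thesis using rs TW_eq[OF w rs] unfolding reduced_word_def by simp
qed

definition TWs :: "'a set" where "TWs = {TW w | w. w permutes {1..n}}"
definition H0 :: "'a set" where "H0 = ospan q qi TWs"

lemma H0_TW: "w permutes {1..n} ==> TW w \<in> H0"
 unfolding H0_def TWs_def by (blast intro: ospan.base)

lemma H0_lT: assumes x: "x \<in> H0" and r: "1 <= r" "r < n" shows "T r * x \<in> H0"
 unfolding H0_def
proof (rule ospan_lmult[OF x[unfolded H0_def]])
 fix s assume "s \<in> TWs"
 then obtain w where w: "w permutes {1..n}" "s = TW w" unfolding TWs_def by blast
 have p: "w \<circ> sr r permutes {1..n}" using w r by (intro permutes_compose sr_permutes)
 have "w r ~= w (Suc r)" using permutes_inj[OF w(1)] by (simp add: inj_eq)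
 then consider "w r < w (Suc r)" | "w (Suc r) < w r" by linarith
 then show "T r * s \<in> ospan q qi TWs"
 proof cases
  case 1
  then show ?thesis using T_mult_TW(1)[OF w(1) r] H0_TW[OF p] w(2) by (simp add: H0_def)
 next
  case 2
  have "q * TW w - TW w + q * TW (w \<circ> sr r) \<in> ospan q qi TWs"
   using H0_TW[OF p] H0_TW[OF w(1)] unfolding H0_def by (intro ospan.add ospan_diff ospan.q)
  then show ?thesis using T_mult_TW(2)[OF w(1) r 2] w(2) by (simp add: left_diff_distrib)
 qed
qed

lemma H0_rT: assumes x: "x \<in> H0" and r: "1 <= r" "r < n" shows "x * T r \<in> H0"
 unfolding H0_def
proof (rule ospan_rmult[OF x[unfolded H0_def]])
 fix s assume "s \<in> TWs"
 then obtain w where w: "w permutes {1..n}" "s = TW w" unfolding TWs_def by blast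
 have p: "sr r \<circ> w permutes {1..n}" using w r by (intro permutes_compose sr_permutes)
 have "inv w r ~= inv w (Suc r)" using permutes_inj[OF permutes_inv[OF w(1)]] by (simp add: inj_eq)
 then consider "inv w r < inv w (Suc r)" | "inv w (Suc r) < inv w r" by linarith
 then show "s * T r \<in> ospan q qi TWs"
 proof cases
  case 1
  then show ?thesis using TW_mult_T(1)[OF w(1) r] H0_TW[OF p] w(2) by (simp add: H0_def)
 next
  case 2
  have "q * TW w - TW w + q * TW (sr r \<circ> w) \<in> ospan q qi TWs"
   using H0_TW[OF p] H0_TW[OF w(1)] unfolding H0_def by (intro ospan.add ospan_diff ospan.q)
  then show ?thesis using TW_mult_T(2)[OF w(1) r 2] w(2) by (simp add: left_diff_distrib)
 qed
qed

lemma H0_alg: "x \<in> H0 ==> x \<in> alg"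
 unfolding H0_def by (induction rule: ospan.induct) (auto intro: alg.intros alg_zero alg_TW simp: TWs_def)

lemma H0_mult: assumes x: "x \<in> H0" and y: "y \<in> H0" shows "x * y \<in> H0"
 unfolding H0_def
proof (rule ospan_lmult[OF y[unfolded H0_def]])
 fix s assume "s \<in> TWs"
 then obtain w where w: "w permutes {1..n}" "s = TW w" unfolding TWs_def by blast
 obtain rs where rs: "reduced_word n w rs" using reduced_word_exists[OF w(1)] by blast
 have "z * TT rs \<in> H0" if "set rs \<subseteq> {1..<n}" "z \<in> H0" for rs z
  using that by (induction rs arbitrary: z) (auto simp: mult.assoc[symmetric] H0_rT)
 from this[of rs x] show "x * s \<in> ospan q qi TWs"
  using rs x TW_eq[OF w(1) rs] w(2) unfolding reduced_word_def H0_def by simp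
qed

lemma L_Suc:
 assumes r: "1 <= r" "r < n"
 shows "L (Suc r) = qi * (T r * L r * T r + T r)"
proof -
 have "(T r - q + 1) * T r = q" using T_quad[OF r] by (simp add: algebra_simps)
 then have "L (Suc r) * q = L (Suc r) * (T r - q + 1) * T r" by (simp add: mult.assoc)
 also have "\<dots> = T r * L r * T r + T r" unfolding LT[OF r] by (simp add: distrib_right)
 finally have "qi * (q * L (Suc r)) = qi * (T r * L r * T r + T r)" by (simp only: q_central)
 then show ?thesis by (simp add: mult.assoc[symmetric] qi_q)
qed

text \<open>For \<open>a <= j\<close> the element \<open>TW (cyc a j)\<close> is the descending
  product of \<open>T (j - 1)\<close> down to \<open>T a\<close>. The permutation brings position
  \<open>j\<close> to the front of the window that starts at \<open>a\<close>.\<close>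

definition cyc :: "nat => nat => nat => nat" where
 "cyc a j k = (if k = j then a else if a <= k \<and> k < j then Suc k else k)"

lemma cyc_permutes:
 assumes "1 <= a" "a <= j" "j <= n"
 shows "cyc a j permutes {1..n}"
 using assms(2,3)
proof (induction j rule: dec_induct)
 case base
 have "cyc a a = id" by (auto simp: cyc_def)
 then show ?case by (simp only: permutes_id)
next
 case (step j)
 have "cyc a (Suc j) = cyc a j \<circ> sr j" using step.hyps by (auto simp: cyc_def sr_apply fun_eq_iff)
 moreover have "cyc a j \<circ> sr j permutes {1..n}"
  using step assms(1) by (intro permutes_compose sr_permutes) auto
 ultimately show ?case by (simp only:)
qed

text \<open>Iterating \<open>L_Suc\<close> builds the descending product of \<open>T\<close> on the
  left; what accumulates on the right matters only up to membership in \<open>H0\<close>.\<close>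

lemma L_expand:
 assumes "1 <= a" "a <= j" "j <= n"
 shows "\<exists>h1\<in>H0. \<exists>h2\<in>H0. L j = TW (cyc a j) * L a * h1 + h2"
 using assms(2,3)
proof (induction j rule: dec_induct)
 case base
 have "cyc a a = id" by (auto simp: cyc_def)
 then have "L a = TW (cyc a a) * L a * TW id + 0" by simp
 moreover have "(0 :: 'a) \<in> H0" unfolding H0_def by (rule ospan.zero)
 ultimately show ?case using H0_TW[OF permutes_id] by blast
next
 case (step j)
 have j: "1 <= j" "j < n" using step assms by simp_all
 obtain h1 h2 where h: "h1 \<in> H0" "h2 \<in> H0" "L j = TW (cyc a j) * L a * h1 + h2" using step by auto
 have cS: "cyc a (Suc j) = cyc a j \<circ> sr j" using step.hyps by (auto simp: cyc_def sr_apply fun_eq_iff)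
 have TC: "T j * TW (cyc a j) = TW (cyc a (Suc j))"
  unfolding cS using step assms by (intro T_mult_TW(1) cyc_permutes) (auto simp: cyc_def)
 have "T j * L j * T j = T j * TW (cyc a j) * L a * (h1 * T j) + T j * h2 * T j"
  unfolding h(3) by (simp add: distrib_left distrib_right mult.assoc)
 then have "L (Suc j) = TW (cyc a (Suc j)) * L a * (qi * (h1 * T j)) + qi * (T j * h2 * T j + T j)"
  unfolding L_Suc[OF j] TC using qi_central[of "TW (cyc a (Suc j)) * L a"]
  by (simp add: distrib_left mult.assoc[symmetric])
 moreover have "qi * (h1 * T j) \<in> H0" using H0_rT[OF h(1) j] unfolding H0_def by (rule ospan.qi)
 moreover have "qi * (T j * h2 * T j + T j) \<in> H0"
  using H0_rT[OF H0_lT[OF h(2) j] j] H0_rT[OF H0_TW[OF permutes_id] j] unfolding H0_def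
  by (intro ospan.qi ospan.add) simp_all
 ultimately show ?case by blast
qed

text \<open>Combinations with at most one \<open>L\<close>, standing on the left. Left
  multiplication by \<open>T\<close> preserves this set, so \<open>TW w * L 1\<close> can be
  rewritten with its \<open>L\<close> next to \<open>mm lam\<close>.\<close>

definition QQ :: "'a set" where "QQ = ospan q qi (TWs \<union> {L j * TW w | j w. 1 <= j \<and> j <= n \<and> w permutes {1..n}})"

lemma H0_QQ: "x \<in> H0 ==> x \<in> QQ"
 unfolding H0_def QQ_def using ospan_mono[of TWs] by blast

lemma L_H0_QQ: assumes "1 <= j" "j <= n" "x \<in> H0" shows "L j * x \<in> QQ"
 unfolding QQ_def by (rule ospan_lmult[OF assms(3)[unfolded H0_def]]) (use assms in \<open>auto simp: TWs_def intro!: ospan.base\<close>)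

lemma QQ_lT:
 assumes x: "x \<in> QQ" and r: "1 <= r" "r < n"
 shows "T r * x \<in> QQ"
 unfolding QQ_def
proof (rule ospan_lmult[OF x[unfolded QQ_def]], fold QQ_def)
 fix s assume "s \<in> TWs \<union> {L j * TW w | j w. 1 <= j \<and> j <= n \<and> w permutes {1..n}}"
 then consider "s \<in> TWs" | j w where "s = L j * TW w" "1 <= j" "j <= n" "w permutes {1..n}" by blast
 then show "T r * s \<in> QQ"
 proof cases
  case 1
  then show ?thesis using H0_lT[OF _ r] by (intro H0_QQ) (auto simp: H0_def intro: ospan.base)
 next
  case 2
  note W = H0_TW[OF 2(4)]
  note TWW = H0_lT[OF W r]
  have qL: "q * x - x \<in> QQ" if "x \<in> QQ" for x using that unfolding QQ_def by (intro ospan_diff ospan.q)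
  have r': "Suc r <= n" "1 <= Suc r" "r <= n" using r by simp_all
  consider "j = r" | "j = Suc r" | "j ~= r" "j ~= Suc r" by blast
  then show ?thesis
  proof cases
   case 1
   have "T r * s = L (Suc r) * (T r * TW w) - (q * (L (Suc r) * TW w) - L (Suc r) * TW w) - TW w"
    unfolding 2(1) 1 mult.assoc[symmetric] TL1[OF r] by (simp add: left_diff_distrib mult.assoc)
   moreover have "\<dots> \<in> QQ"
    using L_H0_QQ[OF r'(2,1) TWW] qL[OF L_H0_QQ[OF r'(2,1) W]] H0_QQ[OF W]
    unfolding QQ_def by (rule ospan_diff[OF ospan_diff])
   ultimately show ?thesis by simp
  next
   case b: 2
   have "T r * s = L r * (T r * TW w) + (q * (L (Suc r) * TW w) - L (Suc r) * TW w) + TW w"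
    unfolding 2(1) b mult.assoc[symmetric] TL2[OF r] by (simp add: left_diff_distrib distrib_right mult.assoc)
   moreover have "\<dots> \<in> QQ"
    using L_H0_QQ[OF r(1) r'(3) TWW] qL[OF L_H0_QQ[OF r'(2,1) W]] H0_QQ[OF W]
    unfolding QQ_def by (rule ospan.add[OF ospan.add])
   ultimately show ?thesis by simp
  next
   case 3
   have "T r * s = L j * (T r * TW w)"
    unfolding 2(1) mult.assoc[symmetric] TL_comm[OF r 2(2,3) 3] ..
   then show ?thesis using L_H0_QQ[OF 2(2,3) TWW] by simp
  qed
 qed
qed

lemma TW_L1_QQ:
 assumes n: "1 <= n" and w: "w permutes {1..n}"
 shows "TW w * L 1 \<in> QQ"
proof -
 obtain rs where rs: "reduced_word n w rs" using reduced_word_exists[OF w] by blast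
 have "L 1 \<in> QQ" using L_H0_QQ[OF _ n H0_TW[OF permutes_id]] by simp
 then have "TT rs * L 1 \<in> QQ" if "set rs \<subseteq> {1..<n}" for rs
  using that by (induction rs) (auto simp: mult.assoc QQ_lT)
 then show ?thesis using rs TW_eq[OF w rs] unfolding reduced_word_def by simp
qed

end

context cyclo_star
begin

text \<open>Reordering rows inside components is a permutation \<open>d\<close> that conjugates the
  row stabilisers. It stays within components, so \<open>TW d\<close> commutes with
  \<open>uu mu\<close>, which depends on component sizes alone; being invertible,
  \<open>TW d\<close> can be moved from one side to the other.\<close>

lemma mm_sortm:
 assumes mu: "msize mu = n"
 obtains d y where "d permutes {1..n}" "y \<in> alg" "mm mu = TW d * mm (sortm mu) * y"
proof -
 let ?nu = "sortm mu"
 have nu: "msize ?nu = n" using msize_sortm[of mu] mu by simp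
 obtain G where G: "inj_on (\<lambda>(l, r, c). (l, G l r, c)) (diagram mu)"
  "\<And>l r c. (l, r, c) \<in> diagram mu ==> (l, G l r, c) \<in> diagram ?nu"
  using sortm_row_map[of mu] by blast
 define GG where "GG = (\<lambda>(l, r, c). (l, G l r, c :: nat))"
 obtain d where d: "d permutes {1..n}"
  "\<And>i. 1 <= i ==> i <= n ==> nd ?nu (d i) = GG (nd mu i)"
  by (rule diagram_move[OF mu nu G(1)[folded GG_def]]) (auto simp: GG_def G(2))
 have Ginj: "r = r'" if "(l, r, c) \<in> diagram mu" "(l, r', c') \<in> diagram mu" "G l r = G l r'" for l r r' c c'
 proof -
  have "(l, r, 0) \<in> diagram mu" "(l, r', 0) \<in> diagram mu" using that by (simp_all add: diagram_iff)
  from inj_onD[OF G(1) _ this] that(3) show ?thesis by simp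
 qed
 have dr: "1 <= d i" "d i <= n" if "1 <= i" "i <= n" for i using perm_range[OF d(1) that] .
 have nod: "nd mu i \<in> diagram mu" if "1 <= i" "i <= n" for i using nd_in[of i mu] that mu by simp
 have lab: "rowl mu i = rowl mu j \<longleftrightarrow> rowl ?nu (d i) = rowl ?nu (d j)"
  and ord: "rowl mu i = rowl mu j ==> i < j \<longleftrightarrow> d i < d j"
  if ij: "1 <= i" "i <= n" "1 <= j" "j <= n" for i j
 proof -
  obtain l r c l' r' c' where N: "nd mu i = (l, r, c)" "nd mu j = (l', r', c')" by (metis prod_cases3)
  have N': "nd ?nu (d i) = (l, G l r, c)" "nd ?nu (d j) = (l', G l' r', c')"
   using d(2) ij N by (simp_all add: GG_def)
  show "rowl mu i = rowl mu j \<longleftrightarrow> rowl ?nu (d i) = rowl ?nu (d j)"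
   using Ginj[of l r c r' c'] nod[OF ij(1,2)] nod[OF ij(3,4)] unfolding rowl_def N N' by auto
  assume eq: "rowl mu i = rowl mu j"
  have "i < j \<longleftrightarrow> node_below (nd mu j) (nd mu i)" using nd_below[of i mu j] ij mu by simp
  also have "\<dots> \<longleftrightarrow> node_below (nd ?nu (d j)) (nd ?nu (d i))"
   using eq unfolding rowl_def N N' node_below_def by auto
  also have "\<dots> \<longleftrightarrow> d i < d j" using nd_below[of "d i" ?nu "d j"] dr ij nu by simp
  finally show "i < j \<longleftrightarrow> d i < d j" .
 qed
 have inc: "incr n (rowl mu) d"
  unfolding incr_def
 proof (intro allI impI)
  fix i j assume "1 <= i" "i < j" "j <= n" "rowl mu i = rowl mu j"
  then show "d i < d j" using ord[of i j] by simp
 qed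
 have inc': "incr n (rowl ?nu) (inv d)"
  unfolding incr_def
 proof (intro allI impI)
  fix i j assume a: "1 <= i" "i < j" "j <= n" "rowl ?nu i = rowl ?nu j"
  have r: "1 <= inv d i" "inv d i <= n" "1 <= inv d j" "inv d j <= n"
   using perm_inv_range[OF d(1)] a by simp_all
  show "inv d i < inv d j"
   using lab[OF r] ord[OF r] a by (simp add: permutes_inverses[OF d(1)])
 qed
 have conj: "XX (rowl mu) * TW d = TW d * XX (rowl ?nu)"
  using convex_rowl[of mu] convex_rowl[of ?nu] mu nu
  by (intro XX_conj d(1) inc inc' lab) simp_all
 have "compl mu (d i) = compl mu i" if i: "1 <= i" "i <= n" for i
 proof -
  obtain l r c where N: "nd mu i = (l, r, c)" by (metis prod_cases3)
  have N': "nd ?nu (d i) = (l, G l r, c)" using d(2) i N by (simp add: GG_def)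
  obtain l' r' c' where N2: "nd mu (d i) = (l', r', c')" by (metis prod_cases3)
  \<comment> \<open>Sorting preserves component sizes, so position \<open>d i\<close> lies in the
    same component of \<open>mu\<close> as of the sorted shape.\<close>
  have lk: "l < k \<longleftrightarrow> l' < k" for k
   using comp_less_iff[of l "G l r" c ?nu k] comp_less_iff[of l' r' c' mu k]
    nd_in[of "d i" ?nu] nd_in[of "d i" mu] tlam_nd[of "d i" ?nu] tlam_nd[of "d i" mu] dr[OF i] mu nu N' N2
   by (simp add: csum_sortm)
  have "l = l'" using lk[of l] lk[of l'] by simp
  then show ?thesis unfolding compl_def N N2 by simp
 qed
 then have y: "d \<in> young n (compl mu)" using d(1) unfolding young_def by simp
 have uu: "uu ?nu = uu mu" unfolding uu_def by (simp add: csum_sortm)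
 obtain z where z: "z \<in> alg" "TW d * z = 1" using TW_invertible[OF d(1)] by blast
 have "mm mu = uu mu * (XX (rowl mu) * TW d) * z" using z(2) by (simp add: mm_def mult.assoc)
 also have "\<dots> = TW d * mm ?nu * z"
  unfolding conj mm_def uu mult.assoc[symmetric] uu_TW_comm[OF mu y] ..
 finally show ?thesis using that d(1) z(1) by blast
qed

end

section \<open>Straightening modulo larger shapes: the Garnir relation\<close>

text \<open>\<open>J\<close> stands for the ideal of larger shapes. It stays abstract here and is
  supplied in \<open>two_sided\<close>, where the induction over shapes shows that their span is an
  ideal.\<close>

locale cyclo_cell = cyclo_star n q T qi L kappa star
 for n and q :: "'a::{ring,monoid_mult}" and T qi L kappa star +
 fixes ell :: nat and lam :: mpart and J :: "'a set"
 assumes mp: "multipartition ell n lam" and kap: "length kappa = ell"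
  and J0: "0 \<in> J" and Jadd: "\<And>x y. x \<in> J ==> y \<in> J ==> x + y \<in> J" and Jneg: "\<And>x. x \<in> J ==> - x \<in> J"
  and Jl: "\<And>g x. g \<in> alg ==> x \<in> J ==> g * x \<in> J" and Jr: "\<And>g x. g \<in> alg ==> x \<in> J ==> x * g \<in> J"
  and JM: "\<And>mu. multipartition ell n mu ==> gtlex ell n mu lam ==> mm mu \<in> J"
begin

lemma size_lam: "msize lam = n" and length_lam: "length lam = ell"
 using multipartitionD[OF mp] by blast+

lemma J_composition:
 assumes "length mu = ell" "msize mu = n" "gtlex ell n (sortm mu) lam"
 shows "mm mu \<in> J"
proof -
 obtain d y where dy: "d permutes {1..n}" "y \<in> alg" "mm mu = TW d * mm (sortm mu) * y"
  using mm_sortm[OF assms(2)] by blast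
 have "mm (sortm mu) \<in> J"
  using JM sortm_multipartition[of mu] assms by simp
 then show ?thesis unfolding dy(3) by (intro Jr[OF dy(2)] Jl[OF alg_TW[OF dy(1)]])
qed

lemma uu_cong: "length mu = length nu ==> (\<And>k. csum mu k = csum nu k) ==> uu mu = uu nu"
 unfolding uu_def by simp

text \<open>The Garnir relation: the labelling \<open>bM\<close> merges the end of row \<open>r\<close> with the beginning of row
 \<open>Suc r\<close>. The resulting composition need not dominate \<open>lam\<close>, which is why shapes are compared
 lexicographically.\<close>
lemma garnir:
 assumes w: "w permutes {1..n}" and inc: "incr n (rowl lam) w" and ns: "tab_of lam w \<notin> std n lam"
 obtains D where "finite D" "w \<in> D" "\<And>u. u \<in> D ==> u permutes {1..n}"
  "\<And>u. u \<in> D ==> u ~= w ==> card (invs n u) < card (invs n w)" "(\<Sum>u\<in>D. mm lam * TW u) \<in> J"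
proof -
 obtain l r c where d: "(l, Suc r, c) \<in> diagram lam" "(l, r, c) \<in> diagram lam"
  and desc: "w (tlam lam (l, Suc r, c)) < w (tlam lam (l, r, c))"
  using not_std_descent[OF mp w inc ns] by blast
 define x y where "x = lam ! l ! r" and "y = lam ! l ! Suc r"
 define pre post us vs where "pre = take l lam" and "post = drop (Suc l) lam"
  and "us = take r (lam ! l)" and "vs = drop (Suc (Suc r)) (lam ! l)"
 have h: "l < length lam" "Suc r < length (lam ! l)" "c < y" "c < x"
  using d unfolding diagram_iff x_def y_def by simp_all
 have lam_l: "lam ! l = us @ x # y # vs" and lus: "length us = r"
  using h(2) unfolding us_def vs_def x_def y_def
  by (simp_all add: Cons_nth_drop_Suc Suc_lessD)
 have lam: "lam = pre @ (us @ x # y # vs) # post" and lpre: "length pre = l"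
  using h(1) unfolding pre_def post_def lam_l[symmetric] by (simp_all add: Cons_nth_drop_Suc)
 define m0 where "m0 = off lam l r"
 have p: "tlam lam (l, r, c) = m0 + c + 1" using d(2) by (simp add: tlam_eq m0_def)
 have offS: "off lam l (Suc r) = m0 + x" unfolding off_def m0_def lam_l using lus by simp
 have e: "tlam lam (l, Suc r, c) = m0 + x + c + 1" using d(1) by (simp add: tlam_eq offS)
 \<comment> \<open>The window of positions from node \<open>(l, r, c)\<close> through node
   \<open>(l, Suc r, c)\<close> has \<open>x + 1\<close> members, one more than row
   \<open>r\<close>; merging it creates a longer row.\<close>
 define inAB where "inAB k \<longleftrightarrow> m0 + c + 1 <= k \<and> k <= m0 + x + c + 1" for k
 define bM where "bM k = (if inAB k then None else Some (rowl lam k))" for k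
 define bN where "bN k = (bM k, rowl lam k)" for k
 have eN: "m0 + x + c + 1 <= n" using tlam_range[OF d(1)] e size_lam by simp
 have rowA: "rowl lam k = (l, r)" if "m0 < k" "k <= m0 + x" for k
  by (rule rowlI) (use h that in \<open>auto simp: m0_def x_def\<close>)
 have rowB: "rowl lam k = (l, Suc r)" if "m0 + x < k" "k <= m0 + x + y" for k
  by (rule rowlI) (use h that offS in \<open>auto simp: y_def\<close>)
 have cvl: "convex_lab n (rowl lam)" using convex_rowl[of lam] size_lam by simp
 have cvM: "convex_lab n bM"
  unfolding convex_lab_def
 proof (intro allI impI)
  fix i j k assume a: "1 <= i" "i <= j" "j <= k" "k <= n" "bM i = bM k"
  show "bM j = bM i"
  proof (cases "inAB i")
   case True
   then have "inAB k" using a(5) by (auto simp: bM_def split: if_splits)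
   then have "inAB j" using True a unfolding inAB_def by linarith
   then show ?thesis using True by (simp add: bM_def)
  next
   case False
   then have nk: "\<not> inAB k" and eq: "rowl lam i = rowl lam k" using a(5) by (auto simp: bM_def split: if_splits)
   have "\<not> inAB j"
   proof
    assume j: "inAB j"
    have lt: "i < m0 + c + 1" "m0 + x + c + 1 < k" using j False nk a unfolding inAB_def by linarith+
    have "rowl lam (m0 + c + 1) = rowl lam i"
     by (rule convex_labD[OF cvl a(1) _ _ a(4) eq]) (use lt in linarith)+
    moreover have "rowl lam (m0 + x + c + 1) = rowl lam i"
     by (rule convex_labD[OF cvl a(1) _ _ a(4) eq]) (use lt in linarith)+
    ultimately show False using rowA[of "m0 + c + 1"] rowB[of "m0 + x + c + 1"] h by simp
   qed
   then show ?thesis using False convex_labD[OF cvl a(1-4) eq] by (simp add: bM_def)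
  qed
 qed
 have cvN: "convex_lab n bN"
  unfolding convex_lab_def
 proof (intro allI impI)
  fix i j k assume a: "1 <= i" "i <= j" "j <= k" "k <= n" "bN i = bN k"
  then have "bM i = bM k" "rowl lam i = rowl lam k" by (simp_all add: bN_def)
  then show "bN j = bN i" using convex_labD[OF cvM a(1-4)] convex_labD[OF cvl a(1-4)] by (simp add: bN_def)
 qed
 \<comment> \<open>\<open>mu\<close> follows the reading order: \<open>c\<close> nodes before the
   window, the window, the rest of the lower row. \<open>mu'\<close> has the same rows with the
   window first, so that row \<open>r\<close> grows from \<open>x\<close> to \<open>x + 1\<close>;
   both sort to the same shape.\<close>
 define mu where "mu = pre @ (us @ c # Suc x # (y - c - 1) # vs) # post"
 define mu' where "mu' = pre @ (us @ Suc x # c # (y - c - 1) # vs) # post"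
 have cs: "csum mu k = csum lam k" for k
 proof -
  have "map sum_list mu = map sum_list lam" unfolding mu_def lam using h by simp
  then show ?thesis unfolding csum_def take_map[symmetric] by simp
 qed
 have cs': "csum mu' k = csum lam k" for k
 proof -
  have "map sum_list mu' = map sum_list lam" unfolding mu'_def lam using h by simp
  then show ?thesis unfolding csum_def take_map[symmetric] by simp
 qed
 have len: "length mu = ell" "length mu' = ell" using length_lam unfolding mu_def mu'_def lam by simp_all
 have sz: "msize mu = n" using csum_length[of mu] csum_length[of lam] cs[of ell] len length_lam size_lam by simp
 have nth_other: "mu ! k = lam ! k" "mu' ! k = lam ! k" if "k ~= l" for k
  using that lpre unfolding mu_def mu'_def lam by (auto simp: nth_append nth_Cons')
 have nth_l: "mu ! l = us @ c # Suc x # (y - c - 1) # vs" "mu' ! l = us @ Suc x # c # (y - c - 1) # vs"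
  using lpre unfolding mu_def mu'_def by (simp_all add: nth_append)
 have "gtlex ell n mu' lam"
 proof (rule gtlexI[of l ell "Suc r"])
  show "l < ell" using h(1) length_lam by simp
  have "Suc r < n" using h(2) part_length_le[OF mp, of l] h(1) length_lam by simp
  then show "Suc r < n + 2" by simp
  show "off lam l (Suc r) < off mu' l (Suc r)"
   unfolding off_def cs' nth_l lam_l using lus by simp
  show "off lam l' i' = off mu' l' i'" if "l' < l" for l' i'
   using nth_other(2)[of l'] that unfolding off_def cs' by simp
  show "off lam l i' = off mu' l i'" if "i' < Suc r" for i'
   using that lus unfolding off_def cs' nth_l lam_l by simp
 qed
 moreover have "sortm mu' = sortm mu"
  unfolding sortm_def mu_def mu'_def using sortd_cong[of "us @ Suc x # c # (y - c - 1) # vs" "us @ c # Suc x # (y - c - 1) # vs"]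
  by simp
 ultimately have "gtlex ell n (sortm mu) lam"
  using gtlex_ge[of ell n mu' lam "sortm mu'"] dominates_sortm[of mu'] len unfolding dominates_iff by simp
 then have mmJ: "mm mu \<in> J" using J_composition len(1) sz by blast
 have young_eq: "young n bM = young n (rowl mu)"
 proof -
  \<comment> \<open>The rows of \<open>mu\<close> are the fibres of \<open>bM\<close> renumbered:
    the window becomes row \<open>Suc r\<close>, and what follows it in the component moves down by
    one row.\<close>
  define g where "g z = (case z of None => (l, Suc r) | Some (a, b) => if a = l \<and> r < b then (a, Suc b) else (a, b))" for z
  have ginj: "g z = g z' \<longleftrightarrow> z = z'" for z z'
   unfolding g_def by (auto split: option.splits if_splits)
  have "rowl mu k = g (bM k)" if k: "1 <= k" "k <= n" for k
  proof -
   obtain a b where ab: "rowl lam k = (a, b)" by fastforce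
   note D = rowlD[OF k(1) _ ab]
   have D: "a < length lam" "b < length (lam ! a)" "off lam a b < k" "k <= off lam a b + lam ! a ! b"
    using rowlD[OF k(1) _ ab] k size_lam by simp_all
   have lm: "length mu = length lam" using len length_lam by simp
   consider "inAB k" | "\<not> inAB k" "a ~= l" | "\<not> inAB k" "a = l" "b < r" | "\<not> inAB k" "a = l" "b = r"
    | "\<not> inAB k" "a = l" "b = Suc r" | "\<not> inAB k" "a = l" "Suc r < b" by linarith
   then show ?thesis
   proof cases
    case 1
    have "off mu l (Suc r) = m0 + c" using lus unfolding off_def cs m0_def nth_l lam_l by simp
    then have "rowl mu k = (l, Suc r)"
     using 1 h lm lus unfolding inAB_def by (intro rowlI) (auto simp: nth_l nth_append)
    then show ?thesis using 1 by (simp add: bM_def g_def)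
   next
    case 2
    have "rowl mu k = (a, b)"
     using 2 D lm nth_other(1)[of a] by (intro rowlI) (auto simp: off_def cs)
    then show ?thesis using 2 ab by (simp add: bM_def g_def)
   next
    case 3
    have "rowl mu k = (a, b)"
     using 3 D lm lus by (intro rowlI) (auto simp: off_def cs nth_l lam_l nth_append)
    then show ?thesis using 3 ab by (simp add: bM_def g_def)
   next
    case 4
    have o: "off mu l r = m0" using lus unfolding off_def cs m0_def nth_l lam_l by simp
    have "rowl mu k = (l, r)"
    proof (rule rowlI)
     show "off mu l r < k" using D 4 o by (simp add: m0_def)
     have "k <= m0 + x" using D 4 by (simp add: m0_def x_def)
     then show "k <= off mu l r + mu ! l ! r"
      using 4(1) o lus unfolding inAB_def by (simp add: nth_l nth_append)
    qed (use h lm lus in \<open>simp_all add: nth_l\<close>)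
    then show ?thesis using 4 ab by (simp add: bM_def g_def)
   next
    case 5
    have o: "off mu l (Suc (Suc r)) = m0 + x + c + 1"
     using lus unfolding off_def cs m0_def nth_l lam_l by simp
    have kk: "m0 + x < k" "k <= m0 + x + y" using D 5 offS by (simp_all add: y_def)
    have "rowl mu k = (l, Suc (Suc r))"
    proof (rule rowlI)
     show "off mu l (Suc (Suc r)) < k" using kk 5(1) h o unfolding inAB_def by linarith
     show "k <= off mu l (Suc (Suc r)) + mu ! l ! Suc (Suc r)"
      using kk h o lus by (simp add: nth_l nth_append)
    qed (use h lm lus in \<open>simp_all add: nth_l\<close>)
    then show ?thesis using 5 ab by (simp add: bM_def g_def)
   next
    case 6
    then obtain b' where b': "b = Suc (Suc (r + b'))" by (metis Suc_leI le_Suc_ex add_Suc)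
    have o: "off mu l (Suc b) = off lam l b"
     using lus h unfolding off_def cs nth_l lam_l b' by (simp add: numeral_3_eq_3 numeral_2_eq_2)
    have "rowl mu k = (l, Suc b)"
    proof (rule rowlI)
     show "off mu l (Suc b) < k" using o D 6 by simp
     show "k <= off mu l (Suc b) + mu ! l ! Suc b"
      using o D 6 lus unfolding b' by (simp add: nth_l lam_l nth_append numeral_3_eq_3 numeral_2_eq_2)
     show "Suc b < length (mu ! l)" using D(2) 6 lus by (simp add: nth_l lam_l)
    qed (use h lm in simp)
    then show ?thesis using 6 ab by (simp add: bM_def g_def)
   qed
  qed
  then show ?thesis using ginj by (intro young_cong) simp
 qed
 let ?D = "{d \<in> young n bM. incr n bN d}"
 have fN: "rowl lam i = rowl lam j" "bM i = bM j" if "bN i = bN j" for i j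
  using that by (simp_all add: bN_def)
 have sumJ: "(\<Sum>d\<in>?D. mm lam * TW d) \<in> J"
 proof -
  \<comment> \<open>\<open>bN\<close> is the common refinement of \<open>rowl lam\<close> and
    \<open>bM\<close>. Splitting \<open>XX bN\<close> off on the right of
    \<open>XX (rowl lam)\<close>, and recombining it with the sum over \<open>?D\<close> to
    \<open>XX bM\<close>, exhibits the sum as a left multiple of \<open>mm mu\<close>.\<close>
  let ?h = "\<Sum>d\<in>{d \<in> young n (rowl lam). incr n bN d}. TW (inv d)"
  have X1: "XX (rowl lam) = ?h * XX bN" by (rule XX_factor_left[OF cvl cvN fN(1)])
  have X2: "XX bM = XX bN * (\<Sum>d\<in>?D. TW d)" by (rule XX_factor[OF cvM cvN fN(2)])
  have hc: "uu lam * ?h = ?h * uu lam"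
   unfolding sum_distrib_left sum_distrib_right
   by (intro sum.cong refl uu_TW_comm[OF size_lam] young_inv young_rowl_compl[OF size_lam]) simp
  have hA: "?h \<in> alg" by (rule alg_sum) (auto intro: alg_TW permutes_inv youngD)
  have "(\<Sum>d\<in>?D. mm lam * TW d) = uu lam * (?h * XX bN) * (\<Sum>d\<in>?D. TW d)"
   unfolding sum_distrib_left[symmetric] mm_def X1 ..
  also have "\<dots> = uu lam * ?h * (XX bN * (\<Sum>d\<in>?D. TW d))" by (simp only: mult.assoc)
  also have "\<dots> = ?h * (uu lam * XX (rowl mu))"
   unfolding X2[symmetric] hc unfolding XX_def young_eq by (simp only: mult.assoc)
  also have "uu lam = uu mu" using len length_lam cs by (intro uu_cong) simp_all
  finally show ?thesis using Jl[OF hA mmJ] unfolding mm_def by simp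
 qed
 obtain d0 w' where f: "d0 \<in> young n bM" "w' permutes {1..n}" "incr n bM w'" "w = w' \<circ> d0"
  using young_factor[OF cvM w] by blast
 have bM_d: "1 <= u i" "u i <= n" "bM (u i) = bM i" if "u \<in> young n bM" "1 <= i" "i <= n" for u i
  using perm_range[OF youngD(1)[OF that(1)] that(2,3)] youngD(2)[OF that] by simp_all
 have d0D: "d0 \<in> ?D"
 proof -
  have "incr n bN d0"
   unfolding incr_def
  proof (intro allI impI)
   fix i j assume a: "1 <= i" "i < j" "j <= n" "bN i = bN j"
   have lt: "w' (d0 i) < w' (d0 j)" using incrD[OF inc a(1-3) fN(1)[OF a(4)]] f(4) by simp
   show "d0 i < d0 j"
   proof (rule ccontr)
    assume "\<not> d0 i < d0 j"
    then consider "d0 i = d0 j" | "d0 j < d0 i" by linarith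
    then show False
    proof cases
     case 2
     have "w' (d0 j) < w' (d0 i)"
      using bM_d[OF f(1), of i] bM_d[OF f(1), of j] a fN(2)[OF a(4)] 2 by (intro incrD[OF f(3)]) simp_all
     then show False using lt by simp
    qed (use lt in simp)
   qed
  qed
  with f(1) show ?thesis by simp
 qed
 have TWc: "TW d * TW w' = TW (w' \<circ> d)" "card (invs n (w' \<circ> d)) = card (invs n d) + card (invs n w')"
  if "d \<in> ?D" for d using TW_comp_incr[OF cvM _ f(2,3), of d] that by simp_all
 \<comment> \<open>\<open>d\<close> inverts only pairs of the window that are split between the two
   rows. For these, monotonicity along rows and the column descent give \<open>w j < w i\<close>, so
   \<open>d0\<close> inverts them too: it is the longest element of \<open>?D\<close>.\<close>
 have sub: "invs n d \<subseteq> invs n d0" if dD: "d \<in> ?D" for d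
 proof (rule subrelI)
  fix i j assume ij: "(i, j) \<in> invs n d"
  then have r: "1 <= i" "i < j" "j <= n" "d j < d i" unfolding invs_def by simp_all
  have dy: "d \<in> young n bM" "incr n bN d" using dD by simp_all
  have bij: "bM i = bM j" using invs_young[OF cvM dy(1) ij] .
  have "bN i ~= bN j" using incrD[OF dy(2) r(1-3)] r(4) by auto
  then have rne: "rowl lam i ~= rowl lam j" using bij by (simp add: bN_def)
  then have AB: "inAB i" "inAB j" using bij by (auto simp: bM_def split: if_splits)
  have im: "i <= m0 + x"
  proof (rule ccontr)
   assume "\<not> i <= m0 + x"
   then show False using rowB[of i] rowB[of j] rne r AB h unfolding inAB_def by simp
  qed
  have jm: "m0 + x < j"
  proof (rule ccontr)
   assume "\<not> m0 + x < j"
   then show False using rowA[of i] rowA[of j] rne r AB h unfolding inAB_def by simp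
  qed
  have "w (m0 + c + 1) <= w i"
  proof (cases "m0 + c + 1 = i")
   case False
   then have lt: "m0 + c + 1 < i" using AB unfolding inAB_def by simp
   have "w (m0 + c + 1) < w i"
    using lt im r rowA[of i] rowA[of "m0 + c + 1"] h by (intro incrD[OF inc]) auto
   then show ?thesis by simp
  qed simp
  moreover have "w j <= w (m0 + x + c + 1)"
  proof (cases "m0 + x + c + 1 = j")
   case False
   then have lt: "j < m0 + x + c + 1" using AB unfolding inAB_def by simp
   have "w j < w (m0 + x + c + 1)"
    using lt jm r eN rowB[of j] rowB[of "m0 + x + c + 1"] h by (intro incrD[OF inc]) auto
   then show ?thesis by simp
  qed simp
  ultimately have wl: "w' (d0 j) < w' (d0 i)" using desc p e f(4) by simp
  have "d0 j < d0 i"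
  proof (rule ccontr)
   assume "\<not> d0 j < d0 i"
   then consider "d0 i = d0 j" | "d0 i < d0 j" by linarith
   then show False
   proof cases
    case 2
    have "w' (d0 i) < w' (d0 j)"
     using bM_d[OF f(1), of i] bM_d[OF f(1), of j] r bij 2 by (intro incrD[OF f(3)]) simp_all
    then show False using wl by simp
   qed (use wl in simp)
  qed
  then show "(i, j) \<in> invs n d0" using r unfolding invs_def by simp
 qed
 have lt: "card (invs n (w' \<circ> d)) < card (invs n w)" if dD: "d \<in> ?D" and ne: "d ~= d0" for d
 proof -
  have "invs n d ~= invs n d0" using invs_eq_imp_eq[OF youngD(1) youngD(1)[OF f(1)]] dD ne by blast
  then have "card (invs n d) < card (invs n d0)" using sub[OF dD] by (intro psubset_card_mono) auto
  then show ?thesis using TWc(2)[OF dD] TWc(2)[OF d0D] f(4) by simp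
 qed
 have winj: "inj_on (\<lambda>d. w' \<circ> d) ?D"
  by (rule inj_onI) (metis fun.inj_map_strong permutes_inj[OF f(2)] injD comp_apply ext)
 have finD: "finite ?D" by (rule finite_subset[OF _ finite_young[of n bM]]) auto
 show ?thesis
 proof (rule that[of "(\<lambda>d. w' \<circ> d) ` ?D"])
  show "w \<in> (\<lambda>d. w' \<circ> d) ` ?D" using d0D f(4) by blast
  show "u permutes {1..n}" if uD: "u \<in> (\<lambda>d. w' \<circ> d) ` ?D" for u
  proof -
   obtain d where d: "d \<in> ?D" "u = w' \<circ> d" using uD by blast
   then have "d \<in> young n bM" by simp
   then show ?thesis unfolding d(2) by (intro permutes_compose[OF _ f(2)] youngD(1))
  qed
  show "card (invs n u) < card (invs n w)" if "u \<in> (\<lambda>d. w' \<circ> d) ` ?D" "u ~= w" for u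
   using that lt f(4) by blast
  have "(\<Sum>u\<in>(\<lambda>d. w' \<circ> d) ` ?D. mm lam * TW u) = (\<Sum>d\<in>?D. mm lam * TW d * TW w')"
   unfolding sum.reindex[OF winj] o_def[of "\<lambda>u. mm lam * TW u"]
   by (intro sum.cong refl) (simp only: TWc(1)[symmetric] mult.assoc)
  also have "\<dots> = (\<Sum>d\<in>?D. mm lam * TW d) * TW w'" by (simp only: sum_distrib_right)
  finally show "(\<Sum>u\<in>(\<lambda>d. w' \<circ> d) ` ?D. mm lam * TW u) \<in> J"
   using Jr[OF alg_TW[OF f(2)] sumJ] by simp
 qed (use finD in simp)
qed

definition Nst :: "'a set" where
 "Nst = ospan q qi ({mm lam * TW (dperm n lam t) | t. t \<in> std n lam} \<union> J)"

text \<open>Induction on length. A nontrivial Young factor is absorbed by \<open>XX\<close> as a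
  power of \<open>q\<close>; a permutation that increases along rows but is not standard is
  exchanged for shorter ones by the Garnir relation.\<close>

lemma mm_TW_Nst:
 assumes "w permutes {1..n}"
 shows "mm lam * TW w \<in> Nst"
 using assms
proof (induction "card (invs n w)" arbitrary: w rule: less_induct)
 case less
 note w = less.prems
 have cvl: "convex_lab n (rowl lam)" using convex_rowl[of lam] size_lam by simp
 show ?case
 proof (cases "incr n (rowl lam) w")
  case False
  obtain v d where vd: "v \<in> young n (rowl lam)" "d permutes {1..n}" "incr n (rowl lam) d" "w = d \<circ> v"
   using young_factor[OF cvl w] by blast
  note c = TW_comp_incr[OF cvl vd(1-3)]
  have "v ~= id" using False vd(3,4) by auto
  then have "invs n v ~= {}" using increasing_permutes_id[OF youngD(1)[OF vd(1)]] by blast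
  then have "0 < card (invs n v)" using finite_invs[of n v] by (meson card_gt_0_iff)
  then have lt: "card (invs n d) < card (invs n w)" using c vd(4) by simp
  have "mm lam * TW w = uu lam * (XX (rowl lam) * TW v) * TW d"
   using c vd(4) by (simp add: mm_def mult.assoc)
  also have "\<dots> = q ^ card (invs n v) * (mm lam * TW d)"
   unfolding XX_mult_TW[OF cvl vd(1)] mm_def
   using central_power[OF q_central, of "card (invs n v)" "uu lam"] by (simp add: mult.assoc[symmetric])
  finally show ?thesis
   using less.hyps[OF lt vd(2)] unfolding Nst_def by (simp add: ospan_qpower)
 next
  case True
  show ?thesis
  proof (cases "tab_of lam w \<in> std n lam")
   case std: True
   have "mm lam * TW w \<in> {mm lam * TW (dperm n lam t) | t. t \<in> std n lam} \<union> J"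
    using std dperm_tab_of[OF size_lam w] by (intro UnI1 CollectI exI[of _ "tab_of lam w"]) simp
   then show ?thesis unfolding Nst_def by (rule ospan.base)
  next
   case False
   obtain D where D: "finite D" "w \<in> D" "\<And>u. u \<in> D ==> u permutes {1..n}"
    "\<And>u. u \<in> D ==> u ~= w ==> card (invs n u) < card (invs n w)" "(\<Sum>u\<in>D. mm lam * TW u) \<in> J"
    using garnir[OF w True False] by blast
   have "mm lam * TW w = (\<Sum>u\<in>D. mm lam * TW u) - (\<Sum>u\<in>D - {w}. mm lam * TW u)"
    using D(1,2) by (simp add: sum.remove)
   moreover have "(\<Sum>u\<in>D. mm lam * TW u) \<in> Nst" unfolding Nst_def using D(5) by (blast intro: ospan.base)
   moreover have "(\<Sum>u\<in>D - {w}. mm lam * TW u) \<in> Nst"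
    using less.hyps D(3,4) unfolding Nst_def by (intro ospan_sum) auto
   ultimately show ?thesis unfolding Nst_def by (simp add: ospan_diff)
  qed
 qed
qed

end

section \<open>Right multiplication by L\<close>

lemma compl_eqI:
 assumes "csum mu l < k" "k <= csum mu (Suc l)" "k <= msize mu"
 shows "compl mu k = l"
proof -
 obtain l' r c where N: "nd mu k = (l', r, c)" by (metis prod_cases3)
 have k: "1 <= k" using assms(1) by simp
 have d: "(l', r, c) \<in> diagram mu" "tlam mu (l', r, c) = k"
  using nd_in[OF k assms(3)] tlam_nd[OF k assms(3)] N by simp_all
 have "\<not> l' < l" "l' < Suc l" using comp_less_iff[OF d(1)] d(2) assms by simp_all
 then show ?thesis unfolding compl_def N by simp
qed

context cyclo_cell
begin

text \<open>Moving a node from component \<open>l\<close> to the preceding one raises a single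
  partial size by one, which lengthens one of the products by one factor.\<close>

lemma uu_add_node:
 assumes "length nu = ell" "1 <= l" "l < ell" "csum lam l < n"
  and "\<And>k. k ~= l ==> csum nu k = csum lam k" "csum nu l = Suc (csum lam l)"
 shows "uu nu = uu lam * FF (kappa ! l) (Suc (csum lam l))"
proof -
 have le: "csum lam k <= n" for k using csum_le[of lam k] size_lam by simp
 obtain p where p: "l = Suc p" using assms(2) by (cases l) auto
 show ?thesis
  unfolding uu_def assms(1) length_lam
  by (rule prod_list_update_commute[where k = p])
   (use assms p le in \<open>auto simp: UU_Suc intro!: UU_FF_comm\<close>)
qed

text \<open>As component \<open>0\<close> is nonempty, every product in \<open>uu lam\<close>
  contains its factor with \<open>L 1\<close>. Together these supply all factors of the cyclotomic
  relation except the one for \<open>kappa ! 0\<close>.\<close>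

lemma uu_first_zero:
 assumes "1 <= ell" "1 <= csum lam 1"
 shows "uu lam * (L 1 - qn (kappa ! 0)) = 0"
proof -
 have le: "csum lam k <= n" for k using csum_le[of lam k] size_lam by simp
 have n1: "1 <= n" using le[of 1] assms(2) by simp
 have LL: "(L 1 - qn k) * (L 1 - qn k') = (L 1 - qn k') * (L 1 - qn k)" for k k'
  using qn_central[of k "L 1"] qn_central[of k' "L 1"] qn_central[of k "qn k'"] by (simp add: algebra_simps)
 have "\<exists>R. prod_list (map (\<lambda>l. UU (kappa ! (l + 1)) (csum lam (l + 1))) ls)
   = prod_list (map (\<lambda>l. L 1 - qn (kappa ! (l + 1))) ls) * R" for ls
 proof (induction ls)
  case Nil
  then show ?case by (intro exI[of _ 1]) simp
 next
  case (Cons l ls)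
  then obtain R where R: "prod_list (map (\<lambda>l. UU (kappa ! (l + 1)) (csum lam (l + 1))) ls)
   = prod_list (map (\<lambda>l. L 1 - qn (kappa ! (l + 1))) ls) * R" by blast
  let ?k = "kappa ! (l + 1)" and ?a = "csum lam (l + 1)"
  let ?D = "prod_list (map (\<lambda>l. L 1 - qn (kappa ! (l + 1))) ls)"
  define Z where "Z = prod_list (map (FF ?k) [2..<?a + 1])"
  have a1: "1 <= ?a" using csum_mono[of 1 "l + 1" lam] assms(2) by simp
  have "[1..<?a + 1] = 1 # [2..<?a + 1]" using a1 by (simp add: upt_conv_Cons numeral_2_eq_2)
  then have U: "UU ?k ?a = qpow (- ?k) * (L 1 - qn ?k) * Z" unfolding UU_def Z_def FF_def by simp
  have ZL: "Z * L 1 = L 1 * Z"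
   unfolding Z_def using le[of "l + 1"] n1 by (intro prod_list_commute) (auto intro!: FF_L_comm)
  have ZD: "?D * Z = Z * ?D"
  proof (rule prod_list_commute)
   fix x assume "x \<in> set (map (\<lambda>l. L 1 - qn (kappa ! (l + 1))) ls)"
   then obtain k where "x = L 1 - qn k" by auto
   then show "x * Z = Z * x" using ZL qn_central[of k Z] by (simp add: left_diff_distrib right_diff_distrib)
  qed
  have "prod_list (map (\<lambda>l. UU (kappa ! (l + 1)) (csum lam (l + 1))) (l # ls))
    = qpow (- ?k) * ((L 1 - qn ?k) * (Z * ?D) * R)"
   unfolding list.map prod_list.Cons R U by (simp only: mult.assoc)
  also have "\<dots> = qpow (- ?k) * (((L 1 - qn ?k) * ?D) * (Z * R))"
   unfolding ZD[symmetric] by (simp only: mult.assoc)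
  also have "\<dots> = prod_list (map (\<lambda>l. L 1 - qn (kappa ! (l + 1))) (l # ls)) * (qpow (- ?k) * (Z * R))"
   unfolding qpow_lc list.map prod_list.Cons ..
  finally show ?case by blast
 qed
 then obtain R where R: "uu lam = prod_list (map (\<lambda>l. L 1 - qn (kappa ! (l + 1))) [0..<ell - 1]) * R"
  unfolding uu_def length_lam by blast
 have kp: "kappa = kappa ! 0 # map (\<lambda>l. kappa ! (l + 1)) [0..<ell - 1]"
  using kap assms(1) by (intro nth_equalityI) (auto simp: nth_Cons')
 have "prod_list (map (\<lambda>k. L 1 - qn k) kappa)
   = (L 1 - qn (kappa ! 0)) * prod_list (map (\<lambda>l. L 1 - qn (kappa ! (l + 1))) [0..<ell - 1])"
  using arg_cong[OF kp, of "\<lambda>ks. prod_list (map (\<lambda>k. L 1 - qn k) ks)"] by (simp add: o_def)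
 then have "(L 1 - qn (kappa ! 0)) * uu lam = prod_list (map (\<lambda>k. L 1 - qn k) kappa) * R"
  unfolding R by (simp only: mult.assoc)
 also have "\<dots> = 0" using L1_zero[OF n1] by simp
 also have "(L 1 - qn (kappa ! 0)) * uu lam = uu lam * (L 1 - qn (kappa ! 0))"
  using uu_L_comm[OF size_lam _ n1] qn_central[of "kappa ! 0" "uu lam"] by (simp add: left_diff_distrib right_diff_distrib)
 finally show ?thesis .
qed

text \<open>For a first node of a row, \<open>L j\<close> is conjugated to the first position of the component; there it
 moves a node to the previous component, or it is killed by the cyclotomic relation.\<close>
lemma first_node_J:
 assumes d: "(l, i, 0) \<in> diagram lam" and j: "j = tlam lam (l, i, 0)" and a1: "a1 = Suc (csum lam l)"
 shows "mm lam * (TW (cyc a1 j) * (L a1 - qn (kappa ! l))) \<in> J"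
proof -
 have h: "l < length lam" "i < length (lam ! l)" "0 < lam ! l ! i" using d by (simp_all add: diagram_iff)
 have jo: "j = Suc (off lam l i)" using tlam_eq[OF d] j by simp
 have aj: "1 <= a1" "a1 <= j" "j <= n" using off_ge_csum[of lam l i] tlam_range[OF d] size_lam j jo a1 by simp_all
 have jS: "j <= csum lam (Suc l)" using off_row_le_csum[OF h(1,2)] h(3) jo by simp
 let ?y = "cyc a1 j"
 have y: "?y permutes {1..n}" using cyc_permutes aj by simp
 have yc: "?y \<in> young n (compl lam)"
 proof -
  have cl: "compl lam k = l" if "a1 <= k" "k <= j" for k
   using that aj a1 jS size_lam by (intro compl_eqI) simp_all
  have "compl lam (?y k) = compl lam k" for k
   using cl[of a1] cl[of j] cl[of k] cl[of "Suc k"] aj by (auto simp: cyc_def)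
  then show ?thesis using y unfolding young_def by simp
 qed
 have comm: "TW ?y * uu lam = uu lam * TW ?y" using uu_TW_comm[OF size_lam yc] by simp
 have X: "mm lam * (TW ?y * (L a1 - qn (kappa ! l))) = XX (rowl lam) * (TW ?y * (uu lam * (L a1 - qn (kappa ! l))))"
  unfolding mm_alt[OF size_lam] mult.assoc[symmetric] comm[symmetric]
  using comm by (simp only: mult.assoc)
 show ?thesis
 proof (cases l)
  case 0
  have "csum lam 0 = 0" by (simp add: csum_def)
  then have "a1 = 1" using a1 0 by simp
  moreover have "1 <= ell" "1 <= csum lam 1" using h(1) length_lam jS 0 jo by simp_all
  ultimately show ?thesis unfolding X using uu_first_zero 0 J0 by simp
 next
  case (Suc p)
  define A x pre post us vs where "A = lam ! p" and "x = lam ! l ! i" and "pre = take p lam"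
   and "post = drop (Suc l) lam" and "us = take i (lam ! l)" and "vs = drop (Suc i) (lam ! l)"
  have lam_l: "lam ! l = us @ x # vs" and lus: "length us = i"
   using h(2) unfolding us_def vs_def x_def by (simp_all add: Cons_nth_drop_Suc Suc_lessD id_take_nth_drop)
  have lam: "lam = pre @ A # (us @ x # vs) # post" and lpre: "length pre = p"
   using h(1) Suc unfolding pre_def post_def A_def lam_l[symmetric] by (simp_all add: Cons_nth_drop_Suc)
  have x: "0 < x" using h(3) by (simp add: x_def)
  \<comment> \<open>A node leaves row \<open>i\<close> of component \<open>l\<close> and becomes a
    new last row of component \<open>p\<close>; no prefix sum decreases, and one of component
    \<open>p\<close> grows.\<close>
  define nu where "nu = pre @ (A @ [1]) # (us @ (x - 1) # vs) # post"
  have len: "length nu = ell" using length_lam unfolding nu_def lam by simp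
  have nth_other: "nu ! k = lam ! k" if "k ~= l" "k ~= p" for k
   using that lpre Suc unfolding nu_def lam by (auto simp: nth_append nth_Cons')
  have nth_l: "nu ! l = us @ (x - 1) # vs" and nth_p: "nu ! p = A @ [1]"
   using lpre Suc unfolding nu_def by (simp_all add: nth_append)
  have cs_le: "csum nu k = csum lam k" if "k <= p" for k
   using that lpre unfolding csum_def nu_def lam by simp
  have cs_l: "csum nu l = Suc (csum lam l)"
   using lpre Suc unfolding csum_def nu_def lam by simp
  have cs_gt: "csum nu k = csum lam k" if lk: "l < k" for k
  proof -
   obtain k' where k: "k = Suc (Suc (p + k'))" using lk Suc less_imp_Suc_add[of l k] by auto
   show ?thesis using lpre x unfolding csum_def nu_def lam k by simp
  qed
  have cs: "csum nu k = csum lam k" if "k ~= l" for k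
   using cs_le[of k] cs_gt[of k] that Suc by (cases "k <= p") auto
  have sz: "msize nu = n"
   using csum_length[of nu] csum_length[of lam] cs_gt[of ell] len length_lam size_lam h(1) by simp
  have off_other: "off nu k r = off lam k r" if "k ~= l" "k ~= p" for k r
   using nth_other[OF that] cs[OF that(1)] by (simp add: off_def)
  have off_p: "off nu p r = off lam p r" if "r <= length A" for r
   using cs[of p] Suc that nth_p unfolding off_def A_def by simp
  have off_pS: "off lam p (Suc (length A)) < off nu p (Suc (length A))"
   using cs[of p] Suc nth_p unfolding off_def A_def by simp
  have off_pl: "off nu p (length A) = csum lam l"
   using off_p[of "length A"] csum_Suc[of p lam] h(1) Suc by (simp add: off_def A_def)
  have off_l1: "off nu l r = Suc (off lam l r)" if "r <= i" for r
   using that lus unfolding off_def cs_l nth_l lam_l by simp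
  have off_l2: "off nu l r = off lam l r" if ir: "i < r" for r
  proof -
   obtain r' where r: "r = Suc (i + r')" using ir less_imp_Suc_add[of i r] by auto
   show ?thesis using lus x unfolding off_def cs_l nth_l lam_l r by simp
  qed
  have "gtlex ell n nu lam"
  proof (rule gtlexI_dom[of p ell "Suc (length A)"])
   show "p < ell" using h(1) length_lam Suc by simp
   then show "Suc (length A) < n + 2" using part_length_le[OF mp, of p] by (simp add: A_def)
   show "off lam l' i' <= off nu l' i'" for l' i'
   proof (cases "l' = p")
    case True
    show ?thesis
    proof (cases "i' <= length A")
     case False
     then show ?thesis using nth_p cs[of p] Suc unfolding True off_def A_def by simp
    qed (use off_p True in simp)
   next
    case False
    then show ?thesis using off_other[of l' i'] off_l1[of i'] off_l2[of i'] by (cases "l' = l"; cases "i' <= i") auto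
   qed
  qed (rule off_pS)
  then have "gtlex ell n (sortm nu) lam"
   using gtlex_ge dominates_sortm[of nu] len unfolding dominates_iff by simp
  then have mmJ: "mm nu \<in> J" using J_composition len sz by blast
  \<comment> \<open>The row labelling with position \<open>j\<close> split off.
    \<open>cyc a1 j\<close> carries its fibres to rows of \<open>nu\<close>; \<open>j\<close> itself
    goes to \<open>a1\<close>, the last position of component \<open>p\<close> in
    \<open>nu\<close>.\<close>
  define b where "b k = (if k = j then None else Some (rowl lam k))" for k
  have rlD: "fst (rowl lam k) < length lam" "snd (rowl lam k) < length (lam ! fst (rowl lam k))"
   "off lam (fst (rowl lam k)) (snd (rowl lam k)) < k"
   "k <= off lam (fst (rowl lam k)) (snd (rowl lam k)) + lam ! fst (rowl lam k) ! snd (rowl lam k)"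
   if "1 <= k" "k <= n" for k
   using rowlD[of k lam "fst (rowl lam k)" "snd (rowl lam k)"] that size_lam by simp_all
  have rj: "rowl lam j = (l, i)" using rowl_tlam[OF d] j by simp
  have cvl: "convex_lab n (rowl lam)" using convex_rowl[of lam] size_lam by simp
  have cvb: "convex_lab n b"
   unfolding convex_lab_def
  proof (intro allI impI)
   fix u v w assume a: "1 <= u" "u <= v" "v <= w" "w <= n" "b u = b w"
   show "b v = b u"
   proof (cases "u = j")
    case True
    then have "w = j" using a(5) by (simp add: b_def split: if_splits)
    then show ?thesis using True a by simp
   next
    case False
    then have wj: "w ~= j" and eq: "rowl lam u = rowl lam w" using a(5) by (auto simp: b_def split: if_splits)
    have rv: "rowl lam v = rowl lam u" using convex_labD[OF cvl a(1-4) eq] .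
    \<comment> \<open>Position \<open>j\<close> is the first of its row, so it cannot be preceded by
      another position with the same label.\<close>
    have "v ~= j"
    proof
     assume vj: "v = j"
     have ru: "rowl lam u = (l, i)" using rv rj vj by simp
     have "off lam l i < u" using rlD(3)[of u] a ru by simp
     then show False using jo False vj a by simp
    qed
    then show ?thesis using False rv by (simp add: b_def)
   qed
  qed
  have cvn: "convex_lab n (rowl nu)" using convex_rowl[of nu] sz by simp
  have lm: "length nu = length lam" using len length_lam by simp
  have rowy: "rowl nu (?y k) = rowl lam k" if k: "1 <= k" "k <= n" "k ~= j" for k
  proof -
   obtain l' r where lr: "rowl lam k = (l', r)" by fastforce
   have D: "l' < length lam" "r < length (lam ! l')" "off lam l' r < k" "k <= off lam l' r + lam ! l' ! r"
    using rlD[OF k(1,2)] lr by simp_all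
   consider "l' < l" | "l' = l" "r < i" | "l' = l" "r = i" | "l' = l" "i < r" | "l < l'" by linarith
   then show ?thesis
   proof cases
    case 1
    have "csum lam (Suc l') <= csum lam l" using 1 by (intro csum_mono) simp
    then have "k < a1" using off_row_le_csum[OF D(1,2)] D(4) a1 by simp
    then have yk: "?y k = k" using aj by (simp add: cyc_def)
    have "rowl nu k = (l', r)"
    proof (cases "l' = p")
     case True
     have "r < length A" using D(2) True by (simp add: A_def)
     then show ?thesis
      using D off_p[of r] lm nth_p True by (intro rowlI) (simp_all add: nth_append A_def)
    next
     case False
     then show ?thesis using D off_other[of l' r] nth_other[of l'] lm 1 by (intro rowlI) simp_all
    qed
    then show ?thesis using yk lr by simp
   next
    case 2
    have "off lam l r + lam ! l ! r <= off lam l i" using 2 D(2) by (intro off_row_le) simp_all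
    then have "k < j" "a1 <= k" using D(3,4) 2 jo a1 off_ge_csum[of lam l r] by simp_all
    then have yk: "?y k = Suc k" by (simp add: cyc_def)
    have "rowl nu (Suc k) = (l, r)"
     using D 2 off_l1[of r] lm lus by (intro rowlI) (auto simp: nth_l lam_l nth_append)
    then show ?thesis using yk lr 2 by simp
   next
    case 3
    then have kj: "j < k" using D jo k(3) by simp
    then have yk: "?y k = k" by (simp add: cyc_def)
    have "rowl nu k = (l, i)"
     using D 3 off_l1[of i] lm lus kj jo h x by (intro rowlI) (auto simp: nth_l lam_l nth_append)
    then show ?thesis using yk lr 3 by simp
   next
    case 4
    have "off lam l i + lam ! l ! i <= off lam l r" using 4 h(2) by (intro off_row_le) simp_all
    then have kj: "j < k" using D(3) 4 jo h(3) by simp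
    then have yk: "?y k = k" by (simp add: cyc_def)
    have "rowl nu k = (l, r)"
     using D 4 off_l2[of r] lm lus by (intro rowlI) (auto simp: nth_l lam_l nth_append nth_Cons')
    then show ?thesis using yk lr 4 by simp
   next
    case 5
    have "csum lam (Suc l) <= csum lam l'" using 5 by (intro csum_mono) simp
    then have kj: "j < k" using jS D(3) off_ge_csum[of lam l' r] by simp
    then have yk: "?y k = k" by (simp add: cyc_def)
    have "rowl nu k = (l', r)"
     using D 5 Suc off_other[of l' r] nth_other[of l'] lm by (intro rowlI) simp_all
    then show ?thesis using yk lr by simp
   qed
  qed
  have rowj: "rowl nu (?y j) = (p, length A)"
  proof -
   have "?y j = a1" by (simp add: cyc_def)
   moreover have "rowl nu a1 = (p, length A)"
    using off_pl a1 nth_p lm h(1) Suc by (intro rowlI) simp_all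
   ultimately show ?thesis by simp
  qed
  have rne: "rowl lam k ~= (p, length A)" if "1 <= k" "k <= n" for k
   using rlD(2)[OF that] by (auto simp: A_def)
  have lab: "b u = b v \<longleftrightarrow> rowl nu (?y u) = rowl nu (?y v)"
   if "1 <= u" "u <= n" "1 <= v" "v <= n" for u v
   using rowy[OF that(1,2)] rowy[OF that(3,4)] rowj rne[OF that(1,2)] rne[OF that(3,4)]
   by (cases "u = j"; cases "v = j") (auto simp: b_def)
  have ymono: "?y u < ?y v" if "u < v" "u ~= j" "v ~= j" for u v
   using that by (auto simp: cyc_def)
  have inc1: "incr n b ?y"
   unfolding incr_def
  proof (intro allI impI)
   fix u v assume "1 <= u" "u < v" "v <= n" "b u = b v"
   then show "?y u < ?y v" by (intro ymono) (auto simp: b_def split: if_splits)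
  qed
  have inc2: "incr n (rowl nu) (inv ?y)"
   unfolding incr_def
  proof (intro allI impI)
   fix u v assume a: "1 <= u" "u < v" "v <= n" "rowl nu u = rowl nu v"
   define u' v' where "u' = inv ?y u" and "v' = inv ?y v"
   have r: "1 <= u'" "u' <= n" "1 <= v'" "v' <= n"
    using perm_inv_range[OF y] a unfolding u'_def v'_def by simp_all
   have yy: "?y u' = u" "?y v' = v" unfolding u'_def v'_def by (simp_all add: permutes_inverses[OF y])
   have bb: "b u' = b v'" using lab[OF r] yy a(4) by simp
   have ne: "u' ~= v'" using yy a(2) by auto
   then have "u' ~= j" "v' ~= j" using bb by (auto simp: b_def split: if_splits)
   then have "\<not> v' < u'" using ymono[of v' u'] yy a(2) by auto
   then show "inv ?y u < inv ?y v" using ne unfolding u'_def v'_def by simp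
  qed
  have conj: "XX b * TW ?y = TW ?y * XX (rowl nu)"
   by (rule XX_conj[OF cvb cvn y inc1 inc2 lab])
  let ?h = "\<Sum>d\<in>{d \<in> young n (rowl lam). incr n b d}. TW (inv d)"
  have Xl: "XX (rowl lam) = ?h * XX b"
  proof (rule XX_factor_left[OF cvl cvb])
   fix u v assume "b u = b v"
   then show "rowl lam u = rowl lam v" by (cases "u = j"; cases "v = j") (simp_all add: b_def)
  qed
  have hA: "?h \<in> alg" by (rule alg_sum) (auto intro: alg_TW permutes_inv youngD)
  have a1n: "csum lam l < n" using aj a1 by simp
  have un: "uu lam * (L a1 - qn (kappa ! l)) = qpow (kappa ! l) * uu nu"
  proof -
   have "qpow (kappa ! l) * uu nu = uu lam * (qpow (kappa ! l) * FF (kappa ! l) a1)"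
    using uu_add_node[OF len _ _ a1n cs cs_l] h(1) length_lam Suc a1 by (simp add: qpow_lc)
   also have "qpow (kappa ! l) * FF (kappa ! l) a1 = L a1 - qn (kappa ! l)"
    unfolding FF_def mult.assoc[symmetric] using qpow_unit[of "- kappa ! l"] by simp
   finally show ?thesis by simp
  qed
  have "XX (rowl lam) * (TW ?y * (uu lam * (L a1 - qn (kappa ! l))))
    = ?h * (XX b * TW ?y) * (qpow (kappa ! l) * uu nu)"
   unfolding un Xl by (simp only: mult.assoc)
  also have "\<dots> = ?h * TW ?y * (qpow (kappa ! l) * (XX (rowl nu) * uu nu))"
   unfolding conj by (simp only: mult.assoc qpow_lc)
  finally have eq: "XX (rowl lam) * (TW ?y * (uu lam * (L a1 - qn (kappa ! l))))
    = ?h * TW ?y * (qpow (kappa ! l) * (XX (rowl nu) * uu nu))" .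
  have "XX (rowl nu) * uu nu \<in> J" using mm_alt[OF sz] mmJ by simp
  then have "qpow (kappa ! l) * (XX (rowl nu) * uu nu) \<in> J" by (rule Jl[OF alg_qpow])
  then show ?thesis unfolding X eq by (rule Jl[OF alg.mult[OF hA alg_TW[OF y]]])
 qed
qed

definition NN :: "'a set" where "NN = ospan q qi ({mm lam * TW w | w. w permutes {1..n}} \<union> J)"

lemma NN_J: "x \<in> J ==> x \<in> NN"
 unfolding NN_def by (blast intro: ospan.base)

lemma NN_H0: assumes "x \<in> H0" shows "mm lam * x \<in> NN"
 unfolding NN_def
proof (rule ospan_lmult[OF assms[unfolded H0_def]])
 fix s assume "s \<in> TWs"
 then show "mm lam * s \<in> ospan q qi ({mm lam * TW w | w. w permutes {1..n}} \<union> J)"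
  unfolding TWs_def by (blast intro: ospan.base)
qed

lemma NN_rH0: assumes "x \<in> NN" "h \<in> H0" shows "x * h \<in> NN"
 unfolding NN_def
proof (rule ospan_rmult[OF assms(1)[unfolded NN_def]], fold NN_def)
 fix s assume "s \<in> {mm lam * TW w | w. w permutes {1..n}} \<union> J"
 then consider w where "s = mm lam * TW w" "w permutes {1..n}" | "s \<in> J" by blast
 then show "s * h \<in> NN"
 proof cases
  case 1
  then show ?thesis using NN_H0[OF H0_mult[OF H0_TW[OF 1(2)] assms(2)]] by (simp add: mult.assoc)
 next
  case 2
  then show ?thesis using NN_J Jr H0_alg[OF assms(2)] by blast
 qed
qed

text \<open>Inside a row \<open>mm lam\<close> absorbs the left \<open>T k\<close> of
  \<open>L_Suc\<close>, which reduces \<open>L j\<close> to the preceding position. At the start of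
  a row \<open>L_expand\<close> transfers the problem to the first position of the component, where
  \<open>L\<close> acts as \<open>[kappa ! l]\<close> modulo \<open>J\<close>.\<close>

lemma mm_L_NN:
 assumes "1 <= j" "j <= n"
 shows "mm lam * L j \<in> NN"
 using assms
proof (induction j rule: less_induct)
 case (less j)
 obtain l i c where N: "nd lam j = (l, i, c)" by (metis prod_cases3)
 have d: "(l, i, c) \<in> diagram lam" "tlam lam (l, i, c) = j"
  using nd_in[of j lam] tlam_nd[of j lam] less.prems size_lam N by simp_all
 show ?case
 proof (cases c)
  case (Suc c')
  have d': "(l, i, c') \<in> diagram lam" using d(1) Suc by (simp add: diagram_iff)
  obtain k where k: "j = Suc k" "k = tlam lam (l, i, c')" using tlam_Suc[of l i c' lam] d Suc by simp
  have k1: "1 <= k" "k < n" using tlam_range[OF d'] k less.prems by simp_all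
  have req: "rowl lam k = rowl lam (Suc k)" using rowl_tlam[OF d(1)] rowl_tlam[OF d'] d(2) k by simp
  have cvl: "convex_lab n (rowl lam)" using convex_rowl[of lam] size_lam by simp
  have mT: "mm lam * T k = q * mm lam"
   unfolding mm_def mult.assoc XX_mult_T[OF cvl k1 req] by (rule q_lc)
  have "mm lam * L j = qi * ((mm lam * T k) * L k * T k + mm lam * T k)"
   unfolding k(1) L_Suc[OF k1] using qi_central[of "mm lam"]
   by (simp add: distrib_left mult.assoc[symmetric])
  also have "\<dots> = qi * (q * ((mm lam * L k) * T k) + q * mm lam)"
   unfolding mT by (simp only: mult.assoc)
  finally have eq: "mm lam * L j = qi * (q * ((mm lam * L k) * T k) + q * mm lam)" .
  have "T k \<in> H0" using H0_TW[OF sr_permutes[OF k1]] TW_sr[OF k1] by simp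
  moreover have "mm lam * L k \<in> NN" using less.IH[of k] k(1) k1 by simp
  ultimately have "(mm lam * L k) * T k \<in> NN" by (rule NN_rH0[rotated])
  moreover have "mm lam \<in> NN" using NN_H0[OF H0_TW[OF permutes_id]] by simp
  ultimately show ?thesis unfolding eq NN_def by (intro ospan.qi ospan.add ospan.q)
 next
  case 0
  let ?a = "Suc (csum lam l)"
  have d0: "(l, i, 0) \<in> diagram lam" "j = tlam lam (l, i, 0)" using d 0 by simp_all
  have aj: "1 <= ?a" "?a <= j" using off_ge_csum[of lam l i] tlam_eq[OF d0(1)] d0(2) by simp_all
  let ?y = "cyc ?a j" and ?k = "qn (kappa ! l)"
  have y: "?y permutes {1..n}" using cyc_permutes aj less.prems by simp
  obtain h1 h2 where hh: "h1 \<in> H0" "h2 \<in> H0" "L j = TW ?y * L ?a * h1 + h2"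
   using L_expand[OF aj less.prems(2)] by blast
  have "mm lam * L j = (mm lam * (TW ?y * (L ?a - ?k))) * h1 + ?k * (mm lam * (TW ?y * h1)) + mm lam * h2"
  proof -
   have "?k * (mm lam * (TW ?y * h1)) = mm lam * (TW ?y * ?k) * h1"
    using qn_central[of "kappa ! l" "mm lam * TW ?y"] by (simp only: mult.assoc[symmetric])
   then show ?thesis unfolding hh(3) by (simp add: distrib_left right_diff_distrib left_diff_distrib mult.assoc)
  qed
  moreover have "(mm lam * (TW ?y * (L ?a - ?k))) * h1 \<in> NN"
   by (intro NN_J Jr[OF H0_alg[OF hh(1)] first_node_J[OF d0 refl]])
  moreover have "?k * (mm lam * (TW ?y * h1)) \<in> NN"
   using NN_H0[OF H0_mult[OF H0_TW[OF y] hh(1)]] unfolding NN_def by (rule ospan_qn)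
  moreover have "mm lam * h2 \<in> NN" by (rule NN_H0[OF hh(2)])
  ultimately show ?thesis unfolding NN_def by (simp add: ospan.add)
 qed
qed

lemma NN_rL1:
 assumes "x \<in> NN" "1 <= n" shows "x * L 1 \<in> NN"
 unfolding NN_def
proof (rule ospan_rmult[OF assms(1)[unfolded NN_def]], fold NN_def)
 fix s assume "s \<in> {mm lam * TW w | w. w permutes {1..n}} \<union> J"
 then consider w where "s = mm lam * TW w" "w permutes {1..n}" | "s \<in> J" by blast
 then show "s * L 1 \<in> NN"
 proof cases
  case 1
  have "mm lam * (TW w * L 1) \<in> ospan q qi ({mm lam * TW w | w. w permutes {1..n}} \<union> J)"
  proof (rule ospan_lmult[OF TW_L1_QQ[OF assms(2) 1(2), unfolded QQ_def]], fold NN_def)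
   fix s assume "s \<in> TWs \<union> {L j * TW w | j w. 1 <= j \<and> j <= n \<and> w permutes {1..n}}"
   then consider "s \<in> TWs" | j w where "s = L j * TW w" "1 <= j" "j <= n" "w permutes {1..n}" by blast
   then show "mm lam * s \<in> NN"
   proof cases
    case 1
    then show ?thesis by (intro NN_H0) (auto simp: H0_def intro: ospan.base)
   next
    case 2
    then show ?thesis using NN_rH0[OF mm_L_NN[OF 2(2,3)] H0_TW[OF 2(4)]] by (simp add: mult.assoc)
   qed
  qed
  then show ?thesis unfolding 1(1) by (simp add: mult.assoc NN_def)
 next
  case 2
  then show ?thesis using NN_J Jr alg.L[of 1] assms(2) by simp
 qed
qed

lemma NN_rL: "1 <= k ==> k <= n ==> x \<in> NN ==> x * L k \<in> NN"
proof (induction k arbitrary: x rule: nat_induct_at_least)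
 case base
 then show ?case using NN_rL1 by simp
next
 case (Suc k)
 have k: "1 <= k" "k < n" using Suc by simp_all
 have T: "T k \<in> H0" using H0_TW[OF sr_permutes[OF k]] TW_sr[OF k] by simp
 have "x * L (Suc k) = qi * (x * T k * L k * T k + x * T k)"
  unfolding L_Suc[OF k] using qi_central[of x] by (simp add: distrib_left mult.assoc[symmetric])
 moreover have "x * T k \<in> NN" using NN_rH0[OF Suc.prems(2) T] .
 moreover from this have "x * T k * L k * T k \<in> NN" using Suc.IH[of "x * T k"] k by (intro NN_rH0[OF _ T]) simp
 ultimately show ?case unfolding NN_def by (simp add: ospan.qi ospan.add)
qed

lemma NN_ralg: "h \<in> alg ==> x \<in> NN ==> x * h \<in> NN"
proof (induction h arbitrary: x rule: alg.induct)
 case (T r)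
 then show ?case using NN_rH0[OF T(3)] H0_TW[OF sr_permutes[OF T(1,2)]] TW_sr[OF T(1,2)] by simp
next
 case (L r)
 then show ?case by (intro NN_rL)
next
 case q
 then show ?case using ospan.q[of x q qi] q_central[of x] unfolding NN_def by simp
next
 case qi
 then show ?case using ospan.qi[of x q qi] qi_central[of x] unfolding NN_def by simp
next
 case (add h1 h2)
 then show ?case unfolding NN_def by (simp add: distrib_left ospan.add)
next
 case (neg h)
 then show ?case unfolding NN_def by (simp add: ospan.neg)
next
 case (mult h1 h2)
 then show ?case by (simp add: mult.assoc[symmetric])
qed simp

theorem mm_alg_Nst:
 assumes "h \<in> alg" shows "mm lam * h \<in> Nst"
proof -
 have "mm lam \<in> NN" using NN_H0[OF H0_TW[OF permutes_id]] by simp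
 then have "mm lam * h \<in> NN" using NN_ralg[OF assms] by blast
 moreover have "NN \<subseteq> Nst"
  unfolding NN_def
  using mm_TW_Nst by (unfold Nst_def, intro ospan_subset) (auto intro: ospan.base)
 ultimately show ?thesis by blast
qed

end

section \<open>Two-sided ideals spanned by Murphy elements\<close>

context cyclo_star
begin

definition Mset :: "nat => (mpart => bool) => 'a set" where
 "Mset ell P = {mst mu s t | mu s t. multipartition ell n mu \<and> P mu \<and> s \<in> std n mu \<and> t \<in> std n mu}"

lemma std_bij: "t \<in> std n lam ==> bij_betw t (diagram lam) {1..n}"
 unfolding std_def by simp

lemma star_mst:
 assumes "multipartition ell n mu" "s \<in> std n mu" "t \<in> std n mu"
 shows "star (mst mu s t) = mst mu t s"
proof -
 have sz: "msize mu = n" using multipartitionD(2)[OF assms(1)] .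
 have p: "dperm n mu s permutes {1..n}" "dperm n mu t permutes {1..n}"
  using dperm_spec(1)[OF sz std_bij] assms by blast+
 show ?thesis
  unfolding mst_def star_mult star_mm[OF sz] star_TW[OF p(2)] star_TW[OF permutes_inv[OF p(1)]]
   permutes_inv_inv[OF p(1)] by (simp only: mult.assoc)
qed

lemma star_alg: "x \<in> alg ==> star x \<in> alg"
 by (induction rule: alg.induct) (auto simp: star_add star_minus star_mult star_T star_L intro: alg.intros)

lemma star_star_alg: "x \<in> alg ==> star (star x) = x"
 by (induction rule: alg.induct) (auto simp: star_add star_minus star_mult star_T star_L)

lemma star_ospan:
 assumes "x \<in> ospan q qi S" "\<And>s. s \<in> S ==> star s \<in> ospan q qi S'"
 shows "star x \<in> ospan q qi S'"
 using assms(1)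
proof induction
 case (q x)
 then show ?case using ospan.q[OF q.IH] q_central[of "star x"] by (simp add: star_mult)
next
 case (qi x)
 then show ?case using ospan.qi[OF qi.IH] qi_central[of "star x"] by (simp add: star_mult)
qed (auto simp: star_add star_minus intro: ospan.intros assms(2))

context
 fixes ell assumes kap: "length kappa = ell"
begin

text \<open>The two claims need each other. The first, for larger shapes, makes their span an ideal,
  so that straightening gives the second for \<open>lam\<close>; applying \<open>star\<close> to the
  second straightens left factors and yields the first.\<close>

lemma two_sided:
 assumes "multipartition ell n lam" "g \<in> alg" "h \<in> alg"
 shows "g * mm lam * h \<in> ospan q qi (Mset ell (\<lambda>mu. mu = lam \<or> gtlex ell n mu lam)) \<and>
  mm lam * h \<in> ospan q qi ({mm lam * TW (dperm n lam t) | t. t \<in> std n lam} \<union> Mset ell (\<lambda>mu. gtlex ell n mu lam))"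
 using assms
proof (induction arbitrary: g h rule: gtlex_induct)
 case (step lam)
 let ?M = "Mset ell (\<lambda>mu. gtlex ell n mu lam)"
 let ?M' = "Mset ell (\<lambda>mu. mu = lam \<or> gtlex ell n mu lam)"
 define J where "J = ospan q qi ?M"
 have sub: "g * mm mu * h \<in> J" if "multipartition ell n mu" "gtlex ell n mu lam" "g \<in> alg" "h \<in> alg" for mu g h
 proof -
  have "g * mm mu * h \<in> ospan q qi (Mset ell (\<lambda>nu. nu = mu \<or> gtlex ell n nu mu))"
   using step.IH[OF that] by blast
  moreover have "Mset ell (\<lambda>nu. nu = mu \<or> gtlex ell n nu mu) \<subseteq> ?M"
   unfolding Mset_def using that(2) gtlex_trans by blast
  ultimately show ?thesis unfolding J_def using ospan_mono by blast
 qed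
 have algTW: "TW (inv (dperm n mu s)) \<in> alg" "TW (dperm n mu s) \<in> alg"
  if "multipartition ell n mu" "s \<in> std n mu" for mu s
  using dperm_spec(1)[OF multipartitionD(2)[OF that(1)] std_bij[OF that(2)]]
  by (blast intro: alg_TW permutes_inv)+
 have gen: "g * s \<in> J \<and> s * g \<in> J" if g: "g \<in> alg" and "s \<in> ?M" for g s
 proof -
  obtain mu u v where s: "s = mst mu u v" "multipartition ell n mu" "gtlex ell n mu lam" "u \<in> std n mu" "v \<in> std n mu"
   using \<open>s \<in> ?M\<close> unfolding Mset_def by blast
  note a = algTW[OF s(2,4)] algTW[OF s(2,5)]
  have "g * s = (g * TW (inv (dperm n mu u))) * mm mu * TW (dperm n mu v)"
   and "s * g = TW (inv (dperm n mu u)) * mm mu * (TW (dperm n mu v) * g)"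
   unfolding s(1) mst_def by (simp_all only: mult.assoc)
  then show ?thesis using sub[OF s(2,3)] a g by (auto intro: alg.mult)
 qed
 interpret cell: cyclo_cell n q T qi L kappa star ell lam J
 proof unfold_locales
  show "multipartition ell n lam" "length kappa = ell" by (fact step.hyps kap)+
  show "0 \<in> J" "\<And>x y. x \<in> J ==> y \<in> J ==> x + y \<in> J" "\<And>x. x \<in> J ==> - x \<in> J"
   unfolding J_def by (auto intro: ospan.intros)
  show "g * x \<in> J" if "g \<in> alg" "x \<in> J" for g x
   unfolding J_def by (rule ospan_lmult[OF that(2)[unfolded J_def]]) (use gen that(1) J_def in blast)
  show "x * g \<in> J" if "g \<in> alg" "x \<in> J" for g x
   unfolding J_def by (rule ospan_rmult[OF that(2)[unfolded J_def]]) (use gen that(1) J_def in blast)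
  show "mm mu \<in> J" if "multipartition ell n mu" "gtlex ell n mu lam" for mu
   using sub[OF that alg.one alg.one] by simp
 qed
 let ?S = "{mm lam * TW (dperm n lam t) | t. t \<in> std n lam}"
 have R: "mm lam * h \<in> ospan q qi (?S \<union> ?M)" if "h \<in> alg" for h
 proof -
  have "ospan q qi (?S \<union> J) \<subseteq> ospan q qi (?S \<union> ?M)"
   unfolding J_def using ospan_mono[of ?M "?S \<union> ?M"] by (intro ospan_subset) (auto intro: ospan.base)
  then show ?thesis using cell.mm_alg_Nst[OF that] unfolding cell.Nst_def by blast
 qed
 have starM: "star s \<in> ospan q qi ?M" if sM: "s \<in> ?M" for s
 proof -
  obtain mu u v where s: "s = mst mu u v" "multipartition ell n mu" "gtlex ell n mu lam" "u \<in> std n mu" "v \<in> std n mu"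
   using sM unfolding Mset_def by blast
  have "mst mu v u \<in> ?M" using s unfolding Mset_def by blast
  then show ?thesis unfolding s(1) star_mst[OF s(2,4,5)] by (rule ospan.base)
 qed
 let ?S' = "{TW (inv (dperm n lam t)) * mm lam | t. t \<in> std n lam}"
 have Lf: "g * mm lam \<in> ospan q qi (?S' \<union> ?M)" if g: "g \<in> alg" for g
 proof -
  have "star (mm lam * star g) \<in> ospan q qi (?S' \<union> ?M)"
  proof (rule star_ospan[OF R[OF star_alg[OF g]]])
   fix s assume "s \<in> ?S \<union> ?M"
   then consider t where "t \<in> std n lam" "s = mm lam * TW (dperm n lam t)" | "s \<in> ?M" by blast
   then show "star s \<in> ospan q qi (?S' \<union> ?M)"
   proof cases
    case 1
    have "star s = TW (inv (dperm n lam t)) * mm lam"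
     unfolding 1(2) star_mult star_mm[OF cell.size_lam]
      star_TW[OF dperm_spec(1)[OF cell.size_lam std_bij[OF 1(1)]]] ..
    then show ?thesis using 1(1) by (blast intro: ospan.base)
   next
    case 2
    then show ?thesis using starM ospan_mono[of ?M "?S' \<union> ?M"] by blast
   qed
  qed
  then show ?thesis by (simp add: star_mult star_star_alg[OF g] star_mm[OF cell.size_lam])
 qed
 have JM': "J \<subseteq> ospan q qi ?M'"
  unfolding J_def by (rule ospan_mono) (auto simp: Mset_def)
 have "g * mm lam * h \<in> ospan q qi ?M'"
 proof (rule ospan_rmult[OF Lf[OF step.prems(1)]])
  fix s assume "s \<in> ?S' \<union> ?M"
  then consider t where "t \<in> std n lam" "s = TW (inv (dperm n lam t)) * mm lam" | "s \<in> ?M" by blast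
  then show "s * h \<in> ospan q qi ?M'"
  proof cases
   case 1
   have "TW (inv (dperm n lam t)) * (mm lam * h) \<in> ospan q qi ?M'"
   proof (rule ospan_lmult[OF R[OF step.prems(2)]])
    fix u assume "u \<in> ?S \<union> ?M"
    then consider v where "v \<in> std n lam" "u = mm lam * TW (dperm n lam v)" | "u \<in> ?M" by blast
    then show "TW (inv (dperm n lam t)) * u \<in> ospan q qi ?M'"
    proof cases
     case a: 1
     have "TW (inv (dperm n lam t)) * u = mst lam t v" unfolding a(2) mst_def ..
     then show ?thesis using a(1) 1(1) step.hyps unfolding Mset_def by (blast intro: ospan.base)
    next
     case 2
     then show ?thesis using gen algTW(1)[OF step.hyps 1(1)] JM' by blast
    qed
   qed
   then show ?thesis unfolding 1(2) by (simp add: mult.assoc)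
  next
   case 2
   then show ?thesis using gen[OF step.prems(2)] JM' by blast
  qed
 qed
 then show ?case using R[OF step.prems(2)] by blast
qed

end

end

section \<open>The free algebra and evaluation homomorphisms\<close>

lemma fa_mult_take: "fa_mult f g w = (\<Sum>i\<le>length w. f (take i w) * g (drop i w))"
 unfolding fa_mult_def
 by (rule sum.reindex_bij_witness[of _ "\<lambda>i. (take i w, drop i w)" "\<lambda>(u, v). length u"]) auto

lemma fa_mult_assoc: "fa_mult (fa_mult f g) h = fa_mult f (fa_mult g h)"
proof
 fix w :: "gen list"
 let ?L = "length w"
 have "fa_mult (fa_mult f g) h w
   = (\<Sum>i\<le>?L. \<Sum>j\<le>i. f (take j w) * g (drop j (take i w)) * h (drop i w))"
  unfolding fa_mult_take sum_distrib_right
  by (intro sum.cong refl) (auto simp: min_def)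
 also have "\<dots> = (\<Sum>(i, j)\<in>Sigma {..?L} (\<lambda>i. {..i}). f (take j w) * g (drop j (take i w)) * h (drop i w))"
  by (subst sum.Sigma) auto
 also have "\<dots> = (\<Sum>(j, k)\<in>Sigma {..?L} (\<lambda>j. {..?L - j}). f (take j w) * (g (take k (drop j w)) * h (drop k (drop j w))))"
  by (rule sum.reindex_bij_witness[of _ "\<lambda>(j, k). (j + k, j)" "\<lambda>(i, j). (j, i - j)"])
   (auto simp: drop_take add.commute mult.assoc)
 also have "\<dots> = (\<Sum>j\<le>?L. \<Sum>k\<le>?L - j. f (take j w) * (g (take k (drop j w)) * h (drop k (drop j w))))"
  by (subst sum.Sigma) auto
 also have "\<dots> = fa_mult f (fa_mult g h) w"
  unfolding fa_mult_take sum_distrib_left by simp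
 finally show "fa_mult (fa_mult f g) h w = fa_mult f (fa_mult g h) w" .
qed

lemma fa_mult_monom: "fa_mult (fa_monom u) (fa_monom v) = fa_monom (u @ v)"
proof
 fix w :: "gen list"
 have fin: "finite {(a, b). a @ b = w}"
 proof (rule finite_subset)
  show "{(a, b). a @ b = w} \<subseteq> (\<lambda>i. (take i w, drop i w)) ` {..length w}"
  proof clarify
   fix a b assume "w = a @ b"
   show "(a, b) \<in> (\<lambda>i. (take i (a @ b), drop i (a @ b))) ` {..length (a @ b)}"
    by (rule image_eqI[of _ _ "length a"]) simp_all
  qed
 qed simp
 have "fa_mult (fa_monom u) (fa_monom v) w = (\<Sum>p\<in>{(a, b). a @ b = w}. if p = (u, v) then 1 else 0)"
  unfolding fa_mult_def fa_monom_def by (intro sum.cong) (auto split: if_splits)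
 then show "fa_mult (fa_monom u) (fa_monom v) w = fa_monom (u @ v) w"
  using fin by (simp add: sum.delta fa_monom_def eq_commute)
qed

lemma fa_mult_one [simp]: "fa_mult fa_one f = f" "fa_mult f fa_one = f"
proof -
 have "(\<Sum>i\<le>length w. (if take i w = [] then 1 else 0) * f (drop i w)) = f w" for w
 proof -
  have "(\<Sum>i\<le>length w. (if take i w = [] then 1 else 0) * f (drop i w)) = (\<Sum>i\<in>{0}. f (drop i w))"
   by (rule sum.mono_neutral_cong_right) auto
  then show ?thesis by simp
 qed
 then show "fa_mult fa_one f = f"
  by (auto simp: fun_eq_iff fa_mult_take fa_one_def fa_monom_def)
 have "(\<Sum>i\<le>length w. f (take i w) * (if drop i w = [] then 1 else 0)) = f w" for w
 proof -
  have "(\<Sum>i\<le>length w. f (take i w) * (if drop i w = [] then 1 else 0)) = (\<Sum>i\<in>{length w}. f (take i w))"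
   by (rule sum.mono_neutral_cong_right) auto
  then show ?thesis by simp
 qed
 then show "fa_mult f fa_one = f"
  by (auto simp: fun_eq_iff fa_mult_take fa_one_def fa_monom_def)
qed

lemma fa_distrib:
 "fa_mult (fa_add f g) h = fa_add (fa_mult f h) (fa_mult g h)"
 "fa_mult h (fa_add f g) = fa_add (fa_mult h f) (fa_mult h g)"
 "fa_mult (fa_sub f g) h = fa_sub (fa_mult f h) (fa_mult g h)"
 "fa_mult h (fa_sub f g) = fa_sub (fa_mult h f) (fa_mult h g)"
 "fa_mult (fa_smult c f) h = fa_smult c (fa_mult f h)"
 "fa_mult h (fa_smult c f) = fa_smult c (fa_mult h f)"
 "fa_mult fa_zero h = fa_zero" "fa_mult h fa_zero = fa_zero"
 by (auto simp: fun_eq_iff fa_mult_take fa_add_def fa_sub_def fa_smult_def fa_zero_def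
   distrib_left distrib_right left_diff_distrib right_diff_distrib sum.distrib sum_subtractf
   sum_distrib_left mult.assoc mult.left_commute)

lemma fa_sub_smult: "fa_sub f g = fa_add f (fa_smult (-1) g)"
 by (simp add: fa_sub_def fa_add_def fa_smult_def)

lemma laurent_ringI: "finite {k. fls_nth f k ~= 0} ==> (\<And>k. fls_nth f k \<in> \<int>) ==> f \<in> laurent_ring"
 by (simp add: laurent_ring_def)

lemma laurent_ring_0 [simp]: "0 \<in> laurent_ring"
 by (simp add: laurent_ring_def)

lemma laurent_ring_1 [simp]: "1 \<in> laurent_ring"
proof (rule laurent_ringI)
 have "{k. fls_nth (1 :: laurent) k ~= 0} \<subseteq> {0}" by (auto simp: fls_one_nth)
 then show "finite {k. fls_nth (1 :: laurent) k ~= 0}" by (rule finite_subset) simp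
qed (simp add: fls_one_nth)

lemma laurent_ring_add: "f \<in> laurent_ring ==> g \<in> laurent_ring ==> f + g \<in> laurent_ring"
 unfolding laurent_ring_def
 by (auto intro: finite_subset[of _ "{k. fls_nth f k ~= 0} \<union> {k. fls_nth g k ~= 0}"])

lemma laurent_ring_uminus: "f \<in> laurent_ring ==> - f \<in> laurent_ring"
 unfolding laurent_ring_def by auto

lemma laurent_ring_m1 [simp]: "-1 \<in> laurent_ring"
 by (intro laurent_ring_uminus laurent_ring_1)

lemma laurent_ring_sum: "(\<And>x. x \<in> S ==> f x \<in> laurent_ring) ==> sum f S \<in> laurent_ring"
 by (induction S rule: infinite_finite_induct) (auto intro: laurent_ring_add)

declare fls_X_power_int [simp del]

lemma laurent_ring_powi [simp]: "tt powi k \<in> laurent_ring"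
proof (rule laurent_ringI)
 have n: "fls_nth (tt powi k) j = (if j = k then 1 else 0)" for j
  by (simp add: fls_X_power_int fls_one_nth)
 have "{j. fls_nth (tt powi k) j ~= 0} \<subseteq> {k}" unfolding n by auto
 then show "finite {j. fls_nth (tt powi k) j ~= 0}" by (rule finite_subset) simp
 show "fls_nth (tt powi k) j \<in> \<int>" for j unfolding n by simp
qed

lemma laurent_ring_power [simp]: "tt ^ k \<in> laurent_ring"
 using laurent_ring_powi[of "int k"] by simp

lemma laurent_ring_tt [simp]: "tt \<in> laurent_ring"
 using laurent_ring_power[of 1] by simp

lemma laurent_ring_qint [simp]: "qint k \<in> laurent_ring"
 unfolding qint_def by (auto intro!: laurent_ring_sum laurent_ring_uminus)

lemma fa_span_sub: "f \<in> fa_span S ==> g \<in> fa_span S ==> fa_sub f g \<in> fa_span S"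
 unfolding fa_sub_smult by (intro fa_span.add fa_span.smult laurent_ring_m1)

lemma fa_ideal_sub: "f \<in> fa_ideal n R ==> g \<in> fa_ideal n R ==> fa_sub f g \<in> fa_ideal n R"
 unfolding fa_sub_smult by (intro fa_ideal.add fa_ideal.smult laurent_ring_m1)

lemma fa_ideal_mono: "R \<subseteq> R' ==> f \<in> fa_ideal n R ==> f \<in> fa_ideal n R'"
 by (rotate_tac, induction rule: fa_ideal.induct) (auto intro: fa_ideal.intros)

text \<open>\<open>falg\<close> also contains functions of infinite support, coefficients outside
  \<open>O\<close> and words with invalid letters; this is the free \<open>O\<close>-algebra
  proper.\<close>

definition fa_carrier :: "nat => falg set" where
 "fa_carrier n = fa_span {fa_monom w | w. \<forall>g\<in>set w. valid_gen n g}"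

lemma fa_carrier_intros [simp, intro]:
 "fa_zero \<in> fa_carrier n"
 "fa_one \<in> fa_carrier n"
 "(\<forall>g\<in>set w. valid_gen n g) ==> fa_monom w \<in> fa_carrier n"
 "f \<in> fa_carrier n ==> g \<in> fa_carrier n ==> fa_add f g \<in> fa_carrier n"
 "f \<in> fa_carrier n ==> g \<in> fa_carrier n ==> fa_sub f g \<in> fa_carrier n"
 "f \<in> fa_carrier n ==> c \<in> laurent_ring ==> fa_smult c f \<in> fa_carrier n"
 unfolding fa_carrier_def fa_one_def
 by (rule fa_span.zero, rule fa_span.base, force, rule fa_span.base, blast, rule fa_span.add, assumption+,
   rule fa_span_sub, assumption+, rule fa_span.smult, assumption+)

lemma fa_carrier_mult [simp, intro]:
 assumes "f \<in> fa_carrier n" "g \<in> fa_carrier n"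
 shows "fa_mult f g \<in> fa_carrier n"
proof -
 have 1: "fa_mult (fa_monom u) g \<in> fa_carrier n" if u: "\<forall>g\<in>set u. valid_gen n g" for u
  using assms(2)[unfolded fa_carrier_def]
 proof induction
  case (base s)
  then obtain v where "s = fa_monom v" "\<forall>g\<in>set v. valid_gen n g" by blast
  then have "\<forall>g\<in>set (u @ v). valid_gen n g" "fa_mult (fa_monom u) s = fa_monom (u @ v)"
   using u by (auto simp: fa_mult_monom)
  then show ?case by (simp only: fa_carrier_intros)
 qed (auto simp: fa_distrib)
 from assms(1)[unfolded fa_carrier_def] show ?thesis
  by induction (auto simp: fa_distrib 1)
qed

lemma fa_ideal_lmult:
 assumes "f \<in> fa_carrier n" "i \<in> fa_ideal n R"
 shows "fa_mult f i \<in> fa_ideal n R"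
proof -
 have 1: "fa_mult (fa_monom w) i \<in> fa_ideal n R" if "\<forall>g\<in>set w. valid_gen n g" for w
  using that
 proof (induction w)
  case Nil
  then show ?case using assms(2) by (simp flip: fa_one_def)
 next
  case (Cons g w)
  have "fa_mult (fa_monom (g # w)) i = fa_mult (fa_monom [g]) (fa_mult (fa_monom w) i)"
   using fa_mult_monom[of "[g]" w] by (simp add: fa_mult_assoc[symmetric])
  then show ?case using Cons by (simp add: fa_ideal.lmult)
 qed
 from assms(1)[unfolded fa_carrier_def] show ?thesis
  by induction (auto simp: fa_distrib 1 intro: fa_ideal.intros)
qed

lemma fa_ideal_rmult:
 assumes "f \<in> fa_carrier n" "i \<in> fa_ideal n R"
 shows "fa_mult i f \<in> fa_ideal n R"
proof -
 have 1: "fa_mult i (fa_monom w) \<in> fa_ideal n R" if "\<forall>g\<in>set w. valid_gen n g" for w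
  using that
 proof (induction w rule: rev_induct)
  case Nil
  then show ?case using assms(2) by (simp flip: fa_one_def)
 next
  case (snoc g w)
  have "fa_mult i (fa_monom (w @ [g])) = fa_mult (fa_mult i (fa_monom w)) (fa_monom [g])"
   using fa_mult_monom[of w "[g]"] by (simp add: fa_mult_assoc)
  then show ?case using snoc by (simp add: fa_ideal.rmult)
 qed
 from assms(1)[unfolded fa_carrier_def] show ?thesis
  by induction (auto simp: fa_distrib 1 intro: fa_ideal.intros)
qed

lemma fa_sum_insert: "finite S ==> x \<notin> S ==> fa_sum F (insert x S) = fa_add (F x) (fa_sum F S)"
 and fa_sum_empty: "fa_sum F {} = fa_zero"
 by (simp_all add: fa_sum_def fa_add_def fa_zero_def)

lemma fa_prod_simps [simp]: "fa_prod [] = fa_one" "fa_prod (x # xs) = fa_mult x (fa_prod xs)"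
 by (simp_all add: fa_prod_def)

text \<open>Evaluation is a homomorphism only on a subset \<open>A\<close>:
  \<open>fa_carrier\<close> for the class map into the quotient, and \<open>fin_supp\<close> for
  operators, where the defining sum has to be finite.\<close>

locale fa_hom =
 fixes n :: nat and A :: "falg set" and ev :: "falg => 'a::{ring,monoid_mult}" and sc :: "laurent => 'a"
 assumes A_gen: "valid_gen n x ==> fa_monom [x] \<in> A"
  and A_one [simp]: "fa_one \<in> A" and A_zero [simp]: "fa_zero \<in> A"
  and A_add [simp]: "f \<in> A ==> g \<in> A ==> fa_add f g \<in> A"
  and A_sub [simp]: "f \<in> A ==> g \<in> A ==> fa_sub f g \<in> A"
  and A_mult [simp]: "f \<in> A ==> g \<in> A ==> fa_mult f g \<in> A"
  and A_smult [simp]: "f \<in> A ==> c \<in> laurent_ring ==> fa_smult c f \<in> A"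
  and ev_one [simp]: "ev fa_one = 1" and ev_zero [simp]: "ev fa_zero = 0"
  and ev_add [simp]: "f \<in> A ==> g \<in> A ==> ev (fa_add f g) = ev f + ev g"
  and ev_sub [simp]: "f \<in> A ==> g \<in> A ==> ev (fa_sub f g) = ev f - ev g"
  and ev_mult [simp]: "f \<in> A ==> g \<in> A ==> ev (fa_mult f g) = ev f * ev g"
  and ev_smult [simp]: "f \<in> A ==> c \<in> laurent_ring ==> ev (fa_smult c f) = sc c * ev f"
begin

abbreviation "eT r \<equiv> ev (fa_monom [gen.T r])"
abbreviation "eL r \<equiv> ev (fa_monom [gen.L r])"

lemma A_T [simp]: "1 <= r ==> r < n ==> fa_monom [gen.T r] \<in> A"
 and A_L [simp]: "1 <= r ==> r <= n ==> fa_monom [gen.L r] \<in> A"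
 by (simp_all add: A_gen valid_gen_def)

lemma A_prod: "set xs \<subseteq> A ==> fa_prod xs \<in> A"
 and ev_prod: "set xs \<subseteq> A ==> ev (fa_prod xs) = prod_list (map ev xs)"
proof -
 show *: "fa_prod xs \<in> A" if "set xs \<subseteq> A" for xs using that by (induction xs) simp_all
 show "ev (fa_prod xs) = prod_list (map ev xs)" if "set xs \<subseteq> A"
  using that by (induction xs) (simp_all add: *)
qed

lemma A_sum: "finite S ==> (\<And>x. x \<in> S ==> F x \<in> A) ==> fa_sum F S \<in> A"
 and ev_sum: "finite S ==> (\<And>x. x \<in> S ==> F x \<in> A) ==> ev (fa_sum F S) = (\<Sum>x\<in>S. ev (F x))"
proof -
 show *: "fa_sum F S \<in> A" if "finite S" "\<And>x. x \<in> S ==> F x \<in> A" for S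
  using that by (induction S) (simp_all add: fa_sum_insert fa_sum_empty)
 show "ev (fa_sum F S) = (\<Sum>x\<in>S. ev (F x))" if "finite S" "\<And>x. x \<in> S ==> F x \<in> A"
  using that by (induction S) (simp_all add: fa_sum_insert fa_sum_empty *)
qed

lemma A_Tword: "set rs \<subseteq> {1..<n} ==> fa_monom (map gen.T rs) \<in> A"
 and ev_Tword: "set rs \<subseteq> {1..<n} ==> ev (fa_monom (map gen.T rs)) = prod_list (map eT rs)"
proof -
 have e: "fa_monom (map gen.T (r # rs)) = fa_mult (fa_monom [gen.T r]) (fa_monom (map gen.T rs))" for r rs
  by (simp add: fa_mult_monom)
 have z: "fa_monom (map gen.T []) = fa_one" by (simp add: fa_one_def)
 show *: "fa_monom (map gen.T rs) \<in> A" if "set rs \<subseteq> {1..<n}" for rs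
  using that by (induction rs) (simp_all only: e z, simp_all)
 show "ev (fa_monom (map gen.T rs)) = prod_list (map eT rs)" if "set rs \<subseteq> {1..<n}"
  using that by (induction rs) (simp_all only: e z, simp_all add: *)
qed

lemma A_scal [simp]: "c \<in> laurent_ring ==> scal c \<in> A"
 and ev_scal [simp]: "c \<in> laurent_ring ==> ev (scal c) = sc c"
 by simp_all

end

text \<open>An evaluation homomorphism whose target satisfies the defining relations.\<close>

locale fa_cyclo = cyclo0 n q T qi L kappa + fa_hom n A ev sc
 for n and q :: "'a::{ring,monoid_mult}" and T qi L kappa A and ev :: "falg => 'a" and sc +
 assumes eT: "1 <= r ==> r < n ==> ev (fa_monom [gen.T r]) = T r"
  and eL: "1 <= r ==> r <= n ==> ev (fa_monom [gen.L r]) = L r"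
  and sc_powi: "sc (tt powi k) = qpow k" and sc_qint: "sc (qint k) = qn k"
begin

lemma ev_Tw:
 assumes w: "w permutes {1..n}"
 shows "Tw n w \<in> A" "ev (Tw n w) = TW w"
proof -
 let ?rs = "SOME rs. reduced_word n w rs"
 have rs: "set ?rs \<subseteq> {1..<n}" using reduced_word_some[OF w] unfolding reduced_word_def by blast
 show "Tw n w \<in> A" unfolding Tw_def by (rule A_Tword[OF rs])
 have m: "map (\<lambda>r. ev (fa_monom [gen.T r])) ?rs = map T ?rs" using rs by (auto simp: eT)
 show "ev (Tw n w) = TW w" unfolding Tw_def TW_def TT_def ev_Tword[OF rs] m ..
qed

lemma ev_u_lam:
 assumes sz: "msize mu = n"
 shows "u_lam kappa mu \<in> A" "ev (u_lam kappa mu) = uu mu"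
proof -
 let ?f = "\<lambda>l r. fa_smult (tt powi (- kappa ! (l + 1))) (fa_sub (gL r) (scal (qint (kappa ! (l + 1)))))"
 let ?xs = "concat (map (\<lambda>l. map (?f l) [1..<csum mu (l + 1) + 1]) [0..<length mu - 1])"
 have u: "u_lam kappa mu = fa_prod ?xs" by (simp add: u_lam_def csum_def)
 have f: "?f l r \<in> A" "ev (?f l r) = FF (kappa ! (l + 1)) r" if "1 <= r" "r < csum mu (l + 1) + 1" for l r
  using that csum_le[of mu "l + 1"] sz by (simp_all add: FF_def sc_powi sc_qint eL)
 have sub: "set ?xs \<subseteq> A" using f by auto
 show "u_lam kappa mu \<in> A" unfolding u by (rule A_prod[OF sub])
 have pc: "prod_list (concat (map G ls)) = prod_list (map (\<lambda>l. prod_list (G l)) ls)" for G and ls :: "nat list"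
  by (induction ls) simp_all
 have "map ev ?xs = concat (map (\<lambda>l. map (FF (kappa ! (l + 1))) [1..<csum mu (l + 1) + 1]) [0..<length mu - 1])"
  unfolding map_concat map_map o_def
  by (intro arg_cong[where f = concat] map_cong refl f(2)) auto
 then show "ev (u_lam kappa mu) = uu mu" unfolding u ev_prod[OF sub] uu_def UU_def by (simp add: pc)
qed

lemma ev_m_lam:
 assumes sz: "msize mu = n"
 shows "m_lam n kappa mu \<in> A" "ev (m_lam n kappa mu) = mm mu"
proof -
 have x: "x_lam n mu \<in> A" "ev (x_lam n mu) = XX (rowl mu)"
  unfolding x_lam_def row_stab_young[OF sz] XX_def
  using ev_Tw[OF youngD(1)[of _ n "rowl mu"]]
  by (auto intro!: A_sum simp: ev_sum[OF finite_young] cong: sum.cong)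
 show "m_lam n kappa mu \<in> A" "ev (m_lam n kappa mu) = mm mu"
  unfolding m_lam_def using ev_u_lam[OF sz] x by (simp_all add: mm_def)
qed

lemma ev_murphy:
 assumes sz: "msize mu = n" and st: "s \<in> std n mu" "t \<in> std n mu"
 shows "murphy n kappa mu s t \<in> A" "ev (murphy n kappa mu s t) = mst mu s t"
proof -
 have b: "bij_betw s (diagram mu) {1..n}" "bij_betw t (diagram mu) {1..n}"
  using st unfolding std_def by simp_all
 have p: "dperm n mu s permutes {1..n}" "dperm n mu t permutes {1..n}"
  using dperm_spec(1)[OF sz b(1)] dperm_spec(1)[OF sz b(2)] by blast+
 show "murphy n kappa mu s t \<in> A" "ev (murphy n kappa mu s t) = mst mu s t"
  unfolding murphy_def mst_def
  using ev_Tw[OF permutes_inv[OF p(1)]] ev_Tw[OF p(2)] ev_m_lam[OF sz] by simp_all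
qed

end

section \<open>The quotient algebra and spanning over O\<close>

text \<open>Spanning is stated in the free algebra alone, so that it can be used outside the
  quotient type, which exists for a single choice of parameters.\<close>

definition hecke_spans :: "nat => int list => bool" where
 "hecke_spans n kappa \<longleftrightarrow> (\<forall>lam h. multipartition (length kappa) n lam --> h \<in> fa_carrier n -->
   (\<exists>f\<in>fa_span ({fa_mult (m_lam n kappa lam) (Tw n (dperm n lam t)) | t. t \<in> std n lam}
    \<union> {murphy n kappa mu u v | mu u v. multipartition (length kappa) n mu \<and> gtlex (length kappa) n mu lam
       \<and> u \<in> std n mu \<and> v \<in> std n mu}).
    fa_sub (fa_mult (m_lam n kappa lam) h) f \<in> fa_ideal n (hecke_relators n kappa)))"

text \<open>Types cannot depend on \<open>n\<close> and \<open>kappa\<close>, so the quotient algebra is only formed for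
 parameters that would be a counterexample to the spanning property.\<close>

definition params :: "nat \<times> int list" where
 "params = (SOME p. \<not> hecke_spans (fst p) (snd p))"

definition pn :: nat where "pn = fst params"
definition pk :: "int list" where "pk = snd params"
text \<open>For \<open>pn = 0\<close> the cyclotomic relator mentions \<open>L 1\<close>, which is
  no valid generator, so it need not lie in the carrier and is left out. The resulting ideal is
  contained in the ideal of all relators, as the transfer back requires.\<close>

definition prel :: "falg set" where "prel = fa_ideal pn (if pn = 0 then {} else hecke_relators pn pk)"

definition hecke_rel :: "falg => falg => bool" where
 "hecke_rel f g \<longleftrightarrow> f \<in> fa_carrier pn \<and> g \<in> fa_carrier pn \<and> fa_sub f g \<in> prel"

lemma prel_zero: "fa_zero \<in> prel"
 unfolding prel_def by (rule fa_ideal.zero)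

lemma prel_add: "f \<in> prel ==> g \<in> prel ==> fa_add f g \<in> prel"
 unfolding prel_def by (rule fa_ideal.add)

lemma prel_sub: "f \<in> prel ==> g \<in> prel ==> fa_sub f g \<in> prel"
 unfolding prel_def by (rule fa_ideal_sub)

lemma prel_lmult: "f \<in> fa_carrier pn ==> g \<in> prel ==> fa_mult f g \<in> prel"
 unfolding prel_def by (rule fa_ideal_lmult)

lemma prel_rmult: "f \<in> fa_carrier pn ==> g \<in> prel ==> fa_mult g f \<in> prel"
 unfolding prel_def by (rule fa_ideal_rmult)

lemma hecke_rel_refl: "f \<in> fa_carrier pn ==> hecke_rel f f"
 using prel_zero by (simp add: hecke_rel_def fa_sub_def fa_zero_def)

lemma hecke_rel_eq: "f \<in> fa_carrier pn ==> f = g ==> hecke_rel f g"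
 using hecke_rel_refl by simp

lemma hecke_rel_sym: "hecke_rel f g ==> hecke_rel g f"
proof -
 assume "hecke_rel f g"
 moreover have "fa_sub g f = fa_sub fa_zero (fa_sub f g)" by (simp add: fa_sub_def fa_zero_def fun_eq_iff)
 ultimately show ?thesis using prel_sub[OF prel_zero] by (auto simp: hecke_rel_def)
qed

lemma hecke_rel_trans: "hecke_rel f g ==> hecke_rel g h ==> hecke_rel f h"
proof -
 assume a: "hecke_rel f g" "hecke_rel g h"
 have "fa_sub f h = fa_add (fa_sub f g) (fa_sub g h)" by (simp add: fa_sub_def fa_add_def fun_eq_iff)
 then show ?thesis using a prel_add by (auto simp: hecke_rel_def)
qed

lemma hecke_rel_carrier: "hecke_rel f g ==> f \<in> fa_carrier pn" "hecke_rel f g ==> g \<in> fa_carrier pn"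
 by (simp_all add: hecke_rel_def)

\<comment> \<open>The relation is partial, so that only elements of the carrier have
  classes.\<close>
quotient_type hecke = falg / partial: hecke_rel
proof (rule part_equivpI)
 show "\<exists>x. hecke_rel x x" using hecke_rel_refl[of fa_zero] by blast
 show "symp hecke_rel" by (rule sympI) (rule hecke_rel_sym)
 show "transp hecke_rel" by (rule transpI) (erule (1) hecke_rel_trans)
qed

instantiation hecke :: "{ring, monoid_mult}"
begin

lift_definition zero_hecke :: hecke is fa_zero by (simp add: hecke_rel_refl)
lift_definition one_hecke :: hecke is fa_one by (simp add: hecke_rel_refl)
lift_definition plus_hecke :: "hecke => hecke => hecke" is fa_add
proof -
 fix f f' g g' assume a: "hecke_rel f f'" "hecke_rel g g'"
 have "fa_sub (fa_add f g) (fa_add f' g') = fa_add (fa_sub f f') (fa_sub g g')"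
  by (simp add: fa_sub_def fa_add_def fun_eq_iff)
 then show "hecke_rel (fa_add f g) (fa_add f' g')" using a prel_add by (simp add: hecke_rel_def)
qed
lift_definition minus_hecke :: "hecke => hecke => hecke" is fa_sub
proof -
 fix f f' g g' assume a: "hecke_rel f f'" "hecke_rel g g'"
 have "fa_sub (fa_sub f g) (fa_sub f' g') = fa_sub (fa_sub f f') (fa_sub g g')"
  by (simp add: fa_sub_def fun_eq_iff)
 then show "hecke_rel (fa_sub f g) (fa_sub f' g')" using a prel_sub by (simp add: hecke_rel_def)
qed
lift_definition uminus_hecke :: "hecke => hecke" is "fa_smult (-1)"
proof -
 fix f g assume a: "hecke_rel f g"
 have "fa_sub (fa_smult (-1) f) (fa_smult (-1) g) = fa_sub fa_zero (fa_sub f g)"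
  by (simp add: fa_sub_def fa_smult_def fa_zero_def fun_eq_iff)
 then show "hecke_rel (fa_smult (-1) f) (fa_smult (-1) g)" using a prel_sub[OF prel_zero] by (simp add: hecke_rel_def)
qed
lift_definition times_hecke :: "hecke => hecke => hecke" is fa_mult
proof -
 fix f f' g g' assume a: "hecke_rel f f'" "hecke_rel g g'"
 have "fa_sub (fa_mult f g) (fa_mult f' g') = fa_add (fa_mult (fa_sub f f') g) (fa_mult f' (fa_sub g g'))"
  unfolding fa_distrib by (simp add: fa_sub_def fa_add_def fun_eq_iff)
 then show "hecke_rel (fa_mult f g) (fa_mult f' g')"
  using a prel_add prel_lmult prel_rmult by (simp add: hecke_rel_def)
qed

instance
proof
 fix a b c :: hecke
 show "a * b * c = a * (b * c)"
  by (transfer, rule hecke_rel_eq) (blast intro: fa_carrier_mult hecke_rel_carrier, rule fa_mult_assoc)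
 show "a + b + c = a + (b + c)"
  by (transfer, rule hecke_rel_eq)
   (blast intro: fa_carrier_intros(4) hecke_rel_carrier, simp add: fa_add_def add.assoc)
 show "a + b = b + a"
  by (transfer, rule hecke_rel_eq)
   (blast intro: fa_carrier_intros(4) hecke_rel_carrier, simp add: fa_add_def add.commute)
 show "0 + a = a"
  by (transfer, rule hecke_rel_eq)
   (blast intro: fa_carrier_intros(1,4) hecke_rel_carrier, simp add: fa_add_def fa_zero_def)
 show "- a + a = 0"
 proof transfer
  fix f assume "hecke_rel f f"
  have "fa_add (fa_smult (-1) f) f = fa_zero" by (simp add: fa_add_def fa_smult_def fa_zero_def)
  then show "hecke_rel (fa_add (fa_smult (-1) f) f) fa_zero" using hecke_rel_refl[of fa_zero] by simp
 qed
 show "a - b = a + - b"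
 proof transfer
  fix f g assume a: "hecke_rel f f" "hecke_rel g g"
  show "hecke_rel (fa_sub f g) (fa_add f (fa_smult (-1) g))"
   unfolding fa_sub_smult[symmetric] using a by (intro hecke_rel_refl fa_carrier_intros(5) hecke_rel_carrier)
 qed
 show "(a + b) * c = a * c + b * c"
  by (transfer, rule hecke_rel_eq)
   (blast intro: fa_carrier_intros(4) fa_carrier_mult hecke_rel_carrier, rule fa_distrib)
 show "a * (b + c) = a * b + a * c"
  by (transfer, rule hecke_rel_eq)
   (blast intro: fa_carrier_intros(4) fa_carrier_mult hecke_rel_carrier, rule fa_distrib)
 show "1 * a = a" "a * 1 = a"
  by (transfer, simp)+
qed

end

definition hcl :: "falg => hecke" where "hcl f = abs_hecke f"

lemma hcl_eq_iff: "f \<in> fa_carrier pn ==> g \<in> fa_carrier pn ==> hcl f = hcl g \<longleftrightarrow> fa_sub f g \<in> prel"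
 unfolding hcl_def using Quotient_rel_abs2[OF Quotient_hecke] hecke_rel_refl Quotient_rel[OF Quotient_hecke, of f g]
 by (auto simp: hecke_rel_def)

lemma hcl_zero_iff:
 assumes "f \<in> fa_carrier pn"
 shows "hcl f = hcl fa_zero \<longleftrightarrow> f \<in> prel"
proof -
 have "fa_sub f fa_zero = f" by (simp add: fa_sub_def fa_zero_def)
 then show ?thesis using assms by (subst hcl_eq_iff) auto
qed

lemma hcl_zero: "hcl fa_zero = 0"
 by (simp add: hcl_def zero_hecke.abs_eq)

lemma hcl_surj: "\<exists>f\<in>fa_carrier pn. x = hcl f"
proof -
 have "hecke_rel (rep_hecke x) (rep_hecke x)" using Quotient_rep_reflp[OF Quotient_hecke] .
 then show ?thesis using Quotient_abs_rep[OF Quotient_hecke, of x] hecke_rel_carrier unfolding hcl_def by metis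
qed

definition hsc :: "laurent => hecke" where "hsc c = hcl (scal c)"

interpretation hk: fa_hom pn "fa_carrier pn" hcl hsc
proof
 have r: "f \<in> fa_carrier pn ==> hecke_rel f f" for f by (rule hecke_rel_refl)
 show "valid_gen pn x ==> fa_monom [x] \<in> fa_carrier pn" for x by simp
 show "hcl fa_one = 1" by (simp add: hcl_def one_hecke.abs_eq)
 show "hcl fa_zero = 0" by (rule hcl_zero)
 fix f g assume f: "f \<in> fa_carrier pn"
 { assume g: "g \<in> fa_carrier pn"
  show "hcl (fa_add f g) = hcl f + hcl g" unfolding hcl_def by (rule plus_hecke.abs_eq[OF r[OF f] r[OF g], symmetric])
  show "hcl (fa_sub f g) = hcl f - hcl g" unfolding hcl_def by (rule minus_hecke.abs_eq[OF r[OF f] r[OF g], symmetric])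
  show "hcl (fa_mult f g) = hcl f * hcl g" unfolding hcl_def by (rule times_hecke.abs_eq[OF r[OF f] r[OF g], symmetric]) }
 { fix c :: laurent assume c: "c \<in> laurent_ring"
  have "hcl (scal c) * hcl f = hcl (fa_mult (scal c) f)"
   unfolding hcl_def using c by (intro times_hecke.abs_eq r f) simp
  then show "hcl (fa_smult c f) = hsc c * hcl f" unfolding hsc_def fa_distrib fa_mult_one by simp }
qed simp_all

definition hq :: hecke where "hq = hsc tt"
definition hqi :: hecke where "hqi = hsc (tt powi (-1))"
definition hT :: "nat => hecke" where "hT r = hcl (gT r)"
definition hL :: "nat => hecke" where "hL r = hcl (gL r)"

lemma scal_mult: "c \<in> laurent_ring ==> d \<in> laurent_ring ==> hsc (c * d) = hsc c * hsc d"
proof -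
 assume "c \<in> laurent_ring" "d \<in> laurent_ring"
 then have "hcl (fa_mult (scal c) (scal d)) = hsc c * hsc d" by simp
 moreover have "fa_mult (scal c) (scal d) = scal (c * d)"
  unfolding fa_distrib fa_mult_one by (simp add: fa_smult_def ac_simps)
 ultimately show ?thesis unfolding hsc_def by simp
qed

lemma scal_add: "c \<in> laurent_ring ==> d \<in> laurent_ring ==> hsc (c + d) = hsc c + hsc d"
proof -
 assume "c \<in> laurent_ring" "d \<in> laurent_ring"
 then have "hcl (fa_add (scal c) (scal d)) = hsc c + hsc d" by simp
 moreover have "fa_add (scal c) (scal d) = scal (c + d)" by (simp add: fa_smult_def fa_add_def distrib_right)
 ultimately show ?thesis unfolding hsc_def by simp
qed

lemma scal_central: "c \<in> laurent_ring ==> hsc c * x = x * hsc c"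
proof -
 assume c: "c \<in> laurent_ring"
 obtain f where f: "f \<in> fa_carrier pn" "x = hcl f" using hcl_surj by blast
 have "hcl (fa_mult (scal c) f) = hcl (fa_mult f (scal c))" unfolding fa_distrib fa_mult_one ..
 then show ?thesis using c f by simp
qed

lemma scal_one: "hsc 1 = 1"
proof -
 have "scal 1 = fa_one" by (simp add: fa_smult_def)
 then show ?thesis by (simp only: hsc_def hk.ev_one)
qed

lemma scal_zero: "hsc 0 = 0"
proof -
 have "scal 0 = fa_zero" by (simp add: fa_smult_def fa_zero_def)
 then show ?thesis by (simp only: hsc_def hk.ev_zero)
qed

lemma scal_neg: "c \<in> laurent_ring ==> hsc (- c) = - hsc c"
 using scal_add[of c "- c"] scal_zero by (simp add: laurent_ring_uminus eq_neg_iff_add_eq_0 add.commute)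

lemma relator_zero: "f \<in> hecke_relators pn pk ==> 1 <= pn ==> f \<in> fa_carrier pn ==> hcl f = 0"
 using hcl_zero_iff[of f] unfolding prel_def hcl_zero by (auto intro: fa_ideal.base)

lemma relatorsI:
 "fa_prod (map (\<lambda>k. fa_sub (gL 1) (scal (qint k))) kappa) \<in> hecke_relators n kappa"
 "1 <= r ==> r < n ==> fa_mult (fa_add (gT r) fa_one) (fa_sub (gT r) (scal tt)) \<in> hecke_relators n kappa"
 "1 <= r ==> r <= n ==> 1 <= s ==> s <= n ==> fa_sub (fa_mult (gL r) (gL s)) (fa_mult (gL s) (gL r)) \<in> hecke_relators n kappa"
 "1 <= r ==> r < n ==> 1 <= s ==> s < n ==> r + 1 < s \<or> s + 1 < r ==> fa_sub (fa_mult (gT r) (gT s)) (fa_mult (gT s) (gT r)) \<in> hecke_relators n kappa"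
 "1 <= s ==> s + 1 < n ==> fa_sub (fa_prod [gT s, gT (s+1), gT s]) (fa_prod [gT (s+1), gT s, gT (s+1)]) \<in> hecke_relators n kappa"
 "1 <= r ==> r < n ==> 1 <= s ==> s <= n ==> s ~= r ==> s ~= r + 1 ==> fa_sub (fa_mult (gT r) (gL s)) (fa_mult (gL s) (gT r)) \<in> hecke_relators n kappa"
 "1 <= r ==> r < n ==> fa_sub (fa_mult (gL (r+1)) (fa_add (fa_sub (gT r) (scal tt)) fa_one)) (fa_add (fa_mult (gT r) (gL r)) fa_one) \<in> hecke_relators n kappa"
 unfolding hecke_relators_def by blast+

lemma relator_cases:
 assumes "f \<in> hecke_relators n kappa"
 obtains (L1) "f = fa_prod (map (\<lambda>k. fa_sub (gL 1) (scal (qint k))) kappa)"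
 | (quad) r where "1 <= r" "r < n" "f = fa_mult (fa_add (gT r) fa_one) (fa_sub (gT r) (scal tt))"
 | (LL) r s where "1 <= r" "r <= n" "1 <= s" "s <= n" "f = fa_sub (fa_mult (gL r) (gL s)) (fa_mult (gL s) (gL r))"
 | (TT) r s where "1 <= r" "r < n" "1 <= s" "s < n" "r + 1 < s \<or> s + 1 < r" "f = fa_sub (fa_mult (gT r) (gT s)) (fa_mult (gT s) (gT r))"
 | (braid) s where "1 <= s" "s + 1 < n" "f = fa_sub (fa_prod [gT s, gT (s+1), gT s]) (fa_prod [gT (s+1), gT s, gT (s+1)])"
 | (TL) r s where "1 <= r" "r < n" "1 <= s" "s <= n" "s ~= r" "s ~= r + 1" "f = fa_sub (fa_mult (gT r) (gL s)) (fa_mult (gL s) (gT r))"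
 | (LT) r where "1 <= r" "r < n" "f = fa_sub (fa_mult (gL (r+1)) (fa_add (fa_sub (gT r) (scal tt)) fa_one)) (fa_add (fa_mult (gT r) (gL r)) fa_one)"
 using assms unfolding hecke_relators_def by blast

interpretation hc: cyclo0 pn hq hT hqi hL pk
proof
 show "hq * x = x * hq" for x unfolding hq_def by (rule scal_central) simp
 have ti: "tt * tt powi (-1) = 1" by (simp add: power_int_minus)
 show "hq * hqi = 1" unfolding hq_def hqi_def using scal_mult[OF laurent_ring_tt laurent_ring_powi[of "-1"]] scal_one ti by (simp only:)
 show "hT r * hT r = (hq - 1) * hT r + hq" if r: "1 <= r" "r < pn" for r
 proof -
  have "(hT r + 1) * (hT r - hq) = 0"
   using relator_zero[OF relatorsI(2)[OF r]] r by (simp add: hT_def hq_def)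
  moreover have "hT r * hq = hq * hT r" unfolding hq_def by (rule scal_central[symmetric]) simp
  ultimately show ?thesis by (simp add: algebra_simps)
 qed
 show "hT r * hT s = hT s * hT r" if r: "1 <= r" "Suc r < s" "s < pn" for r s
  using relator_zero[OF relatorsI(4)[of r pn s]] r by (simp add: hT_def)
 show "hT r * hT (Suc r) * hT r = hT (Suc r) * hT r * hT (Suc r)" if r: "1 <= r" "Suc r < pn" for r
  using relator_zero[OF relatorsI(5)[of r pn]] r by (simp add: hT_def mult.assoc)
 show "hL r * hL s = hL s * hL r" if r: "1 <= r" "r <= pn" "1 <= s" "s <= pn" for r s
  using relator_zero[OF relatorsI(3)[OF r]] r by (simp add: hL_def)
 show "hT r * hL s = hL s * hT r" if r: "1 <= r" "r < pn" "1 <= s" "s <= pn" "s ~= r" "s ~= Suc r" for r s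
  using relator_zero[OF relatorsI(6)[of r pn s]] r by (simp add: hT_def hL_def)
 show "hL (Suc r) * (hT r - hq + 1) = hT r * hL r + 1" if r: "1 <= r" "r < pn" for r
  using relator_zero[OF relatorsI(7)[OF r]] r by (simp add: hT_def hL_def hq_def)
qed

text \<open>Integrality of the coefficients makes every element a finite sum of powers of
  \<open>t\<close> and their negatives, so no rule for scalars is required.\<close>

lemma laurent_ring_induct [consumes 1, case_names zero add neg powi]:
 assumes c: "c \<in> laurent_ring" and 0: "P 0" and add: "\<And>x y. x \<in> laurent_ring ==> y \<in> laurent_ring ==> P x ==> P y ==> P (x + y)"
  and neg: "\<And>x. x \<in> laurent_ring ==> P x ==> P (- x)" and powi: "\<And>k. P (tt powi k)"
 shows "P c"
proof -
 let ?S = "{k. fls_nth c k ~= 0}"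
 let ?Q = "\<lambda>x. x \<in> laurent_ring \<and> P x"
 have fin: "finite ?S" and int: "\<And>k. fls_nth c k \<in> \<int>" using c by (simp_all add: laurent_ring_def)
 have nat: "?Q (of_nat m * tt powi k)" for m k
  by (induction m) (simp_all add: 0 add powi distrib_right laurent_ring_add)
 have Q: "?Q (of_int a * tt powi k)" for a k
  using nat[of "nat a" k] nat[of "nat (- a)" k] neg[of "of_nat (nat (- a)) * tt powi k"]
  by (cases "a \<ge> 0") (auto intro: laurent_ring_uminus dest: laurent_ring_uminus)
 have QS: "?Q (\<Sum>k\<in>S. of_int (a k) * tt powi k)" if "finite S" for S a
  using that by (induction S) (use 0 add Q laurent_ring_add in auto)
 have "c = (\<Sum>k\<in>?S. of_int \<lfloor>fls_nth c k\<rfloor> * tt powi k)"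
 proof (rule fls_eqI)
  fix j
  have "fls_nth (of_int a * tt powi k :: laurent) j = (if j = k then of_int a else 0)" for a k
   by (simp add: fls_X_power_int fls_times_both_shifted_simp fls_shift_nth fls_of_int_nth flip: fls_of_int)
  then show "fls_nth c j = fls_nth (\<Sum>k\<in>?S. of_int \<lfloor>fls_nth c k\<rfloor> * tt powi k) j"
   using fin int[of j] by (simp add: fls_nth_sum sum.delta' of_int_floor_cancel)
 qed
 then show ?thesis using QS[OF fin, of "\<lambda>k. \<lfloor>fls_nth c k\<rfloor>"] by simp
qed

lemma hsc_powi: "hsc (tt powi k) = hc.qpow k"
proof -
 have pw: "hsc (tt ^ m) = hq ^ m" for m
  by (induction m) (simp_all add: scal_one scal_mult hq_def)
 have "hsc ((tt powi (-1)) ^ m) = hqi ^ m" for m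
 proof (induction m)
  case (Suc m)
  have e: "(tt powi (-1)) ^ m = tt powi (- int m)" by (simp add: power_int_minus power_inverse)
  have "hsc ((tt powi (-1)) ^ Suc m) = hsc (tt powi (-1)) * hsc (tt powi (- int m))"
   unfolding power_Suc e by (intro scal_mult laurent_ring_powi)
  then show ?case using Suc unfolding e hqi_def by simp
 qed (simp add: scal_one)
 moreover have "(tt powi (-1)) ^ nat (- k) = tt powi k" if "k < 0"
  using that by (simp add: power_int_def power_inverse)
 moreover have "tt ^ nat k = tt powi k" if "0 <= k"
  using that by (simp add: power_int_def)
 ultimately show ?thesis using pw[of "nat k"] unfolding hc.qpow_def by (metis linorder_not_le)
qed

lemma hsc_sum: "finite S ==> (\<And>x. x \<in> S ==> f x \<in> laurent_ring) ==> hsc (sum f S) = (\<Sum>x\<in>S. hsc (f x))"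
 by (induction S rule: finite_induct) (simp_all add: scal_zero scal_add laurent_ring_sum)

lemma hsc_qint: "hsc (qint k) = hc.qn k"
proof -
 have p: "hsc (tt ^ i) = hq ^ i" for i using hsc_powi[of "int i"] by (simp add: hc.qpow_def)
 have m: "hsc (tt powi (- int i)) = hqi ^ i" for i
  using hsc_powi[of "- int i"] by (cases "i = 0") (simp_all add: hc.qpow_def scal_one)
 have s1: "hsc (\<Sum>i<nat k. tt ^ i) = (\<Sum>i<nat k. hq ^ i)" by (simp add: hsc_sum p)
 have s2: "hsc (\<Sum>i\<in>{1..nat (-k)}. tt powi (- int i)) = (\<Sum>i\<in>{1..nat (- k)}. hqi ^ i)"
  by (simp only: hsc_sum finite_atLeastAtMost laurent_ring_powi m)
 have i: "(\<Sum>i\<in>{1..nat (-k)}. tt powi (- int i)) \<in> laurent_ring" by (intro laurent_ring_sum laurent_ring_powi)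
 show ?thesis
 proof (cases "0 <= k")
  case True
  then show ?thesis unfolding qint_def hc.qn_def using s1 by (simp only: if_True)
 next
  case False
  then show ?thesis unfolding qint_def hc.qn_def using s2 scal_neg[OF i] by (simp only: if_False)
 qed
qed

definition frev :: "falg => falg" where "frev f = (\<lambda>w. f (rev w))"

lemma frev_simps [simp]:
 "frev (fa_add f g) = fa_add (frev f) (frev g)" "frev (fa_sub f g) = fa_sub (frev f) (frev g)"
 "frev (fa_smult c f) = fa_smult c (frev f)" "frev fa_zero = fa_zero" "frev fa_one = fa_one"
 "frev (fa_monom w) = fa_monom (rev w)"
 by (auto simp: frev_def fa_add_def fa_sub_def fa_smult_def fa_zero_def fa_one_def fa_monom_def fun_eq_iff)

lemma frev_mult [simp]: "frev (fa_mult f g) = fa_mult (frev g) (frev f)"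
proof
 fix w
 have "frev (fa_mult f g) w = (\<Sum>i\<le>length w. f (take i (rev w)) * g (drop i (rev w)))"
  by (simp add: frev_def fa_mult_take)
 also have "\<dots> = (\<Sum>i\<le>length w. g (rev (take i w)) * f (rev (drop i w)))"
  by (rule sum.reindex_bij_witness[of _ "\<lambda>i. length w - i" "\<lambda>i. length w - i"])
   (auto simp: take_rev drop_rev mult.commute)
 finally show "frev (fa_mult f g) w = fa_mult (frev g) (frev f) w"
  by (simp add: frev_def fa_mult_take)
qed

lemma frev_carrier: "f \<in> fa_carrier n ==> frev f \<in> fa_carrier n"
 unfolding fa_carrier_def[of n]
proof (induction rule: fa_span.induct)
 case (base s)
 then obtain w where w: "s = fa_monom w" "\<forall>g\<in>set w. valid_gen n g" by blast
 then have "frev s = fa_monom (rev w)" "\<forall>g\<in>set (rev w). valid_gen n g" by simp_all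
 then show ?case by (blast intro: fa_span.base)
qed (auto intro: fa_span.intros)

lemma frev_prod: "frev (fa_prod xs) = fa_prod (rev (map frev xs))"
proof -
 have app: "fa_prod (xs @ [x]) = fa_mult (fa_prod xs) x" for xs x
  by (induction xs) (simp_all add: fa_mult_assoc)
 show ?thesis by (induction xs) (simp_all add: app)
qed

text \<open>Most relators are symmetric up to sign or the order of commuting factors. The last one
  is not, and its reversal is \<open>TL2\<close>.\<close>

lemma relator_rev:
 assumes pn: "1 <= pn" and f: "f \<in> hecke_relators pn pk"
 shows "frev f \<in> prel"
proof -
 have "frev f \<in> fa_carrier pn \<and> hcl (frev f) = 0"
  using f
 proof (cases rule: relator_cases)
  case L1
  let ?g = "\<lambda>k. fa_sub (gL 1) (scal (qint k))"
  have gA: "set (map ?g pk) \<subseteq> fa_carrier pn" "set (rev (map ?g pk)) \<subseteq> fa_carrier pn" using pn by auto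
  have fr: "frev f = fa_prod (rev (map ?g pk))" unfolding L1 frev_prod by (simp add: o_def)
  have c: "hcl (?g k) * hcl (?g k') = hcl (?g k') * hcl (?g k)" for k k'
   using scal_central[of "qint k" "hL 1"] scal_central[of "qint k'" "hL 1"] scal_central[of "qint k" "hsc (qint k')"] pn
   by (simp add: hL_def algebra_simps)
  have "hcl (frev f) = prod_list (rev (map hcl (map ?g pk)))" unfolding fr hk.ev_prod[OF gA(2)] by (simp add: rev_map)
  also have "\<dots> = prod_list (map hcl (map ?g pk))" by (rule prod_list_rev_commute) (use c in auto)
  also have "\<dots> = 0" using relator_zero[OF f pn] hk.ev_prod[OF gA(1)] hk.A_prod[OF gA(1)] L1 by simp
  finally show ?thesis using fr hk.A_prod[OF gA(2)] by simp
 next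
  case (quad r)
  have "(hT r - hq) * (hT r + 1) = 0"
   using hc.T_quad[OF quad(1,2)] hc.q_central[of "hT r"] by (simp add: algebra_simps)
  then show ?thesis unfolding quad(3) using quad(1,2) by (simp add: hT_def hq_def)
 next
  case (LL r s)
  then show ?thesis using hc.L_comm[of r s] by (simp add: hL_def)
 next
  case (TT r s)
  have "hT r * hT s = hT s * hT r" using TT hc.T_comm[of r s] hc.T_comm[of s r] by auto
  then show ?thesis using TT by (simp add: hT_def)
 next
  case (braid s)
  then show ?thesis using hc.T_braid[of s] by (simp add: hT_def mult.assoc)
 next
  case (TL r s)
  then show ?thesis using hc.TL_comm[of r s] by (simp add: hT_def hL_def)
 next
  case (LT r)
  have "(hT r - hq + 1) * hL (Suc r) - (hL r * hT r + 1) = 0"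
   using hc.TL2[OF LT(1,2)] by (simp add: algebra_simps)
  then show ?thesis unfolding LT(3) using LT(1,2) by (simp add: hT_def hL_def hq_def)
 qed
 then show ?thesis using hcl_zero_iff[of "frev f"] hcl_zero by metis
qed

lemma prel_rev: "f \<in> prel ==> frev f \<in> prel"
 unfolding prel_def
proof (induction rule: fa_ideal.induct)
 case (base r)
 then show ?case using relator_rev[of r] unfolding prel_def by (auto split: if_splits)
next
 case (lmult a g)
 then show ?case by (simp add: fa_ideal.rmult)
next
 case (rmult a g)
 then show ?case by (simp add: fa_ideal.lmult)
qed (auto intro: fa_ideal.zero fa_ideal.add fa_ideal.smult)

lift_definition hstar :: "hecke => hecke" is frev
proof -
 fix f g assume "hecke_rel f g"
 then show "hecke_rel (frev f) (frev g)"
  using frev_carrier prel_rev[of "fa_sub f g"] by (simp add: hecke_rel_def)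
qed

lemma hstar_hcl: "f \<in> fa_carrier pn ==> hstar (hcl f) = hcl (frev f)"
 unfolding hcl_def by (rule hstar.abs_eq[OF hecke_rel_refl])

interpretation hcs: cyclo_star pn hq hT hqi hL pk hstar
proof
 fix x y :: hecke
 obtain f where f: "f \<in> fa_carrier pn" "x = hcl f" using hcl_surj by blast
 obtain g where g: "g \<in> fa_carrier pn" "y = hcl g" using hcl_surj by blast
 show "hstar (x + y) = hstar x + hstar y"
  unfolding f g using f(1) g(1) hstar_hcl[of "fa_add f g"] by (simp add: hstar_hcl frev_carrier)
 show "hstar (x * y) = hstar y * hstar x"
  unfolding f g using f(1) g(1) hstar_hcl[of "fa_mult f g"] by (simp add: hstar_hcl frev_carrier)
 show "hstar 1 = 1" using hstar_hcl[of fa_one] by simp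
 show "hstar hq = hq" using hstar_hcl[of "scal tt"] by (simp add: hq_def)
 show "hstar (hT r) = hT r" if "1 <= r" "r < pn" for r using hstar_hcl[of "gT r"] that by (simp add: hT_def)
 show "hstar (hL r) = hL r" if "1 <= r" "r <= pn" for r using hstar_hcl[of "gL r"] that by (simp add: hL_def)
 show "prod_list (map (\<lambda>k. hL 1 - hc.qn k) pk) = 0" if pn: "1 <= pn"
 proof -
  let ?g = "\<lambda>k. fa_sub (gL 1) (scal (qint k))"
  have gA: "set (map ?g pk) \<subseteq> fa_carrier pn" using pn by auto
  have "map hcl (map ?g pk) = map (\<lambda>k. hL 1 - hc.qn k) pk" using pn by (simp add: hL_def hsc_qint)
  then show ?thesis
   using relator_zero[OF relatorsI(1) pn hk.A_prod[OF gA]] hk.ev_prod[OF gA] by (simp only:)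
 qed
qed

interpretation hf: fa_cyclo pn hq hT hqi hL pk "fa_carrier pn" hcl hsc
 by unfold_locales (simp_all add: hT_def hL_def hsc_powi hsc_qint)

lemma hcl_alg: "f \<in> fa_carrier pn ==> hcl f \<in> hc.alg"
proof -
 have sc: "hsc c \<in> hc.alg" if "c \<in> laurent_ring" for c
  using that
 proof (induction rule: laurent_ring_induct)
  case zero then show ?case by (simp add: scal_zero hc.alg_zero)
 next
  case (add x y) then show ?case by (simp add: scal_add hc.alg.add)
 next
  case (neg x) then show ?case by (simp add: scal_neg hc.alg.neg)
 next
  case (powi k) then show ?case by (simp add: hsc_powi hc.alg_qpow)
 qed
 have m: "hcl (fa_monom w) \<in> hc.alg \<and> fa_monom w \<in> fa_carrier pn" if "\<forall>g\<in>set w. valid_gen pn g" for w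
  using that
 proof (induction w)
  case Nil
  then show ?case using hc.alg.one hk.ev_one unfolding fa_one_def by simp
 next
  case (Cons g w)
  have e: "fa_monom (g # w) = fa_mult (fa_monom [g]) (fa_monom w)" by (simp add: fa_mult_monom)
  have "hcl (fa_monom [g]) \<in> hc.alg"
  proof (cases g)
   case (L r)
   then show ?thesis using Cons.prems hc.alg.L[of r] by (simp add: valid_gen_def hL_def)
  next
   case (T r)
   then show ?thesis using Cons.prems hc.alg.T[of r] by (simp add: valid_gen_def hT_def)
  qed
  then show ?case using Cons unfolding e by (simp add: hc.alg.mult)
 qed
 assume "f \<in> fa_carrier pn"
 then have "hcl f \<in> hc.alg \<and> f \<in> fa_carrier pn"
  unfolding fa_carrier_def[of pn]
 proof (induction rule: fa_span.induct)
  case (base s)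
  then show ?case using m unfolding fa_carrier_def by blast
 next
  case zero
  then show ?case using hc.alg_zero hcl_zero by (auto intro: fa_span.zero)
 next
  case (add f g)
  then show ?case unfolding fa_carrier_def[symmetric] by (auto intro: hc.alg.add)
 next
  case (smult f c)
  then show ?case unfolding fa_carrier_def[symmetric] by (auto intro: hc.alg.mult sc)
 qed
 then show ?thesis by blast
qed

text \<open>Each closure rule of \<open>ospan\<close> has a counterpart for \<open>fa_span\<close>,
  as \<open>hq\<close> and \<open>hqi\<close> are the classes of the scalars \<open>t\<close> and
  its inverse.\<close>

lemma ospan_lift:
 assumes "x \<in> ospan hq hqi (hcl ` F)" "F \<subseteq> fa_carrier pn"
 shows "\<exists>f\<in>fa_span F. f \<in> fa_carrier pn \<and> hcl f = x"
 using assms(1)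
proof induction
 case zero
 then show ?case using hcl_zero fa_span.zero by blast
next
 case (base s)
 then show ?case using assms(2) fa_span.base by blast
next
 case (add x y)
 then obtain f g where "f \<in> fa_span F" "f \<in> fa_carrier pn" "hcl f = x" "g \<in> fa_span F" "g \<in> fa_carrier pn" "hcl g = y"
  by blast
 then show ?case by (intro bexI[of _ "fa_add f g"]) (auto intro: fa_span.add)
next
 case (neg x)
 then obtain f where f: "f \<in> fa_span F" "f \<in> fa_carrier pn" "hcl f = x" by blast
 have "hcl (fa_smult (-1) f) = - x" using f scal_neg[of 1] by (simp add: scal_one)
 then show ?case using f by (intro bexI[of _ "fa_smult (-1) f"]) (auto intro: fa_span.smult)
next
 case (q x)
 then obtain f where "f \<in> fa_span F" "f \<in> fa_carrier pn" "hcl f = x" by blast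
 then show ?case by (intro bexI[of _ "fa_smult tt f"]) (auto intro: fa_span.smult simp: hq_def)
next
 case (qi x)
 then obtain f where f: "f \<in> fa_span F" "f \<in> fa_carrier pn" "hcl f = x" by blast
 have "hcl (fa_smult (tt powi (-1)) f) = hsc (tt powi (-1)) * hcl f" by (rule hk.ev_smult[OF f(2) laurent_ring_powi])
 moreover have "fa_smult (tt powi (-1)) f \<in> fa_span F" "fa_smult (tt powi (-1)) f \<in> fa_carrier pn"
  by (rule fa_span.smult[OF f(1) laurent_ring_powi], rule fa_carrier_intros(6)[OF f(2) laurent_ring_powi])
 ultimately show ?case using f(3) unfolding hqi_def by metis
qed

lemma hecke_spans_params: "hecke_spans pn pk"
 unfolding hecke_spans_def
proof (intro allI impI)
 fix lam h assume lam: "multipartition (length pk) pn lam" and h: "h \<in> fa_carrier pn"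
 let ?ell = "length pk"
 let ?F = "{fa_mult (m_lam pn pk lam) (Tw pn (dperm pn lam t)) | t. t \<in> std pn lam}
    \<union> {murphy pn pk mu u v | mu u v. multipartition ?ell pn mu \<and> gtlex ?ell pn mu lam
       \<and> u \<in> std pn mu \<and> v \<in> std pn mu}"
 have sz: "msize lam = pn" using multipartitionD(2)[OF lam] .
 have g1: "fa_mult (m_lam pn pk lam) (Tw pn (dperm pn lam t)) \<in> fa_carrier pn"
  "hcl (fa_mult (m_lam pn pk lam) (Tw pn (dperm pn lam t))) = hc.mm lam * hc.TW (dperm pn lam t)"
  if "t \<in> std pn lam" for t
  using hf.ev_m_lam[OF sz] hf.ev_Tw[OF dperm_spec(1)[OF sz hcs.std_bij[OF that]]] by simp_all
 have g2: "murphy pn pk mu u v \<in> fa_carrier pn" "hcl (murphy pn pk mu u v) = hc.mst mu u v"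
  if "multipartition ?ell pn mu" "u \<in> std pn mu" "v \<in> std pn mu" for mu u v
  using hf.ev_murphy[OF multipartitionD(2)[OF that(1)] that(2,3)] by simp_all
 have FA: "?F \<subseteq> fa_carrier pn" using g1(1) g2(1) by blast
 have im: "{hc.mm lam * hc.TW (dperm pn lam t) | t. t \<in> std pn lam} \<union> hcs.Mset ?ell (\<lambda>mu. gtlex ?ell pn mu lam) \<subseteq> hcl ` ?F"
 proof
  fix x assume "x \<in> {hc.mm lam * hc.TW (dperm pn lam t) | t. t \<in> std pn lam} \<union> hcs.Mset ?ell (\<lambda>mu. gtlex ?ell pn mu lam)"
  then consider t where "t \<in> std pn lam" "x = hc.mm lam * hc.TW (dperm pn lam t)"
   | mu u v where "multipartition ?ell pn mu" "gtlex ?ell pn mu lam" "u \<in> std pn mu" "v \<in> std pn mu" "x = hc.mst mu u v"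
   unfolding hcs.Mset_def by blast
  then show "x \<in> hcl ` ?F"
  proof cases
   case 1
   then show ?thesis unfolding 1(2) g1(2)[OF 1(1), symmetric] by blast
  next
   case 2
   then show ?thesis unfolding 2(5) g2(2)[OF 2(1,3,4), symmetric] by blast
  qed
 qed
 have "hc.mm lam * hcl h \<in> ospan hq hqi (hcl ` ?F)"
  using hcs.two_sided[OF refl lam hc.alg.one hcl_alg[OF h]] ospan_mono[OF im] by blast
 from ospan_lift[OF this FA] obtain f where f: "f \<in> fa_span ?F" "f \<in> fa_carrier pn" "hcl f = hc.mm lam * hcl h" by blast
 have mh: "fa_mult (m_lam pn pk lam) h \<in> fa_carrier pn" using hf.ev_m_lam(1)[OF sz] h by simp
 have "hcl (fa_mult (m_lam pn pk lam) h) = hcl f" using hf.ev_m_lam[OF sz] h f(3) by simp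
 then have "fa_sub (fa_mult (m_lam pn pk lam) h) f \<in> prel" using hcl_eq_iff[OF mh f(2)] by blast
 then have "fa_sub (fa_mult (m_lam pn pk lam) h) f \<in> fa_ideal pn (hecke_relators pn pk)"
  unfolding prel_def by (rule fa_ideal_mono[rotated]) auto
 then show "\<exists>f\<in>fa_span ?F. fa_sub (fa_mult (m_lam pn pk lam) h) f \<in> fa_ideal pn (hecke_relators pn pk)"
  using f(1) by blast
qed

theorem hecke_spans: "hecke_spans n kappa"
proof (rule ccontr)
 assume "\<not> hecke_spans n kappa"
 then have "\<exists>p. \<not> hecke_spans (fst p) (snd p)" by (metis fst_conv snd_conv)
 then have "\<not> hecke_spans (fst params) (snd params)" unfolding params_def by (rule someI_ex)
 then show False using hecke_spans_params unfolding pn_def pk_def by simp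
qed

section \<open>Linear operators as a ring, and evaluation in it\<close>

text \<open>Linear operators on all functions, packed into a type so that the locales over rings
  apply to them.\<close>

typedef (overloaded) ('i, 'k::field) lop = "{F :: ('i => 'k) => ('i => 'k).
  (\<forall>u v. F (\<lambda>s. u s + v s) = (\<lambda>s. F u s + F v s)) \<and> (\<forall>c v. F (\<lambda>s. c * v s) = (\<lambda>s. c * F v s))}"
 by (rule exI[of _ "\<lambda>v. v"]) simp

setup_lifting type_definition_lop

lift_definition app :: "('i, 'k::field) lop => ('i => 'k) => 'i => 'k" is "\<lambda>F. F" .

lemma app_add: "app F (\<lambda>s. u s + v s) s = app F u s + app F v s"
 by transfer simp
lemma app_smult: "app F (\<lambda>s. c * v s) s = c * app F v s"
 by transfer simp
lemma lop_eqI: "(\<And>v s. app F v s = app G v s) ==> F = G"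
 by transfer (simp add: fun_eq_iff)

instantiation lop :: (type, field) "{ring, monoid_mult}"
begin
lift_definition zero_lop :: "('a, 'b) lop" is "\<lambda>v s. 0" by simp
lift_definition one_lop :: "('a, 'b) lop" is "\<lambda>v. v" by simp
lift_definition plus_lop :: "('a, 'b) lop => ('a, 'b) lop => ('a, 'b) lop" is "\<lambda>F G v s. F v s + G v s" by (simp add: algebra_simps)
lift_definition minus_lop :: "('a, 'b) lop => ('a, 'b) lop => ('a, 'b) lop" is "\<lambda>F G v s. F v s - G v s" by (simp add: algebra_simps)
lift_definition uminus_lop :: "('a, 'b) lop => ('a, 'b) lop" is "\<lambda>F v s. - F v s" by simp
lift_definition times_lop :: "('a, 'b) lop => ('a, 'b) lop => ('a, 'b) lop" is "\<lambda>F G v. F (G v)" by simp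
instance
 by standard (transfer, simp add: fun_eq_iff algebra_simps)+
end

lemma app_ring [simp]:
 "app 0 v s = 0" "app 1 v = v" "app (F + G) v s = app F v s + app G v s"
 "app (F - G) v s = app F v s - app G v s" "app (- F) v s = - app F v s" "app (F * G) v = app F (app G v)"
 by (transfer, simp)+

lemma app_op_sum: "app (\<Sum>i\<in>I. F i) v s = (\<Sum>i\<in>I. app (F i) v s)"
 by (induction I rule: infinite_finite_induct) simp_all

lift_definition lsc :: "'k::field => ('i, 'k) lop" is "\<lambda>c v s. c * v s" by (simp add: algebra_simps)

lemma app_lsc [simp]: "app (lsc c) v s = c * v s"
 by transfer simp

lemma lsc_central: "lsc c * F = F * lsc c"
 by (rule lop_eqI) (simp add: app_smult[of F c, symmetric] app_lsc[abs_def])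

lemma lsc_hom: "lsc 0 = 0" "lsc 1 = 1" "lsc (c + d) = lsc c + lsc d" "lsc (- c) = - lsc c" "lsc (c * d) = lsc c * lsc d"
 "lsc (c - d) = lsc c - lsc d"
 by (rule lop_eqI, simp add: algebra_simps)+

lemma lsc_lc: "x * (lsc c * y) = lsc c * (x * y)"
 using lsc_central[of c x] by (simp only: mult.assoc[symmetric])

lemma lsc_power: "lsc (c ^ k) = lsc c ^ k"
 by (induction k) (simp_all add: lsc_hom)

lemma lsc_sum: "lsc (sum f S) = (\<Sum>x\<in>S. lsc (f x))"
 by (induction S rule: infinite_finite_induct) (simp_all add: lsc_hom)

definition fin_supp :: "falg set" where "fin_supp = {f. finite {w. f w ~= 0}}"

text \<open>Meaningful on \<open>fin_supp\<close>; for an infinite support the sum is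
  \<open>0\<close> by convention.\<close>

definition lev :: "(gen => ('i, laurent) lop) => falg => ('i, laurent) lop" where
 "lev G f = (\<Sum>w\<in>{w. f w ~= 0}. lsc (f w) * prod_list (map G w))"

lemma lev_superset:
 assumes "finite S" "{w. f w ~= 0} \<subseteq> S"
 shows "lev G f = (\<Sum>w\<in>S. lsc (f w) * prod_list (map G w))"
 unfolding lev_def by (rule sum.mono_neutral_left) (use assms in \<open>auto simp: lsc_hom\<close>)

lemma fin_suppD: "f \<in> fin_supp ==> finite {w. f w ~= 0}"
 by (simp add: fin_supp_def)

lemma fin_suppI: "finite S ==> {w. f w ~= 0} \<subseteq> S ==> f \<in> fin_supp"
 unfolding fin_supp_def by (blast intro: finite_subset)

text \<open>Restricting the splittings to the two supports allows a product of sums to be regrouped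
  by concatenated words in \<open>fa_hom_lev\<close>.\<close>

lemma fa_mult_finite:
 assumes f: "f \<in> fin_supp" and g: "g \<in> fin_supp"
 shows "fa_mult f g w = (\<Sum>(u, v)\<in>{p \<in> {u. f u ~= 0} \<times> {v. g v ~= 0}. fst p @ snd p = w}. f u * g v)"
proof -
 have "finite {(a, b). a @ b = w}"
 proof (rule finite_subset)
  show "{(a, b). a @ b = w} \<subseteq> set (map (\<lambda>i. (take i w, drop i w)) [0..<Suc (length w)])"
  proof clarify
   fix a b assume "w = a @ b"
   then show "(a, b) \<in> set (map (\<lambda>i. (take i (a @ b), drop i (a @ b))) [0..<Suc (length (a @ b))])"
    unfolding set_map by (intro image_eqI[of _ _ "length a"]) simp_all
  qed
 qed simp
 then show ?thesis unfolding fa_mult_def by (intro sum.mono_neutral_right) auto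
qed

lemma fa_hom_lev: "fa_hom n fin_supp (lev G) lsc"
proof
 have mon: "fa_monom w \<in> fin_supp" and lmon: "lev G (fa_monom w) = prod_list (map G w)" for w
  using fin_suppI[of "{w}" "fa_monom w"] lev_superset[of "{w}" "fa_monom w" G]
  by (auto simp: fa_monom_def lsc_hom)
 show "fa_monom [x] \<in> fin_supp" for x by (rule mon)
 show "fa_one \<in> fin_supp" "lev G fa_one = 1" unfolding fa_one_def using mon[of "[]"] lmon[of "[]"] by simp_all
 show "fa_zero \<in> fin_supp" "lev G fa_zero = 0" by (simp_all add: fin_supp_def fa_zero_def lev_def)
 fix f g :: falg and c :: laurent
 assume f: "f \<in> fin_supp"
 have ff: "finite {w. f w ~= 0}" using fin_suppD[OF f] .
 have sm: "{w. fa_smult c f w ~= 0} \<subseteq> {w. f w ~= 0}" by (auto simp: fa_smult_def)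
 show "fa_smult c f \<in> fin_supp" by (rule fin_suppI[OF ff sm])
 show "lev G (fa_smult c f) = lsc c * lev G f"
  unfolding lev_superset[OF ff sm] by (simp add: lev_def fa_smult_def lsc_hom sum_distrib_left mult.assoc)
 assume g: "g \<in> fin_supp"
 have fg: "finite {w. g w ~= 0}" using fin_suppD[OF g] .
 let ?S = "{w. f w ~= 0} \<union> {w. g w ~= 0}"
 have fS: "finite ?S" using ff fg by simp
 have sa: "{w. fa_add f g w ~= 0} \<subseteq> ?S" "{w. fa_sub f g w ~= 0} \<subseteq> ?S" by (auto simp: fa_add_def fa_sub_def)
 show "fa_add f g \<in> fin_supp" "fa_sub f g \<in> fin_supp" by (rule fin_suppI[OF fS], rule sa)+
 have e: "lev G f = (\<Sum>w\<in>?S. lsc (f w) * prod_list (map G w))" "lev G g = (\<Sum>w\<in>?S. lsc (g w) * prod_list (map G w))"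
  by (rule lev_superset[OF fS], blast)+
 show "lev G (fa_add f g) = lev G f + lev G g"
  unfolding lev_superset[OF fS sa(1)] e by (simp add: fa_add_def lsc_hom distrib_right sum.distrib)
 show "lev G (fa_sub f g) = lev G f - lev G g"
  unfolding lev_superset[OF fS sa(2)] e by (simp add: fa_sub_def lsc_hom left_diff_distrib sum_subtractf)
 let ?P = "{u. f u ~= 0} \<times> {v. g v ~= 0}"
 let ?W = "(\<lambda>p. fst p @ snd p) ` ?P"
 have fP: "finite ?P" using ff fg by simp
 have sW: "{w. fa_mult f g w ~= 0} \<subseteq> ?W"
 proof
  fix w assume "w \<in> {w. fa_mult f g w ~= 0}"
  then have "{p \<in> ?P. fst p @ snd p = w} ~= {}" using fa_mult_finite[OF f g, of w] by force
  then show "w \<in> ?W" by blast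
 qed
 have fW: "finite ?W" using fP by simp
 show "fa_mult f g \<in> fin_supp" by (rule fin_suppI[OF fW sW])
 have "lev G f * lev G g = (\<Sum>p\<in>?P. lsc (f (fst p) * g (snd p)) * prod_list (map G (fst p @ snd p)))"
 proof -
  have "lsc (f u) * prod_list (map G u) * (lsc (g v) * prod_list (map G v))
    = lsc (f u * g v) * prod_list (map G (u @ v))" for u v
   by (simp only: lsc_hom mult.assoc map_append prod_list.append lsc_lc[of "prod_list (map G u)"])
  then show ?thesis unfolding lev_def sum_product sum.cartesian_product by (simp add: split_def)
 qed
 also have "\<dots> = (\<Sum>w\<in>?W. \<Sum>p\<in>{p \<in> ?P. fst p @ snd p = w}. lsc (f (fst p) * g (snd p)) * prod_list (map G (fst p @ snd p)))"
  by (rule sum.image_gen[OF fP])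
 also have "\<dots> = (\<Sum>w\<in>?W. lsc (fa_mult f g w) * prod_list (map G w))"
  unfolding fa_mult_finite[OF f g] lsc_sum sum_distrib_right by (intro sum.cong refl) (auto simp: split_def)
 finally show "lev G (fa_mult f g) = lev G f * lev G g" unfolding lev_superset[OF fW sW] by simp
qed

lemma lev_monom: "lev G (fa_monom [x]) = G x"
proof -
 have "{w. fa_monom [x] w ~= 0} = {[x]}" by (auto simp: fa_monom_def)
 then show ?thesis unfolding lev_def by (simp add: fa_monom_def lsc_hom)
qed

section \<open>Coefficients of the seminormal form\<close>

lemma qint_geometric: "qint k * (tt - 1) = tt powi k - 1"
proof (cases "0 <= k")
 case True
 have "(\<Sum>i<m. tt ^ i) * (tt - 1) = tt ^ m - 1" for m
  by (induction m) (simp_all add: algebra_simps)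
 then show ?thesis using True by (simp add: qint_def power_int_def)
next
 case False
 have "(\<Sum>i\<in>{1..m}. tt powi (- int i)) * (tt - 1) = 1 - tt powi (- int m)" for m
 proof (induction m)
  case (Suc m)
  have "tt powi (- int (Suc m)) * tt = tt powi (- int m)"
   using power_int_add[of tt "- int (Suc m)" 1] by simp
  then show ?case using Suc by (simp add: algebra_simps)
 qed simp
 from this[of "nat (- k)"] show ?thesis using False by (simp add: qint_def)
qed

lemma tt_minus_1: "tt - 1 ~= 0"
proof
 assume "tt - 1 = 0"
 then have "fls_nth tt 0 = fls_nth (1 :: laurent) 0" by simp
 then show False by simp
qed

lemma tt_powi_inj: "tt powi k = tt powi m \<longleftrightarrow> k = m"
proof
 assume "tt powi k = tt powi m"
 then have "fls_nth (tt powi k) k = fls_nth (tt powi m) k" by simp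
 then show "k = m" by (simp add: fls_X_power_int fls_one_nth split: if_splits)
qed simp

lemma qint_eq: "qint k = (tt powi k - 1) / (tt - 1)"
 using qint_geometric[of k] tt_minus_1 by (simp add: field_simps)

lemma qint_Suc: "qint (k + 1) = tt * qint k + 1"
 using tt_minus_1 unfolding qint_eq by (simp add: power_int_add field_simps)

lemma qint_nonzero: "k ~= 0 ==> qint k ~= 0"
 using tt_powi_inj[of k 0] tt_minus_1 unfolding qint_eq by simp

text \<open>Diagonal entries, and with \<open>smB\<close> the off-diagonal entries, of Young's
  seminormal form for \<open>T r\<close>; \<open>x\<close> and \<open>y\<close> are the powers of
  \<open>t\<close> given by the contents of \<open>r\<close> and \<open>Suc r\<close>.\<close>

definition smA :: "laurent => laurent => laurent" where "smA x y = (tt - 1) * y / (y - x)"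
definition smB :: "laurent => laurent => laurent" where "smB x y = (x - tt * y) / (x - y)"

lemma sm_sum: "x ~= y ==> smA x y + smA y x = tt - 1"
proof -
 assume "x ~= y"
 then have "x - y ~= 0" "y - x ~= 0" by auto
 then show ?thesis unfolding smA_def by (simp add: divide_simps) (simp add: algebra_simps)
qed

text \<open>Together with \<open>sm_sum\<close>: the two by two block with diagonal
  \<open>smA x y\<close>, \<open>smA y x\<close> has trace \<open>t - 1\<close> and determinant
  \<open>-t\<close>.\<close>

lemma sm_quad: "x ~= y ==> smA x y * smA x y + smB x y * smB y x = (tt - 1) * smA x y + tt"
proof -
 assume "x ~= y"
 then have "x - y ~= 0" "y - x ~= 0" by auto
 then show ?thesis unfolding smA_def smB_def by (simp add: divide_simps) (simp add: algebra_simps)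
qed

text \<open>The last two identities follow by clearing denominators. For the first,
  \<open>sm_quad\<close> eliminates \<open>smB\<close>, and the difference of the two sides is then
  a multiple of the second identity.\<close>

lemma sm_braid:
 assumes "x ~= y" "y ~= z" "x ~= z"
 shows "smA x y * smA y z * smA x y + smA x z * (smB x y * smB y x)
   = smA y z * smA x y * smA y z + smA x z * (smB y z * smB z y)"
  and "smA x y * smA y z + smA x z * smA y x = smA y z * smA x z"
  and "smA x y * smA x z = smA y z * smA x y + smA x z * smA z y"
proof -
 have ne: "x - y ~= 0" "y - x ~= 0" "y - z ~= 0" "z - y ~= 0" "x - z ~= 0" "z - x ~= 0" using assms by auto
 show 2: "smA x y * smA y z + smA x z * smA y x = smA y z * smA x z"
  using ne unfolding smA_def by (simp add: divide_simps) (simp add: algebra_simps)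
 show 3: "smA x y * smA x z = smA y z * smA x y + smA x z * smA z y"
  using ne unfolding smA_def by (simp add: divide_simps) (simp add: algebra_simps)
 have b1: "smB x y * smB y x = (tt - 1) * smA x y + tt - smA x y * smA x y"
  and b2: "smB y z * smB z y = (tt - 1) * smA y z + tt - smA y z * smA y z"
  using sm_quad[OF assms(1)] sm_quad[OF assms(2)] by (simp_all add: algebra_simps)
 have s: "smA y x = tt - 1 - smA x y" "smA z y = tt - 1 - smA y z"
  using sm_sum[OF assms(1)] sm_sum[OF assms(2)] by (simp_all add: algebra_simps)
 define a b c where "a = smA x y" "b = smA y z" "c = smA x z"
 have k: "a * b + c * (tt - 1 - a) = b * c" "a * c = b * a + c * (tt - 1 - b)"
  using 2 3 unfolding s a_b_c_def by simp_all
 have "a * b * a + c * ((tt - 1) * a + tt - a * a) - (b * a * b + c * ((tt - 1) * b + tt - b * b))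
   = (a - b) * (a * b + c * (tt - 1 - a) - b * c)" by (simp add: algebra_simps)
 then show "smA x y * smA y z * smA x y + smA x z * (smB x y * smB y x)
   = smA y z * smA x y * smA y z + smA x z * (smB y z * smB z y)"
  unfolding b1 b2 using k unfolding a_b_c_def by simp
qed

text \<open>Neighbours in a row have \<open>y = t * x\<close>, neighbours in a column
  \<open>x = t * y\<close>; there the block degenerates to the eigenvalue \<open>t\<close>,
  respectively \<open>-1\<close>.\<close>

lemma sm_row: "x ~= 0 ==> smA x (tt * x) = tt" "x ~= 0 ==> smB (tt * x) x = 0"
 and sm_col: "x ~= 0 ==> smA (tt * x) x = -1"
proof -
 assume "x ~= 0"
 moreover have "tt * x - x = (tt - 1) * x" "x - tt * x = - ((tt - 1) * x)" by (simp_all add: algebra_simps)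
 ultimately show "smA x (tt * x) = tt" "smB (tt * x) x = 0" "smA (tt * x) x = -1"
  using tt_minus_1 unfolding smA_def smB_def by simp_all
qed

section \<open>Standard tableaux and adjacent swaps\<close>

fun cover :: "node => node => bool" where
 "cover (l, r, c) y \<longleftrightarrow> y = (l, r, Suc c) \<or> y = (l, Suc r, c)"

definition nod :: "mpart => tableau => nat => node" where
 "nod lam s k = inv_into (diagram lam) s k"

lemma sr_sr_tab [simp]: "sr r \<circ> (sr r \<circ> s) = (s :: tableau)"
 by (auto simp: fun_eq_iff sr_apply)

lemma stdI:
 assumes "bij_betw s (diagram lam) {1..n}" "\<And>x. x \<notin> diagram lam ==> s x = 0"
  "\<And>x y. x \<in> diagram lam ==> y \<in> diagram lam ==> cover x y ==> s x < s y"
  and down: "\<And>l r c. (l, r, Suc c) \<in> diagram lam ==> (l, r, c) \<in> diagram lam"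
   "\<And>l r c. (l, Suc r, c) \<in> diagram lam ==> (l, r, c) \<in> diagram lam"
 shows "s \<in> std n lam"
 using assms(1,2) assms(3)[OF down(1)] assms(3)[OF down(2)] unfolding std_def by simp

locale shape =
 fixes ell n :: nat and lam :: mpart
 assumes mp: "multipartition ell n lam"
begin

abbreviation "D \<equiv> diagram lam"
abbreviation "S \<equiv> std n lam"
abbreviation "nd' \<equiv> nod lam"

lemma sz: "msize lam = n" and length_lam: "length lam = ell"
 using multipartitionD[OF mp] by blast+

lemma D_down: "(l, r, c) \<in> D ==> r' <= r ==> c' <= c ==> (l, r', c') \<in> D"
proof -
 assume a: "(l, r, c) \<in> D" "r' <= r" "c' <= c"
 then have h: "l < length lam" "r < length (lam ! l)" "c < lam ! l ! r" by (simp_all add: diagram_iff)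
 have "is_partition (lam ! l)" using multipartitionD(3)[OF mp] h(1) length_lam by simp
 from partition_antimono[OF this a(2) h(2)] show ?thesis using h a by (simp add: diagram_iff)
qed

lemma D_down1: "(l, r, Suc c) \<in> D ==> (l, r, c) \<in> D" "(l, Suc r, c) \<in> D ==> (l, r, c) \<in> D"
 by (rule D_down, assumption, simp_all)+

lemma std_bij: "s \<in> S ==> bij_betw s D {1..n}"
 unfolding std_def by simp

lemma std_out: "s \<in> S ==> x \<notin> D ==> s x = 0"
 unfolding std_def by blast

lemma std_range: "s \<in> S ==> x \<in> D ==> 1 <= s x" "s \<in> S ==> x \<in> D ==> s x <= n"
 using bij_betwE[OF std_bij] by auto

lemma std_inj: "s \<in> S ==> x \<in> D ==> y \<in> D ==> s x = s y ==> x = y"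
 using std_bij[of s] unfolding bij_betw_def inj_on_def by blast

lemma bij_nod:
 assumes "bij_betw s D {1..n}" "1 <= k" "k <= n"
 shows "nd' s k \<in> D" "s (nd' s k) = k"
proof -
 have "k \<in> s ` D" using assms unfolding bij_betw_def by simp
 then show "nd' s k \<in> D" "s (nd' s k) = k"
  unfolding nod_def by (rule inv_into_into, rule f_inv_into_f)
qed

lemma bij_nod_eq:
 assumes "bij_betw s D {1..n}" "x \<in> D" shows "nd' s (s x) = x"
 using assms unfolding nod_def bij_betw_def by (simp add: inv_into_f_f)

lemmas nod_in = bij_nod(1)[OF std_bij] and s_nod = bij_nod(2)[OF std_bij] and nod_s = bij_nod_eq[OF std_bij]

lemma std_cover: "s \<in> S ==> x \<in> D ==> y \<in> D ==> cover x y ==> s x < s y"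
 by (cases x) (auto simp: std_def)

lemma std_row:
 assumes s: "s \<in> S" and "(l, r, c') \<in> D" "c <= c'"
 shows "s (l, r, c) <= s (l, r, c')"
 using assms(3,2)
proof (induction c' rule: dec_induct)
 case (step k)
 have d: "(l, r, k) \<in> D" using D_down1(1)[OF step.prems] .
 have "s (l, r, k) < s (l, r, Suc k)" using s d step.prems by (intro std_cover) auto
 then show ?case using step.IH[OF d] by simp
qed simp

lemma std_mono:
 assumes s: "s \<in> S" and y: "(l, r', c') \<in> D" and le: "r <= r'" "c <= c'"
 shows "s (l, r, c) <= s (l, r', c')"
 using le(1) y
proof (induction r' rule: dec_induct)
 case base
 then show ?case using std_row[OF s _ le(2)] by simp
next
 case (step k)
 have d: "(l, k, c') \<in> D" using D_down1(2)[OF step.prems] .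
 have "s (l, k, c') < s (l, Suc k, c')" using s d step.prems by (intro std_cover) auto
 then show ?case using step.IH[OF d] by simp
qed

lemma std_less:
 assumes s: "s \<in> S" and y: "(l, r', c') \<in> D" and le: "r <= r'" "c <= c'" "(r, c) ~= (r', c')"
 shows "s (l, r, c) < s (l, r', c')"
 using std_mono[OF s y le(1,2)] std_inj[OF s D_down[OF y le(1,2)] y] le(3) by fastforce

lemma tsw_bij:
 assumes s: "bij_betw s D {1..n}" and r: "1 <= r" "r < n"
 shows "bij_betw (sr r \<circ> s) D {1..n}"
 using bij_betw_trans[OF s permutes_imp_bij[OF sr_permutes[OF r]]] .

lemma tsw_nod:
 assumes s: "bij_betw s D {1..n}" and r: "1 <= r" "r < n" and k: "1 <= k" "k <= n"
 shows "nd' (sr r \<circ> s) k = nd' s (sr r k)"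
proof -
 have k': "1 <= sr r k" "sr r k <= n" using perm_range[OF sr_permutes[OF r] k] .
 have "(sr r \<circ> s) (nd' s (sr r k)) = k" using bij_nod(2)[OF s k'] by (auto simp: sr_apply)
 then show ?thesis using bij_nod_eq[OF tsw_bij[OF s r] bij_nod(1)[OF s k']] by simp
qed

text \<open>A swap changes only the relative order of \<open>r\<close> and \<open>Suc r\<close>,
  while standardness compares a node with its right and lower neighbours.\<close>

lemma tsw_std:
 assumes s: "s \<in> S" and r: "1 <= r" "r < n"
 shows "sr r \<circ> s \<in> S \<longleftrightarrow> \<not> cover (nd' s r) (nd' s (Suc r))"
proof
 have P: "nd' s r \<in> D" "s (nd' s r) = r" using nod_in[OF s] s_nod[OF s] r by simp_all
 have Q: "nd' s (Suc r) \<in> D" "s (nd' s (Suc r)) = Suc r" using nod_in[OF s] s_nod[OF s] r by simp_all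
 show "\<not> cover (nd' s r) (nd' s (Suc r))" if "sr r \<circ> s \<in> S"
  using std_cover[OF that P(1) Q(1)] P(2) Q(2) by (auto simp: sr_apply)
 show "sr r \<circ> s \<in> S" if nc: "\<not> cover (nd' s r) (nd' s (Suc r))"
 proof (rule stdI[OF tsw_bij[OF std_bij[OF s] r] _ _ D_down1])
  show "(sr r \<circ> s) x = 0" if "x \<notin> D" for x using std_out[OF s that] r by (simp add: sr_apply)
  fix x y assume xy: "x \<in> D" "y \<in> D" "cover x y"
  have lt: "s x < s y" using std_cover[OF s xy] .
  have "\<not> (s x = r \<and> s y = Suc r)" using nc xy nod_s[OF s xy(1)] nod_s[OF s xy(2)] by auto
  then show "(sr r \<circ> s) x < (sr r \<circ> s) y" using lt by (auto simp: sr_apply)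
 qed
qed

lemma not_std_cover: "cover x y ==> x \<in> D ==> y \<in> D ==> u y < u x ==> u \<notin> S"
 using std_cover[of u x y] by force

lemma finite_std: "finite S"
proof (rule finite_subset)
 show "S \<subseteq> (\<lambda>w. tab_of lam w) ` {w. w permutes {1..n}}"
 proof
  fix s assume s: "s \<in> S"
  have "s = tab_of lam (dperm n lam s)"
   using dperm_spec(2)[OF sz std_bij[OF s]] std_out[OF s] by (auto simp: tab_of_def)
  then show "s \<in> (\<lambda>w. tab_of lam w) ` {w. w permutes {1..n}}"
   using dperm_spec(1)[OF sz std_bij[OF s]] by blast
 qed
 show "finite ((\<lambda>w. tab_of lam w) ` {w. w permutes {1..n}})" by (simp add: finite_permutations)
qed

lemma tlam_std: "tlam lam \<in> S"
proof (rule stdI[OF _ _ _ D_down1])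
 show "bij_betw (tlam lam) D {1..n}" using tlam_bij[of lam] sz by simp
 show "tlam lam x = 0" if "x \<notin> D" for x using that by (cases x) (simp add: tlam_def)
 show "tlam lam x < tlam lam y" if "x \<in> D" "y \<in> D" "cover x y" for x y
  by (rule tlam_mono[OF that(1,2)]) (use that(3) in \<open>cases x; auto simp: node_below_def\<close>)
qed

end

section \<open>The seminormal representation\<close>

locale seminormal = shape ell n lam for ell n lam +
 fixes kappa :: "int list"
 assumes ell1: "1 <= ell" and kap: "length kappa = ell"
  and gap: "\<And>l. l + 1 < ell ==> kappa ! l - kappa ! (l + 1) > int n"
begin

fun ct :: "node => int" where "ct (l, r, c) = kappa ! l + int c - int r"

lemma kappa_gap:
 assumes "l < l'" "l' < ell" shows "kappa ! l - kappa ! l' > int n"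
proof -
 have "Suc l <= l'" using assms(1) by simp
 then show ?thesis using assms(2)
 proof (induction l' rule: dec_induct)
  case base
  then show ?case using gap[of l] by simp
 next
  case (step k)
  then show ?case using gap[of k] by simp
 qed
qed

text \<open>Column \<open>c\<close> down to row \<open>r\<close> in one component and row
  \<open>r'\<close> up to column \<open>c'\<close> in another are disjoint sets of nodes of the
  diagram.\<close>

lemma arm_leg:
 assumes "(l, r, c) \<in> D" "(l', r', c') \<in> D" "l ~= l'"
 shows "r + c' + 2 <= n"
proof -
 let ?A = "(\<lambda>i. (l, i, c)) ` {..r} \<union> (\<lambda>j. (l', r', j)) ` {..c'}"
 have "card ?A = card ((\<lambda>i. (l, i, c)) ` {..r}) + card ((\<lambda>j. (l', r', j)) ` {..c'})"
  using assms(3) by (intro card_Un_disjoint) auto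
 also have "\<dots> = r + 1 + (c' + 1)" by (subst (1 2) card_image) (auto simp: inj_on_def)
 finally have "card ?A = r + c' + 2" by simp
 moreover have "?A \<subseteq> D" using assms D_down by auto
 ultimately show ?thesis using card_mono[OF finite_diagram[of lam], of ?A] card_diagram[of lam] sz by simp
qed

text \<open>The entries of \<open>kappa\<close> differ by at least \<open>n + 1\<close>, and by
  \<open>arm_leg\<close> rows and columns can lower the difference by at most
  \<open>n - 2\<close>.\<close>

lemma ct_gap:
 assumes "x \<in> D" "y \<in> D" "fst x < fst y"
 shows "ct x - ct y \<ge> 3"
proof -
 obtain l r c l' r' c' where xy: "x = (l, r, c)" "y = (l', r', c')" by (cases x, cases y)
 have "r + c' + 2 <= n" using arm_leg[of l r c l' r' c'] assms xy by simp
 moreover have "l' < ell" using assms(2) length_lam xy by (simp add: diagram_iff)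
 then have "kappa ! l - kappa ! l' > int n" using kappa_gap assms(3) xy by simp
 ultimately show ?thesis unfolding xy by simp
qed

text \<open>The default \<open>kappa ! 0\<close> keeps the cyclotomic relator zero for
  \<open>n = 0\<close>, when entry \<open>1\<close> does not exist.\<close>

definition cc :: "tableau => nat => int" where
 "cc s k = (if 1 <= k \<and> k <= n then ct (nd' s k) else kappa ! 0)"
definition xx :: "tableau => nat => laurent" where "xx s k = tt powi cc s k"

lemma xx_nonzero: "xx s k ~= 0"
 by (simp add: xx_def)

lemma cc_tsw: "s \<in> S ==> 1 <= r ==> r < n ==> cc (sr r \<circ> s) k = cc s (sr r k)"
 using tsw_nod[OF std_bij] perm_range[OF sr_permutes[of r n], of k] permutes_not_in[OF sr_permutes[of r n], of k]
 by (auto simp: cc_def)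

lemma xx_tsw: "s \<in> S ==> 1 <= r ==> r < n ==> xx (sr r \<circ> s) k = xx s (sr r k)"
 by (simp add: xx_def cc_tsw)

text \<open>Nodes of equal content lie on one diagonal of one component. The right and the lower
  neighbour of the upper node have two different entries strictly in between, so the entries differ
  by at least three; the braid relation involves distances up to two.\<close>

lemma cc_distinct:
 assumes s: "s \<in> S" and k: "1 <= j" "j < k" "k <= n" "k <= j + 2"
 shows "cc s j ~= cc s k"
proof
 assume eq: "cc s j = cc s k"
 have J: "nd' s j \<in> D" "s (nd' s j) = j" and K: "nd' s k \<in> D" "s (nd' s k) = k"
  using nod_in[OF s] s_nod[OF s] k by simp_all
 obtain l r c l' r' c' where N: "nd' s j = (l, r, c)" "nd' s k = (l', r', c')" by (metis prod_cases3)
 have e: "ct (l, r, c) = ct (l', r', c')" using eq k N by (simp add: cc_def)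
 have ll: "l = l'"
  using ct_gap[OF J(1) K(1)] ct_gap[OF K(1) J(1)] e unfolding N by (metis fst_conv linorder_neqE_nat diff_self not_numeral_le_zero)
 have rc: "int c - int r = int c' - int r'" using e ll by simp
 consider "r < r'" | "r = r'" | "r' < r" by linarith
 then show False
 proof cases
  case 1
  then have c: "c < c'" using rc by simp
  have d: "(l, r', c') \<in> D" using K(1) N ll by simp
  have d1: "(l, r, Suc c) \<in> D" "(l, Suc r, c) \<in> D" by (rule D_down[OF d], use 1 c in simp_all)+
  have "s (l, r, c) < s (l, r, Suc c)" "s (l, r, c) < s (l, Suc r, c)"
   by (rule std_less[OF s d1(1)], simp_all) (rule std_less[OF s d1(2)], simp_all)
  moreover have "s (l, r, Suc c) < s (l, r', c')" "s (l, Suc r, c) < s (l, r', c')"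
   by (rule std_less[OF s d], use 1 c in auto)+
  moreover have "s (l, r, Suc c) ~= s (l, Suc r, c)" using std_inj[OF s d1] by auto
  ultimately show False using J(2) K(2) N ll k by auto
 next
  case 2
  then show False using rc ll J(2) K(2) N k by simp
 next
  case 3
  then have c: "c' < c" using rc by simp
  have d: "(l, r, c) \<in> D" using J(1) N by simp
  have "s (l, r', c') < s (l, r, c)" by (rule std_less[OF s d], use 3 c in auto)
  then show False using J(2) K(2) N ll k by simp
 qed
qed

lemma xx_distinct: "s \<in> S ==> 1 <= j ==> j < k ==> k <= n ==> k <= j + 2 ==> xx s j ~= xx s k"
 using cc_distinct[of s j k] by (simp add: xx_def tt_powi_inj)

lemma cover_cc:
 assumes s: "s \<in> S" and r: "1 <= r" "r < n" and c: "cover (nd' s r) (nd' s (Suc r))"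
 shows "(cc s (Suc r) = cc s r + 1 \<and> nd' s (Suc r) = (case nd' s r of (l, i, j) => (l, i, Suc j))) \<or>
  (cc s (Suc r) = cc s r - 1 \<and> nd' s (Suc r) = (case nd' s r of (l, i, j) => (l, Suc i, j)))"
proof -
 obtain l i j where N: "nd' s r = (l, i, j)" by (metis prod_cases3)
 show ?thesis using c r N by (auto simp: cc_def)
qed

text \<open>Contents differing by one put the nodes on neighbouring diagonals of one component.
  Unless the nodes are adjacent, either standardness reverses their order or a node between them
  would need an entry between \<open>r\<close> and \<open>Suc r\<close>.\<close>

lemma noncover_cc:
 assumes s: "s \<in> S" and r: "1 <= r" "r < n" and nc: "\<not> cover (nd' s r) (nd' s (Suc r))"
 shows "cc s (Suc r) ~= cc s r + 1" "cc s (Suc r) ~= cc s r - 1"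
proof -
 have J: "nd' s r \<in> D" "s (nd' s r) = r" and K: "nd' s (Suc r) \<in> D" "s (nd' s (Suc r)) = Suc r"
  using nod_in[OF s] s_nod[OF s] r by simp_all
 obtain l i j l' i' j' where N: "nd' s r = (l, i, j)" "nd' s (Suc r) = (l', i', j')" by (metis prod_cases3)
 have cc: "cc s r = ct (l, i, j)" "cc s (Suc r) = ct (l', i', j')" using r N by (simp_all add: cc_def)
 have lj: "s (l, i, j) = r" "s (l', i', j') = Suc r" using J K N by simp_all
 have ll: "l = l'" if "\<bar>cc s (Suc r) - cc s r\<bar> = 1"
  using ct_gap[OF J(1) K(1)] ct_gap[OF K(1) J(1)] that unfolding N cc by (cases l l' rule: linorder_cases) auto
 have bad: "False" if h: "l = l'" "i <= i'" "j <= j'" "i + j + 2 <= i' + j'"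
 proof -
  have d: "(l, i', j') \<in> D" using K(1) N that by simp
  \<comment> \<open>Of two nodes at distance at least two, one further to the south-east, the
    rectangle they span contains a third one, a single step away from the first.\<close>
  obtain a b where ab: "i <= a" "a <= i'" "j <= b" "b <= j'" "a + b = i + j + 1"
  proof (cases "i < i'")
   case True
   then show ?thesis using that[of "Suc i" j] h by simp
  next
   case False
   then show ?thesis using that[of i "Suc j"] h by simp
  qed
  have "s (l, i, j) < s (l, a, b)" using D_down[OF d ab(2,4)] by (rule std_less[OF s]) (use ab in auto)
  moreover have "s (l, a, b) < s (l, i', j')" by (rule std_less[OF s d]) (use ab that in auto)
  ultimately show False using lj that(1) by simp
 qed
 have bad2: "False" if "l = l'" "i' <= i" "j' <= j"
 proof -
  have "s (l, i', j') <= s (l, i, j)" using J(1) N that by (intro std_mono[OF s]) simp_all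
  then show False using lj that(1) by simp
 qed
 show "cc s (Suc r) ~= cc s r + 1"
 proof
  assume e: "cc s (Suc r) = cc s r + 1"
  then have l: "l = l'" using ll by simp
  have e': "int j' - int i' = int j - int i + 1" using e l unfolding cc by simp
  consider "i' = i" | "i < i'" | "i' < i" by linarith
  then show False
  proof cases
   case 1 then show ?thesis using e' l nc N by simp
  next
   case 2 then show ?thesis using bad[OF l] e' by simp
  next
   case 3 then show ?thesis using bad2[OF l] e' by simp
  qed
 qed
 show "cc s (Suc r) ~= cc s r - 1"
 proof
  assume e: "cc s (Suc r) = cc s r - 1"
  then have l: "l = l'" using ll by simp
  have e': "int j' - int i' = int j - int i - 1" using e l unfolding cc by simp
  consider "j' = j" | "j < j'" | "j' < j" by linarith
  then show False
  proof cases
   case 1 then show ?thesis using e' l nc N by simp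
  next
   case 2 then show ?thesis using bad[OF l] e' by simp
  next
   case 3 then show ?thesis using bad2[OF l] e' by simp
  qed
 qed
qed

text \<open>Off the standard tableaux \<open>T r\<close> acts as \<open>t\<close> and, in
  \<open>opL\<close>, \<open>L k\<close> as \<open>[kappa_0 + k - 1]\<close>. This is a
  one-dimensional representation, so the relations hold for operators on all functions of type
  \<open>tableau => laurent\<close>.\<close>

definition opT :: "nat => (tableau => laurent) => tableau => laurent" where
 "opT r v s = (if s \<in> S then smA (xx s r) (xx s (Suc r)) * v s
   + smB (xx s r) (xx s (Suc r)) * (if sr r \<circ> s \<in> S then v (sr r \<circ> s) else 0)
  else tt * v s)"

definition opL :: "nat => (tableau => laurent) => tableau => laurent" where
 "opL k v s = (if s \<in> S then qint (cc s k) else qint (kappa ! 0 + int k - 1)) * v s"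

definition rT :: "nat => (tableau, laurent) lop" where "rT r = Abs_lop (opT r)"
definition rL :: "nat => (tableau, laurent) lop" where "rL k = Abs_lop (opL k)"

lemma app_rT [simp]: "app (rT r) = opT r"
 unfolding rT_def app_def by (simp, subst Abs_lop_inverse) (auto simp: opT_def fun_eq_iff algebra_simps)

lemma app_rL [simp]: "app (rL r) = opL r"
 unfolding rL_def app_def by (simp, subst Abs_lop_inverse) (auto simp: opL_def fun_eq_iff algebra_simps)

lemma opT_std: "s \<in> S ==> opT r v s = smA (xx s r) (xx s (Suc r)) * v s
   + smB (xx s r) (xx s (Suc r)) * (if sr r \<circ> s \<in> S then v (sr r \<circ> s) else 0)"
 by (simp add: opT_def)

lemma cover_sm:
 assumes s: "s \<in> S" and r: "1 <= r" "r < n" and ns: "sr r \<circ> s \<notin> S"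
 shows "smB (xx s r) (xx s (Suc r)) * smB (xx s (Suc r)) (xx s r) = 0"
  "smA (xx s r) (xx s (Suc r)) = tt \<or> smA (xx s r) (xx s (Suc r)) = -1"
proof -
 have c: "cover (nd' s r) (nd' s (Suc r))" using tsw_std[OF s r] ns by blast
 have "xx s (Suc r) = tt * xx s r \<or> xx s r = tt * xx s (Suc r)"
  using cover_cc[OF s r c] power_int_add[of tt 1 "cc s r"] power_int_add[of tt 1 "cc s (Suc r)"]
  by (auto simp: xx_def add.commute)
 then show "smB (xx s r) (xx s (Suc r)) * smB (xx s (Suc r)) (xx s r) = 0"
  "smA (xx s r) (xx s (Suc r)) = tt \<or> smA (xx s r) (xx s (Suc r)) = -1"
  using sm_row[OF xx_nonzero[of s r]] sm_row[OF xx_nonzero[of s "Suc r"]] sm_col[OF xx_nonzero[of s "Suc r"]] by auto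
qed

lemma quad_std:
 assumes s: "s \<in> S" and r: "1 <= r" "r < n"
 shows "opT r (opT r v) s = (tt - 1) * opT r v s + tt * v s"
proof -
 let ?X = "xx s r" and ?Y = "xx s (Suc r)"
 have ne: "?X ~= ?Y" using xx_distinct[OF s r(1), of "Suc r"] r by simp
 have ss: "sr r \<circ> (sr r \<circ> s) = s" by simp
 show ?thesis
 proof (cases "sr r \<circ> s \<in> S")
  case True
  have x': "xx (sr r \<circ> s) r = ?Y" "xx (sr r \<circ> s) (Suc r) = ?X" using xx_tsw[OF s r] by (simp_all add: sr_apply)
  have e1: "opT r v (sr r \<circ> s) = smA ?Y ?X * v (sr r \<circ> s) + smB ?Y ?X * v s"
   using opT_std[OF True, of r v] s unfolding x' ss by simp
  have e0: "opT r v s = smA ?X ?Y * v s + smB ?X ?Y * v (sr r \<circ> s)"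
   using opT_std[OF s, of r v] True by simp
  have e: "opT r (opT r v) s = smA ?X ?Y * opT r v s + smB ?X ?Y * opT r v (sr r \<circ> s)"
   using opT_std[OF s, of r "opT r v"] True by simp
  have a: "smA ?Y ?X = tt - 1 - smA ?X ?Y" using sm_sum[OF ne] by (simp add: algebra_simps)
  have "opT r (opT r v) s = (smA ?X ?Y * smA ?X ?Y + smB ?X ?Y * smB ?Y ?X) * v s
    + (tt - 1) * smB ?X ?Y * v (sr r \<circ> s)"
   unfolding e e0 e1 a by (simp add: algebra_simps)
  also have "\<dots> = (tt - 1) * opT r v s + tt * v s" unfolding sm_quad[OF ne] e0 by (simp add: algebra_simps)
  finally show ?thesis .
 next
  case False
  have e: "opT r w s = smA ?X ?Y * w s" for w using opT_std[OF s, of r w] False by simp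
  show ?thesis unfolding e using cover_sm(2)[OF s r False] by (auto simp: algebra_simps)
 qed
qed

lemma far_std:
 assumes s: "s \<in> S" and r: "1 <= r" "Suc r < u" "u < n"
 shows "opT r (opT u v) s = opT u (opT r v) s"
proof -
 have r1: "1 <= r" "r < n" and u1: "1 <= u" "u < n" using r by simp_all
 have com: "sr u \<circ> (sr r \<circ> s) = sr r \<circ> (sr u \<circ> s)" using r by (auto simp: fun_eq_iff sr_apply)
 have xr: "xx (sr u \<circ> s) r = xx s r" "xx (sr u \<circ> s) (Suc r) = xx s (Suc r)"
  and xu: "xx (sr r \<circ> s) u = xx s u" "xx (sr r \<circ> s) (Suc u) = xx s (Suc u)"
  using xx_tsw[OF s r1] xx_tsw[OF s u1] r by (simp_all add: sr_apply)
 have P: "s (nd' s r) = r" "s (nd' s (Suc r)) = Suc r" "s (nd' s u) = u" "s (nd' s (Suc u)) = Suc u"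
  using s_nod[OF s] r by simp_all
 have mr: "sr r \<circ> s \<in> S" and mu: "sr u \<circ> s \<in> S" if ru: "sr r \<circ> (sr u \<circ> s) \<in> S"
 proof -
  show "sr r \<circ> s \<in> S"
  proof (rule ccontr)
   assume "sr r \<circ> s \<notin> S"
   then have c: "cover (nd' s r) (nd' s (Suc r))" using tsw_std[OF s r1] by blast
   have "sr r \<circ> (sr u \<circ> s) \<notin> S"
    by (rule not_std_cover[OF c]) (use nod_in[OF s] P r in \<open>auto simp: sr_apply\<close>)
   then show False using ru by contradiction
  qed
  show "sr u \<circ> s \<in> S"
  proof (rule ccontr)
   assume "sr u \<circ> s \<notin> S"
   then have c: "cover (nd' s u) (nd' s (Suc u))" using tsw_std[OF s u1] by blast
   have "sr r \<circ> (sr u \<circ> s) \<notin> S"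
    by (rule not_std_cover[OF c]) (use nod_in[OF s] P r in \<open>auto simp: sr_apply\<close>)
   then show False using ru by contradiction
  qed
 qed
 let ?V = "\<lambda>w. if w \<in> S then v w else 0"
 let ?a = "smA (xx s r) (xx s (Suc r))" and ?b = "smB (xx s r) (xx s (Suc r))"
  and ?c = "smA (xx s u) (xx s (Suc u))" and ?d = "smB (xx s u) (xx s (Suc u))"
 have e1: "(if sr r \<circ> s \<in> S then opT u v (sr r \<circ> s) else 0) = ?c * ?V (sr r \<circ> s) + ?d * ?V (sr r \<circ> (sr u \<circ> s))"
  using mr opT_std[of "sr r \<circ> s" u v] unfolding xu com by auto
 have e2: "(if sr u \<circ> s \<in> S then opT r v (sr u \<circ> s) else 0) = ?a * ?V (sr u \<circ> s) + ?b * ?V (sr r \<circ> (sr u \<circ> s))"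
  using mu opT_std[of "sr u \<circ> s" r v] unfolding xr by auto
 show ?thesis
  unfolding opT_std[OF s, of r "opT u v"] opT_std[OF s, of u "opT r v"] e1 e2 opT_std[OF s, of r v] opT_std[OF s, of u v]
  by (simp add: algebra_simps)
qed

text \<open>Both sides are expanded over the six tableaux obtained by permuting three consecutive
  entries. Nonstandard ones carry the value \<open>0\<close>, and where a swap leaves the standard
  tableaux the corresponding product of two \<open>smB\<close> vanishes, so the generic identities
  \<open>sm_braid\<close> cover every case.\<close>

lemma braid_std:
 assumes s: "s \<in> S" and r: "1 <= r" "Suc r < n"
 shows "opT r (opT (Suc r) (opT r v)) s = opT (Suc r) (opT r (opT (Suc r) v)) s"
proof -
 let ?u = "Suc r"
 have r1: "1 <= r" "r < n" and u1: "1 <= ?u" "?u < n" using r by simp_all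
 define s1 s2 s12 s21 s3 where "s1 = sr r \<circ> s" and "s2 = sr ?u \<circ> s" and "s12 = sr ?u \<circ> s1" and "s21 = sr r \<circ> s2" and "s3 = sr r \<circ> s12"
 define X Y Z where "X = xx s r" and "Y = xx s ?u" and "Z = xx s (Suc ?u)"
 have ne: "X ~= Y" "Y ~= Z" "X ~= Z"
  unfolding X_def Y_def Z_def by (rule xx_distinct[OF s], use r in simp_all)+
 have s3: "s3 = sr ?u \<circ> s21"
  unfolding s3_def s12_def s1_def s21_def s2_def by (auto simp: fun_eq_iff sr_apply)
 have bk: "sr r \<circ> s1 = s" "sr ?u \<circ> s2 = s" "sr ?u \<circ> s12 = s1" "sr r \<circ> s21 = s2"
  unfolding s1_def s2_def s12_def s21_def by simp_all
 have x1: "xx s1 r = Y" "xx s1 ?u = X" "xx s1 (Suc ?u) = Z"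
  unfolding s1_def X_def Y_def Z_def using xx_tsw[OF s r1] by (simp_all add: sr_apply)
 have x2: "xx s2 r = X" "xx s2 ?u = Z" "xx s2 (Suc ?u) = Y"
  unfolding s2_def X_def Y_def Z_def using xx_tsw[OF s u1] by (simp_all add: sr_apply)
 have P: "s (nd' s r) = r" "s (nd' s ?u) = ?u" "s (nd' s (Suc ?u)) = Suc ?u" using s_nod[OF s] r by simp_all
 have in1: "nd' s r \<in> D" "nd' s ?u \<in> D" "nd' s (Suc ?u) \<in> D" using nod_in[OF s] r by simp_all
 have n1: "s12 \<notin> S" "s3 \<notin> S" if "s1 \<notin> S"
 proof -
  have c: "cover (nd' s r) (nd' s ?u)" using tsw_std[OF s r1] that unfolding s1_def by blast
  show "s12 \<notin> S" "s3 \<notin> S"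
   by (rule not_std_cover[OF c in1(1,2)]; simp add: s3_def s12_def s1_def P sr_apply)+
 qed
 have n2: "s21 \<notin> S" "s3 \<notin> S" if "s2 \<notin> S"
 proof -
  have c: "cover (nd' s ?u) (nd' s (Suc ?u))" using tsw_std[OF s u1] that unfolding s2_def by blast
  show "s21 \<notin> S" "s3 \<notin> S"
   by (rule not_std_cover[OF c in1(2,3)]; simp add: s3 s21_def s2_def P sr_apply)+
 qed
 have n12: "s3 \<notin> S" if "s1 \<in> S" "s12 \<notin> S"
 proof -
  have c: "cover (nd' s1 ?u) (nd' s1 (Suc ?u))" using tsw_std[OF that(1) u1] that(2) unfolding s12_def by blast
  have nn: "nd' s1 ?u = nd' s r" "nd' s1 (Suc ?u) = nd' s (Suc ?u)"
   unfolding s1_def using tsw_nod[OF std_bij[OF s] r1] r by (simp_all add: sr_apply)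
  show ?thesis
   by (rule not_std_cover[OF c[unfolded nn] in1(1,3)]; simp add: s3_def s12_def s1_def P sr_apply)
 qed
 have n21: "s3 \<notin> S" if "s2 \<in> S" "s21 \<notin> S"
 proof -
  have c: "cover (nd' s2 r) (nd' s2 ?u)" using tsw_std[OF that(1) r1] that(2) unfolding s21_def by blast
  have nn: "nd' s2 r = nd' s r" "nd' s2 ?u = nd' s (Suc ?u)"
   unfolding s2_def using tsw_nod[OF std_bij[OF s] u1] r by (simp_all add: sr_apply)
  show ?thesis
   by (rule not_std_cover[OF c[unfolded nn] in1(1,3)]; simp add: s3 s21_def s2_def P sr_apply)
 qed
 have x12: "xx s12 r = Y" "xx s12 ?u = Z" "xx s12 (Suc ?u) = X" if "s1 \<in> S"
  unfolding s12_def using xx_tsw[OF that u1] x1 by (simp_all add: sr_apply)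
 have x21: "xx s21 r = Z" "xx s21 ?u = X" "xx s21 (Suc ?u) = Y" if "s2 \<in> S"
  unfolding s21_def using xx_tsw[OF that r1] x2 by (simp_all add: sr_apply)
 let ?V = "\<lambda>w. if w \<in> S then v w else 0"
 define v0 v1 v2 v12 v21 v3 where vd: "v0 = v s" "v1 = ?V s1" "v2 = ?V s2" "v12 = ?V s12" "v21 = ?V s21" "v3 = ?V s3"
 have z1: "s1 \<notin> S ==> v1 = 0 \<and> v12 = 0 \<and> v3 = 0" using n1 by (simp add: vd)
 have z2: "s2 \<notin> S ==> v2 = 0 \<and> v21 = 0 \<and> v3 = 0" using n2 by (simp add: vd)
 have b1: "s1 \<notin> S ==> smB X Y * smB Y X = 0" using cover_sm(1)[OF s r1] unfolding X_def Y_def s1_def by blast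
 have b2: "s2 \<notin> S ==> smB Y Z * smB Z Y = 0" using cover_sm(1)[OF s u1] unfolding Y_def Z_def s2_def by blast
 have e0: "opT r v s = smA X Y * v0 + smB X Y * v1" "opT ?u v s = smA Y Z * v0 + smB Y Z * v2"
  using opT_std[OF s] unfolding X_def Y_def Z_def vd s1_def s2_def by simp_all
 have f2: "(if s2 \<in> S then opT r v s2 else 0) = smA X Z * v2 + smB X Z * v21"
 proof (cases "s2 \<in> S")
  case True
  then show ?thesis using opT_std[OF True, of r v] unfolding x2 vd s21_def by simp
 qed (use z2 in simp)
 have f1: "(if s1 \<in> S then opT ?u v s1 else 0) = smA X Z * v1 + smB X Z * v12"
 proof (cases "s1 \<in> S")
  case True
  then show ?thesis using opT_std[OF True, of ?u v] unfolding x1 vd s12_def by simp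
 qed (use z1 in simp)
 have g1: "opT ?u (opT r v) s = smA Y Z * (smA X Y * v0 + smB X Y * v1) + smB Y Z * (smA X Z * v2 + smB X Z * v21)"
  using opT_std[OF s, of ?u "opT r v"] unfolding s2_def[symmetric] f2 e0 X_def[symmetric] Y_def[symmetric] Z_def[symmetric] .
 have g2: "opT r (opT ?u v) s = smA X Y * (smA Y Z * v0 + smB Y Z * v2) + smB X Y * (smA X Z * v1 + smB X Z * v12)"
  using opT_std[OF s, of r "opT ?u v"] unfolding s1_def[symmetric] f1 e0 X_def[symmetric] Y_def[symmetric] Z_def[symmetric] .
 have h1: "smB X Y * (if s1 \<in> S then opT ?u (opT r v) s1 else 0)
  = smB X Y * (smA X Z * (smA Y X * v1) + smB X Z * (smA Y Z * v12 + smB Y Z * v3)) + smA X Z * (smB X Y * smB Y X) * v0"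
 proof (cases "s1 \<in> S")
  case True
  have i: "(if s12 \<in> S then opT r v s12 else 0) = smA Y Z * v12 + smB Y Z * v3"
  proof (cases "s12 \<in> S")
   case a: True
   then show ?thesis using opT_std[OF a, of r v] unfolding x12[OF True] vd s3_def by simp
  qed (use n12[OF True] in \<open>simp add: vd\<close>)
  have j: "opT r v s1 = smA Y X * v1 + smB Y X * v0"
   using opT_std[OF True, of r v] True s unfolding bk x1 vd by simp
  have "opT ?u (opT r v) s1 = smA X Z * (smA Y X * v1 + smB Y X * v0) + smB X Z * (smA Y Z * v12 + smB Y Z * v3)"
   using opT_std[OF True, of ?u "opT r v"] unfolding s12_def[symmetric] i j x1 .
  then show ?thesis using True by (simp add: algebra_simps)
 next
  case False
  then show ?thesis using z1 b1 by simp
 qed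
 have h2: "smB Y Z * (if s2 \<in> S then opT r (opT ?u v) s2 else 0)
  = smB Y Z * (smA X Z * (smA Z Y * v2) + smB X Z * (smA X Y * v21 + smB X Y * v3)) + smA X Z * (smB Y Z * smB Z Y) * v0"
 proof (cases "s2 \<in> S")
  case True
  have i: "(if s21 \<in> S then opT ?u v s21 else 0) = smA X Y * v21 + smB X Y * v3"
  proof (cases "s21 \<in> S")
   case a: True
   then show ?thesis using opT_std[OF a, of ?u v] unfolding x21[OF True] vd s3 by simp
  qed (use n21[OF True] in \<open>simp add: vd\<close>)
  have j: "opT ?u v s2 = smA Z Y * v2 + smB Z Y * v0"
   using opT_std[OF True, of ?u v] True s unfolding bk x2 vd by simp
  have "opT r (opT ?u v) s2 = smA X Z * (smA Z Y * v2 + smB Z Y * v0) + smB X Z * (smA X Y * v21 + smB X Y * v3)"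
   using opT_std[OF True, of r "opT ?u v"] unfolding s21_def[symmetric] i j x2 .
  then show ?thesis using True by (simp add: algebra_simps)
 next
  case False
  then show ?thesis using z2 b2 by simp
 qed
 have L: "opT r (opT ?u (opT r v)) s = (smA X Y * smA Y Z * smA X Y + smA X Z * (smB X Y * smB Y X)) * v0
   + (smA X Y * smA Y Z + smA X Z * smA Y X) * (smB X Y * v1) + (smA X Y * smA X Z) * (smB Y Z * v2)
   + smA X Y * smB Y Z * smB X Z * v21 + smB X Y * smB X Z * smA Y Z * v12 + smB X Y * smB X Z * smB Y Z * v3"
  using opT_std[OF s, of r "opT ?u (opT r v)"]
  unfolding s1_def[symmetric] g1 X_def[symmetric] Y_def[symmetric] h1 by (simp add: algebra_simps)
 have R: "opT ?u (opT r (opT ?u v)) s = (smA Y Z * smA X Y * smA Y Z + smA X Z * (smB Y Z * smB Z Y)) * v0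
   + (smA Y Z * smA X Z) * (smB X Y * v1) + (smA Y Z * smA X Y + smA X Z * smA Z Y) * (smB Y Z * v2)
   + smA X Y * smB Y Z * smB X Z * v21 + smB X Y * smB X Z * smA Y Z * v12 + smB X Y * smB X Z * smB Y Z * v3"
  using opT_std[OF s, of ?u "opT r (opT ?u v)"]
  unfolding s2_def[symmetric] g2 Y_def[symmetric] Z_def[symmetric] h2 by (simp add: algebra_simps)
 show ?thesis unfolding L R sm_braid[OF ne] ..
qed

lemma opT_out: "s \<notin> S ==> opT r v s = tt * v s"
 by (simp add: opT_def)

lemma opL_tsw: "s \<in> S ==> opL k v s = qint (cc s k) * v s"
 by (simp add: opL_def)

lemma LT_std:
 assumes s: "s \<in> S" and r: "1 <= r" "r < n"
 shows "qint (cc s (Suc r)) * (opT r v s - tt * v s + v s) = opT r (opL r v) s + v s"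
proof -
 let ?X = "xx s r" and ?Y = "xx s (Suc r)"
 have ne: "?X ~= ?Y" using xx_distinct[OF s r(1), of "Suc r"] r by simp
 then have ne': "?Y - ?X ~= 0" by simp
 have q: "qint (cc s (Suc r)) = (?Y - 1) / (tt - 1)" "qint (cc s r) = (?X - 1) / (tt - 1)"
  by (simp_all add: qint_eq xx_def)
 have key: "qint (cc s (Suc r)) * (smA ?X ?Y - tt + 1) = smA ?X ?Y * qint (cc s r) + 1"
 proof -
  have "smA ?X ?Y - tt + 1 = (tt - 1) * ?X / (?Y - ?X)"
   using ne' unfolding smA_def by (simp add: field_simps)
  then show ?thesis unfolding q smA_def using ne' tt_minus_1 by (simp add: divide_simps) (simp add: algebra_simps)
 qed
 have l: "opL r v (sr r \<circ> s) = qint (cc s (Suc r)) * v (sr r \<circ> s)" if "sr r \<circ> s \<in> S"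
  using opL_tsw[OF that, of r v] cc_tsw[OF s r] by (simp add: sr_apply)
 show ?thesis
  unfolding opT_std[OF s, of r v] opT_std[OF s, of r "opL r v"] opL_tsw[OF s]
 proof (cases "sr r \<circ> s \<in> S")
  case True
  have "qint (cc s (Suc r)) * (smA ?X ?Y * v s + smB ?X ?Y * v (sr r \<circ> s) - tt * v s + v s)
    = (qint (cc s (Suc r)) * (smA ?X ?Y - tt + 1)) * v s + smB ?X ?Y * (qint (cc s (Suc r)) * v (sr r \<circ> s))"
   by (simp add: algebra_simps)
  then show "qint (cc s (Suc r)) * (smA ?X ?Y * v s + smB ?X ?Y * (if sr r \<circ> s \<in> S then v (sr r \<circ> s) else 0) - tt * v s + v s)
   = smA ?X ?Y * (qint (cc s r) * v s) + smB ?X ?Y * (if sr r \<circ> s \<in> S then opL r v (sr r \<circ> s) else 0) + v s"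
   using True l unfolding key by (simp add: algebra_simps)
 next
  case False
  have "qint (cc s (Suc r)) * (smA ?X ?Y * v s - tt * v s + v s) = (qint (cc s (Suc r)) * (smA ?X ?Y - tt + 1)) * v s"
   by (simp add: algebra_simps)
  then show "qint (cc s (Suc r)) * (smA ?X ?Y * v s + smB ?X ?Y * (if sr r \<circ> s \<in> S then v (sr r \<circ> s) else 0) - tt * v s + v s)
   = smA ?X ?Y * (qint (cc s r) * v s) + smB ?X ?Y * (if sr r \<circ> s \<in> S then opL r v (sr r \<circ> s) else 0) + v s"
   using False unfolding key by (simp add: algebra_simps)
 qed
qed

lemma rep_cyclo0: "cyclo0 n (lsc tt) rT (lsc (tt powi (-1))) rL"
proof
 show "lsc tt * x = x * lsc tt" for x :: "(tableau, laurent) lop" by (rule lsc_central)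
 show "lsc tt * lsc (tt powi (-1)) = (1 :: (tableau, laurent) lop)"
  by (simp add: lsc_hom(5)[symmetric] power_int_minus lsc_hom(2))
 show "rT r * rT r = (lsc tt - 1) * rT r + lsc tt" if r: "1 <= r" "r < n" for r
 proof (rule lop_eqI)
  fix v s
  show "app (rT r * rT r) v s = app ((lsc tt - 1) * rT r + lsc tt) v s"
  proof (cases "s \<in> S")
   case True
   then show ?thesis using quad_std[OF True r, of v] by (simp add: algebra_simps)
  next
   case False
   then show ?thesis by (simp add: opT_out algebra_simps)
  qed
 qed
 show "rT r * rT u = rT u * rT r" if r: "1 <= r" "Suc r < u" "u < n" for r u
 proof (rule lop_eqI)
  fix v s
  show "app (rT r * rT u) v s = app (rT u * rT r) v s"
   using far_std[OF _ r, of s v] by (cases "s \<in> S") (simp_all add: opT_out)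
 qed
 show "rT r * rT (Suc r) * rT r = rT (Suc r) * rT r * rT (Suc r)" if r: "1 <= r" "Suc r < n" for r
 proof (rule lop_eqI)
  fix v s
  show "app (rT r * rT (Suc r) * rT r) v s = app (rT (Suc r) * rT r * rT (Suc r)) v s"
   using braid_std[OF _ r, of s v] by (cases "s \<in> S") (simp_all add: opT_out)
 qed
 show "rL r * rL u = rL u * rL r" for r u
  by (rule lop_eqI) (simp add: opL_def algebra_simps)
 show "rT r * rL u = rL u * rT r" if r: "1 <= r" "r < n" "1 <= u" "u <= n" "u ~= r" "u ~= Suc r" for r u
 proof (rule lop_eqI)
  fix v s
  have "cc (sr r \<circ> s) u = cc s u" if "s \<in> S" using cc_tsw[OF that r(1,2)] r by (simp add: sr_apply)
  then show "app (rT r * rL u) v s = app (rL u * rT r) v s"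
   by (cases "s \<in> S") (simp_all add: opT_def opL_def algebra_simps)
 qed
 show "rL (Suc r) * (rT r - lsc tt + 1) = rT r * rL r + 1" if r: "1 <= r" "r < n" for r
 proof (rule lop_eqI)
  fix v s
  show "app (rL (Suc r) * (rT r - lsc tt + 1)) v s = app (rT r * rL r + 1) v s"
  proof (cases "s \<in> S")
   case True
   then show ?thesis using LT_std[OF True r, of v] by (simp add: opL_tsw)
  next
   case False
   then show ?thesis using qint_Suc[of "kappa ! 0 + int r - 1"] by (simp add: opT_out opL_def algebra_simps)
  qed
 qed
qed

end

section \<open>The action of the algebra and the invariant form\<close>

lemma qint_diff: "tt powi (- k) * (qint a - qint k) = qint (a - k)"
proof -
 have "tt powi (- k) * (tt powi a - tt powi k) = tt powi (a - k) - 1"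
  using power_int_add[of tt "- k" a] power_int_add[of tt "- k" k] by (simp add: right_diff_distrib add.commute)
 moreover have "qint a - qint k = (tt powi a - tt powi k) / (tt - 1)"
  unfolding qint_eq by (simp add: diff_divide_distrib[symmetric])
 ultimately show ?thesis unfolding qint_eq[of "a - k"] by simp
qed

lemma row_less_off:
 assumes d: "(l0, r0, c0) \<in> diagram mu" and l: "l < length mu"
 shows "(l0 < l \<or> l0 = l \<and> r0 < i) \<longleftrightarrow> tlam mu (l0, r0, c0) <= off mu l i"
proof -
 have h: "l0 < length mu" "r0 < length (mu ! l0)" "c0 < mu ! l0 ! r0" using d by (simp_all add: diagram_iff)
 have t: "tlam mu (l0, r0, c0) = off mu l0 r0 + c0 + 1" by (rule tlam_eq[OF d])
 consider "l0 < l" | "l0 = l" "r0 < i" | "l0 = l" "i <= r0" | "l < l0" by linarith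
 then show ?thesis
 proof cases
  case 1
  then show ?thesis using comp_less_iff[OF d, of l] off_ge_csum[of mu l i] by simp
 next
  case 2
  then show ?thesis using off_row_le[of r0 mu l i] h t by simp
 next
  case 3
  have "off mu l i <= off mu l r0" using sum_take_mono[OF 3(2), of "mu ! l"] by (simp add: off_def)
  then show ?thesis using 3 t by simp
 next
  case 4
  have "off mu l i <= csum mu (Suc l)" using off_le_csum[OF l] .
  also have "\<dots> <= csum mu l0" using 4 by (intro csum_mono) simp
  also have "\<dots> <= off mu l0 r0" by (rule off_ge_csum)
  finally show ?thesis using 4 t by simp
 qed
qed

definition gmap :: "(nat => 'a) => (nat => 'a) => gen => 'a" where
 "gmap t l g = (case g of gen.L r => l r | gen.T r => t r)"

lemma monom_fin_supp [simp]: "fa_monom w \<in> fin_supp"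
 by (rule fin_suppI[of "{w}"]) (auto simp: fa_monom_def)

context seminormal
begin

lemma rep_qpow: "cyclo0.qpow (lsc tt) (lsc (tt powi (-1))) k = (lsc (tt powi k) :: (tableau, laurent) lop)"
proof (cases "0 <= k")
 case True
 then have "tt ^ nat k = tt powi k" by (simp add: power_int_def)
 then show ?thesis
  unfolding cyclo0.qpow_def[OF rep_cyclo0] lsc_power[symmetric] using True by simp
next
 case False
 then have "(tt powi (-1)) ^ nat (- k) = tt powi k"
  by (simp add: power_int_def power_inverse)
 then show ?thesis
  unfolding cyclo0.qpow_def[OF rep_cyclo0] lsc_power[symmetric] using False by simp
qed

lemma rep_qn: "cyclo0.qn (lsc tt) (lsc (tt powi (-1))) k = (lsc (qint k) :: (tableau, laurent) lop)"
proof -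
 have m: "(tt powi (-1)) ^ i = tt powi (- int i)" for i
  by (simp add: power_int_minus power_inverse)
 show ?thesis
  unfolding cyclo0.qn_def[OF rep_cyclo0] qint_def lsc_power[symmetric] lsc_sum[symmetric] lsc_hom(4)[symmetric] m by (simp only: if_distrib[of lsc])
qed

sublocale rep: fa_cyclo n "lsc tt" rT "lsc (tt powi (-1))" rL kappa fin_supp "lev (gmap rT rL)" lsc
proof (rule fa_cyclo.intro[OF rep_cyclo0 fa_hom_lev], unfold_locales)
 show "lev (gmap rT rL) (fa_monom [gen.T r]) = rT r" for r by (simp add: lev_monom gmap_def)
 show "lev (gmap rT rL) (fa_monom [gen.L r]) = rL r" for r by (simp add: lev_monom gmap_def)
 show "(lsc (tt powi k) :: (tableau, laurent) lop) = cyclo0.qpow (lsc tt) (lsc (tt powi (-1))) k" for k by (rule rep_qpow[symmetric])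
 show "(lsc (qint k) :: (tableau, laurent) lop) = cyclo0.qn (lsc tt) (lsc (tt powi (-1))) k" for k by (rule rep_qn[symmetric])
qed

abbreviation "ev \<equiv> lev (gmap rT rL)"

lemma ev_gL [simp]: "ev (gL r) = rL r" and ev_gT [simp]: "ev (gT r) = rT r"
 by (simp_all add: lev_monom gmap_def)

lemma fin_scal [simp]: "scal c \<in> fin_supp" and ev_scal' [simp]: "ev (scal c) = lsc c"
proof -
 have "{w. scal c w ~= 0} \<subseteq> {[]}" by (auto simp: fa_smult_def fa_one_def fa_monom_def)
 then show "scal c \<in> fin_supp" "ev (scal c) = lsc c"
  using fin_suppI[of "{[]}"] lev_superset[of "{[]}" "scal c" "gmap rT rL"]
  by (auto simp: fa_smult_def fa_one_def fa_monom_def)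
qed

text \<open>Entry \<open>1\<close> sits at a node \<open>(l, 0, 0)\<close>. This makes one factor of
  the cyclotomic relator vanish.\<close>

lemma first_content: "s \<in> S ==> \<exists>l<ell. cc s 1 = kappa ! l"
proof (cases "1 <= n")
 case True
 assume s: "s \<in> S"
 have N: "nd' s 1 \<in> D" "s (nd' s 1) = 1" using nod_in[OF s] s_nod[OF s] True by simp_all
 obtain l r c where e: "nd' s 1 = (l, r, c)" by (metis prod_cases3)
 have d: "(l, 0, 0) \<in> D" using D_down[of l r c 0 0] N e by simp
 have "(r, c) = (0, 0)"
 proof (rule ccontr)
  assume "(r, c) ~= (0, 0)"
  then have "s (l, 0, 0) < s (l, r, c)" using N e by (intro std_less[OF s]) auto
  then show False using std_range(1)[OF s d] N e by simp
 qed
 then have "cc s 1 = kappa ! l" using True e by (simp add: cc_def)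
 then show ?thesis using d length_lam by (auto simp: diagram_iff)
next
 case False
 then show ?thesis using ell1 by (intro exI[of _ 0]) (simp add: cc_def)
qed

lemma ideal_zero:
 assumes "i \<in> fa_ideal n (hecke_relators n kappa)"
 shows "i \<in> fin_supp \<and> ev i = 0"
 using assms
proof induction
 case (base r)
 then show ?case
 proof (cases rule: relator_cases)
  case L1
  let ?g = "\<lambda>k. fa_sub (gL 1) (scal (qint k))"
  have gA: "set (map ?g kappa) \<subseteq> fin_supp" by auto
  have e: "app (prod_list (map ev (map ?g ks))) v s
   = prod_list (map (\<lambda>k. (if s \<in> S then qint (cc s 1) else qint (kappa ! 0)) - qint k) ks) * v s" for ks v s
   by (induction ks) (simp_all add: opL_def algebra_simps)
  have "ev r = 0"
   unfolding L1 rep.ev_prod[OF gA]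
  proof (rule lop_eqI)
   fix v s
   have "\<exists>l<ell. (if s \<in> S then qint (cc s 1) else qint (kappa ! 0)) = qint (kappa ! l)"
   proof (cases "s \<in> S")
    case True
    then show ?thesis using first_content[of s] by auto
   next
    case False
    then show ?thesis using ell1 by (intro exI[of _ 0]) simp
   qed
   then have "\<exists>k\<in>set kappa. (if s \<in> S then qint (cc s 1) else qint (kappa ! 0)) = qint k"
    unfolding kap[symmetric] by (metis nth_mem)
   then have "prod_list (map (\<lambda>k. (if s \<in> S then qint (cc s 1) else qint (kappa ! 0)) - qint k) kappa) = 0"
    unfolding prod_list_zero_iff by auto
   then show "app (prod_list (map ev (map ?g kappa))) v s = app 0 v s" unfolding e by simp
  qed
  then show ?thesis using rep.A_prod[OF gA] L1 by simp
 next
  case (quad r')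
  have "(rT r' + 1) * (rT r' - lsc tt) = 0"
   using rep.T_quad[OF quad(1,2)] rep.q_central[of "rT r'"] by (simp add: algebra_simps)
  then show ?thesis unfolding quad(3) by simp
 next
  case (LL r' u)
  then show ?thesis using rep.L_comm[of r' u] by simp
 next
  case (TT r' u)
  have "rT r' * rT u = rT u * rT r'" using TT rep.T_comm[of r' u] rep.T_comm[of u r'] by auto
  then show ?thesis using TT by simp
 next
  case (braid u)
  then show ?thesis using rep.T_braid[of u] by (simp add: mult.assoc)
 next
  case (TL r' u)
  then show ?thesis using rep.TL_comm[of r' u] by simp
 next
  case (LT r')
  then show ?thesis using rep.LT[OF LT(1,2)] by simp
 qed
next
 case (lmult a g)
 then show ?case by (simp add: rep.A_mult)
next
 case (rmult a g)
 then show ?case by (simp add: rep.A_mult)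
qed (simp_all)

abbreviation "tla \<equiv> tlam lam"

text \<open>Inversions recorded as pairs of nodes rather than of entries, because the factors below
  depend on the contents of these nodes.\<close>

definition IP :: "tableau => (node \<times> node) set" where
 "IP s = {(P, Q). P \<in> D \<and> Q \<in> D \<and> tla P < tla Q \<and> s Q < s P}"

abbreviation zz :: "node => laurent" where "zz x \<equiv> tt powi ct x"

text \<open>Norms of the seminormal basis. The factor at a pair is the ratio of the two
  \<open>smB\<close> that link a tableau to its swap, as self-adjointness of \<open>T r\<close>
  demands.\<close>

definition G0 :: "tableau => laurent" where
 "G0 s = (\<Prod>(P, Q)\<in>IP s. (tt * zz Q - zz P) / (zz Q - tt * zz P))"
text \<open>The product of the coefficients \<open>smB\<close> along a chain of swaps leading from
  the initial tableau to \<open>s\<close>.\<close>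

definition pc :: "tableau => laurent" where
 "pc s = (\<Prod>(P, Q)\<in>IP s. (zz Q - tt * zz P) / (zz Q - zz P))"
definition B0 :: "(tableau => laurent) => (tableau => laurent) => laurent" where
 "B0 v w = (\<Sum>s\<in>S. G0 s * v s * w s)"

lemma finite_IP [simp]: "finite (IP s)"
 by (rule finite_subset[of _ "D \<times> D"]) (auto simp: IP_def)

text \<open>Within a component \<open>Q\<close> must be strictly below and strictly to the left of
  \<open>P\<close>, each of which lowers the content; across components \<open>ct_gap\<close>
  applies.\<close>

lemma IP_ct:
 assumes s: "s \<in> S" and pq: "(P, Q) \<in> IP s"
 shows "ct P - ct Q \<ge> 2"
proof -
 obtain l r c l' r' c' where xy: "P = (l, r, c)" "Q = (l', r', c')" by (cases P, cases Q)
 have d: "P \<in> D" "Q \<in> D" and lt: "tla P < tla Q" "s Q < s P" using pq by (auto simp: IP_def)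
 have nb: "node_below Q P" using tlam_less_iff[OF d] lt by simp
 then consider "l < l'" | "l = l'" "r < r'" | "l = l'" "r = r'" "c < c'" unfolding xy node_below_def by auto
 then show ?thesis
 proof cases
  case 1
  then show ?thesis using ct_gap[OF d] xy by simp
 next
  case 2
  have "c' < c"
  proof (rule ccontr)
   assume "\<not> c' < c"
   then have "s (l, r, c) < s (l, r', c')" using d 2 xy by (intro std_less[OF s]) auto
   then show False using lt xy 2 by simp
  qed
  then show ?thesis using 2 xy by simp
 next
  case 3
  have "s (l, r, c) < s (l, r', c')" using d 3 xy by (intro std_less[OF s]) auto
  then show ?thesis using lt xy 3 by simp
 qed
qed

lemma zz_ne:
 assumes "ct P - ct Q \<ge> 2"
 shows "zz Q - zz P ~= 0" "zz Q - tt * zz P ~= 0" "tt * zz Q - zz P ~= 0"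
proof -
 have "tt * zz P = tt powi (ct P + 1)" "tt * zz Q = tt powi (ct Q + 1)" by (simp_all add: power_int_add)
 then show "zz Q - zz P ~= 0" "zz Q - tt * zz P ~= 0" "tt * zz Q - zz P ~= 0"
  using assms tt_powi_inj by simp_all
qed

lemma G0_nonzero: "s \<in> S ==> G0 s ~= 0" and pc_nonzero: "s \<in> S ==> pc s ~= 0"
 unfolding G0_def pc_def using zz_ne[OF IP_ct] by (auto simp: prod_zero_iff[OF finite_IP])

lemma IP_tl: "IP tla = {}"
 by (auto simp: IP_def)

lemma IP_tsw:
 assumes s: "s \<in> S" and r: "1 <= r" "r < n" and up: "tla (nd' s r) < tla (nd' s (Suc r))"
 shows "IP (sr r \<circ> s) = insert (nd' s r, nd' s (Suc r)) (IP s)" "(nd' s r, nd' s (Suc r)) \<notin> IP s"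
proof -
 have P: "nd' s r \<in> D" "s (nd' s r) = r" and Q: "nd' s (Suc r) \<in> D" "s (nd' s (Suc r)) = Suc r"
  using nod_in[OF s] s_nod[OF s] r by simp_all
 show "(nd' s r, nd' s (Suc r)) \<notin> IP s" using P Q by (simp add: IP_def)
 have "(a, b) \<in> IP (sr r \<circ> s) \<longleftrightarrow> (a, b) = (nd' s r, nd' s (Suc r)) \<or> (a, b) \<in> IP s" for a b
 proof (cases "a \<in> D \<and> b \<in> D \<and> tla a < tla b")
  case True
  have na: "nd' s (s a) = a" "nd' s (s b) = b" using nod_s[OF s] True by simp_all
  have "s a ~= s b" using std_inj[OF s, of a b] True by (metis less_irrefl)
  then show ?thesis using True na P Q up unfolding IP_def
   by (cases "s a = r"; cases "s b = Suc r"; cases "s a = Suc r"; cases "s b = r") (auto simp: sr_apply)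
 next
  case False
  then show ?thesis using P Q up by (auto simp: IP_def)
 qed
 note iff = this
 show "IP (sr r \<circ> s) = insert (nd' s r, nd' s (Suc r)) (IP s)"
 proof (rule set_eqI)
  fix p
  show "p \<in> IP (sr r \<circ> s) \<longleftrightarrow> p \<in> insert (nd' s r, nd' s (Suc r)) (IP s)"
   using iff[of "fst p" "snd p"] by simp
 qed
qed

lemma xx_zz: "1 <= k ==> k <= n ==> xx s k = zz (nd' s k)"
 by (simp add: xx_def cc_def)

lemma G0_smB_up:
 assumes s: "s \<in> S" and r: "1 <= r" "r < n" and s': "sr r \<circ> s \<in> S" and up: "tla (nd' s r) < tla (nd' s (Suc r))"
 shows "G0 (sr r \<circ> s) * smB (xx s (Suc r)) (xx s r) = G0 s * smB (xx s r) (xx s (Suc r))"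
proof -
 have X: "xx s r = zz (nd' s r)" "xx s (Suc r) = zz (nd' s (Suc r))" using xx_zz r by simp_all
 have "(nd' s r, nd' s (Suc r)) \<in> IP (sr r \<circ> s)" using IP_tsw(1)[OF s r up] by simp
 note ne = zz_ne[OF IP_ct[OF s' this]]
 have e: "G0 (sr r \<circ> s) = (tt * zz (nd' s (Suc r)) - zz (nd' s r)) / (zz (nd' s (Suc r)) - tt * zz (nd' s r)) * G0 s"
  unfolding G0_def IP_tsw(1)[OF s r up] using IP_tsw(2)[OF s r up] by simp
 have k: "(tt * y - x) / (y - tt * x) * smB y x = smB x y" if "y - x ~= 0" "y - tt * x ~= 0" for x y
 proof -
  have "x - y ~= 0" using that by auto
  then show ?thesis using that unfolding smB_def by (simp add: divide_simps) (simp add: algebra_simps)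
 qed
 have c: "a * g * b = g * c" if "a * b = c" for a b c g :: laurent
  using that by (simp only: mult.commute[of a g] mult.assoc)
 show ?thesis unfolding X e by (rule c[OF k[OF ne(1,2)]])
qed

lemma G0_smB:
 assumes s: "s \<in> S" and r: "1 <= r" "r < n" and s': "sr r \<circ> s \<in> S"
 shows "G0 (sr r \<circ> s) * smB (xx (sr r \<circ> s) r) (xx (sr r \<circ> s) (Suc r)) = G0 s * smB (xx s r) (xx s (Suc r))"
proof -
 have x: "xx (sr r \<circ> s) r = xx s (Suc r)" "xx (sr r \<circ> s) (Suc r) = xx s r" using xx_tsw[OF s r] by (simp_all add: sr_apply)
 have nn: "nd' (sr r \<circ> s) r = nd' s (Suc r)" "nd' (sr r \<circ> s) (Suc r) = nd' s r"
  using tsw_nod[OF std_bij[OF s] r] r by (simp_all add: sr_apply)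
 have "tla (nd' s r) ~= tla (nd' s (Suc r))"
  using inj_onD[OF tlam_inj _ nod_in[OF s] nod_in[OF s], of r "Suc r"] s_nod[OF s, of r] s_nod[OF s, of "Suc r"] r by auto
 then consider "tla (nd' s r) < tla (nd' s (Suc r))" | "tla (nd' s (Suc r)) < tla (nd' s r)" by linarith
 then show ?thesis
 proof cases
  case 1
  then show ?thesis unfolding x by (rule G0_smB_up[OF s r s'])
 next
  case 2
  have "G0 (sr r \<circ> (sr r \<circ> s)) * smB (xx (sr r \<circ> s) (Suc r)) (xx (sr r \<circ> s) r)
    = G0 (sr r \<circ> s) * smB (xx (sr r \<circ> s) r) (xx (sr r \<circ> s) (Suc r))"
   by (rule G0_smB_up[OF s' r]) (use s 2 nn in simp_all)
  then show ?thesis unfolding x by simp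
 qed
qed

text \<open>The diagonal parts agree, and the off-diagonal parts are matched by the substitution of
  \<open>sr r \<circ> s\<close> for \<open>s\<close> together with \<open>G0_smB\<close>.\<close>

lemma B0_opT:
 assumes r: "1 <= r" "r < n"
 shows "B0 (opT r v) w = B0 v (opT r w)"
proof -
 let ?R = "{s \<in> S. sr r \<circ> s \<in> S}"
 have fR: "finite ?R" using finite_std by simp
 have e: "B0 (opT r v) w = (\<Sum>s\<in>S. G0 s * smA (xx s r) (xx s (Suc r)) * v s * w s)
   + (\<Sum>s\<in>?R. G0 s * smB (xx s r) (xx s (Suc r)) * v (sr r \<circ> s) * w s)" for v w
 proof -
  have "B0 (opT r v) w = (\<Sum>s\<in>S. G0 s * smA (xx s r) (xx s (Suc r)) * v s * w s
    + (if sr r \<circ> s \<in> S then G0 s * smB (xx s r) (xx s (Suc r)) * v (sr r \<circ> s) * w s else 0))"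
   unfolding B0_def by (intro sum.cong refl) (simp add: opT_std algebra_simps)
  then show ?thesis by (simp add: sum.distrib sum.inter_filter[OF finite_std])
 qed
 have "(\<Sum>s\<in>?R. G0 s * smB (xx s r) (xx s (Suc r)) * v (sr r \<circ> s) * w s)
   = (\<Sum>s\<in>?R. G0 s * smB (xx s r) (xx s (Suc r)) * w (sr r \<circ> s) * v s)"
  by (rule sum.reindex_bij_witness[of _ "\<lambda>s. sr r \<circ> s" "\<lambda>s. sr r \<circ> s"])
   (use G0_smB[OF _ r] in \<open>auto simp: algebra_simps\<close>)
 moreover have "B0 v (opT r w) = B0 (opT r w) v" unfolding B0_def by (simp add: mult_ac)
 ultimately show ?thesis unfolding e by (simp add: mult_ac)
qed

lemma B0_TT: "set rs \<subseteq> {1..<n} ==> B0 (app (rep.TT rs) v) w = B0 v (app (rep.TT (rev rs)) w)"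
 by (induction rs arbitrary: v w) (simp_all add: B0_opT)

lemma B0_TW:
 assumes w: "w permutes {1..n}"
 shows "B0 (app (rep.TW w) v) x = B0 v (app (rep.TW (inv w)) x)"
proof -
 obtain rs where rs: "reduced_word n w rs" using reduced_word_exists[OF w] by blast
 then have "set rs \<subseteq> {1..<n}" unfolding reduced_word_def by blast
 then show ?thesis
  using B0_TT rep.TW_eq[OF w rs] rep.TW_eq[OF permutes_inv[OF w] reduced_word_rev[OF w rs]] by simp
qed

lemma zero_on_TT: "set rs \<subseteq> {1..<n} ==> (\<And>s. s \<in> S ==> v s = 0) ==> s \<in> S ==> app (rep.TT rs) v s = 0"
 by (induction rs arbitrary: s) (simp_all add: opT_def)

text \<open>Values off the standard tableaux never feed back into the values on them, so functions
  matter only up to their restriction to \<open>S\<close>.\<close>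

lemma zero_on_TW:
 assumes w: "w permutes {1..n}" and "\<And>s. s \<in> S ==> v s = 0" "s \<in> S"
 shows "app (rep.TW w) v s = 0"
proof -
 obtain rs where rs: "reduced_word n w rs" using reduced_word_exists[OF w] by blast
 then have "set rs \<subseteq> {1..<n}" unfolding reduced_word_def by blast
 then show ?thesis using zero_on_TT assms(2,3) rep.TW_eq[OF w rs] by simp
qed

text \<open>The eigenvalue of \<open>uu mu\<close> at the tableau \<open>s\<close>.\<close>

definition UV :: "mpart => tableau => laurent" where
 "UV mu s = prod_list (map (\<lambda>l. prod_list (map (\<lambda>r. qint (cc s r - kappa ! (l + 1))) [1..<csum mu (l + 1) + 1])) [0..<length mu - 1])"

lemma app_prod_diag:
 assumes "\<And>x v s. x \<in> set xs ==> s \<in> S ==> app (F x) v s = e x s * v s" "s \<in> S"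
 shows "app (prod_list (map F xs)) v s = prod_list (map (\<lambda>x. e x s) xs) * v s"
 using assms by (induction xs arbitrary: v) (simp_all add: mult.assoc)

lemma app_uu: assumes "s \<in> S" shows "app (rep.uu mu) v s = UV mu s * v s"
proof -
 have F: "app (rep.FF k r) v s = qint (cc s r - k) * v s" if "s \<in> S" for k r v s
  unfolding rep.FF_def rep.sc_powi[symmetric] rep.sc_qint[symmetric]
  using that qint_diff[of k "cc s r"] by (simp add: opL_def left_diff_distrib[symmetric] mult.assoc[symmetric])
 have U: "app (rep.UU k a) v s = prod_list (map (\<lambda>r. qint (cc s r - k)) [1..<a + 1]) * v s" if "s \<in> S" for k a v s
  unfolding rep.UU_def by (rule app_prod_diag[OF F that])
 show ?thesis unfolding rep.uu_def UV_def by (rule app_prod_diag[OF U assms])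
qed

lemma UV_nonzero_iff:
 "UV mu s ~= 0 \<longleftrightarrow> (\<forall>l r. l < length mu - 1 --> 1 <= r --> r <= csum mu (l + 1) --> cc s r ~= kappa ! (l + 1))"
proof -
 have q: "qint k = 0 \<longleftrightarrow> k = 0" for k using qint_nonzero[of k] by (cases "k = 0") (simp_all add: qint_def)
 have p: "prod_list (map f xs) = 0 \<longleftrightarrow> (\<exists>x\<in>set xs. f x = 0)" for f :: "nat => laurent" and xs
  by (induction xs) auto
 have "UV mu s ~= 0 \<longleftrightarrow> (\<forall>l\<in>{..<length mu - 1}. \<forall>r\<in>{1..csum mu (l + 1)}. cc s r ~= kappa ! (l + 1))"
  unfolding UV_def p q right_minus_eq set_upt lessThan_atLeast0 atLeastLessThanSuc_atLeastAtMost Suc_eq_plus1[symmetric]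
  by blast
 then show ?thesis by (simp add: Ball_def) blast
qed

end

declare power_int_minus1_right [simp del]

section \<open>Support of the images under the elements attached to a shape\<close>

context seminormal
begin

definition pre :: "node => node => bool" where
 "pre P N \<longleftrightarrow> fst P = fst N \<and> fst (snd P) <= fst (snd N) \<and> snd (snd P) <= snd (snd N)"

lemma smA_tt_cover:
 assumes s: "s \<in> S" and r: "1 <= r" "r < n" and s': "sr r \<circ> s \<in> S"
 shows "smA (xx s r) (xx s (Suc r)) ~= tt"
proof
 assume e: "smA (xx s r) (xx s (Suc r)) = tt"
 let ?x = "xx s r" and ?y = "xx s (Suc r)"
 have "?x ~= ?y" using xx_distinct[OF s, of r "Suc r"] r by simp
 then have "(tt - 1) * ?y = tt * (?y - ?x)" using e unfolding smA_def by (simp add: field_simps)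
 then have "?y = tt * ?x" by (simp add: algebra_simps)
 then have "tt powi cc s (Suc r) = tt powi (cc s r + 1)" unfolding xx_def by (simp add: power_int_add)
 then have "cc s (Suc r) = cc s r + 1" unfolding tt_powi_inj .
 then show False using noncover_cc(1)[OF s r] tsw_std[OF s r] s' by blast
qed

text \<open>With eigenvalue \<open>t\<close>, a nonzero value at \<open>s\<close> forces one at the
  swapped tableau, since the diagonal entry differs from \<open>t\<close>. Vertically adjacent nodes
  would give the eigenvalue \<open>-1\<close> instead.\<close>

lemma tt_eigen_swap:
 assumes s: "s \<in> S" and r: "1 <= r" "r < n" and e: "opT r v s = tt * v s" and nz: "v s ~= 0"
 shows "sr r \<circ> s \<in> S ==> v (sr r \<circ> s) ~= 0"
  and "\<not> (nd' s r = (l, i, j) \<and> nd' s (Suc r) = (l, Suc i, j))"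
proof -
 show "v (sr r \<circ> s) ~= 0" if s': "sr r \<circ> s \<in> S"
  using e nz smA_tt_cover[OF s r s'] s' by (auto simp: opT_std[OF s])
 show "\<not> (nd' s r = (l, i, j) \<and> nd' s (Suc r) = (l, Suc i, j))"
 proof
  assume N: "nd' s r = (l, i, j) \<and> nd' s (Suc r) = (l, Suc i, j)"
  then have "cover (nd' s r) (nd' s (Suc r))" by simp
  then have ns: "sr r \<circ> s \<notin> S" using tsw_std[OF s r] by blast
  have "cc s r = cc s (Suc r) + 1" using N r by (simp add: cc_def)
  then have "xx s r = tt * xx s (Suc r)" unfolding xx_def by (simp add: power_int_add)
  then have "smA (xx s r) (xx s (Suc r)) = -1" using sm_col[OF xx_nonzero] by simp
  then have "tt * v s = - v s" using e ns by (simp add: opT_std[OF s])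
  then have "(tt + 1) * v s = 0" by (simp only: distrib_right mult_1_left left_minus)
  moreover have "tt + 1 ~= 0"
  proof
   assume "tt + 1 = (0 :: laurent)"
   then have "fls_nth (tt + 1) 0 = fls_nth (0 :: laurent) 0" by simp
   then show False by simp
  qed
  ultimately show False using nz by simp
 qed
qed

text \<open>Where the vector is nonzero, moving the entries not dominated by \<open>P\<close> out of the window between
 \<open>P\<close> and \<open>Q\<close>, and then \<open>Q\<close> down next to \<open>P\<close>, never leaves the support.\<close>

lemma support_no_column:
 assumes b: "convex_lab n b" and e: "\<And>r s. 1 <= r ==> r < n ==> b r = b (Suc r) ==> s \<in> S ==> opT r v s = tt * v s"
  and s: "s \<in> S" "v s ~= 0" and P: "(l, i, j) \<in> D" and Q: "(l, Suc i, j) \<in> D"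
 shows "b (s (l, i, j)) ~= b (s (l, Suc i, j))"
 using s
\<comment> \<open>A swap that moves a node not south-east of \<open>P\<close> lowers the first
  summand and keeps the entry of \<open>Q\<close>; a swap that moves \<open>Q\<close> lowers its
  entry and keeps the first summand.\<close>
proof (induction "(\<Sum>N\<in>{N\<in>D. \<not> pre (l, i, j) N}. s N) + s (l, Suc i, j)" arbitrary: s rule: less_induct)
 case less
 let ?P = "(l, i, j)" and ?Q = "(l, Suc i, j)" and ?X = "{N\<in>D. \<not> pre (l, i, j) N}"
 note s = less.prems(1)
 have fX: "finite ?X" by simp
 have lt: "s ?P < s ?Q" using std_cover[OF s P Q] by simp
 have rng: "1 <= s ?P" "s ?Q <= n" using std_range[OF s] P Q by auto
 show ?case
 proof
  assume bb: "b (s ?P) = b (s ?Q)"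
  have win: "b k = b (s ?P)" if "s ?P <= k" "k <= s ?Q" for k
   using convex_labD[OF b rng(1) that rng(2) bb] .
  have step: False if k: "s ?P <= k" "k < s ?Q" and nc: "\<not> cover (nd' s k) (nd' s (Suc k))"
   and w: "s ?P <= (sr k \<circ> s) ?P" "(sr k \<circ> s) ?P <= s ?Q" "s ?P <= (sr k \<circ> s) ?Q" "(sr k \<circ> s) ?Q <= s ?Q"
   and m: "(\<Sum>N\<in>?X. (sr k \<circ> s) N) + (sr k \<circ> s) ?Q < (\<Sum>N\<in>?X. s N) + s ?Q" for k
  proof -
   have kr: "1 <= k" "k < n" using k rng by simp_all
   have s': "sr k \<circ> s \<in> S" using tsw_std[OF s kr] nc by blast
   have "b k = b (Suc k)" using win[of k] win[of "Suc k"] k by simp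
   then have nz: "v (sr k \<circ> s) ~= 0" using tt_eigen_swap(1)[OF s kr e[OF kr _ s] less.prems(2) s'] by blast
   have "b ((sr k \<circ> s) ?P) ~= b ((sr k \<circ> s) ?Q)" by (rule less.hyps[OF m s' nz])
   then show False using win[OF w(1,2)] win[OF w(3,4)] by simp
  qed
  show False
  proof (cases "\<exists>k. s ?P <= k \<and> k < s ?Q \<and> pre ?P (nd' s k) \<and> \<not> pre ?P (nd' s (Suc k))")
   case True
   then obtain k where k: "s ?P <= k" "k < s ?Q" "pre ?P (nd' s k)" "\<not> pre ?P (nd' s (Suc k))" by blast
   have kr: "1 <= k" "k < n" using k rng by simp_all
   have K: "nd' s k \<in> D" "s (nd' s k) = k" "nd' s (Suc k) \<in> D" "s (nd' s (Suc k)) = Suc k"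
    using nod_in[OF s] s_nod[OF s] kr by simp_all
   have nQ: "s ?Q ~= Suc k" using nod_s[OF s Q] k(4) by (auto simp: pre_def)
   have le: "(sr k \<circ> s) N <= s N" if "N \<in> ?X" for N
    using that k(3) nod_s[OF s, of N] by (auto simp: sr_apply)
   show False
   proof (rule step[OF k(1,2)])
    show "\<not> cover (nd' s k) (nd' s (Suc k))" using k(3,4) by (cases "nd' s k") (auto simp: pre_def)
    show "s ?P <= (sr k \<circ> s) ?P" "(sr k \<circ> s) ?P <= s ?Q" "s ?P <= (sr k \<circ> s) ?Q" "(sr k \<circ> s) ?Q <= s ?Q"
     using k(1,2) lt nQ by (auto simp: sr_apply)
    have "(\<Sum>N\<in>?X. (sr k \<circ> s) N) < (\<Sum>N\<in>?X. s N)"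
    proof (rule sum_strict_mono_ex1[OF fX])
     show "\<forall>N\<in>?X. (sr k \<circ> s) N <= s N" using le by blast
     show "\<exists>N\<in>?X. (sr k \<circ> s) N < s N"
      by (rule bexI[of _ "nd' s (Suc k)"]) (use K k(4) in \<open>simp_all add: sr_apply\<close>)
    qed
    moreover have "(sr k \<circ> s) ?Q = s ?Q" using k(2) nQ by (simp add: sr_apply)
    ultimately show "(\<Sum>N\<in>?X. (sr k \<circ> s) N) + (sr k \<circ> s) ?Q < (\<Sum>N\<in>?X. s N) + s ?Q" by simp
   qed
  next
   case False
   have all: "pre ?P (nd' s k)" if "s ?P <= k" "k <= s ?Q" for k
    using that
   proof (induction k rule: dec_induct)
    case base
    then show ?case using nod_s[OF s P] by (simp add: pre_def)
   next
    case (step k)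
    then show ?case using False by simp
   qed
   define k where "k = s ?Q - 1"
   have k: "s ?P <= k" "Suc k = s ?Q" "k < s ?Q" using lt by (simp_all add: k_def)
   have kr: "1 <= k" "k < n" using k rng by simp_all
   have K: "nd' s (Suc k) = ?Q" "nd' s k \<in> D" "s (nd' s k) = k" using nod_s[OF s Q] nod_in[OF s] s_nod[OF s] k kr by simp_all
   have pk: "pre ?P (nd' s k)" using all k by simp
   show False
   proof (cases "nd' s k = ?P")
    case True
    then show False
     using tt_eigen_swap(2)[OF s kr e[OF kr _ s] less.prems(2), of l i j] K(1) win[of k] win[of "Suc k"] k by simp
   next
    case ne: False
    have kP: "s ?P ~= k" using ne nod_s[OF s P] by auto
    show False
    proof (rule step[OF k(1,3)])
     show "\<not> cover (nd' s k) (nd' s (Suc k))" using ne pk unfolding K(1)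
      by (cases "nd' s k") (auto simp: pre_def)
     show "s ?P <= (sr k \<circ> s) ?P" "(sr k \<circ> s) ?P <= s ?Q" "s ?P <= (sr k \<circ> s) ?Q" "(sr k \<circ> s) ?Q <= s ?Q"
      using k lt kP by (auto simp: sr_apply)
     have "(sr k \<circ> s) N = s N" if "N \<in> ?X" for N
     proof -
      have "pre ?P (nd' s (Suc k))" unfolding K(1) by (simp add: pre_def)
      then have "s N ~= k" "s N ~= Suc k" using that pk nod_s[OF s, of N] by auto
      then show ?thesis by (simp add: sr_apply)
     qed
     then have "(\<Sum>N\<in>?X. (sr k \<circ> s) N) = (\<Sum>N\<in>?X. s N)" by (intro sum.cong) auto
     moreover have "(sr k \<circ> s) ?Q < s ?Q" unfolding comp_def k(2)[symmetric] by (simp add: sr_apply)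
     ultimately show "(\<Sum>N\<in>?X. (sr k \<circ> s) N) + (sr k \<circ> s) ?Q < (\<Sum>N\<in>?X. s N) + s ?Q" by simp
    qed
   qed
  qed
 qed
qed

lemma rowl_lex:
 assumes "1 <= i" "i < j" "j <= msize mu"
 shows "fst (rowl mu i) < fst (rowl mu j) \<or> fst (rowl mu i) = fst (rowl mu j) \<and> snd (rowl mu i) <= snd (rowl mu j)"
 using nd_below[of i mu j] assms unfolding node_below_def rowl_def by (auto split: prod.splits)

context
 fixes mu :: mpart and v :: "tableau => laurent"
 assumes mu: "multipartition ell n mu"
begin

lemma mu_facts: "length mu = ell" "msize mu = n" "convex_lab n (rowl mu)"
 using multipartitionD[OF mu] convex_rowl[of mu] by auto

lemma mm_UV: "s \<in> S ==> app (rep.mm mu) v s ~= 0 ==> UV mu s ~= 0"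
 unfolding rep.mm_def by (auto simp: app_uu)

lemma mm_eigen:
 assumes "1 <= r" "r < n" "rowl mu r = rowl mu (Suc r)"
 shows "opT r (app (rep.mm mu) v) s = tt * app (rep.mm mu) v s"
proof -
 have "rT r * rep.mm mu = lsc tt * rep.mm mu"
  by (simp only: rep.mm_alt[OF mu_facts(2)] mult.assoc[symmetric] rep.T_mult_XX[OF mu_facts(3) assms])
 then have "app (rT r * rep.mm mu) v s = app (lsc tt * rep.mm mu) v s" by simp
 then show ?thesis by simp
qed

text \<open>Induction down a column. A position in an earlier component of \<open>mu\<close> would
  force the entry of \<open>(l, 0, 0)\<close>, a node of content \<open>kappa ! l\<close>, into the
  range where \<open>uu mu\<close> has a factor vanishing at that content. Each further row moves
  strictly on, by \<open>support_no_column\<close>.\<close>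

lemma support_rows:
 assumes s: "s \<in> S" and nz: "app (rep.mm mu) v s ~= 0" and x: "(l, r, c) \<in> D"
  and b: "rowl mu (s (l, r, c)) = (l', r')"
 shows "l < l' \<or> l = l' \<and> r <= r'"
 using x b
proof (induction r arbitrary: l' r')
 case 0
 have comp: "l <= l'" if x: "(l, r, c) \<in> D" and b: "rowl mu (s (l, r, c)) = (l', r')" for r l' r'
 proof (rule ccontr)
  assume l: "\<not> l <= l'"
  have d: "(l, 0, 0) \<in> D" using D_down[OF x] by simp
  have n: "1 <= s (l, r, c)" "s (l, r, c) <= n" using std_range[OF s x] by simp_all
  obtain c' where N: "nd mu (s (l, r, c)) = (l', r', c')"
   using b unfolding rowl_def by (cases "nd mu (s (l, r, c))") simp
  have "(l', r', c') \<in> diagram mu" "tlam mu (l', r', c') = s (l, r, c)"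
   using nd_in[of "s (l, r, c)" mu] tlam_nd[of "s (l, r, c)" mu] n mu_facts N by simp_all
  then have "s (l, r, c) <= csum mu l" using comp_less_iff[of l' r' c' mu l] l by simp
  moreover have "s (l, 0, 0) <= s (l, r, c)" using std_mono[OF s x] by simp
  ultimately have le: "1 <= s (l, 0, 0)" "s (l, 0, 0) <= csum mu (l - 1 + 1)" using std_range[OF s d] l by simp_all
  have "l < ell" using d length_lam by (simp add: diagram_iff)
  then have "l - 1 < length mu - 1" using l mu_facts by simp
  then have "cc s (s (l, 0, 0)) ~= kappa ! (l - 1 + 1)" using mm_UV[OF s nz] le unfolding UV_nonzero_iff by blast
  moreover have "cc s (s (l, 0, 0)) = kappa ! l" using nod_s[OF s d] std_range[OF s d] by (simp add: cc_def)
  ultimately show False using l by simp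
 qed
 then show ?case using 0 by fastforce
next
 case (Suc r)
 have P: "(l, r, c) \<in> D" using D_down1(2)[OF Suc.prems(1)] .
 obtain l2 r2 where b2: "rowl mu (s (l, r, c)) = (l2, r2)" by (cases "rowl mu (s (l, r, c))")
 have ih: "l < l2 \<or> l = l2 \<and> r <= r2" using Suc.IH[OF P b2] .
 have "s (l, r, c) < s (l, Suc r, c)" using std_cover[OF s P Suc.prems(1)] by simp
 then have lex: "l2 < l' \<or> l2 = l' \<and> r2 <= r'"
  using rowl_lex[of "s (l, r, c)" "s (l, Suc r, c)" mu] std_range[OF s P] std_range[OF s Suc.prems(1)] mu_facts b2 Suc.prems(2)
  by simp
 have "(l2, r2) ~= (l', r')"
  using support_no_column[of "rowl mu" "app (rep.mm mu) v", OF mu_facts(3) _ s nz P Suc.prems(1)] mm_eigen b2 Suc.prems(2)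
  by fastforce
 then show ?case using ih lex by auto
qed

lemma support_move:
 assumes s: "s \<in> S" and nz: "app (rep.mm mu) v s ~= 0" and l: "l < ell" and k: "1 <= k" "k <= off mu l i"
 shows "tla (nd' s k) <= off lam l i"
proof -
 have kn: "k <= n" using k off_le_msize[of l mu i] l mu_facts by simp
 obtain l0 r0 c0 where N: "nd' s k = (l0, r0, c0)" by (metis prod_cases3)
 have x: "(l0, r0, c0) \<in> D" "s (l0, r0, c0) = k" using nod_in[OF s k(1) kn] s_nod[OF s k(1) kn] N by simp_all
 obtain l' r' c' where M: "nd mu k = (l', r', c')" by (metis prod_cases3)
 have y: "(l', r', c') \<in> diagram mu" "tlam mu (l', r', c') = k"
  using nd_in[of k mu] tlam_nd[of k mu] k kn mu_facts M by simp_all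
 have "l' < l \<or> l' = l \<and> r' < i" using row_less_off[OF y(1), of l i] y(2) k l mu_facts by simp
 moreover have "l0 < l' \<or> l0 = l' \<and> r0 <= r'" using support_rows[OF s nz x(1)] x(2) M by (simp add: rowl_def)
 ultimately show ?thesis unfolding N using row_less_off[OF x(1), of l i] l length_lam by auto
qed

text \<open>The first \<open>off mu l i\<close> entries occupy nodes among the first
  \<open>off lam l i\<close> in reading order; counting gives the inequality.\<close>

lemma support_dominates:
 assumes s: "s \<in> S" and nz: "app (rep.mm mu) v s ~= 0"
 shows "dominates lam mu"
 unfolding dominates_iff
proof (intro allI impI)
 fix l i assume l: "l < length lam"
 have kn: "k <= n" if "k <= off mu l i" for k using that off_le_msize[of l mu i] l mu_facts length_lam by simp
 have "(\<lambda>k. tla (nd' s k)) ` {1..off mu l i} \<subseteq> {1..off lam l i}"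
  using support_move[OF s nz, of l _ i] l length_lam tlam_range(1)[OF nod_in[OF s]] kn by auto
 moreover have "inj_on (\<lambda>k. tla (nd' s k)) {1..off mu l i}"
 proof (rule inj_onI)
  fix j k assume jk: "j \<in> {1..off mu l i}" "k \<in> {1..off mu l i}" and eq: "tla (nd' s j) = tla (nd' s k)"
  have r: "1 <= j" "j <= n" "1 <= k" "k <= n" using jk kn[of j] kn[of k] by simp_all
  have "nd' s j = nd' s k" using inj_onD[OF tlam_inj eq] nod_in[OF s r(1,2)] nod_in[OF s r(3,4)] by simp
  then show "j = k" using s_nod[OF s r(1,2)] s_nod[OF s r(3,4)] by metis
 qed
 ultimately have "card {1..off mu l i} <= card {1..off lam l i}" by (intro card_inj_on_le) auto
 then show "off mu l i <= off lam l i" by simp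
qed

end

lemma std_incr:
 assumes s: "s \<in> S" shows "incr n (rowl lam) (dperm n lam s)"
 unfolding incr_def
proof (intro allI impI)
 fix i j assume ij: "1 <= i" "i < j" "j <= n" "rowl lam i = rowl lam j"
 have I: "nd lam i \<in> D" "nd lam j \<in> D" "tla (nd lam i) = i" "tla (nd lam j) = j"
  using nd_in[of i lam] nd_in[of j lam] tlam_nd[of i lam] tlam_nd[of j lam] ij sz by simp_all
 obtain l r c where N: "nd lam i = (l, r, c)" by (metis prod_cases3)
 obtain c' where M: "nd lam j = (l, r, c')" using ij(4) N unfolding rowl_def by (cases "nd lam j") simp
 have "c < c'" using tlam_eq[of l r c lam] tlam_eq[of l r c' lam] I N M ij by simp
 then have "s (nd lam i) < s (nd lam j)" using std_less[OF s, of l r c' r c] I N M by simp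
 then show "dperm n lam s i < dperm n lam s j"
  using dperm_spec(2)[OF sz std_bij[OF s] I(1)] dperm_spec(2)[OF sz std_bij[OF s] I(2)] I by simp
qed

text \<open>By \<open>support_rows\<close> no entry lies in a row that starts after the row of its
  position. The row offsets are merely permuted, so their sums agree and all inequalities are
  equalities. Hence \<open>dperm n lam s\<close> is in the row stabiliser, and it increases along
  rows.\<close>

lemma support_tlam:
 assumes s: "s \<in> S" and nz: "app (rep.mm lam) v s ~= 0"
 shows "s = tla"
proof -
 let ?d = "dperm n lam s"
 let ?e = "inv ?d"
 let ?f = "\<lambda>k. off lam (fst (rowl lam k)) (snd (rowl lam k))"
 note b = convex_rowl[of lam, unfolded sz]
 have d: "?d permutes {1..n}" "\<And>x. x \<in> D ==> ?d (tla x) = s x" using dperm_spec[OF sz std_bij[OF s]] by auto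
 have e: "?e permutes {1..n}" using permutes_inv[OF d(1)] .
 have ek: "?e k = tla (nd' s k)" if "1 <= k" "k <= n" for k
  using d(2)[OF nod_in[OF s that]] s_nod[OF s that] permutes_inverses(2)[OF d(1), of "tla (nd' s k)"] by simp
 have row: "rowl lam k = (l, r) ==> \<exists>c. (l, r, c) \<in> D \<and> tla (l, r, c) = k" if k: "1 <= k" "k <= n" for k l r
  using nd_in[of k lam] tlam_nd[of k lam] k sz unfolding rowl_def by (cases "nd lam k") auto
 have le: "?f (?e k) <= ?f k" if k: "1 <= k" "k <= n" for k
 proof -
  obtain l0 r0 c0 where N: "nd' s k = (l0, r0, c0)" by (metis prod_cases3)
  have x: "(l0, r0, c0) \<in> D" "s (l0, r0, c0) = k" using nod_in[OF s k] s_nod[OF s k] N by simp_all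
  obtain l r where lr: "rowl lam k = (l, r)" by (cases "rowl lam k")
  have "l < length lam" using row[OF k lr] by (auto simp: diagram_iff)
  moreover have "l0 < l \<or> l0 = l \<and> r0 <= r" using support_rows[OF mp s nz x(1)] x(2) lr by simp
  moreover have "l0 < length lam" using x by (simp add: diagram_iff)
  ultimately have "off lam l0 r0 <= off lam l r"
   using off_le_csum[of l0 lam r0] csum_mono[of "Suc l0" l lam] off_ge_csum[of lam l r] sum_take_mono[of r0 r "lam ! l"]
   by (auto simp: off_def)
  then show ?thesis using ek[OF k] N rowl_tlam[OF x(1)] lr by simp
 qed
 have "(\<Sum>k\<in>{1..n}. ?f (?e k)) = (\<Sum>k\<in>{1..n}. ?f k)"
  using sum.permute[OF e, of ?f] by (simp add: comp_def)
 note eq = this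
 have fe: "?f (?e k) = ?f k" if "1 <= k" "k <= n" for k
 proof (rule ccontr)
  assume "?f (?e k) ~= ?f k"
  then have "?f (?e k) < ?f k" using le[OF that] by simp
  then have "(\<Sum>k\<in>{1..n}. ?f (?e k)) < (\<Sum>k\<in>{1..n}. ?f k)"
   using le that by (intro sum_strict_mono_ex1) auto
  then show False using eq by simp
 qed
 have "rowl lam (?e k) = rowl lam k" if k: "1 <= k" "k <= n" for k
 proof -
  obtain l r l' r' where lr: "rowl lam k = (l, r)" "rowl lam (?e k) = (l', r')" by (cases "rowl lam k", cases "rowl lam (?e k)")
  obtain c c' where c: "(l, r, c) \<in> D" "(l', r', c') \<in> D" using row[OF k lr(1)] row[OF perm_range[OF e k] lr(2)] by blast
  have z: "(l, r, 0) \<in> D" "(l', r', 0) \<in> D" using D_down[OF c(1)] D_down[OF c(2)] by simp_all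
  have "tla (l, r, 0) = tla (l', r', 0)" using fe[OF k] lr tlam_eq[OF z(1)] tlam_eq[OF z(2)] by simp
  then show ?thesis using inj_onD[OF tlam_inj _ z] lr by simp
 qed
 then have "?e \<in> young n (rowl lam)" using e unfolding young_def by simp
 then have "?d \<in> young n (rowl lam)" using young_inv[of ?e n "rowl lam"] inv_inv_eq[OF permutes_bij[OF d(1)]] by simp
 then have "?d = id" using young_incr_id[OF b _ std_incr[OF s]] by simp
 then have "s x = tla x" if "x \<in> D" for x using d(2)[OF that] by simp
 then show ?thesis using std_out[OF s] std_out[OF tlam_std] by (metis ext)
qed

text \<open>Consecutive positions of one row are horizontal neighbours in the initial tableau, where
  the block of \<open>T r\<close> degenerates to the eigenvalue \<open>t\<close>.\<close>

lemma tlam_swap: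
 assumes r: "1 <= r" "r < n" "rowl lam r = rowl lam (Suc r)"
 shows "opT r v tla = tt * v tla"
proof -
 have nn: "nd' tla k = nd lam k" for k by (simp add: nod_def nd_def)
 obtain l i c where N: "nd lam r = (l, i, c)" by (metis prod_cases3)
 obtain c' where M: "nd lam (Suc r) = (l, i, c')" using r(3) N unfolding rowl_def by (cases "nd lam (Suc r)") simp
 have "(l, i, c) \<in> D" "(l, i, c') \<in> D" "tla (l, i, c) = r" "tla (l, i, c') = Suc r"
  using nd_in[of r lam] nd_in[of "Suc r" lam] tlam_nd[of r lam] tlam_nd[of "Suc r" lam] r sz N M by simp_all
 then have c': "c' = Suc c" using tlam_eq[of l i c lam] tlam_eq[of l i c' lam] by simp
 have "cover (nd' tla r) (nd' tla (Suc r))" unfolding nn N M c' by simp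
 then have ns: "sr r \<circ> tla \<notin> S" using tsw_std[OF tlam_std r(1,2)] by blast
 have "cc tla (Suc r) = cc tla r + 1" using r N M c' by (simp add: cc_def nn)
 then have "xx tla (Suc r) = tt * xx tla r" unfolding xx_def by (simp add: power_int_add)
 then have "smA (xx tla r) (xx tla (Suc r)) = tt" using sm_row(1)[OF xx_nonzero] by simp
 then show ?thesis using ns by (simp add: opT_std[OF tlam_std])
qed

lemma TW_young_tlam:
 assumes "w \<in> young n (rowl lam)"
 shows "app (rep.TW w) v tla = tt ^ card (invs n w) * v tla"
 using assms
proof (induction "card (invs n w)" arbitrary: w rule: less_induct)
 case less
 note b = convex_rowl[of lam, unfolded sz]
 show ?case
 proof (cases "w = id")
  case True
  show ?thesis unfolding True by (simp only: invs_id card.empty power_0 rep.TW_id mult_1_left app_ring)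
 next
  case False
  then have "\<not> incr n (rowl lam) w" using young_incr_id[OF b less.prems] by blast
  then obtain r where r: "1 <= r" "r < n" "rowl lam r = rowl lam (Suc r)" "w (Suc r) < w r"
   using incr_descent[OF b youngD(1)[OF less.prems]] by blast
  have w1: "w \<circ> sr r \<in> young n (rowl lam)" using young_comp[OF less.prems young_sr[OF r(1-3)]] .
  have c: "card (invs n w) = Suc (card (invs n (w \<circ> sr r)))"
   using card_invs_down[OF youngD(1)[OF less.prems] r(1,2,4)] .
  have "app (rep.TW w) v tla = opT r (app (rep.TW (w \<circ> sr r)) v) tla"
   using rep.TW_left[OF youngD(1)[OF less.prems] r(1,2,4)] by simp
  also have "\<dots> = tt * app (rep.TW (w \<circ> sr r)) v tla" by (rule tlam_swap[OF r(1-3)])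
  finally show ?thesis using less.hyps[OF _ w1] c by simp
 qed
qed

text \<open>The scalar by which \<open>mm lam\<close> acts at the initial tableau; its second factor
  is the Poincare polynomial of the row stabiliser.\<close>

definition gam :: laurent where
 "gam = UV lam tla * (\<Sum>w\<in>young n (rowl lam). tt ^ card (invs n w))"

lemma mm_lam:
 assumes s: "s \<in> S"
 shows "app (rep.mm lam) v s = (if s = tla then gam * v tla else 0)"
proof (cases "s = tla")
 case True
 have "app (rep.XX (rowl lam)) v tla = (\<Sum>w\<in>young n (rowl lam). tt ^ card (invs n w) * v tla)"
  unfolding rep.XX_def app_op_sum by (intro sum.cong refl TW_young_tlam)
 then show ?thesis using s True by (simp add: rep.mm_def app_uu gam_def sum_distrib_right mult.assoc)
next
 case False
 then show ?thesis using support_tlam[OF s] by auto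
qed

end

section \<open>Murphy elements as rank one operators, and the Gram entries\<close>

lemma perm_descent:
 assumes w: "w permutes {1..n}" and "w ~= id"
 obtains r where "1 <= r" "r < n" "w (Suc r) < w r"
proof -
 have b: "convex_lab n (\<lambda>_. 0 :: nat)" by (simp add: convex_lab_def)
 have "w \<in> young n (\<lambda>_. 0 :: nat)" using w by (simp add: young_def)
 then have "\<not> incr n (\<lambda>_. 0 :: nat) w" using young_incr_id[OF b] assms(2) by blast
 then show thesis using incr_descent[OF b w] that by blast
qed

lemma laurent_ring_mult:
 assumes "f \<in> laurent_ring" "g \<in> laurent_ring" shows "f * g \<in> laurent_ring"
proof -
 have 1: "tt powi k * tt powi j \<in> laurent_ring" for k j
  by (simp flip: power_int_add)
 have 2: "tt powi k * g \<in> laurent_ring" for k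
  using assms(2)
  by (induction rule: laurent_ring_induct) (simp_all add: 1 distrib_left laurent_ring_add laurent_ring_uminus)
 show ?thesis using assms(1)
  by (induction rule: laurent_ring_induct) (simp_all add: 2 distrib_right laurent_ring_add laurent_ring_uminus)
qed

text \<open>Makes the coefficients of an expansion explicit, so that one expansion can be evaluated
  on the modules of different shapes.\<close>

lemma fa_span_coeffs:
 assumes "finite I" and "f \<in> fa_span (g ` I)"
 shows "\<exists>c. (\<forall>i\<in>I. c i \<in> laurent_ring) \<and> f = fa_sum (\<lambda>i. fa_smult (c i) (g i)) I"
 using assms(2)
proof induction
 case zero
 then show ?case by (intro exI[of _ "\<lambda>i. 0"]) (simp add: fa_sum_def fa_smult_def fa_zero_def)
next
 case (base s)
 then obtain i where i: "i \<in> I" "s = g i" by blast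
 have "s = fa_sum (\<lambda>j. fa_smult (if j = i then 1 else 0) (g j)) I"
  using i assms(1) by (simp add: fa_sum_def fa_smult_def if_distrib[of "\<lambda>x. x * _"] cong: if_cong)
 then show ?case by (intro exI[of _ "\<lambda>j. if j = i then 1 else 0"]) simp
next
 case (add a b)
 then obtain c d where "\<forall>i\<in>I. c i \<in> laurent_ring" "a = fa_sum (\<lambda>i. fa_smult (c i) (g i)) I"
  "\<forall>i\<in>I. d i \<in> laurent_ring" "b = fa_sum (\<lambda>i. fa_smult (d i) (g i)) I" by blast
 then show ?case
  by (intro exI[of _ "\<lambda>i. c i + d i"])
   (simp add: laurent_ring_add fa_sum_def fa_smult_def fa_add_def sum.distrib distrib_right)
next
 case (smult a k)
 then obtain c where "\<forall>i\<in>I. c i \<in> laurent_ring" "a = fa_sum (\<lambda>i. fa_smult (c i) (g i)) I" by blast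
 then show ?case using smult
  by (intro exI[of _ "\<lambda>i. k * c i"])
   (simp add: laurent_ring_mult fa_sum_def fa_smult_def sum_distrib_left mult.assoc)
qed

lemma fa_span_sum:
 assumes "finite I" "\<And>i. i \<in> I ==> c i \<in> laurent_ring" "\<And>i. i \<in> I ==> c i ~= 0 ==> g i \<in> X"
 shows "fa_sum (\<lambda>i. fa_smult (c i) (g i)) I \<in> fa_span X"
 using assms
proof (induction I)
 case (insert i I)
 have "fa_smult (c i) (g i) \<in> fa_span X"
 proof (cases "c i = 0")
  case True
  then have "fa_smult (c i) (g i) = fa_zero" by (simp add: fa_smult_def fa_zero_def)
  then show ?thesis by (simp add: fa_span.zero)
 next
  case False
  then show ?thesis using insert by (intro fa_span.smult fa_span.base) simp_all
 qed
 then show ?case using insert by (simp add: fa_sum_insert fa_span.add)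
qed (simp add: fa_sum_empty fa_span.zero)

context seminormal
begin

definition del :: "tableau => tableau => laurent" where
 "del u = (\<lambda>s. if s = u then 1 else 0)"
text \<open>By \<open>mst_act\<close> this vector spans the image, on standard coordinates, of every
  Murphy element with left index \<open>t\<close>.\<close>

definition vv :: "tableau => tableau => laurent" where
 "vv t = app (rep.TW (inv (dperm n lam t))) (del tla)"

lemma dp: "t \<in> S ==> dperm n lam t permutes {1..n}" "t \<in> S ==> x \<in> D ==> dperm n lam t (tla x) = t x"
 using dperm_spec[OF sz std_bij] by blast+

lemma dperm_step:
 assumes t: "t \<in> S" and ne: "t ~= tla"
 obtains r where "1 <= r" "r < n" "sr r \<circ> t \<in> S" "tla (nd' (sr r \<circ> t) r) < tla (nd' (sr r \<circ> t) (Suc r))"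
  "inv (dperm n lam t) = inv (dperm n lam (sr r \<circ> t)) \<circ> sr r"
  "inv (dperm n lam (sr r \<circ> t)) r < inv (dperm n lam (sr r \<circ> t)) (Suc r)"
proof -
 let ?w = "inv (dperm n lam t)"
 have w: "?w permutes {1..n}" using permutes_inv[OF dp(1)[OF t]] .
 have wk: "inv (dperm n lam t) k = tla (nd' t k)" if "1 <= k" "k <= n" "t \<in> S" for k t
  using dp(2)[OF that(3) nod_in[OF that(3,1,2)]] s_nod[OF that(3,1,2)] permutes_inverses(2)[OF dp(1)[OF that(3)], of "tla (nd' t k)"] by simp
 have "?w ~= id"
 proof
  assume "?w = id"
  then have "dperm n lam t = id" using inv_inv_eq[OF permutes_bij[OF dp(1)[OF t]]] by (metis inv_id)
  then have "t x = tla x" if "x \<in> D" for x using dp(2)[OF t that] by simp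
  then have "t = tla" using std_out[OF t] std_out[OF tlam_std] by (metis ext)
  then show False using ne by simp
 qed
 then obtain r where r: "1 <= r" "r < n" "?w (Suc r) < ?w r" using perm_descent[OF w] by blast
 have lt: "tla (nd' t (Suc r)) < tla (nd' t r)" using r wk[OF _ _ t, of r] wk[OF _ _ t, of "Suc r"] by simp
 have "\<not> cover (nd' t r) (nd' t (Suc r))"
  using std_cover[OF tlam_std nod_in[OF t, of r] nod_in[OF t, of "Suc r"]] lt r by auto
 then have t': "sr r \<circ> t \<in> S" using tsw_std[OF t r(1,2)] by blast
 have n': "nd' (sr r \<circ> t) r = nd' t (Suc r)" "nd' (sr r \<circ> t) (Suc r) = nd' t r"
  using tsw_nod[OF std_bij[OF t] r(1,2)] r by (simp_all add: sr_apply)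
 have p: "sr r \<circ> dperm n lam t permutes {1..n}" using permutes_compose[OF dp(1)[OF t] sr_permutes[OF r(1,2)]] .
 have d': "dperm n lam (sr r \<circ> t) = sr r \<circ> dperm n lam t"
  by (rule perm_eqI[OF sz dp(1)[OF t'] p]) (simp only: dp(2)[OF t'] dp(2)[OF t] comp_apply)
 have "inv (dperm n lam (sr r \<circ> t)) = inv (dperm n lam t) \<circ> inv (sr r)"
  unfolding d' using o_inv_distrib[OF permutes_bij[OF sr_permutes[OF r(1,2)]] permutes_bij[OF dp(1)[OF t]]] .
 then have iv: "inv (dperm n lam t) = inv (dperm n lam (sr r \<circ> t)) \<circ> sr r"
  by (simp add: comp_assoc permutes_inv_o(2)[OF sr_permutes[OF r(1,2)]])
 show thesis
 proof (rule that[OF r(1,2) t' _ iv])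
  show "tla (nd' (sr r \<circ> t) r) < tla (nd' (sr r \<circ> t) (Suc r))" using lt n' by simp
  then show "inv (dperm n lam (sr r \<circ> t)) r < inv (dperm n lam (sr r \<circ> t)) (Suc r)"
   using wk[OF _ _ t', of r] wk[OF _ _ t', of "Suc r"] r by simp
 qed
qed

lemma vv_tlam: "vv tla = del tla"
 unfolding vv_def dperm_tlam[OF sz] inv_id rep.TW_id by simp

lemma IP_step:
 assumes s: "s \<in> S" and r: "1 <= r" "r < n" and s': "sr r \<circ> s \<in> S"
 shows "card (IP s) <= Suc (card (IP (sr r \<circ> s)))"
proof -
 have nn: "nd' (sr r \<circ> s) r = nd' s (Suc r)" "nd' (sr r \<circ> s) (Suc r) = nd' s r"
  using tsw_nod[OF std_bij[OF s] r] r by (simp_all add: sr_apply)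
 have "tla (nd' s r) ~= tla (nd' s (Suc r))"
  using inj_onD[OF tlam_inj _ nod_in[OF s] nod_in[OF s], of r "Suc r"] s_nod[OF s, of r] s_nod[OF s, of "Suc r"] r by auto
 then consider "tla (nd' s r) < tla (nd' s (Suc r))" | "tla (nd' s (Suc r)) < tla (nd' s r)" by linarith
 then show ?thesis
 proof cases
  case 1
  then show ?thesis using IP_tsw[OF s r] by simp
 next
  case 2
  then show ?thesis using IP_tsw[OF s' r] nn by simp
 qed
qed

text \<open>Induction on inversions. Applying \<open>T r\<close> adds swapped tableaux with
  coefficient \<open>smB\<close> and raises the number of inversions by at most one, so the value at
  \<open>t\<close> comes from \<open>sr r \<circ> t\<close> alone.\<close>

lemma vv_triangular:
 assumes "t \<in> S"
 shows "vv t t = pc t \<and> (\<forall>s\<in>S. vv t s ~= 0 --> s = t \<or> card (IP s) < card (IP t))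
  \<and> perm_length n (dperm n lam t) = card (IP t)"
 using assms
proof (induction "card (IP t)" arbitrary: t rule: less_induct)
 case less
 note t = less.prems
 show ?case
 proof (cases "t = tla")
  case True
  have "perm_length n (dperm n lam tla) = 0"
   unfolding dperm_tlam[OF sz] by (simp add: perm_length_eq[OF permutes_id] del: id_apply)
  then show ?thesis unfolding True vv_tlam by (simp add: del_def pc_def IP_tl)
 next
  case False
  obtain r where r: "1 <= r" "r < n" and t': "sr r \<circ> t \<in> S"
   and up: "tla (nd' (sr r \<circ> t) r) < tla (nd' (sr r \<circ> t) (Suc r))"
   and iv: "inv (dperm n lam t) = inv (dperm n lam (sr r \<circ> t)) \<circ> sr r"
   and lt: "inv (dperm n lam (sr r \<circ> t)) r < inv (dperm n lam (sr r \<circ> t)) (Suc r)"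
   using dperm_step[OF t False] by blast
  let ?t = "sr r \<circ> t"
  let ?P = "nd' ?t r" and ?Q = "nd' ?t (Suc r)"
  have ip: "IP t = insert (?P, ?Q) (IP ?t)" "(?P, ?Q) \<notin> IP ?t" using IP_tsw[OF t' r up] by simp_all
  then have c: "card (IP t) = Suc (card (IP ?t))" by simp
  have ih: "vv ?t ?t = pc ?t" "\<And>s. s \<in> S ==> vv ?t s ~= 0 ==> s = ?t \<or> card (IP s) < card (IP ?t)"
   "perm_length n (dperm n lam ?t) = card (IP ?t)"
   using less.hyps[OF _ t'] c by auto
  have p': "inv (dperm n lam ?t) permutes {1..n}" using permutes_inv[OF dp(1)[OF t']] .
  have v: "vv t = opT r (vv ?t)"
   unfolding vv_def iv rep.T_mult_TW(1)[OF p' r lt, symmetric] by simp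
  have "perm_length n (dperm n lam t) = card (IP t)"
   using card_invs_up[OF p' r lt] ih(3) c card_invs_inv[OF dp(1)[OF t]] card_invs_inv[OF dp(1)[OF t']]
   unfolding iv[symmetric] perm_length_eq[OF dp(1)[OF t]] perm_length_eq[OF dp(1)[OF t']] by presburger
  moreover have "s = t \<or> card (IP s) < card (IP t)" if s: "s \<in> S" and nz: "vv t s ~= 0" for s
  proof -
   have "vv ?t s ~= 0 \<or> (sr r \<circ> s \<in> S \<and> vv ?t (sr r \<circ> s) ~= 0)"
    using nz unfolding v opT_std[OF s] by (auto split: if_splits)
   then show ?thesis
   proof
    assume "vv ?t s ~= 0"
    then show ?thesis using ih(2)[OF s] c by auto
   next
    assume a: "sr r \<circ> s \<in> S \<and> vv ?t (sr r \<circ> s) ~= 0"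
    have "s = t" if "sr r \<circ> s = ?t" using arg_cong[OF that, of "\<lambda>x. sr r \<circ> x"] by simp
    then show ?thesis using ih(2)[of "sr r \<circ> s"] a c IP_step[OF s r] by auto
   qed
  qed
  moreover have "vv t t = pc t"
  proof -
   have "t ~= ?t" using c arg_cong[of t ?t "\<lambda>t. card (IP t)"] by linarith
   then have "vv ?t t = 0" using ih(2)[OF t] c by fastforce
   then have "vv t t = smB (xx t r) (xx t (Suc r)) * pc ?t" unfolding v opT_std[OF t] using t' ih(1) by simp
   moreover have "xx t r = zz ?Q" "xx t (Suc r) = zz ?P"
    using xx_zz r tsw_nod[OF std_bij[OF t] r] by (simp_all add: sr_apply)
   ultimately show ?thesis unfolding pc_def ip(1) using ip(2) by (simp add: smB_def)
  qed
  ultimately show ?thesis by blast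
 qed
qed

text \<open>Among the indices with nonzero coefficient take one with the most inversions; at that
  tableau only the diagonal term is left.\<close>

lemma vv_independent:
 assumes z: "\<And>s. s \<in> S ==> (\<Sum>t\<in>S. c t * vv t s) = 0" and t: "t \<in> S"
 shows "c t = 0"
proof (rule ccontr)
 assume "c t ~= 0"
 define X where "X = {t \<in> S. c t ~= 0}"
 have "finite X" "X ~= {}" using finite_std t \<open>c t ~= 0\<close> by (auto simp: X_def)
 then obtain u where u: "u \<in> X" and mx: "Max ((\<lambda>t. card (IP t)) ` X) = card (IP u)"
  using obtains_MAX[of X "\<lambda>t. card (IP t)"] by blast
 have le: "card (IP t) <= card (IP u)" if "t \<in> X" for t
  unfolding mx[symmetric] using that \<open>finite X\<close> by (intro Max_ge) auto
 have uS: "u \<in> S" using u by (simp add: X_def)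
 have "(\<Sum>t\<in>S. c t * vv t u) = (\<Sum>t\<in>{u}. c t * vv t u)"
 proof (rule sum.mono_neutral_right)
  show "\<forall>i\<in>S - {u}. c i * vv i u = 0"
  proof
   fix i assume i: "i \<in> S - {u}"
   show "c i * vv i u = 0"
   proof (rule ccontr)
    assume "c i * vv i u ~= 0"
    then have "i \<in> X" "card (IP u) < card (IP i)" using i vv_triangular[of i] uS by (auto simp: X_def)
    then show False using le[of i] by simp
   qed
  qed
 qed (use finite_std uS in auto)
 then have "c u * pc u = 0" using z[OF uS] vv_triangular[OF uS] by simp
 then show False using u pc_nonzero[OF uS] by (simp add: X_def)
qed

lemma B0_del: "t \<in> S ==> B0 (del t) v = G0 t * v t" "B0 v w = B0 w v"
 "t \<in> S ==> B0 v (del t) = G0 t * v t"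
proof -
 show c: "B0 v w = B0 w v" for v w by (simp add: B0_def mult_ac)
 show d: "B0 (del t) v = G0 t * v t" if "t \<in> S" for t v
 proof -
  have "B0 (del t) v = (\<Sum>s\<in>S. if s = t then G0 s * v s else 0)"
   unfolding B0_def by (intro sum.cong refl) (simp add: del_def)
  then show ?thesis using that finite_std by simp
 qed
 show "B0 v (del t) = G0 t * v t" if "t \<in> S" using c d that by simp
qed

lemma G0_tl: "G0 tla = 1" by (simp add: G0_def IP_tl)

lemma B0_cong: "(\<And>s. s \<in> S ==> v s = v' s) ==> B0 v w = B0 v' w"
 unfolding B0_def by (intro sum.cong refl) simp

lemma B0_smult: "B0 (\<lambda>s. c * v s) w = c * B0 v w"
 unfolding B0_def sum_distrib_left by (intro sum.cong refl) simp

lemma TW_cong: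
 assumes w: "w permutes {1..n}" and eq: "\<And>s. s \<in> S ==> v s = v' s" and s: "s \<in> S"
 shows "app (rep.TW w) v s = app (rep.TW w) v' s"
proof -
 have "app (rep.TW w) (\<lambda>s. v s + (-1) * v' s) s = 0" using zero_on_TW[OF w _ s, of "\<lambda>s. v s + (-1) * v' s"] eq by simp
 then show ?thesis unfolding app_add app_smult[of _ "-1"] by simp
qed

text \<open>\<open>mm lam\<close> projects to the initial tableau, and the adjoint of
  \<open>TW (dperm n lam t)\<close> turns the coordinate at that tableau into the pairing with
  \<open>vv t\<close>.\<close>

lemma mst_act:
 assumes u: "u \<in> S" and t: "t \<in> S" and s: "s \<in> S"
 shows "app (rep.mst lam u t) x s = gam * B0 x (vv t) * vv u s"
proof -
 let ?y = "app (rep.TW (dperm n lam t)) x"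
 have "?y tla = B0 ?y (del tla)" using B0_del(3)[OF tlam_std] G0_tl by simp
 also have "\<dots> = B0 x (vv t)" unfolding vv_def by (rule B0_TW[OF dp(1)[OF t]])
 finally have y: "?y tla = B0 x (vv t)" .
 have "app (rep.mst lam u t) x s = app (rep.TW (inv (dperm n lam u))) (app (rep.mm lam) ?y) s"
  by (simp add: rep.mst_def)
 also have "\<dots> = app (rep.TW (inv (dperm n lam u))) (\<lambda>s. gam * B0 x (vv t) * del tla s) s"
  by (rule TW_cong[OF permutes_inv[OF dp(1)[OF u]] _ s]) (simp add: mm_lam y del_def)
 also have "\<dots> = gam * B0 x (vv t) * vv u s" unfolding app_smult vv_def ..
 finally show ?thesis .
qed

lemma mm_zero:
 assumes "multipartition ell n mu" "\<not> dominates lam mu" "s \<in> S"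
 shows "app (rep.mm mu) x s = 0"
 using support_dominates[OF assms(1,3)] assms(2) by blast

lemma mst_zero:
 assumes mu: "multipartition ell n mu" and nd: "\<not> dominates lam mu" and u: "u \<in> std n mu" and s: "s \<in> S"
 shows "app (rep.mst mu u t) x s = 0"
proof -
 have "inv (dperm n mu u) permutes {1..n}"
  using permutes_inv[OF dperm_spec(1)[of mu n u]] multipartitionD(2)[OF mu] u by (simp add: std_def)
 then show ?thesis unfolding rep.mst_def app_ring
  by (rule zero_on_TW[OF _ mm_zero[OF mu nd] s])
qed

lemma gam_nonzero: "gam ~= 0"
proof -
 have "UV lam tla ~= 0"
  unfolding UV_nonzero_iff
 proof (intro allI impI)
  fix l r assume h: "l < length lam - 1" "1 <= r" "r <= csum lam (l + 1)"
  have rn: "r <= n" using h csum_le[of lam "l + 1"] sz by simp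
  have nn: "nd' tla r = nd lam r" by (simp add: nod_def nd_def)
  obtain l0 i c where N: "nd lam r = (l0, i, c)" by (metis prod_cases3)
  have x: "(l0, i, c) \<in> D" "tla (l0, i, c) = r" using nd_in[of r lam] tlam_nd[of r lam] h rn sz N by simp_all
  have "l0 < l + 1" using comp_less_iff[OF x(1), of "l + 1"] x(2) h by simp
  then have "kappa ! l0 - kappa ! (l + 1) > int n" using kappa_gap[of l0 "l + 1"] h length_lam by simp
  moreover have "i < n" using x(1) part_length_le[OF mp, of l0] length_lam by (simp add: diagram_iff)
  ultimately show "cc tla r ~= kappa ! (l + 1)" using h rn nn N by (simp add: cc_def)
 qed
 moreover have "(\<Sum>w\<in>young n (rowl lam). tt ^ card (invs n w)) ~= 0"
 proof
  assume z: "(\<Sum>w\<in>young n (rowl lam). tt ^ card (invs n w)) = 0"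
  \<comment> \<open>The constant term counts the permutations without inversions and is at least
    \<open>1\<close>, because of \<open>id\<close>.\<close>
  have "fls_nth (\<Sum>w\<in>young n (rowl lam). tt ^ card (invs n w)) 0
    = (\<Sum>w\<in>young n (rowl lam). if card (invs n w) = 0 then 1 else 0)"
   unfolding fls_nth_sum by (intro sum.cong refl) (auto simp: fls_X_power_nth)
  also have "\<dots> \<ge> (\<Sum>w\<in>{id}. if card (invs n w) = 0 then 1 else 0)"
   by (rule sum_mono2) (auto simp: young_id)
  finally show False unfolding z using invs_id[of n] by (simp del: id_apply add: id_def)
 qed
 ultimately show ?thesis by (simp add: gam_def)
qed

end

context seminormal
begin

text \<open>On the module of \<open>lam\<close> only terms of shape \<open>lam\<close> survive, and
  they act through pairs of a functional and a vector. Independence of the \<open>vv\<close>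
  separates the left indices; testing on \<open>del s\<close> and using independence again separates
  the right ones.\<close>

lemma coeff_vanish:
 assumes fin: "finite I"
  and I: "\<And>mu u v. (mu, u, v) \<in> I ==> multipartition ell n mu \<and> u \<in> std n mu \<and> v \<in> std n mu"
  and dom: "\<And>mu u v. (mu, u, v) \<in> I ==> c (mu, u, v) ~= 0 ==> dominates lam mu ==> mu = lam"
  and z: "\<And>x s. s \<in> S ==> (\<Sum>(mu, u, v)\<in>I. c (mu, u, v) * app (rep.mst mu u v) x s) = 0"
  and i: "(lam, u, v) \<in> I"
 shows "c (lam, u, v) = 0"
proof -
 define c' where "c' u v = (if (lam, u, v) \<in> I then c (lam, u, v) else 0)" for u v
 let ?J = "(\<lambda>(u, v). (lam, u, v)) ` (S \<times> S)"
 let ?f = "\<lambda>x s. \<lambda>(mu, u, v). c (mu, u, v) * app (rep.mst mu u v) x s"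
 have fJ: "finite ?J" using finite_std by simp
 have sum0: "(\<Sum>u\<in>S. (\<Sum>v\<in>S. c' u v * gam * B0 x (vv v)) * vv u s) = 0" if s: "s \<in> S" for x s
 proof -
  have "0 = (\<Sum>i\<in>I. ?f x s i)" using z[OF s, of x] by simp
  also have "\<dots> = (\<Sum>i\<in>?J \<inter> I. ?f x s i)"
  proof (rule sum.mono_neutral_right[OF fin], blast, rule ballI)
   fix j assume j: "j \<in> I - ?J \<inter> I"
   obtain mu u v where m: "j = (mu, u, v)" by (metis prod_cases3)
   show "?f x s j = 0"
   proof (cases "c j = 0")
    case False
    have "mu ~= lam" using I[of mu u v] j m by auto
    then have "\<not> dominates lam mu" using dom[of mu u v] j m False by auto
    then show ?thesis using mst_zero[of mu u s v x] I[of mu u v] j m s by simp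
   qed (simp add: m)
  qed
  also have "\<dots> = (\<Sum>i\<in>?J. if i \<in> I then ?f x s i else 0)" by (rule sum.inter_restrict[OF fJ])
  also have "\<dots> = (\<Sum>(u, v)\<in>S \<times> S. if (lam, u, v) \<in> I then ?f x s (lam, u, v) else 0)"
   by (subst sum.reindex) (auto simp: inj_on_def intro!: sum.cong)
  also have "\<dots> = (\<Sum>(u, v)\<in>S \<times> S. c' u v * gam * B0 x (vv v) * vv u s)"
   by (intro sum.cong refl) (auto simp: c'_def mst_act s mult.assoc)
  finally show ?thesis unfolding sum_distrib_right sum.cartesian_product by simp
 qed
 have uv: "u \<in> S" "v \<in> S" using I[OF i] by auto
 have "(\<Sum>v\<in>S. c' u v * gam * B0 x (vv v)) = 0" for x
  by (rule vv_independent[OF sum0 uv(1)])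
 then have z': "(\<Sum>v\<in>S. c' u v * gam * B0 (del s) (vv v)) = 0" for s .
 have "gam * G0 s * (\<Sum>v\<in>S. c' u v * vv v s) = 0" if "s \<in> S" for s
 proof -
  have "gam * G0 s * (\<Sum>v\<in>S. c' u v * vv v s) = (\<Sum>v\<in>S. c' u v * gam * B0 (del s) (vv v))"
   unfolding B0_del(1)[OF that] sum_distrib_left by (intro sum.cong refl) (simp only: mult_ac)
  then show ?thesis using z' by simp
 qed
 then have "(\<Sum>v\<in>S. c' u v * vv v s) = 0" if "s \<in> S" for s
  using that gam_nonzero G0_nonzero by simp
 then have "c' u v = 0" by (rule vv_independent[OF _ uv(2)])
 then show ?thesis using i by (simp add: c'_def)
qed

lemma ev_mur:
 assumes "multipartition ell n mu" "u \<in> std n mu" "v \<in> std n mu"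
 shows "murphy n kappa mu u v \<in> fin_supp" "ev (murphy n kappa mu u v) = rep.mst mu u v"
 using rep.ev_murphy[OF multipartitionD(2)[OF assms(1)] assms(2,3)] by blast+

lemma above_zero:
 assumes "h \<in> hecke_above n kappa lam"
 shows "h \<in> fin_supp \<and> (\<forall>x. \<forall>s\<in>S. app (ev h) x s = 0)"
 using assms unfolding hecke_above_def
proof induction
 case (base m)
 then obtain mu u v where m: "m = murphy n kappa mu u v" "multipartition ell n mu" "strictly_dominates mu lam"
  "u \<in> std n mu" "v \<in> std n mu" using length_lam by auto
 have "\<not> dominates lam mu" using dominates_antisym[OF mp m(2)] m(3) by (auto simp: strictly_dominates_def)
 then show ?case using ev_mur[OF m(2,4,5)] mst_zero[OF m(2) _ m(4)] m(1) by simp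
qed (simp_all)

lemma ev_coeffs:
 assumes fin: "finite I" and I: "\<And>mu u v. (mu, u, v) \<in> I ==> multipartition ell n mu \<and> u \<in> std n mu \<and> v \<in> std n mu"
  and c: "\<forall>i\<in>I. c i \<in> laurent_ring"
 shows "fa_sum (\<lambda>i. fa_smult (c i) ((\<lambda>(mu, u, v). murphy n kappa mu u v) i)) I \<in> fin_supp"
  "app (ev (fa_sum (\<lambda>i. fa_smult (c i) ((\<lambda>(mu, u, v). murphy n kappa mu u v) i)) I)) x s
   = (\<Sum>(mu, u, v)\<in>I. c (mu, u, v) * app (rep.mst mu u v) x s)"
proof -
 let ?F = "\<lambda>i. fa_smult (c i) ((\<lambda>(mu, u, v). murphy n kappa mu u v) i)"
 have F: "?F i \<in> fin_supp \<and> app (ev (?F i)) x s = (case i of (mu, u, v) => c (mu, u, v) * app (rep.mst mu u v) x s)"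
  if "i \<in> I" for i x s
  using that I c ev_mur by (cases i) auto
 then show "fa_sum ?F I \<in> fin_supp" by (intro rep.A_sum[OF fin]) blast
 have e: "ev (fa_sum ?F I) = (\<Sum>i\<in>I. ev (?F i))" by (rule rep.ev_sum[OF fin]) (use F in blast)
 show "app (ev (fa_sum ?F I)) x s = (\<Sum>(mu, u, v)\<in>I. c (mu, u, v) * app (rep.mst mu u v) x s)"
  unfolding e app_op_sum by (intro sum.cong refl conjunct2[OF F])
qed

abbreviation "prd s t \<equiv> fa_mult (murphy n kappa lam (tlam lam) s) (murphy n kappa lam t (tlam lam))"

lemma ev_prd:
 assumes "s \<in> S" "t \<in> S" "w \<in> S"
 shows "prd s t \<in> fin_supp" "app (ev (prd s t)) x w = gam * (gam * B0 x (del tla) * B0 (vv t) (vv s)) * del tla w"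
proof -
 note e = ev_mur[OF mp tlam_std assms(1)] ev_mur[OF mp assms(2) tlam_std]
 show "prd s t \<in> fin_supp" using e by simp
 have "app (ev (prd s t)) x w = app (rep.mst lam tla s) (app (rep.mst lam t tla) x) w" using e by simp
 also have "\<dots> = gam * B0 (\<lambda>w. gam * B0 x (vv tla) * vv t w) (vv s) * vv tla w"
  unfolding mst_act[OF tlam_std assms(1,3)]
  using B0_cong[of "app (rep.mst lam t tla) x" "\<lambda>w. gam * B0 x (vv tla) * vv t w" "vv s"]
   mst_act[OF assms(2) tlam_std] by simp
 finally show "app (ev (prd s t)) x w = gam * (gam * B0 x (del tla) * B0 (vv t) (vv s)) * del tla w"
  unfolding B0_smult vv_tlam .
qed

text \<open>Relators and larger shapes act as zero on the standard coordinates of this module.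
  Comparing what remains at \<open>del tla\<close> and cancelling \<open>gam\<close> fixes
  \<open>c\<close>.\<close>

lemma cong_above_value:
 assumes st: "s \<in> S" "t \<in> S" and c: "c \<in> laurent_ring"
  and co: "cong_above n kappa lam (prd s t) (fa_smult c (murphy n kappa lam (tlam lam) (tlam lam)))"
 shows "c = gam * B0 (vv t) (vv s)"
proof -
 obtain i h where ih: "i \<in> fa_ideal n (hecke_relators n kappa)" "h \<in> hecke_above n kappa lam"
  and eq: "fa_sub (prd s t) (fa_smult c (murphy n kappa lam (tlam lam) (tlam lam))) = fa_add i h"
  using co unfolding cong_above_def by blast
 note m = ev_mur[OF mp tlam_std tlam_std] and p = ev_prd[OF st tlam_std]
 have "app (ev (fa_sub (prd s t) (fa_smult c (murphy n kappa lam (tlam lam) (tlam lam))))) (del tla) tla = 0"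
  unfolding eq using ideal_zero[OF ih(1)] above_zero[OF ih(2)] tlam_std by simp
 then have "app (ev (prd s t)) (del tla) tla = c * app (rep.mst lam tla tla) (del tla) tla"
  using m p(1) c by simp
 moreover have "B0 (del tla) (del tla) = 1" "del tla tla = 1"
  using B0_del(1)[OF tlam_std, of "del tla"] G0_tl by (simp_all add: del_def)
 ultimately have "gam * (gam * B0 (vv t) (vv s)) = c * gam"
  using p(2) mst_act[OF tlam_std tlam_std tlam_std] by (simp add: vv_tlam)
 then show ?thesis using gam_nonzero by (simp add: mult.commute)
qed

lemma Tw_id: "Tw n id = fa_one"
proof -
 have "(SOME rs. reduced_word n id rs) = []"
  using someI_ex[OF reduced_word_exists[OF permutes_id, of n]] unfolding reduced_word_def
  by (simp add: perm_length_eq[OF permutes_id] del: id_apply)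
 then show ?thesis by (simp add: Tw_def fa_one_def)
qed

lemma murphy_tlam: "murphy n kappa lam (tlam lam) t = fa_mult (m_lam n kappa lam) (Tw n (dperm n lam t))"
 unfolding murphy_def dperm_tlam[OF sz] inv_id Tw_id by simp

lemma seminormal_other: "multipartition ell n nu ==> seminormal ell n nu kappa"
 by unfold_locales (use ell1 kap gap in auto)

lemma fa_hom_carrier: "fa_hom n (fin_supp \<inter> fa_carrier n) ev lsc"
 by unfold_locales simp_all

text \<open>With the intersection as domain, the membership parts of \<open>ev_Tw\<close> and
  \<open>ev_murphy\<close> show that these elements lie in \<open>fa_carrier\<close>.\<close>

lemma fa_cyclo_carrier: "fa_cyclo n (lsc tt) rT (lsc (tt powi (-1))) rL (fin_supp \<inter> fa_carrier n) ev lsc"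
proof (rule fa_cyclo.intro[OF rep_cyclo0 fa_hom_carrier])
 show "fa_cyclo_axioms n (lsc tt) rT (lsc (tt powi (-1))) rL ev lsc"
  by (rule fa_cyclo_axioms.intro) (rule rep.eT rep.eL rep.sc_powi rep.sc_qint; assumption)+
qed

text \<open>Straightening expands the product over lexicographically larger shapes. Evaluating that
  expansion on the module of each shape shows that only shapes dominating \<open>lam\<close> occur;
  on the module of \<open>lam\<close> itself the coefficient of the initial pair can be read
  off.\<close>

lemma cong_above_exists:
 assumes st: "s \<in> S" "t \<in> S"
 shows "\<exists>c\<in>laurent_ring. cong_above n kappa lam (prd s t) (fa_smult c (murphy n kappa lam (tlam lam) (tlam lam)))"
proof -
 define I where "I = (\<lambda>t. (lam, tla, t)) ` S \<union>
  (SIGMA mu:{mu. multipartition ell n mu \<and> gtlex ell n mu lam}. std n mu \<times> std n mu)"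
 let ?g = "\<lambda>(mu, u, v). murphy n kappa mu u v"
 let ?gen = "\<lambda>mu u v. fa_mult (m_lam n kappa lam) (Tw n (dperm n lam t))"
 have I: "multipartition ell n mu \<and> u \<in> std n mu \<and> v \<in> std n mu" if "(mu, u, v) \<in> I" for mu u v
  using that mp tlam_std by (auto simp: I_def)
 have fin: "finite I"
  unfolding I_def using finite_std shape.finite_std[OF shape.intro]
  by (auto intro!: finite_SigmaI finite_subset[OF _ finite_multipartitions[of ell n]])
 let ?h = "fa_mult (Tw n (dperm n lam s)) (murphy n kappa lam t (tlam lam))"
 have P: "prd s t = fa_mult (m_lam n kappa lam) ?h"
  unfolding murphy_tlam[of s] fa_mult_assoc ..
 note C = fa_cyclo.ev_Tw(1)[OF fa_cyclo_carrier] fa_cyclo.ev_murphy(1)[OF fa_cyclo_carrier]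
 have "?h \<in> fa_carrier n"
  using C(1)[OF dp(1)[OF st(1)]] C(2)[OF sz st(2) tlam_std] by (intro fa_carrier_mult) blast+
 then obtain f where f: "f \<in> fa_span ({fa_mult (m_lam n kappa lam) (Tw n (dperm n lam t)) | t. t \<in> S} \<union>
   {murphy n kappa mu u v | mu u v. multipartition ell n mu \<and> gtlex ell n mu lam \<and> u \<in> std n mu \<and> v \<in> std n mu})"
  and fi: "fa_sub (prd s t) f \<in> fa_ideal n (hecke_relators n kappa)"
  using hecke_spans[of n kappa] mp unfolding hecke_spans_def kap P by blast
 have "{fa_mult (m_lam n kappa lam) (Tw n (dperm n lam t)) | t. t \<in> S} \<union>
   {murphy n kappa mu u v | mu u v. multipartition ell n mu \<and> gtlex ell n mu lam \<and> u \<in> std n mu \<and> v \<in> std n mu} = ?g ` I"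
  unfolding I_def image_Un by (rule arg_cong2[of _ _ _ _ "(\<union>)"]) (auto simp: murphy_tlam image_iff, blast)
 then obtain c where c: "\<forall>i\<in>I. c i \<in> laurent_ring" and fc: "f = fa_sum (\<lambda>i. fa_smult (c i) (?g i)) I"
  using fa_span_coeffs[OF fin, of f ?g] f by auto
 have act: "(\<Sum>(mu, u, v)\<in>I. c (mu, u, v) * app (cyclo0.mst n (lsc tt) (seminormal.rT n nu kappa) (lsc (tt powi (-1)))
   (seminormal.rL n nu kappa) kappa mu u v) x w) = app (lev (gmap (seminormal.rT n nu kappa) (seminormal.rL n nu kappa)) (prd s t)) x w"
  if nu: "multipartition ell n nu" for nu x w
 proof -
  interpret N: seminormal ell n nu kappa by (rule seminormal_other[OF nu])
  have "prd s t = fa_add (fa_sub (prd s t) f) f" by (simp add: fa_add_def fa_sub_def)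
  then have "N.ev (prd s t) = N.ev (fa_add (fa_sub (prd s t) f) f)" by (rule arg_cong)
  also have "\<dots> = N.ev (fa_sub (prd s t) f) + N.ev f"
   by (rule N.rep.ev_add[OF conjunct1[OF N.ideal_zero[OF fi]]]) (simp only: fc N.ev_coeffs(1)[OF fin I c])
  also have "\<dots> = N.ev f" using N.ideal_zero[OF fi] by simp
  finally show ?thesis unfolding fc using N.ev_coeffs(2)[OF fin I c, of x w] by (simp only:)
 qed
 \<comment> \<open>On the module of \<open>mu\<close> the product acts as zero unless
   \<open>mu\<close> dominates \<open>lam\<close>. If it does not, no shape strictly below
   \<open>mu\<close> can occur either, since by induction it would dominate \<open>lam\<close> and
   so would \<open>mu\<close>. Then \<open>coeff_vanish\<close> applies.\<close>
 have dom: "dominates mu lam" if "(mu, u, v) \<in> I" "c (mu, u, v) ~= 0" for mu u v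
  using that
 proof (induction "dweight n mu" arbitrary: mu u v rule: less_induct)
  case less
  note mu = I[OF less.prems(1)]
  interpret N: seminormal ell n mu kappa by (rule seminormal_other) (use mu in blast)
  show ?case
  proof (rule ccontr)
   assume nd: "\<not> dominates mu lam"
   have "c (mu, u, v) = 0"
   proof (rule N.coeff_vanish[OF fin I _ _ less.prems(1)])
    fix nu u' v' assume h: "(nu, u', v') \<in> I" "c (nu, u', v') ~= 0" "dominates mu nu"
    show "nu = mu"
    proof (rule ccontr)
     assume "nu ~= mu"
     then have "strictly_dominates mu nu" using h by (simp add: strictly_dominates_def)
     then have "dweight n nu < dweight n mu" using dweight_strict I[OF h(1)] mu by blast
     then have "dominates nu lam" using less.hyps h by blast
     moreover have "length mu = length nu" using I[OF h(1)] mu by (simp add: multipartition_def)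
     ultimately show False using dominates_trans[of mu nu lam] h(3) nd by blast
    qed
   next
    fix x w assume w: "w \<in> N.S"
    have hf: "?h \<in> fin_supp"
     by (rule N.rep.A_mult[OF N.rep.ev_Tw(1)[OF dp(1)[OF st(1)]] N.ev_mur(1)[OF mp st(2) tlam_std]])
    have "N.ev (prd s t) = N.rep.mm lam * N.ev ?h"
     unfolding P N.rep.ev_mult[OF N.rep.ev_m_lam(1)[OF sz] hf] N.rep.ev_m_lam(2)[OF sz] by (rule refl)
    then have "app (N.ev (prd s t)) x w = 0" using N.mm_zero[OF mp nd w] by simp
    then show "(\<Sum>(mu', u, v)\<in>I. c (mu', u, v) * app (N.rep.mst mu' u v) x w) = 0"
     using act[of mu x w] mu by simp
   qed (use I in blast)+
   then show False using less.prems(2) by simp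
  qed
 qed
 let ?i = "(lam, tla, tla)"
 have iI: "?i \<in> I" using tlam_std by (simp add: I_def)
 let ?c = "gam * B0 (vv t) (vv s)"
 \<comment> \<open>Subtracting the expected multiple leaves a combination that acts as zero on this
   module, so all coefficients of shape \<open>lam\<close> are determined at once.\<close>
 define d where "d i = (if i = ?i then c i - ?c else c i)" for i
 have dz: "d (lam, tla, v) = 0" if "(lam, tla, v) \<in> I" for v
 proof (rule coeff_vanish[OF fin I _ _ that])
  fix mu u v assume h: "(mu, u, v) \<in> I" "d (mu, u, v) ~= 0" "dominates lam mu"
  show "mu = lam"
  proof (rule ccontr)
   assume "mu ~= lam"
   then have "dominates mu lam" using h dom[OF h(1)] by (simp add: d_def split: if_splits)
   then show False using dominates_antisym[OF mp, of mu] I[OF h(1)] h \<open>mu ~= lam\<close> by blast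
  qed
 next
  fix x w assume w: "w \<in> S"
  have "(\<Sum>(mu, u, v)\<in>I. d (mu, u, v) * app (rep.mst mu u v) x w)
    = (\<Sum>(mu, u, v)\<in>I. c (mu, u, v) * app (rep.mst mu u v) x w
       - (if (mu, u, v) = ?i then ?c * app (rep.mst lam tla tla) x w else 0))"
   by (intro sum.cong refl) (auto simp: d_def left_diff_distrib)
  also have "\<dots> = (\<Sum>(mu, u, v)\<in>I. c (mu, u, v) * app (rep.mst mu u v) x w) - ?c * app (rep.mst lam tla tla) x w"
  proof -
   have "(fst i = lam \<and> fst (snd i) = tla \<and> snd (snd i) = tla) = (i = ?i)" for i by (cases i) auto
   then show ?thesis using fin iI by (simp add: split_def sum_subtractf)
  qed
  also have "\<dots> = 0"
   unfolding act[OF mp] ev_prd(2)[OF st w] mst_act[OF tlam_std tlam_std w] by (simp add: vv_tlam)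
  finally show "(\<Sum>(mu, u, v)\<in>I. d (mu, u, v) * app (rep.mst mu u v) x w) = 0" .
 qed (use I in blast)+
 have cv: "c ?i = ?c" using dz[OF iI] by (simp add: d_def)
 have cz: "mu ~= lam \<and> dominates mu lam" if "(mu, u, v) \<in> I - {?i}" "c (mu, u, v) ~= 0" for mu u v
 proof -
  have "mu ~= lam"
  proof
   assume e: "mu = lam"
   then have "u = tla" using that by (auto simp: I_def gtlex_irrefl)
   then show False using dz[of v] that e by (auto simp: d_def split: if_splits)
  qed
  then show ?thesis using dom that by blast
 qed
 let ?h = "fa_sum (\<lambda>i. fa_smult (c i) (?g i)) (I - {?i})"
 have "?h \<in> hecke_above n kappa lam"
  unfolding hecke_above_def
 proof (rule fa_span_sum)
  fix i assume i: "i \<in> I - {?i}" "c i ~= 0"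
  obtain mu u v where m: "i = (mu, u, v)" by (metis prod_cases3)
  show "?g i \<in> {murphy n kappa mu u v |mu u v. multipartition (length lam) n mu \<and> strictly_dominates mu lam \<and> u \<in> std n mu \<and> v \<in> std n mu}"
   using cz[of mu u v] i I[of mu u v] m length_lam by (auto simp: strictly_dominates_def)
 qed (use fin c in auto)
 moreover have "f = fa_add (fa_smult ?c (murphy n kappa lam (tlam lam) (tlam lam))) ?h"
  using fa_sum_insert[of "I - {?i}" ?i "\<lambda>i. fa_smult (c i) (?g i)"] fin iI cv unfolding fc by (simp add: insert_absorb)
 then have "fa_sub (prd s t) (fa_smult ?c (murphy n kappa lam (tlam lam) (tlam lam))) = fa_add (fa_sub (prd s t) f) ?h"
  by (simp add: fa_add_def fa_sub_def)
 ultimately have "cong_above n kappa lam (prd s t) (fa_smult ?c (murphy n kappa lam (tlam lam) (tlam lam)))"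
  unfolding cong_above_def using fi by blast
 moreover have "?c \<in> laurent_ring" using c iI cv by metis
 ultimately show ?thesis by blast
qed

lemma gram_eq:
 assumes "s \<in> S" "t \<in> S"
 shows "gram n kappa lam s t = gam * B0 (vv t) (vv s)"
proof -
 obtain c where c: "c \<in> laurent_ring" "cong_above n kappa lam (prd s t) (fa_smult c (murphy n kappa lam (tlam lam) (tlam lam)))"
  using cong_above_exists[OF assms] by blast
 have "gram n kappa lam s t = c"
  unfolding gram_def
  by (rule the_equality) (use c cong_above_value[OF assms] in blast)+
 then show ?thesis using cong_above_value[OF assms c] by simp
qed

end

section \<open>Determinants over a finite index set\<close>

lemma laurent_neg_self: "x = - x ==> x = (0 :: laurent)"
 by (simp add: fls_eq_iff)

text \<open>Composition with the transposition of the two rows reverses every sign and keeps every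
  product, so the determinant is its own negative.\<close>

lemma det_on_equal_rows:
 fixes B :: "'a => 'a => laurent"
 assumes fin: "finite S" and ab: "a \<in> S" "b \<in> S" "a ~= b" and eq: "B a = B b"
 shows "det_on S B = 0"
proof (rule laurent_neg_self)
 let ?t = "Transposition.transpose a b"
 have t: "?t permutes S" using ab by (simp add: permutes_swap_id)
 have "det_on S B = (\<Sum>p\<in>{p. p permutes S}. of_int (sign (p \<circ> ?t)) * (\<Prod>s\<in>S. B s ((p \<circ> ?t) s)))"
  unfolding det_on_def
  by (rule sum.reindex_bij_witness[of _ "\<lambda>p. p \<circ> ?t" "\<lambda>p. p \<circ> ?t"])
   (auto simp: comp_assoc permutes_compose[OF t])
 also have "\<dots> = (\<Sum>p\<in>{p. p permutes S}. - (of_int (sign p) * (\<Prod>s\<in>S. B s (p s))))"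
 proof (rule sum.cong[OF refl])
  fix p assume "p \<in> {p. p permutes S}"
  then have p: "p permutes S" by simp
  have "sign (p \<circ> ?t) = sign p * sign ?t"
   using permutation_permutes p t fin by (intro sign_compose) blast+
  then have s: "sign (p \<circ> ?t) = - sign p" using ab by (simp add: sign_swap_id)
  have "(\<Prod>s\<in>S. B s ((p \<circ> ?t) s)) = (\<Prod>s\<in>S. B (?t s) (p (?t s)))"
   by (intro prod.cong refl) (use eq in \<open>auto simp: Transposition.transpose_def\<close>)
  also have "\<dots> = (\<Prod>s\<in>S. B s (p s))"
   using prod.permute[OF t, of "\<lambda>s. B s (p s)"] by (simp add: comp_def)
  finally show "of_int (sign (p \<circ> ?t)) * (\<Prod>s\<in>S. B s ((p \<circ> ?t) s)) = - (of_int (sign p) * (\<Prod>s\<in>S. B s (p s)))"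
   unfolding s by simp
 qed
 also have "\<dots> = - det_on S B" by (simp add: det_on_def sum_negf)
 finally show "det_on S B = - det_on S B" .
qed

lemma det_on_permute_rows:
 assumes fin: "finite S" and f: "f permutes S"
 shows "det_on S (\<lambda>s. B (f s)) = of_int (sign f) * det_on S B"
proof -
 have "det_on S (\<lambda>s. B (f s)) = (\<Sum>p\<in>{p. p permutes S}. of_int (sign (p \<circ> f)) * (\<Prod>s\<in>S. B (f s) ((p \<circ> f) s)))"
  unfolding det_on_def
  by (rule sum.reindex_bij_witness[of _ "\<lambda>p. p \<circ> f" "\<lambda>p. p \<circ> inv f"])
   (auto simp: comp_assoc permutes_compose[OF f] permutes_compose[OF permutes_inv[OF f]] permutes_inv_o[OF f])
 also have "\<dots> = (\<Sum>p\<in>{p. p permutes S}. of_int (sign f) * (of_int (sign p) * (\<Prod>s\<in>S. B s (p s))))"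
 proof (rule sum.cong[OF refl])
  fix p assume "p \<in> {p. p permutes S}"
  then have p: "p permutes S" by simp
  have s: "sign (p \<circ> f) = sign p * sign f"
   using permutation_permutes p f fin by (intro sign_compose) blast+
  have "(\<Prod>s\<in>S. B (f s) ((p \<circ> f) s)) = (\<Prod>s\<in>S. B s (p s))"
   using prod.permute[OF f, of "\<lambda>s. B s (p s)"] by (simp add: comp_def)
  then show "of_int (sign (p \<circ> f)) * (\<Prod>s\<in>S. B (f s) ((p \<circ> f) s)) = of_int (sign f) * (of_int (sign p) * (\<Prod>s\<in>S. B s (p s)))"
   unfolding s by simp
 qed
 finally show ?thesis by (simp add: det_on_def sum_distrib_left)
qed

text \<open>Expanding the product of sums gives one determinant for each function \<open>f\<close>
  on \<open>S\<close>. Noninjective \<open>f\<close> repeat a row; the injective ones are the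
  permutations.\<close>

lemma det_on_mult:
 fixes A B :: "'a => 'a => laurent"
 assumes fin: "finite S"
 shows "det_on S (\<lambda>s t. \<Sum>w\<in>S. A s w * B w t) = det_on S A * det_on S B"
proof -
 let ?P = "{p. p permutes S}" and ?E = "S \<rightarrow>\<^sub>E S"
 let ?h = "\<lambda>p. restrict p S"
 have fP: "finite ?P" using fin by (simp add: finite_permutations)
 have fE: "finite ?E" using fin by (simp add: finite_PiE)
 have "det_on S (\<lambda>s t. \<Sum>w\<in>S. A s w * B w t)
   = (\<Sum>p\<in>?P. \<Sum>f\<in>?E. of_int (sign p) * (\<Prod>s\<in>S. A s (f s) * B (f s) (p s)))"
  unfolding det_on_def by (intro sum.cong refl) (simp add: prod_sum_PiE[OF fin] fin sum_distrib_left)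
 also have "\<dots> = (\<Sum>f\<in>?E. \<Sum>p\<in>?P. of_int (sign p) * (\<Prod>s\<in>S. A s (f s) * B (f s) (p s)))"
  by (rule sum.swap)
 also have "\<dots> = (\<Sum>f\<in>?E. (\<Prod>s\<in>S. A s (f s)) * det_on S (\<lambda>s. B (f s)))"
  unfolding det_on_def by (intro sum.cong refl) (simp add: prod.distrib sum_distrib_left mult_ac)
 also have "\<dots> = (\<Sum>f\<in>?h ` ?P. (\<Prod>s\<in>S. A s (f s)) * det_on S (\<lambda>s. B (f s)))"
 proof (rule sum.mono_neutral_right[OF fE])
  show "?h ` ?P \<subseteq> ?E" by (auto simp: permutes_in_image)
  show "\<forall>f\<in>?E - ?h ` ?P. (\<Prod>s\<in>S. A s (f s)) * det_on S (\<lambda>s. B (f s)) = 0"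
  proof
   fix f assume f: "f \<in> ?E - ?h ` ?P"
   have "\<not> inj_on f S"
   proof
    assume "inj_on f S"
    moreover have "f ` S \<subseteq> S" using f by auto
    ultimately have "bij_betw f S S" using fin endo_inj_surj by (simp add: bij_betw_def)
    let ?p = "\<lambda>x. if x \<in> S then f x else x"
    have "bij_betw ?p S S" using \<open>bij_betw f S S\<close> by (subst bij_betw_cong[of S ?p f]) auto
    then have "?p permutes S" by (rule bij_imp_permutes) simp
    moreover have "f = ?h ?p" using f by (auto simp: fun_eq_iff PiE_def extensional_def)
    ultimately have "f \<in> ?h ` ?P" by blast
    then show False using f by blast
   qed
   then obtain a b where "a \<in> S" "b \<in> S" "a ~= b" "f a = f b" unfolding inj_on_def by blast
   then show "(\<Prod>s\<in>S. A s (f s)) * det_on S (\<lambda>s. B (f s)) = 0"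
    using det_on_equal_rows[OF fin, of a b "\<lambda>s. B (f s)"] by simp
  qed
 qed
 also have "\<dots> = (\<Sum>p\<in>?P. (\<Prod>s\<in>S. A s (?h p s)) * det_on S (\<lambda>s. B (?h p s)))"
 proof (rule sum.reindex[unfolded comp_def])
  show "inj_on ?h ?P"
  proof (rule inj_onI)
   fix p q assume pq: "p \<in> ?P" "q \<in> ?P" "?h p = ?h q"
   show "p = q"
   proof
    fix x show "p x = q x"
     using pq permutes_not_in[of p S x] permutes_not_in[of q S x] by (cases "x \<in> S") (metis restrict_apply', simp)
   qed
  qed
 qed
 also have "\<dots> = (\<Sum>p\<in>?P. of_int (sign p) * (\<Prod>s\<in>S. A s (p s)) * det_on S B)"
 proof (rule sum.cong[OF refl])
  fix p assume "p \<in> ?P"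
  then have p: "p permutes S" by simp
  have "det_on S (\<lambda>s. B (?h p s)) = det_on S (\<lambda>s. B (p s))" unfolding det_on_def by (intro sum.cong refl) simp
  then show "(\<Prod>s\<in>S. A s (?h p s)) * det_on S (\<lambda>s. B (?h p s)) = of_int (sign p) * (\<Prod>s\<in>S. A s (p s)) * det_on S B"
   using det_on_permute_rows[OF fin p, of B] by simp
 qed
 also have "\<dots> = det_on S A * det_on S B" by (simp add: det_on_def sum_distrib_right)
 finally show ?thesis .
qed

text \<open>A permutation with nonzero product lowers \<open>rk\<close> at each point that it moves,
  yet it preserves the sum of \<open>rk\<close> over \<open>S\<close>; so it is the
  identity.\<close>

lemma det_on_triangular:
 fixes B :: "'a => 'a => 'b::idom" and rk :: "'a => nat"
 assumes fin: "finite S" and tri: "\<And>s t. s \<in> S ==> t \<in> S ==> B s t ~= 0 ==> t = s \<or> rk t < rk s"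
 shows "det_on S B = (\<Prod>s\<in>S. B s s)"
proof -
 have "(\<Prod>s\<in>S. B s (p s)) = 0" if p: "p permutes S" "p ~= id" for p
 proof (rule ccontr)
  assume "(\<Prod>s\<in>S. B s (p s)) ~= 0"
  then have nz: "p s = s \<or> rk (p s) < rk s" if "s \<in> S" for s
   using tri[OF that, of "p s"] permutes_in_image[OF p(1), of s] that fin by (simp add: prod_zero_iff)
  obtain x where x: "p x ~= x" using p(2) by (auto simp: fun_eq_iff)
  then have "x \<in> S" using permutes_not_in[OF p(1)] by blast
  have "rk (p s) <= rk s" if "s \<in> S" for s using nz[OF that] by (metis le_refl less_imp_le)
  then have "(\<Sum>s\<in>S. rk (p s)) < (\<Sum>s\<in>S. rk s)"
   using nz[OF \<open>x \<in> S\<close>] x \<open>x \<in> S\<close> fin by (intro sum_strict_mono_ex1) auto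
  moreover have "(\<Sum>s\<in>S. rk (p s)) = (\<Sum>s\<in>S. rk s)"
   using sum.permute[OF p(1), of rk] by (simp add: comp_def)
  ultimately show False by simp
 qed
 then have "det_on S B = (\<Sum>p\<in>{id}. of_int (sign p) * (\<Prod>s\<in>S. B s (p s)))"
  unfolding det_on_def using fin
  by (intro sum.mono_neutral_right) (auto simp: finite_permutations permutes_id)
 then show ?thesis by simp
qed

section \<open>The Gram determinant as a product over tableaux\<close>

text \<open>Here \<open>q\<close> is \<open>t\<close> and \<open>y\<close> is \<open>t\<close> to
  the power \<open>d\<close>, the content difference of an inverted pair. The right-hand side is
  \<open>q\<close> times \<open>[d + 1] [d - 1]\<close> over the square of
  \<open>[d]\<close>.\<close>

lemma pair_ratio_identity:
 fixes q y :: "'a::field"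
 assumes "q ~= 0" "q - 1 ~= 0" "1 - y ~= 0"
 shows "(1 - q * y) * (q - y) / ((1 - y) * (1 - y))
  = q * ((q * y - 1) / (q - 1) * ((y / q - 1) / (q - 1)) / ((y - 1) / (q - 1) * ((y - 1) / (q - 1))))"
proof -
 have "y - 1 ~= 0" using assms by auto
 then show ?thesis using assms by (simp add: divide_simps) (simp add: algebra_simps)
qed

context seminormal
begin

lemma det_cong: "(\<And>s t. s \<in> S ==> t \<in> S ==> G s t = G' s t) ==> det_on S G = det_on S G'"
 unfolding det_on_def by (intro sum.cong refl arg_cong2[of _ _ _ _ "(*)"] prod.cong) (auto simp: permutes_in_image)

text \<open>The Gram matrix is the triangular matrix of the vectors \<open>vv\<close>, times the
  diagonal matrix of the norms scaled by \<open>gam\<close>, times the transpose of the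
  first.\<close>

lemma gram_det_diag: "gram_det n kappa lam = (\<Prod>t\<in>S. gam * (pc t * pc t * G0 t))"
proof -
 have tri: "vv t s ~= 0 ==> s = t \<or> card (IP s) < card (IP t)" "vv t t = pc t" if "t \<in> S" "s \<in> S" for s t
  using vv_triangular[OF that(1)] that(2) by auto
 have "vv t t ~= 0" if "t \<in> S" for t using tri(2)[OF that that] pc_nonzero[OF that] by simp
 define A where "A s w = vv s w" for s w
 define B where "B w t = gam * G0 w * vv t w" for w t
 have "gram_det n kappa lam = det_on S (\<lambda>s t. \<Sum>w\<in>S. A s w * B w t)"
  unfolding gram_det_def
  by (rule det_cong) (simp add: gram_eq B0_def A_def B_def sum_distrib_left mult_ac)
 also have "\<dots> = det_on S A * det_on S B" by (rule det_on_mult[OF finite_std])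
 also have "det_on S A = (\<Prod>s\<in>S. A s s)"
  by (rule det_on_triangular[where rk = "\<lambda>s. card (IP s)", OF finite_std]) (use tri in \<open>auto simp: A_def\<close>)
 also have "det_on S B = (\<Prod>s\<in>S. B s s)"
 \<comment> \<open>The transposed factor is triangular for the reversed rank.\<close>
 proof (rule det_on_triangular[where rk = "\<lambda>s. Max ((\<lambda>t. card (IP t)) ` S) - card (IP s)", OF finite_std])
  fix s t assume st: "s \<in> S" "t \<in> S" "B s t ~= 0"
  have "card (IP t) <= Max ((\<lambda>t. card (IP t)) ` S)" using st finite_std by (intro Max_ge) auto
  then show "t = s \<or> Max ((\<lambda>t. card (IP t)) ` S) - card (IP t) < Max ((\<lambda>t. card (IP t)) ` S) - card (IP s)"
   using tri(1)[of t s] st by (auto simp: B_def)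
 qed
 finally show ?thesis unfolding prod.distrib[symmetric]
  by (simp add: A_def B_def tri mult_ac cong: prod.cong)
qed

lemma pc_G0: "t \<in> S ==> pc t * pc t * G0 t
  = tt ^ card (IP t) * (\<Prod>(P, Q)\<in>IP t. qint (ct P - ct Q + 1) * qint (ct P - ct Q - 1) / (qint (ct P - ct Q) * qint (ct P - ct Q)))"
proof -
 assume t: "t \<in> S"
 have "(zz Q - tt * zz P) / (zz Q - zz P) * ((zz Q - tt * zz P) / (zz Q - zz P)) * ((tt * zz Q - zz P) / (zz Q - tt * zz P))
   = tt * (qint (ct P - ct Q + 1) * qint (ct P - ct Q - 1) / (qint (ct P - ct Q) * qint (ct P - ct Q)))"
  if "(P, Q) \<in> IP t" for P Q
 proof -
  have ne: "zz Q - zz P ~= 0" "zz Q - tt * zz P ~= 0" "tt * zz Q - zz P ~= 0" using zz_ne[OF IP_ct[OF t that]] by blast+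
  have q: "qint k = qint k * (tt - 1) / (tt - 1)" for k using tt_minus_1 by simp
  have z0: "zz Q ~= 0" by simp
  define y where "y = tt powi (ct P - ct Q)"
  have e: "zz P = zz Q * y" "tt powi (ct P - ct Q + 1) = tt * y" "tt * tt powi (ct P - ct Q - 1) = y"
   unfolding y_def by (simp_all flip: power_int_add power_int_add_1 power_int_add_1')
  have e3: "tt powi (ct P - ct Q - 1) = y / tt" using e(3) nonzero_mult_div_cancel_left[of tt "tt powi (ct P - ct Q - 1)"] by (metis fls_X_nonzero)
  have Q1: "qint (ct P - ct Q + 1) = (tt * y - 1) / (tt - 1)" "qint (ct P - ct Q - 1) = (y / tt - 1) / (tt - 1)"
   "qint (ct P - ct Q) = (y - 1) / (tt - 1)"
   unfolding qint_eq e(2) e3 y_def by simp_all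
  have d: "y - 1 ~= 0" "1 - y ~= 0" "1 - tt * y ~= 0" using ne unfolding e(1) by auto
  have "zz Q - zz P = zz Q * (1 - y)" "zz Q - tt * zz P = zz Q * (1 - tt * y)" "tt * zz Q - zz P = zz Q * (tt - y)"
   unfolding e(1) by (simp_all add: algebra_simps)
  moreover have "z * (1 - tt * y) / (z * (1 - y)) * (z * (1 - tt * y) / (z * (1 - y))) * (z * (tt - y) / (z * (1 - tt * y)))
    = (1 - tt * y) * (tt - y) / ((1 - y) * (1 - y))" if "z ~= 0" for z
   using d that by (simp add: divide_simps)
  moreover have "(1 - tt * y) * (tt - y) / ((1 - y) * (1 - y))
    = tt * ((tt * y - 1) / (tt - 1) * ((y / tt - 1) / (tt - 1)) / ((y - 1) / (tt - 1) * ((y - 1) / (tt - 1))))"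
   by (rule pair_ratio_identity[OF _ tt_minus_1 d(2)]) simp
  ultimately show ?thesis unfolding Q1 using z0 by (simp only:)
 qed
 note factor = this
 have "pc t * pc t * G0 t = (\<Prod>(P, Q)\<in>IP t. tt * (qint (ct P - ct Q + 1) * qint (ct P - ct Q - 1) / (qint (ct P - ct Q) * qint (ct P - ct Q))))"
  unfolding pc_def G0_def prod.distrib[symmetric]
  by (intro prod.cong refl) (use factor in \<open>simp add: split_def\<close>)
 then show ?thesis by (simp only: split_def prod.distrib prod_constant)
qed

end

section \<open>Poincare polynomials of Young subgroups and the scalar gam\<close>

lemma card_invs_left:
 assumes w: "w permutes {1..n}" and r: "1 <= r" "r < n" "inv w (Suc r) < inv w r"
 shows "card (invs n w) = Suc (card (invs n (sr r \<circ> w)))"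
proof -
 have p: "sr r \<circ> w permutes {1..n}" using permutes_compose[OF w sr_permutes[OF r(1,2)]] .
 have "inv (sr r \<circ> w) = inv w \<circ> inv (sr r)"
  using o_inv_distrib[OF permutes_bij[OF sr_permutes[OF r(1,2)]] permutes_bij[OF w]] .
 also have "inv (sr r) = sr r" by (rule inv_equality) (simp_all add: sr_apply)
 finally have e: "inv (sr r \<circ> w) = inv w \<circ> sr r" .
 show ?thesis
  using card_invs_down[OF permutes_inv[OF w] r] card_invs_inv[OF w] card_invs_inv[OF p, unfolded e] by linarith
qed

text \<open>Interpolates between the trivial group at \<open>m = 0\<close> and the whole Young
  subgroup at \<open>m = n\<close>.\<close>

definition yfix :: "nat => (nat => 'b) => nat => (nat => nat) set" where
 "yfix n b m = {w \<in> young n b. \<forall>i>m. w i = i}"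

text \<open>The induction splits according to the value at \<open>m + 1\<close>; lowering that value by one adds one inversion.\<close>

lemma poincare_step:
 assumes b: "convex_lab n b" and m: "m < n"
 shows "(\<Sum>w\<in>yfix n b (Suc m). tt ^ card (invs n w))
  = qint (int (card {j \<in> {1..Suc m}. b j = b (Suc m)})) * (\<Sum>w\<in>yfix n b m. tt ^ card (invs n w))"
proof -
 define J where "J = {j \<in> {1..Suc m}. b j = b (Suc m)}"
 define F where "F j = (\<Sum>w\<in>{w \<in> yfix n b (Suc m). w (Suc m) = j}. tt ^ card (invs n w))" for j
 let ?P = "\<Sum>w\<in>yfix n b m. tt ^ card (invs n w)"
 have fin: "finite (yfix n b k)" for k by (simp add: yfix_def)
 have Jconv: "Suc j \<in> J" if "j \<in> J" "j <= m" for j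
  using that convex_labD[OF b, of j "Suc j" "Suc m"] m by (auto simp: J_def)
 have yw: "w permutes {1..n}" "w i <= Suc m \<longleftrightarrow> i <= Suc m" if "w \<in> yfix n b (Suc m)" for w i
 proof -
  show p: "w permutes {1..n}" using that youngD(1) by (auto simp: yfix_def)
  have fixd: "\<And>i. i > Suc m ==> w i = i" using that by (simp add: yfix_def)
  show "w i <= Suc m \<longleftrightarrow> i <= Suc m"
   using fixd[of i] fixd[of "w i"] injD[OF permutes_inj[OF p], of i "w i"] by (metis not_le_imp_less not_le)
 qed
 have "(\<Sum>w\<in>yfix n b (Suc m). tt ^ card (invs n w)) = (\<Sum>j\<in>J. F j)"
 proof -
  have "(\<lambda>w. w (Suc m)) ` yfix n b (Suc m) \<subseteq> J"
  proof clarify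
   fix w assume w: "w \<in> yfix n b (Suc m)"
   have "w \<in> young n b" using w by (simp add: yfix_def)
   then show "w (Suc m) \<in> J"
    using youngD(2)[of w n b "Suc m"] perm_range[OF yw(1)[OF w], of "Suc m"] yw(2)[OF w, of "Suc m"] m by (simp add: J_def)
  qed
  then show ?thesis unfolding F_def by (intro sum.group[symmetric] fin) (simp_all add: J_def)
 qed
 moreover have "F j = tt ^ (Suc m - j) * ?P" if "j \<in> J" for j
 proof -
  have "j <= Suc m" using that by (simp add: J_def)
  then show ?thesis using that
  proof (induction rule: inc_induct)
   case base
   have "(\<forall>i>m. w i = i) \<longleftrightarrow> (\<forall>i>Suc m. w i = i) \<and> w (Suc m) = Suc m" for w :: "nat => nat"
    using Suc_lessI by (metis Suc_lessD lessI)
   then have "{w \<in> yfix n b (Suc m). w (Suc m) = Suc m} = yfix n b m"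
    unfolding yfix_def by auto
   then show ?case by (simp add: F_def)
  next
   case (step j)
   have j: "1 <= j" "j < n" "j <= m" "b j = b (Suc j)" using step m Jconv[of j] by (auto simp: J_def)
   have sj: "sr j \<in> young n b" using young_sr j by blast
   have mem: "sr j \<circ> w \<in> yfix n b (Suc m)" if "w \<in> yfix n b (Suc m)" for w
    using that young_comp[OF sj, of w] j by (auto simp: yfix_def sr_apply)
   have ivs: "card (invs n w) = Suc (card (invs n (sr j \<circ> w)))" if w: "w \<in> yfix n b (Suc m)" "w (Suc m) = j" for w
   proof (rule card_invs_left[OF yw(1)[OF w(1)] j(1,2)])
    have "inv w j = Suc m" using permutes_inverses(2)[OF yw(1)[OF w(1)], of "Suc m"] w(2) by simp
    moreover have "w (inv w (Suc j)) = Suc j" using permutes_inverses(1)[OF yw(1)[OF w(1)]] .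
    then have "inv w (Suc j) <= Suc m" "inv w (Suc j) ~= Suc m" using yw(2)[OF w(1), of "inv w (Suc j)"] j w(2) by auto
    ultimately show "inv w (Suc j) < inv w j" by simp
   qed
   have "F j = (\<Sum>w\<in>{w \<in> yfix n b (Suc m). w (Suc m) = Suc j}. tt * tt ^ card (invs n w))"
    unfolding F_def
   proof (rule sum.reindex_bij_witness[of _ "\<lambda>w. sr j \<circ> w" "\<lambda>w. sr j \<circ> w"])
    fix w assume w: "w \<in> {w \<in> yfix n b (Suc m). w (Suc m) = j}"
    show "sr j \<circ> (sr j \<circ> w) = w" by (simp add: fun_eq_iff sr_apply)
    show "sr j \<circ> w \<in> {w \<in> yfix n b (Suc m). w (Suc m) = Suc j}" using w mem[of w] by (simp add: sr_apply)
    show "tt * tt ^ card (invs n (sr j \<circ> w)) = tt ^ card (invs n w)" using w ivs[of w] by simp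
   next
    fix w assume w: "w \<in> {w \<in> yfix n b (Suc m). w (Suc m) = Suc j}"
    show "sr j \<circ> (sr j \<circ> w) = w" by (simp add: fun_eq_iff sr_apply)
    show "sr j \<circ> w \<in> {w \<in> yfix n b (Suc m). w (Suc m) = j}" using w mem[of w] by (simp add: sr_apply)
   qed
   also have "\<dots> = tt * F (Suc j)" by (simp add: F_def sum_distrib_left)
   also have "F (Suc j) = tt ^ (Suc m - Suc j) * ?P" by (rule step.IH) (use step.prems j Jconv in simp)
   finally show ?case using j by (simp add: Suc_diff_le mult.assoc)
  qed
 qed
 ultimately have "(\<Sum>w\<in>yfix n b (Suc m). tt ^ card (invs n w)) = (\<Sum>j\<in>J. tt ^ (Suc m - j)) * ?P"
  by (simp add: sum_distrib_right)
 \<comment> \<open>\<open>J\<close> is an interval ending in \<open>Suc m\<close>, so the exponents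
   run from \<open>0\<close> to \<open>card J - 1\<close>.\<close>
 also have "(\<Sum>j\<in>J. tt ^ (Suc m - j)) = qint (int (card J))"
 proof -
  have Sm: "Suc m \<in> J" "finite J" by (simp_all add: J_def)
  define a where "a = Min J"
  have a: "a \<in> J" "\<And>j. j \<in> J ==> a <= j"
   unfolding a_def using Min_in[OF Sm(2)] Min_le[OF Sm(2)] Sm(1) by blast+
  have jJ: "j \<in> J" if "a <= j" "j <= Suc m" for j
   using that by (induction j rule: dec_induct) (use a Jconv in auto)
  have Jm: "j <= Suc m" if "j \<in> J" for j using that by (simp add: J_def)
  have J: "J = {a..Suc m}" unfolding set_eq_iff atLeastAtMost_iff using jJ Jm a(2) by blast
  have "a <= Suc m" using a Sm by blast
  then have "(\<Sum>j\<in>J. tt ^ (Suc m - j)) = (\<Sum>i<card J. tt ^ i)"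
   unfolding J by (intro sum.reindex_bij_witness[of _ "\<lambda>i. Suc m - i" "\<lambda>j. Suc m - j"]) auto
  then show ?thesis by (simp add: qint_def)
 qed
 finally show ?thesis by (simp add: J_def)
qed

lemma poincare:
 assumes b: "convex_lab n b"
 shows "(\<Sum>w\<in>young n b. tt ^ card (invs n w)) = (\<Prod>k\<in>{1..n}. qint (int (card {j \<in> {1..k}. b j = b k})))"
proof -
 have z: "yfix n b 0 = {id}"
  using youngD(1)[of _ n b] permutes_not_in[of _ "{1..n}" 0] young_id[of n b]
  by (auto simp: yfix_def fun_eq_iff) (metis atLeastAtMost_iff not_one_le_zero gr0I)
 have "m <= n ==> (\<Sum>w\<in>yfix n b m. tt ^ card (invs n w)) = (\<Prod>k\<in>{1..m}. qint (int (card {j \<in> {1..k}. b j = b k})))" for m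
 proof (induction m)
  case 0
  show ?case unfolding z by (simp del: id_apply)
 next
  case (Suc m)
  then show ?case using poincare_step[OF b, of m] by (simp add: mult.commute)
 qed
 from this[of n] show ?thesis
 proof -
  have "yfix n b n = young n b"
   using youngD(1)[of _ n b] permutes_not_in[of _ "{1..n}"] by (fastforce simp: yfix_def)
  then show ?thesis using \<open>n <= n ==> _\<close> by simp
 qed
qed

context seminormal
begin

text \<open>A node in column \<open>c\<close> is preceded by \<open>c\<close> positions of its row,
  and it meets one factor of \<open>uu lam\<close> for each later component. In this form the
  factors are the boundary terms of the telescoping sums.\<close>

lemma gam_eq: "gam = (\<Prod>x\<in>D. qint (int (snd (snd x)) + 1) * (\<Prod>m\<in>{fst x<..<ell}. qint (ct x - kappa ! m)))"
proof -
 have bij: "bij_betw tla D {1..n}" using tlam_bij[of lam] sz by simp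
 have "(\<Sum>w\<in>young n (rowl lam). tt ^ card (invs n w)) = (\<Prod>k\<in>{1..n}. qint (int (card {j \<in> {1..k}. rowl lam j = rowl lam k})))"
  using poincare convex_rowl[of lam] sz by blast
 also have "\<dots> = (\<Prod>x\<in>D. qint (int (card {j \<in> {1..tla x}. rowl lam j = rowl lam (tla x)})))"
  by (rule prod.reindex_bij_betw[OF bij, symmetric])
 also have "\<dots> = (\<Prod>x\<in>D. qint (int (snd (snd x)) + 1))"
 proof (rule prod.cong[OF refl])
  fix x assume "x \<in> D"
  then obtain l r c where x: "x = (l, r, c)" "(l, r, c) \<in> D" by (cases x) auto
  have t: "tla (l, r, c') = off lam l r + c' + 1" "(l, r, c') \<in> D" if "c' <= c" for c'
   using tlam_eq[of l r c' lam] D_down[OF x(2) _ that, of r] by simp_all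
  have "{j \<in> {1..tla x}. rowl lam j = rowl lam (tla x)} = (\<lambda>c. off lam l r + c + 1) ` {..c}"
  proof (intro equalityI subsetI)
   fix j assume j: "j \<in> {j \<in> {1..tla x}. rowl lam j = rowl lam (tla x)}"
   then have jn: "1 <= j" "j <= n" using tlam_range(2)[OF x(2)] sz x by auto
   have J: "nd lam j \<in> D" "tla (nd lam j) = j" using nd_in[of j lam] tlam_nd[of j lam] jn sz by simp_all
   obtain c' where N: "nd lam j = (l, r, c')"
    using j rowl_tlam[OF x(2)] x(1) unfolding rowl_def by (cases "nd lam j") auto
   have "off lam l r + c' + 1 = j" using tlam_eq[of l r c' lam] J N by simp
   then show "j \<in> (\<lambda>c. off lam l r + c + 1) ` {..c}" using j t(1)[of c] x by (intro image_eqI[of _ _ c']) auto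
  next
   fix j assume "j \<in> (\<lambda>c. off lam l r + c + 1) ` {..c}"
   then obtain c' where c': "c' <= c" "j = tla (l, r, c')" using t(1) by auto
   then show "j \<in> {j \<in> {1..tla x}. rowl lam j = rowl lam (tla x)}"
    using t[OF c'(1)] t(1)[of c] rowl_tlam[OF t(2)[OF c'(1)]] rowl_tlam[OF x(2)] x by simp
  qed
  then have "card {j \<in> {1..tla x}. rowl lam j = rowl lam (tla x)} = c + 1"
   by (simp add: card_image inj_on_def)
  then show "qint (int (card {j \<in> {1..tla x}. rowl lam j = rowl lam (tla x)})) = qint (int (snd (snd x)) + 1)"
   using x by (simp add: add.commute)
 qed
 finally have p: "(\<Sum>w\<in>young n (rowl lam). tt ^ card (invs n w)) = (\<Prod>x\<in>D. qint (int (snd (snd x)) + 1))" .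
 have pl: "prod_list (map f [0..<a]) = prod f {..<a}" "prod_list (map f [1..<a + 1]) = prod f {1..a}" for f :: "nat => laurent" and a
  by (induction a) (simp_all add: mult.commute)
 have "UV lam tla = (\<Prod>l<ell - 1. \<Prod>r\<in>{1..csum lam (l + 1)}. qint (cc tla r - kappa ! (l + 1)))"
  unfolding UV_def pl length_lam ..
 also have "\<dots> = (\<Prod>l<ell - 1. \<Prod>x\<in>{x \<in> D. fst x < l + 1}. qint (ct x - kappa ! (l + 1)))"
 proof (rule prod.cong[OF refl])
  fix l assume "l \<in> {..<ell - 1}"
  have sub: "{1..csum lam (l + 1)} = tla ` {x \<in> D. fst x < l + 1}"
  proof (intro equalityI subsetI)
   fix k assume "k \<in> {1..csum lam (l + 1)}"
   then have k: "1 <= k" "k <= csum lam (l + 1)" "k <= n" using csum_le[of lam "l + 1"] sz by auto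
   have K: "nd lam k \<in> D" "tla (nd lam k) = k" using nd_in[of k lam] tlam_nd[of k lam] k sz by simp_all
   then have "fst (nd lam k) < l + 1" using comp_less_iff[of "fst (nd lam k)" _ _ lam "l + 1"] k by (cases "nd lam k") auto
   then show "k \<in> tla ` {x \<in> D. fst x < l + 1}" using K by (intro image_eqI[of _ _ "nd lam k"]) auto
  next
   fix k assume "k \<in> tla ` {x \<in> D. fst x < l + 1}"
   then obtain l' r c where x: "(l', r, c) \<in> D" "l' < l + 1" "k = tla (l', r, c)" by auto
   then show "k \<in> {1..csum lam (l + 1)}" using comp_less_iff[OF x(1), of "l + 1"] tlam_range(1)[OF x(1)] by simp
  qed
  have "cc tla (tla x) = ct x" if "x \<in> D" for x
   using nod_s[OF tlam_std that] std_range[OF tlam_std that] by (simp add: cc_def)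
  then show "(\<Prod>r\<in>{1..csum lam (l + 1)}. qint (cc tla r - kappa ! (l + 1)))
    = (\<Prod>x\<in>{x \<in> D. fst x < l + 1}. qint (ct x - kappa ! (l + 1)))"
   unfolding sub by (subst prod.reindex) (auto intro: inj_on_subset[OF tlam_inj] prod.cong)
 qed
 also have "\<dots> = (\<Prod>l<ell - 1. \<Prod>x\<in>D. if fst x < l + 1 then qint (ct x - kappa ! (l + 1)) else 1)"
  by (intro prod.cong refl prod.inter_filter finite_diagram)
 also have "\<dots> = (\<Prod>x\<in>D. \<Prod>l<ell - 1. if fst x < l + 1 then qint (ct x - kappa ! (l + 1)) else 1)"
  by (rule prod.swap)
 also have "\<dots> = (\<Prod>x\<in>D. \<Prod>m\<in>{fst x<..<ell}. qint (ct x - kappa ! m))"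
 proof (rule prod.cong[OF refl])
  fix x
  show "(\<Prod>l<ell - 1. if fst x < l + 1 then qint (ct x - kappa ! (l + 1)) else 1) = (\<Prod>m\<in>{fst x<..<ell}. qint (ct x - kappa ! m))"
   unfolding prod.inter_filter[OF finite_lessThan, symmetric]
   by (rule prod.reindex_bij_witness[of _ "\<lambda>m. m - 1" Suc]) auto
 qed
 finally show ?thesis unfolding gam_def p by (simp add: prod.distrib mult.commute)
qed

end

section \<open>Addable and removable nodes, and the telescoping sum\<close>

text \<open>Diagrams as downward closed sets of nodes, a description in which inserting or deleting
  a node is direct; \<open>is_mp_diagram_iff\<close> ties it to lists of row lengths.\<close>

definition young_set :: "nat => node set => bool" where
 "young_set ell X \<longleftrightarrow> finite X \<and> (\<forall>l r c. (l, r, c) \<in> X --> l < ell)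
  \<and> (\<forall>l r c. (l, r, Suc c) \<in> X --> (l, r, c) \<in> X) \<and> (\<forall>l r c. (l, Suc r, c) \<in> X --> (l, r, c) \<in> X)"

definition rlen :: "node set => nat => nat => nat" where "rlen X l r = card {c. (l, r, c) \<in> X}"

lemma down_nat:
 assumes fin: "finite A" and d: "\<And>c. Suc c \<in> A ==> c \<in> A"
 shows "c \<in> A \<longleftrightarrow> c < card A"
proof -
 have le: "c \<in> A" if "c <= c'" "c' \<in> A" for c c'
  using that by (induction c' rule: dec_induct) (use d in auto)
 have "A = {..<card A}"
 proof (cases "A = {}")
  case False
  have "A = {..Max A}" using le[OF _ Max_in[OF fin False]] Max_ge[OF fin] by auto
  then show ?thesis by (metis card_atMost lessThan_Suc_atMost)
 qed simp
 then show ?thesis by blast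
qed

lemma young_setD:
 assumes "young_set ell X"
 shows "finite X" "(l, r, c) \<in> X ==> l < ell" "(l, r, Suc c) \<in> X ==> (l, r, c) \<in> X"
  "(l, Suc r, c) \<in> X ==> (l, r, c) \<in> X"
 using assms unfolding young_set_def by blast+

lemma young_setI:
 assumes "finite X" "\<And>l r c. (l, r, c) \<in> X ==> l < ell" "\<And>l r c. (l, r, Suc c) \<in> X ==> (l, r, c) \<in> X"
  "\<And>l r c. (l, Suc r, c) \<in> X ==> (l, r, c) \<in> X"
 shows "young_set ell X"
 using assms unfolding young_set_def by blast

lemma young_set_insert:
 assumes y: "young_set ell X" and m: "m < ell" and c: "\<And>c'. c = Suc c' ==> (m, i, c') \<in> X"
  and i: "\<And>i'. i = Suc i' ==> (m, i', c) \<in> X"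
 shows "young_set ell (insert (m, i, c) X)"
proof (rule young_setI)
 show "finite (insert (m, i, c) X)" using young_setD(1)[OF y] by simp
 show "l < ell" if "(l, r, k) \<in> insert (m, i, c) X" for l r k
  using that young_setD(2)[OF y, of l r k] m by auto
 show "(l, r, k) \<in> insert (m, i, c) X" if "(l, r, Suc k) \<in> insert (m, i, c) X" for l r k
  using that young_setD(3)[OF y, of l r k] c[of k] by auto
 show "(l, r, k) \<in> insert (m, i, c) X" if "(l, Suc r, k) \<in> insert (m, i, c) X" for l r k
  using that young_setD(4)[OF y, of l r k] i[of r] by auto
qed

lemma young_set_delete:
 assumes y: "young_set ell X" and n: "(m, i, Suc c) \<notin> X" "(m, Suc i, c) \<notin> X"
 shows "young_set ell (X - {(m, i, c)})"
proof (rule young_setI)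
 show "finite (X - {(m, i, c)})" using young_setD(1)[OF y] by simp
 show "l < ell" if "(l, r, k) \<in> X - {(m, i, c)}" for l r k
  using that young_setD(2)[OF y, of l r k] by simp
 show "(l, r, k) \<in> X - {(m, i, c)}" if "(l, r, Suc k) \<in> X - {(m, i, c)}" for l r k
  using that young_setD(3)[OF y, of l r k] n by auto
 show "(l, r, k) \<in> X - {(m, i, c)}" if "(l, Suc r, k) \<in> X - {(m, i, c)}" for l r k
  using that young_setD(4)[OF y, of l r k] n by auto
qed

lemma young_set_finite:
 assumes "young_set ell X" shows "finite {c. (l, r, c) \<in> X}" "finite {r. (l, r, 0) \<in> X}"
proof -
 note f = young_setD(1)[OF assms]
 show "finite {c. (l, r, c) \<in> X}"
  by (rule finite_subset[of _ "(\<lambda>x. snd (snd x)) ` X"]) (force, simp add: f)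
 show "finite {r. (l, r, 0) \<in> X}"
  by (rule finite_subset[of _ "(\<lambda>x. fst (snd x)) ` X"]) (force, simp add: f)
qed

lemma rlen_iff:
 assumes y: "young_set ell X" shows "(l, r, c) \<in> X \<longleftrightarrow> c < rlen X l r"
 using down_nat[OF young_set_finite(1)[OF y], of l r c] young_setD(3)[OF y] unfolding rlen_def by simp

lemma rlen_antimono: "young_set ell X ==> rlen X l (Suc r) <= rlen X l r"
 unfolding rlen_def by (rule card_mono[OF young_set_finite(1)]) (use young_setD(4) in blast)+

lemma is_mp_diagram_iff: "is_mp_diagram ell X \<longleftrightarrow> young_set ell X"
proof
 assume "is_mp_diagram ell X"
 then obtain nu where nu: "length nu = ell" "\<forall>p\<in>set nu. is_partition p" "diagram nu = X"
  unfolding is_mp_diagram_def by blast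
 have 1: "(l, r, c) \<in> diagram nu" if "(l, Suc r, c) \<in> diagram nu" for l r c
  using that partition_antimono[of "nu ! l" r "Suc r"] nu(2) by (auto simp: diagram_iff)
 have 2: "(l, r, c) \<in> diagram nu" if "(l, r, Suc c) \<in> diagram nu" for l r c
  using that by (simp add: diagram_iff)
 have 3: "l < ell" if "(l, r, c) \<in> diagram nu" for l r c
  using that by (simp add: diagram_iff nu(1))
 show "young_set ell X" unfolding young_set_def nu(3)[symmetric] using 1 2 3 finite_diagram[of nu] by blast
next
 assume y: "young_set ell X"
 define ht where "ht l = card {r. (l, r, 0) \<in> X}" for l
 have ht: "(l, r, 0) \<in> X \<longleftrightarrow> r < ht l" for l r
  unfolding ht_def using down_nat[OF young_set_finite(2)[OF y], of l r] young_setD(4)[OF y] by simp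
 let ?nu = "map (\<lambda>l. map (rlen X l) [0..<ht l]) [0..<ell]"
 have anti: "rlen X l r' <= rlen X l r" if "r <= r'" for l r r'
  using that by (induction r' rule: dec_induct) (auto intro: le_trans[OF rlen_antimono[OF y]])
 have "is_partition (map (rlen X l) [0..<ht l])" for l
  unfolding is_partition_def sorted_wrt_rev
 proof
  show "sorted_wrt (\<lambda>x y. y <= x) (map (rlen X l) [0..<ht l])"
   by (simp add: sorted_wrt_iff_nth_less anti)
  show "0 \<notin> set (map (rlen X l) [0..<ht l])"
  proof
   assume "0 \<in> set (map (rlen X l) [0..<ht l])"
   then obtain r where r: "r < ht l" "rlen X l r = 0" by auto
   have "(l, r, 0) \<in> X" using r(1) unfolding ht .
   then show False using r(2) unfolding rlen_iff[OF y] by simp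
  qed
 qed
 note part = this
 have dia: "diagram ?nu = X"
 proof -
  have "(l, r, c) \<in> diagram ?nu \<longleftrightarrow> (l, r, c) \<in> X" for l r c
  proof -
   have "l < ell" "r < ht l" if "(l, r, c) \<in> X"
    using young_setD(2)[OF y that] that rlen_iff[OF y, of l r c] rlen_iff[OF y, of l r 0] ht[of l r] by simp_all
   then show ?thesis using rlen_iff[OF y, of l r c] by (auto simp: diagram_iff)
  qed
  then show ?thesis by auto
 qed
 show "is_mp_diagram ell X" unfolding is_mp_diagram_def
  by (intro exI[of _ ?nu] conjI dia) (simp, use part in auto)
qed

lemma addable_iff:
 assumes y: "young_set ell X"
 shows "(m, i, c) \<in> addable ell X \<longleftrightarrow> m < ell \<and> c = rlen X m i \<and> (i = 0 \<or> rlen X m i < rlen X m (i - 1))"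
proof
 note X = rlen_iff[OF y]
 assume "(m, i, c) \<in> addable ell X"
 then have n: "(m, i, c) \<notin> X" and z: "young_set ell (insert (m, i, c) X)" by (simp_all add: addable_def is_mp_diagram_iff)
 have z': "(l, r, Suc k) \<in> insert (m, i, c) X ==> (l, r, k) \<in> insert (m, i, c) X"
  "(l, Suc r, k) \<in> insert (m, i, c) X ==> (l, r, k) \<in> insert (m, i, c) X" for l r k
  using z unfolding young_set_def by blast+
 have "m < ell" using z unfolding young_set_def by blast
 moreover have "c = rlen X m i"
 proof (cases c)
  case 0
  then show ?thesis using n X by auto
 next
  case (Suc c')
  then have "(m, i, c') \<in> X" using z'(1)[of m i c'] by simp
  then show ?thesis using n X Suc by auto
 qed
 moreover have "c < rlen X m (i - 1)" if ne: "i ~= 0"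
 proof -
  obtain i' where i': "i = Suc i'" using ne not0_implies_Suc by blast
  then have "(m, i', c) \<in> X" using z'(2)[of m i' c] by simp
  then show ?thesis using X i' by simp
 qed
 ultimately show "m < ell \<and> c = rlen X m i \<and> (i = 0 \<or> rlen X m i < rlen X m (i - 1))" by auto
next
 note X = rlen_iff[OF y]
 assume a: "m < ell \<and> c = rlen X m i \<and> (i = 0 \<or> rlen X m i < rlen X m (i - 1))"
 then have n: "(m, i, c) \<notin> X" using X by simp
 have "(m, i, c') \<in> X" if "c = Suc c'" for c' using a that X[of m i c'] by simp
 moreover have "(m, i', c) \<in> X" if "i = Suc i'" for i' using a that X[of m i' c] by simp
 ultimately have "young_set ell (insert (m, i, c) X)"
  using a by (intro young_set_insert[OF y]) simp_all
 then show "(m, i, c) \<in> addable ell X" using n by (simp add: addable_def is_mp_diagram_iff)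
qed

lemma removable_iff:
 assumes y: "young_set ell X"
 shows "(m, i, c) \<in> removable ell X \<longleftrightarrow> Suc c = rlen X m i \<and> rlen X m (Suc i) < rlen X m i"
proof
 note X = rlen_iff[OF y]
 assume "(m, i, c) \<in> removable ell X"
 then have n: "(m, i, c) \<in> X" and z: "young_set ell (X - {(m, i, c)})" by (simp_all add: removable_def is_mp_diagram_iff)
 have z': "(l, r, Suc k) \<in> X - {(m, i, c)} ==> (l, r, k) \<in> X - {(m, i, c)}"
  "(l, Suc r, k) \<in> X - {(m, i, c)} ==> (l, r, k) \<in> X - {(m, i, c)}" for l r k
  using z unfolding young_set_def by blast+
 have "(m, i, Suc c) \<notin> X" "(m, Suc i, c) \<notin> X" using z'(1)[of m i c] z'(2)[of m i c] by auto
 then show "Suc c = rlen X m i \<and> rlen X m (Suc i) < rlen X m i" using n X by auto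
next
 note X = rlen_iff[OF y]
 assume a: "Suc c = rlen X m i \<and> rlen X m (Suc i) < rlen X m i"
 then have n: "(m, i, c) \<in> X" "(m, i, Suc c) \<notin> X" "(m, Suc i, c) \<notin> X" using X by auto
 then have "young_set ell (X - {(m, i, c)})"
  by (intro young_set_delete[OF y])
 then show "(m, i, c) \<in> removable ell X" using n by (simp add: removable_def is_mp_diagram_iff)
qed

text \<open>The summand is a second difference of \<open>F\<close>, so only terms at the two ends of
  the row remain.\<close>

lemma row_telescope:
 fixes F :: "int => int"
 shows "(\<Sum>j<p. F (x - int j + 1) + F (x - int j - 1) - 2 * F (x - int j))
  = F (x + 1) - F (x + 1 - int p) + F (x - int p) - F x"
 by (induction p) (simp_all add: algebra_simps)

text \<open>After cancellation, row \<open>i\<close> leaves a positive term at the first free place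
  of row \<open>Suc i\<close> and a negative one at its own last node. For equal row lengths these
  cancel; at a strict drop they are an addable and a removable node.\<close>

lemma component_telescope:
 fixes F :: "int => int" and p :: "nat => nat"
 assumes "k <= N" "p N = 0" and anti: "\<And>i. p (Suc i) <= p i"
 shows "F (x + int k) + (\<Sum>i\<in>{k..<N}. \<Sum>j<p i. F (x + int i - int j + 1) + F (x + int i - int j - 1) - 2 * F (x + int i - int j))
  = F (x + int k - int (p k))
   + (\<Sum>i\<in>{i \<in> {k..<N}. p (Suc i) < p i}. F (x + int (Suc i) - int (p (Suc i))) - F (x + int (Suc i) - int (p i)))"
 using assms(1)
proof (induction k rule: inc_induct)
 case base
 then show ?case using assms(2) by simp
next
 case (step k)
 have s: "{k..<N} = insert k {Suc k..<N}" using step by auto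
 let ?f = "\<lambda>i. F (x + int (Suc i) - int (p (Suc i))) - F (x + int (Suc i) - int (p i))"
 have "(\<Sum>i\<in>{i \<in> {k..<N}. p (Suc i) < p i}. ?f i) = ?f k + (\<Sum>i\<in>{i \<in> {Suc k..<N}. p (Suc i) < p i}. ?f i)"
 proof (cases "p (Suc k) < p k")
  case True
  then have "{i \<in> {k..<N}. p (Suc i) < p i} = insert k {i \<in> {Suc k..<N}. p (Suc i) < p i}" unfolding s by auto
  then show ?thesis by simp
 next
  case False
  then have "{i \<in> {k..<N}. p (Suc i) < p i} = {i \<in> {Suc k..<N}. p (Suc i) < p i}" "p (Suc k) = p k"
   unfolding s using anti[of k] by auto
  then show ?thesis by simp
 qed
 then show ?case using step.IH row_telescope[of F "x + int k" "p k"] unfolding s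
  by (simp add: algebra_simps)
qed

definition cont :: "int list => node => int" where "cont kappa = (\<lambda>(l, r, c). kappa ! l + int c - int r)"

text \<open>The node right of \<open>A\<close> may be addable and counts as below \<open>A\<close>; it contributes \<open>F (-1)\<close>.\<close>

lemma second_difference_sum:
 fixes F :: "int => int" and kappa :: "int list"
 assumes y: "young_set ell X" and A: "(m0, r0, c0) \<in> X" "(m0, r0, Suc c0) \<notin> X" "(m0, Suc r0, c0) \<notin> X"
  and F1: "F (-1) = 0"
 defines "a \<equiv> cont kappa (m0, r0, c0)"
 shows "F (int c0 + 1) + (\<Sum>m\<in>{m0<..<ell}. F (a - kappa ! m))
   + (\<Sum>Q\<in>{Q \<in> X. node_below Q (m0, r0, c0)}. F (a - cont kappa Q + 1) + F (a - cont kappa Q - 1) - 2 * F (a - cont kappa Q))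
  = (\<Sum>B\<in>{B \<in> addable ell X. node_below B (m0, r0, c0)}. F (a - cont kappa B))
   - (\<Sum>B\<in>{B \<in> removable ell X. node_below B (m0, r0, c0)}. F (a - cont kappa B))"
  and "finite {B \<in> addable ell X. node_below B (m0, r0, c0)}" "finite {B \<in> removable ell X. node_below B (m0, r0, c0)}"
proof -
 note X = rlen_iff[OF y]
 let ?p = "rlen X" and ?A = "(m0, r0, c0)"
 let ?M = "{m0..<ell}"
 have pA: "?p m0 r0 = Suc c0" "?p m0 (Suc r0) <= c0" using A X by auto
 note fX = young_setD(1)[OF y] and m0 = young_setD(2)[OF y A(1)]
 \<comment> \<open>A bound past the last nonempty row, so that each component sum ends in an empty
   row.\<close>
 define N where "N = Suc (Max ((\<lambda>x. fst (snd x)) ` X))"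
 have rN: "r < N" if "(l, r, c) \<in> X" for l r c
  using that fX unfolding N_def by (intro le_imp_less_Suc Max_ge) (auto intro: rev_image_eqI)
 have pN: "?p m i = 0" if "N <= i" for m i using rN[of m i 0] X[of m i 0] that by auto
 have piN: "i < N" if "0 < ?p m i" for m i using that pN[of i m] by (cases "N <= i") simp_all
 \<comment> \<open>The nodes below \<open>A\<close> begin with the next row in the component of
   \<open>A\<close>, whose own row ends at \<open>A\<close>, and with row \<open>0\<close> in later
   components.\<close>
 define i0 where "i0 m = (if m = m0 then Suc r0 else 0)" for m
 have i0N: "i0 m <= N" for m using rN[OF A(1)] by (simp add: i0_def)
 let ?K = "SIGMA m:?M. {i \<in> {i0 m..<N}. ?p m (Suc i) < ?p m i}"
 let ?g0 = "\<lambda>m. (m, i0 m, ?p m (i0 m))" and ?g1 = "\<lambda>(m, i). (m, Suc i, ?p m (Suc i))" and ?g2 = "\<lambda>(m, i). (m, i, ?p m i - 1)"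
 let ?Add = "{B \<in> addable ell X. node_below B ?A}" and ?Rem = "{B \<in> removable ell X. node_below B ?A}"
 have fK: "finite ?K" by auto
 have below: "node_below (m, i, c) ?A \<longleftrightarrow> m0 < m \<or> m = m0 \<and> (r0 < i \<or> i = r0 \<and> c0 < c)" for m i c
  by (auto simp: node_below_def)
 have add1: "?g0 ` ?M \<union> ?g1 ` ?K \<subseteq> ?Add"
  using m0 pA by (auto simp: addable_iff[OF y] below i0_def)
 have add2: "?Add \<subseteq> insert (m0, r0, Suc c0) (?g0 ` ?M \<union> ?g1 ` ?K)"
 proof
  fix B assume B: "B \<in> ?Add"
  obtain m i c where b: "B = (m, i, c)" by (metis prod_cases3)
  have h: "m < ell" "c = ?p m i" "i = 0 \<or> ?p m i < ?p m (i - 1)" "m0 < m \<or> m = m0 \<and> (r0 < i \<or> i = r0 \<and> c0 < c)"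
   using B unfolding b mem_Collect_eq addable_iff[OF y] below by blast+
  have "(m = m0 \<and> i = r0) \<or> i = i0 m \<or> i0 m < i" using h(4) by (cases "m = m0") (auto simp: i0_def)
  then consider "m = m0" "i = r0" | "i = i0 m" | "i0 m < i" by blast
  then show "B \<in> insert (m0, r0, Suc c0) (?g0 ` ?M \<union> ?g1 ` ?K)"
  proof cases
   case 1
   then show ?thesis using h pA b by simp
  next
   case 2
   then show ?thesis using h b by auto
  next
   case 3
   then obtain i' where i': "i = Suc i'" by (cases i) auto
   then have "?p m (Suc i') < ?p m i'" "i0 m <= i'" using h 3 by auto
   moreover have "i' < N" using piN[of m i'] calculation by simp
   ultimately have "(m, i') \<in> ?K" using h by auto
   then have "?g1 (m, i') \<in> ?g1 ` ?K" by (rule imageI)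
   moreover have "?g1 (m, i') = B" using h b i' by simp
   ultimately show ?thesis by simp
  qed
 qed
 have rem: "?Rem = ?g2 ` ?K"
 proof (intro equalityI subsetI)
  fix B assume B: "B \<in> ?Rem"
  obtain m i c where b: "B = (m, i, c)" by (metis prod_cases3)
  have h: "Suc c = ?p m i" "?p m (Suc i) < ?p m i" "m0 < m \<or> m = m0 \<and> (r0 < i \<or> i = r0 \<and> c0 < c)"
   using B unfolding b mem_Collect_eq removable_iff[OF y] below by blast+
  have "(m, i, c) \<in> X" using X h by auto
  then have "m < ell" by (rule young_setD(2)[OF y])
  moreover have "i0 m <= i" using h pA by (auto simp: i0_def)
  moreover have "i < N" using piN[of m i] h by simp
  ultimately have "(m, i) \<in> ?K" using h by auto
  then have "?g2 (m, i) \<in> ?g2 ` ?K" by (rule imageI)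
  moreover have "c = ?p m i - 1" using h(1) by linarith
  then have "?g2 (m, i) = B" using b by simp
  ultimately show "B \<in> ?g2 ` ?K" by simp
 next
  fix B assume "B \<in> ?g2 ` ?K"
  then show "B \<in> ?Rem" by (auto simp: removable_iff[OF y] below i0_def split: if_splits)
 qed
 show fin: "finite ?Add" "finite ?Rem" unfolding rem using fK finite_subset[OF add2] by auto
 have "(\<Sum>B\<in>?Add. F (a - cont kappa B)) = (\<Sum>B\<in>?g0 ` ?M \<union> ?g1 ` ?K. F (a - cont kappa B))"
 proof (rule sum.mono_neutral_right[OF fin(1) add1])
  show "\<forall>B\<in>?Add - (?g0 ` ?M \<union> ?g1 ` ?K). F (a - cont kappa B) = 0"
  proof
   fix B assume "B \<in> ?Add - (?g0 ` ?M \<union> ?g1 ` ?K)"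
   then have "B = (m0, r0, Suc c0)" using add2 by blast
   then have "a - cont kappa B = -1" by (simp add: a_def cont_def)
   then show "F (a - cont kappa B) = 0" using F1 by simp
  qed
 qed
 also have "\<dots> = (\<Sum>B\<in>?g0 ` ?M. F (a - cont kappa B)) + (\<Sum>B\<in>?g1 ` ?K. F (a - cont kappa B))"
  by (rule sum.union_disjoint) (use fK in auto)
 also have "(\<Sum>B\<in>?g0 ` ?M. F (a - cont kappa B)) = (\<Sum>m\<in>?M. F (a - kappa ! m + int (i0 m) - int (?p m (i0 m))))"
  by (subst sum.reindex) (auto simp: inj_on_def cont_def algebra_simps intro!: sum.cong)
 also have "(\<Sum>B\<in>?g1 ` ?K. F (a - cont kappa B)) = (\<Sum>(m, i)\<in>?K. F (a - kappa ! m + int (Suc i) - int (?p m (Suc i))))"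
  by (subst sum.reindex) (auto simp: inj_on_def cont_def algebra_simps intro!: sum.cong)
 finally have sA: "(\<Sum>B\<in>?Add. F (a - cont kappa B)) = (\<Sum>m\<in>?M. F (a - kappa ! m + int (i0 m) - int (?p m (i0 m))))
   + (\<Sum>(m, i)\<in>?K. F (a - kappa ! m + int (Suc i) - int (?p m (Suc i))))" .
 have sR: "(\<Sum>B\<in>?Rem. F (a - cont kappa B)) = (\<Sum>(m, i)\<in>?K. F (a - kappa ! m + int (Suc i) - int (?p m i)))"
  unfolding rem by (subst sum.reindex) (auto simp: inj_on_def cont_def algebra_simps of_nat_diff intro!: sum.cong)
 let ?h = "\<lambda>m i j. F (a - kappa ! m + int i - int j + 1) + F (a - kappa ! m + int i - int j - 1) - 2 * F (a - kappa ! m + int i - int j)"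
 have "{Q \<in> X. node_below Q ?A} = (SIGMA m:?M. SIGMA i:{i0 m..<N}. {..<?p m i})"
 proof -
  have "(m, i, j) \<in> {Q \<in> X. node_below Q ?A} \<longleftrightarrow> (m, i, j) \<in> (SIGMA m:?M. SIGMA i:{i0 m..<N}. {..<?p m i})" for m i j
  proof -
   have "m < ell" "i < N" if "(m, i, j) \<in> X" using young_setD(2)[OF y that] rN[OF that] by simp_all
   then show ?thesis using X[of m i j] pA by (auto simp: below i0_def)
  qed
  note iff = this
  show ?thesis
  proof (rule set_eqI)
   fix Q :: node
   obtain m i j where q: "Q = (m, i, j)" by (metis prod_cases3)
   show "Q \<in> {Q \<in> X. node_below Q ?A} \<longleftrightarrow> Q \<in> (SIGMA m:?M. SIGMA i:{i0 m..<N}. {..<?p m i})"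
    unfolding q by (rule iff)
  qed
 qed
 note Qs = this
 have sQ: "(\<Sum>Q\<in>{Q \<in> X. node_below Q ?A}. F (a - cont kappa Q + 1) + F (a - cont kappa Q - 1) - 2 * F (a - cont kappa Q))
   = (\<Sum>m\<in>?M. \<Sum>i\<in>{i0 m..<N}. \<Sum>j<?p m i. ?h m i j)"
 proof -
  have "(\<Sum>m\<in>?M. \<Sum>i\<in>{i0 m..<N}. \<Sum>j<?p m i. ?h m i j)
    = (\<Sum>(m, i, j)\<in>(SIGMA m:?M. SIGMA i:{i0 m..<N}. {..<?p m i}). ?h m i j)"
   by (simp add: sum.Sigma)
  then show ?thesis unfolding Qs by (simp only:) (rule sum.cong, auto simp: cont_def algebra_simps)
 qed
 have M: "?M = insert m0 {m0<..<ell}" using m0 by auto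
 \<comment> \<open>The boundary terms are the starting values of the component sums; in the
   component of \<open>A\<close>, starting at row \<open>Suc r0\<close>, the argument is
   \<open>c0 + 1\<close>.\<close>
 have s0: "F (int c0 + 1) + (\<Sum>m\<in>{m0<..<ell}. F (a - kappa ! m)) = (\<Sum>m\<in>?M. F (a - kappa ! m + int (i0 m)))"
  unfolding M by (simp add: i0_def a_def cont_def algebra_simps)
 have "(\<Sum>m\<in>?M. F (a - kappa ! m + int (i0 m)) + (\<Sum>i\<in>{i0 m..<N}. \<Sum>j<?p m i. ?h m i j))
   = (\<Sum>m\<in>?M. F (a - kappa ! m + int (i0 m) - int (?p m (i0 m)))
    + (\<Sum>i\<in>{i \<in> {i0 m..<N}. ?p m (Suc i) < ?p m i}. F (a - kappa ! m + int (Suc i) - int (?p m (Suc i))) - F (a - kappa ! m + int (Suc i) - int (?p m i))))"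
  by (intro sum.cong refl component_telescope i0N pN rlen_antimono[OF y]) simp
 note total = this
 have k: "(\<Sum>(m, i)\<in>?K. f m i) = (\<Sum>m\<in>?M. \<Sum>i\<in>{i \<in> {i0 m..<N}. ?p m (Suc i) < ?p m i}. f m i)" for f :: "nat => nat => int"
  by (rule sum.Sigma[symmetric]) auto
 show "F (int c0 + 1) + (\<Sum>m\<in>{m0<..<ell}. F (a - kappa ! m))
   + (\<Sum>Q\<in>{Q \<in> X. node_below Q ?A}. F (a - cont kappa Q + 1) + F (a - cont kappa Q - 1) - 2 * F (a - cont kappa Q))
  = (\<Sum>B\<in>?Add. F (a - cont kappa B)) - (\<Sum>B\<in>?Rem. F (a - cont kappa B))"
  unfolding s0 sA sR sQ k using total by (simp add: sum.distrib sum_subtractf)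
qed

section \<open>Cyclotomic polynomials\<close>

abbreviation xp :: "nat => rat poly" where "xp n \<equiv> monom 1 n - 1"

text \<open>By Bezout \<open>a * x = b * y + gcd a b\<close>, and \<open>xp (x * a)\<close> minus a
  monomial multiple of \<open>xp (y * b)\<close> equals \<open>xp (gcd a b)\<close>.\<close>

lemma xp_common_divisor:
 assumes "c dvd xp a" "c dvd xp b" "1 <= a"
 shows "c dvd xp (gcd a b)"
proof -
 have mult: "c dvd xp (k * m)" if "c dvd xp m" for k m
 proof (induction k)
  case (Suc k)
  have e: "xp (Suc k * m) = monom 1 m * xp (k * m) + xp m" by (simp add: algebra_simps mult_monom)
  show ?case unfolding e using Suc that by (intro dvd_add dvd_mult)
 qed simp
 obtain x y where xy: "a * x = b * y + gcd a b" using bezout_nat[of a b] assms(3) by auto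
 have "xp (x * a) - monom 1 (gcd a b) * xp (y * b) = xp (gcd a b)"
  using xy by (simp add: algebra_simps mult_monom)
 moreover have "c dvd xp (x * a) - monom 1 (gcd a b) * xp (y * b)"
  using mult[OF assms(1), of x] mult[OF assms(2), of y] by simp
 ultimately show ?thesis by (simp only:)
qed

text \<open>A repeated factor divides the derivative as well, and the derivative times the variable
  over \<open>m\<close> differs from \<open>xp m\<close> by \<open>1\<close>.\<close>

lemma xp_squarefree:
 assumes "c * c dvd xp m" "1 <= m" shows "is_unit c"
proof -
 obtain k where k: "xp m = c * (c * k)" using assms(1) by (auto simp: dvd_def mult.assoc)
 have "pderiv (xp m) = c * pderiv (c * k) + pderiv c * (c * k)" unfolding k pderiv_mult by (simp add: algebra_simps)
 also have "\<dots> = c * (pderiv (c * k) + pderiv c * k)" by (simp add: algebra_simps)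
 finally have "c dvd pderiv (xp m)" by simp
 then have 1: "c dvd smult (1 / of_nat m) (monom 1 1 * pderiv (xp m))" by (intro dvd_smult dvd_mult)
 have 2: "c dvd xp m" using k by simp
 have "c dvd smult (1 / of_nat m) (monom 1 1 * pderiv (xp m)) - xp m" by (rule dvd_diff[OF 1 2])
 also have "smult (1 / of_nat m) (monom 1 1 * pderiv (xp m)) - xp m = 1"
  using assms(2) by (simp add: pderiv_diff pderiv_monom mult_monom smult_monom)
 finally show ?thesis .
qed

lemma prod_dvd_coprime:
 fixes f :: "nat => rat poly"
 assumes "finite A" "\<And>i. i \<in> A ==> f i dvd x" "\<And>i j. i \<in> A ==> j \<in> A ==> i ~= j ==> coprime (f i) (f j)"
 shows "prod f A dvd x"
 using assms
proof (induction A)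
 case (insert i A)
 have "coprime (f i) (prod f A)"
  by (rule prod_coprime_right) (use insert in auto)
 then show ?case using insert by (simp add: divides_mult)
qed simp

declare cyclo.simps [simp del]

text \<open>The recursion divides by a product over proper divisors, so that product has to divide
  \<open>xp m\<close>. Its factors are pairwise coprime: a common divisor of two of them divides
  \<open>xp g\<close> for a proper divisor \<open>g\<close> of one index, and then its square
  divides a squarefree polynomial.\<close>

lemma prod_cyclo: "1 <= m ==> (\<Prod>d\<in>{d. d dvd m}. cyclo d) = xp m"
proof (induction m rule: less_induct)
 case (less m)
 let ?A = "{d. d dvd m \<and> d < m}"
 have fA: "finite ?A" by simp
 have pos: "1 <= d" if "d \<in> ?A" for d using that less.prems by (auto intro: Suc_leI dvd_pos_nat)
 have ih: "(\<Prod>e\<in>{e. e dvd d}. cyclo e) = xp d" if "d \<in> ?A" for d using less.IH[of d] pos[OF that] that by blast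
 have fin: "finite {e. e dvd d}" if "1 <= d" for d :: nat using that by simp
 have dv: "cyclo d dvd xp d" if "d \<in> ?A" for d
  unfolding ih[OF that, symmetric] by (rule dvd_prodI) (use fin pos[OF that] in auto)
 have sub: "xp a dvd xp b" if "a dvd b" "b \<in> ?A" for a b
 proof -
  have "a \<in> ?A" using that less.prems pos[OF that(2)] by (auto dest: dvd_imp_le intro: dvd_trans)
  then show ?thesis unfolding ih[OF that(2), symmetric] ih[OF \<open>a \<in> ?A\<close>, symmetric]
   by (intro prod_dvd_prod_subset) (use that fin pos[OF that(2)] in \<open>auto intro: dvd_trans\<close>)
 qed
 have sq: "is_unit c" if c: "c dvd cyclo d" "c dvd xp g" and g: "g dvd d" "g < d" and d: "d \<in> ?A" for c d g
 proof -
  have gA: "g \<in> ?A" using g d less.prems by (auto intro: dvd_trans)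
  have f: "finite {e. e dvd d \<and> e ~= d}" by (rule finite_subset[OF _ fin[OF pos[OF d]]]) blast
  have e: "{e. e dvd d} = insert d {e. e dvd d \<and> e ~= d}" by auto
  have "xp d = cyclo d * (\<Prod>e\<in>{e. e dvd d \<and> e ~= d}. cyclo e)"
   unfolding ih[OF d, symmetric] by (subst e, subst prod.insert[OF f]) simp_all
  moreover have "xp g dvd (\<Prod>e\<in>{e. e dvd d \<and> e ~= d}. cyclo e)"
   unfolding ih[OF gA, symmetric]
   by (rule prod_dvd_prod_subset) (use fin pos[OF d] g in \<open>auto intro: dvd_trans dest: dvd_antisym\<close>)
  ultimately have "c * c dvd xp d" using c by (auto intro: mult_dvd_mono dvd_trans)
  then show ?thesis using xp_squarefree pos[OF d] by blast
 qed
 have "coprime (cyclo d) (cyclo d')" if d: "d \<in> ?A" "d' \<in> ?A" "d ~= d'" for d d'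
 proof (rule coprimeI)
  fix c assume c: "c dvd cyclo d" "c dvd cyclo d'"
  have g: "c dvd xp (gcd d d')"
   by (rule xp_common_divisor) (use c dv d pos in \<open>auto intro: dvd_trans\<close>)
  have "gcd d d' < d \<or> gcd d d' < d'"
  proof (rule ccontr)
   assume "\<not> ?thesis"
   moreover have "gcd d d' <= d" "gcd d d' <= d'"
    using pos[OF d(1)] pos[OF d(2)] by (auto intro!: dvd_imp_le)
   ultimately have "gcd d d' = d" "gcd d d' = d'" by simp_all
   then show False using d(3) by simp
  qed
  then show "is_unit c" using sq[OF c(1) g] sq[OF c(2) g] d by auto
 qed
 then have "prod cyclo ?A dvd xp m"
 proof (intro prod_dvd_coprime[OF fA])
  fix d assume d: "d \<in> ?A"
  have "c dvd xp m" if "c dvd xp d" for c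
  proof -
   obtain k where k: "m = k * d" using d by (auto simp: dvd_def mult.commute)
   have "c dvd xp (j * d)" for j
   proof (induction j)
    case (Suc j)
    have e: "xp (Suc j * d) = monom 1 d * xp (j * d) + xp d" by (simp add: algebra_simps mult_monom)
    show ?case unfolding e using Suc that by (intro dvd_add dvd_mult)
   qed simp
   then show ?thesis using k by simp
  qed
  then show "cyclo d dvd xp m" using dv[OF d] by blast
 qed
 moreover have "cyclo m = xp m div prod cyclo ?A" using less.prems by (subst cyclo.simps) simp
 moreover have "{d. d dvd m} = insert m ?A" using less.prems by (auto dest: dvd_imp_le)
 then have "(\<Prod>d\<in>{d. d dvd m}. cyclo d) = cyclo m * prod cyclo ?A" by simp
 ultimately show ?case by simp
qed

lemma fls_of_poly_xp: "fps_to_fls (fps_of_poly (xp m)) = tt ^ m - 1"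
 by (simp add: fps_of_poly_diff fps_of_poly_monom fps_to_fls_power)

lemma fls_of_poly_prod: "fps_to_fls (fps_of_poly (prod f A)) = (\<Prod>d\<in>A. fps_to_fls (fps_of_poly (f d :: rat poly)))"
 by (induction A rule: infinite_finite_induct) (simp_all add: fps_of_poly_mult fls_times_fps_to_fls)

lemma prod_cyclo_t:
 assumes "1 <= m" shows "(\<Prod>d\<in>{d. d dvd m}. cyclo_t d) = tt ^ m - 1"
 unfolding cyclo_t_def fls_of_poly_prod[symmetric] prod_cyclo[OF assms] fls_of_poly_xp ..

lemma cyclo_t_1: "cyclo_t 1 = tt - 1"
 using prod_cyclo_t[of 1] by simp

lemma cyclo_t_nonzero: "1 <= e ==> cyclo_t e ~= 0"
proof
 assume e: "1 <= e" "cyclo_t e = 0"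
 have "finite {d. d dvd e}" using e by simp
 then have "(\<Prod>d\<in>{d. d dvd e}. cyclo_t d) = 0" using e by (intro prod_zero bexI[of _ e]) auto
 then have "tt powi (int e) = tt powi 0" using prod_cyclo_t[OF e(1)] by simp
 then show False unfolding tt_powi_inj using e(1) by simp
qed

text \<open>Writing the factorisation with \<open>powi\<close> and an indicator over the uniform
  range \<open>{2..M}\<close> turns quotients of quantum integers into sums of exponents.\<close>

lemma qint_cyclo:
 assumes m: "1 <= m" "m <= int M"
 shows "qint m = (\<Prod>e\<in>{2..M}. cyclo_t e powi (if int e dvd m then 1 else 0))"
proof -
 let ?m = "nat m"
 have s: "{d. d dvd ?m} = insert 1 {e \<in> {2..M}. e dvd ?m}"
 proof -
  have "d \<in> {2..M}" if "d dvd ?m" "d ~= 1" for d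
  proof -
   have "d ~= 0" "d <= ?m" using that m by (auto dest: dvd_imp_le intro!: gr0I)
   then show ?thesis using that m by auto
  qed
  then show ?thesis by auto
 qed
 have "qint m = (tt ^ ?m - 1) / (tt - 1)" using m by (simp add: qint_eq power_int_def)
 also have "tt ^ ?m - 1 = (tt - 1) * (\<Prod>e\<in>{e \<in> {2..M}. e dvd ?m}. cyclo_t e)"
  using prod_cyclo_t[of ?m] m unfolding s by (simp add: cyclo_t_1[unfolded One_nat_def])
 also have "\<dots> / (tt - 1) = (\<Prod>e\<in>{e \<in> {2..M}. e dvd ?m}. cyclo_t e)"
  using tt_minus_1 by simp
 also have "\<dots> = (\<Prod>e\<in>{2..M}. if e dvd ?m then cyclo_t e else 1)"
  by (rule prod.inter_filter) simp
 also have "\<dots> = (\<Prod>e\<in>{2..M}. cyclo_t e powi (if int e dvd m then 1 else 0))"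
  using m by (intro prod.cong refl) (auto simp: int_dvd_int_iff[symmetric])
 finally show ?thesis .
qed

section \<open>Matching exponents with degrees\<close>

context seminormal
begin

definition ind :: "nat => int => int" where "ind e d = (if int e dvd d then 1 else 0)"
definition QQ :: "tableau => node => node set" where "QQ t A = {Q. (A, Q) \<in> IP t}"
text \<open>The exponent of the \<open>e\<close>-th cyclotomic polynomial in \<open>ww t A\<close>,
  the share of node \<open>A\<close> in the factor of the tableau \<open>t\<close>. It has the form
  of the left-hand side of \<open>second_difference_sum\<close> with
  \<open>F = ind e\<close>.\<close>

definition dg :: "nat => tableau => node => int" where
 "dg e t A = ind e (int (snd (snd A)) + 1) + (\<Sum>m\<in>{fst A<..<ell}. ind e (ct A - kappa ! m))
  + (\<Sum>Q\<in>QQ t A. ind e (ct A - ct Q + 1) + ind e (ct A - ct Q - 1) - 2 * ind e (ct A - ct Q))"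

lemma cont_ct: "cont kappa = ct"
 by (rule ext) (auto simp: cont_def)

lemma young_set_restrict:
 assumes t: "t \<in> S" shows "young_set ell {x. 1 <= t x \<and> t x <= k}"
proof -
 have sub: "x \<in> D" if "1 <= t x" for x using std_out[OF t, of x] that by auto
 have fin: "finite {x. 1 <= t x \<and> t x <= k}" by (rule finite_subset[OF _ finite_diagram[of lam]]) (use sub in blast)
 have l: "l < ell" if "1 <= t (l, r, c)" for l r c using sub[OF that] length_lam by (simp add: diagram_iff)
 have c: "1 <= t (l, r, c) \<and> t (l, r, c) <= k" if "1 <= t (l, r, Suc c)" "t (l, r, Suc c) <= k" for l r c
  using sub[OF that(1)] D_down1(1)[OF sub[OF that(1)]] std_range[OF t] std_cover[OF t, of "(l, r, c)" "(l, r, Suc c)"] that by fastforce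
 have r: "1 <= t (l, r, c) \<and> t (l, r, c) <= k" if "1 <= t (l, Suc r, c)" "t (l, Suc r, c) <= k" for l r c
  using sub[OF that(1)] D_down1(2)[OF sub[OF that(1)]] std_range[OF t] std_cover[OF t, of "(l, r, c)" "(l, Suc r, c)"] that by fastforce
 show ?thesis unfolding young_set_def mem_Collect_eq using fin l c r by blast
qed

lemma deg_sub_sum:
 assumes t: "t \<in> S"
 shows "deg_sub e kappa t n = (\<Sum>A\<in>D. d_node e kappa A {x. 1 <= t x \<and> t x <= t A})"
proof -
 let ?g = "\<lambda>k. d_node e kappa (THE A. t A = k) {x. 1 <= t x \<and> t x <= k}"
 have "deg_sub e kappa t m = (\<Sum>k\<in>{1..m}. ?g k)" for m by (induction m) simp_all
 then have "deg_sub e kappa t n = (\<Sum>k\<in>{1..n}. ?g k)" .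
 also have "\<dots> = (\<Sum>A\<in>D. ?g (t A))" by (rule sum.reindex_bij_betw[OF std_bij[OF t], symmetric])
 also have "\<dots> = (\<Sum>A\<in>D. d_node e kappa A {x. 1 <= t x \<and> t x <= t A})"
 proof (rule sum.cong[OF refl])
  fix A assume A: "A \<in> D"
  have "(THE A'. t A' = t A) = A"
  proof (rule the_equality)
   fix A' assume e: "t A' = t A"
   then have "A' \<in> D" using std_range(1)[OF t A] std_out[OF t, of A'] by auto
   then show "A' = A" using std_inj[OF t _ A e] by blast
  qed simp
  then show "?g (t A) = d_node e kappa A {x. 1 <= t x \<and> t x <= t A}" by simp
 qed
 finally show ?thesis .
qed

text \<open>In the subtableau up to the entry of \<open>A\<close>, the node \<open>A\<close> is a
  corner, and the nodes below it are those inverted with \<open>A\<close>. Equality of residues is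
  divisibility of a content difference, so \<open>second_difference_sum\<close> applies to the
  divisibility indicator.\<close>

lemma d_node_dg:
 assumes t: "t \<in> S" and A: "A \<in> D" and e: "2 <= e"
 shows "d_node e kappa A {x. 1 <= t x \<and> t x <= t A} = dg e t A"
proof -
 obtain m0 r0 c0 where a: "A = (m0, r0, c0)" by (metis prod_cases3)
 let ?X = "{x. 1 <= t x \<and> t x <= t A}"
 have y: "young_set ell ?X" by (rule young_set_restrict[OF t])
 have X1: "(m0, r0, c0) \<in> ?X" using std_range(1)[OF t A] a by simp
 have nX: "x \<notin> ?X" if "cover A x" for x
  using std_cover[OF t A _ that] std_out[OF t, of x] by (cases "x \<in> D") auto
 have X2: "(m0, r0, Suc c0) \<notin> ?X" "(m0, Suc r0, c0) \<notin> ?X" using nX a by simp_all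
 have F1: "ind e (-1) = 0" using e by (simp add: ind_def)
 note sd = second_difference_sum(1)[where F = "ind e" and kappa = kappa, OF y X1 X2 F1, folded a, unfolded cont_ct]
 note fin = second_difference_sum(2,3)[where F = "ind e", OF y X1 X2 F1, folded a]
 have Q: "{Q \<in> ?X. node_below Q A} = QQ t A"
 proof (intro equalityI subsetI)
  fix Q assume q: "Q \<in> {Q \<in> ?X. node_below Q A}"
  then have QD: "Q \<in> D" using std_out[OF t, of Q] by auto
  have "Q ~= A" using q node_below_asym by blast
  then have "t Q ~= t A" using std_inj[OF t QD A] by blast
  then show "Q \<in> QQ t A" using q QD A tlam_less_iff[OF A QD] by (simp add: QQ_def IP_def)
 next
  fix Q assume "Q \<in> QQ t A"
  then have h: "Q \<in> D" "tla A < tla Q" "t Q < t A" by (simp_all add: QQ_def IP_def)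
  then show "Q \<in> {Q \<in> ?X. node_below Q A}" using tlam_less_iff[OF A h(1)] std_range(1)[OF t h(1)] by simp
 qed
 have res: "residue e kappa B = residue e kappa A \<longleftrightarrow> int e dvd (ct A - ct B)" for B
 proof -
  have "residue e kappa B = ct B mod int e" for B by (cases B) (simp add: residue_def)
  then show ?thesis using mod_eq_dvd_iff[of "ct A" "int e" "ct B"] by auto
 qed
 have cardF: "int (card {B \<in> Z. residue e kappa B = residue e kappa A \<and> node_below B A})
   = (\<Sum>B\<in>{B \<in> Z. node_below B A}. ind e (ct A - ct B))" if "finite {B \<in> Z. node_below B A}" for Z
 proof -
  have "{B \<in> Z. residue e kappa B = residue e kappa A \<and> node_below B A}
    = {B \<in> {B \<in> Z. node_below B A}. int e dvd (ct A - ct B)}" unfolding res by blast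
  then show ?thesis using sum.inter_filter[OF that, of "\<lambda>_. 1 :: int"] by (simp add: ind_def)
 qed
 show ?thesis
  unfolding d_node_def kap cardF[OF fin(1)] cardF[OF fin(2)] sd[symmetric] Q dg_def using a by simp
qed

lemma deg_lam_dg:
 assumes e: "2 <= e" shows "deg_lam e n kappa lam = (\<Sum>t\<in>S. \<Sum>A\<in>D. dg e t A)"
 unfolding deg_lam_def
proof (rule sum.cong[OF refl])
 fix t assume t: "t \<in> S"
 show "deg_sub e kappa t n = (\<Sum>A\<in>D. dg e t A)"
  unfolding deg_sub_sum[OF t] by (intro sum.cong refl d_node_dg[OF t _ e])
qed

definition ww :: "tableau => node => laurent" where
 "ww t A = qint (int (snd (snd A)) + 1) * (\<Prod>m\<in>{fst A<..<ell}. qint (ct A - kappa ! m))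
  * (\<Prod>Q\<in>QQ t A. qint (ct A - ct Q + 1) * qint (ct A - ct Q - 1) / (qint (ct A - ct Q) * qint (ct A - ct Q)))"

text \<open>Grouping inverted pairs by their first node attaches each factor to the node with the
  larger entry, in agreement with the recursive definition of the degree.\<close>

lemma gram_det_ww: "gram_det n kappa lam = tt ^ len_lam n lam * (\<Prod>t\<in>S. \<Prod>A\<in>D. ww t A)"
proof -
 have "gam * (pc t * pc t * G0 t) = tt ^ perm_length n (dperm n lam t) * (\<Prod>A\<in>D. ww t A)" if t: "t \<in> S" for t
 proof -
  have ip: "IP t = Sigma D (QQ t)" by (auto simp: QQ_def IP_def)
  have fQ: "finite (QQ t A)" for A by (rule finite_subset[OF _ finite_diagram[of lam]]) (auto simp: QQ_def IP_def)
  have "(\<Prod>(P, Q)\<in>IP t. qint (ct P - ct Q + 1) * qint (ct P - ct Q - 1) / (qint (ct P - ct Q) * qint (ct P - ct Q)))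
   = (\<Prod>A\<in>D. \<Prod>Q\<in>QQ t A. qint (ct A - ct Q + 1) * qint (ct A - ct Q - 1) / (qint (ct A - ct Q) * qint (ct A - ct Q)))"
   unfolding ip by (rule prod.Sigma[symmetric]) (use fQ in auto)
  then show ?thesis
   using vv_triangular[OF t] unfolding pc_G0[OF t] gam_eq ww_def prod.distrib by (simp only: mult_ac)
 qed
 then show ?thesis unfolding gram_det_diag len_lam_def power_sum prod.distrib[symmetric]
  by (intro prod.cong refl)
qed

text \<open>A single bound for the arguments of all quantum integers involved, so that all
  factorisations run over the same finite range of \<open>e\<close>.\<close>

lemma content_bound: "\<exists>M::nat. \<forall>A\<in>D. int (snd (snd A)) + 1 <= int M \<and> (\<forall>m<ell. ct A - kappa ! m <= int M)
  \<and> (\<forall>Q\<in>D. ct A - ct Q + 1 <= int M)"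
proof -
 let ?Z = "(\<lambda>x. int (snd (snd x)) + 1) ` D \<union> (\<lambda>(x, m). ct x - kappa ! m) ` (D \<times> {..<ell}) \<union> (\<lambda>(x, y). ct x - ct y + 1) ` (D \<times> D)"
 have fin: "finite (insert 0 ?Z)" by simp
 have le: "z <= int (nat (Max (insert 0 ?Z)))" if "z \<in> ?Z" for z
 proof -
  have "z <= Max (insert 0 ?Z)" using that by (intro Max_ge[OF fin]) blast
  then show ?thesis by (rule order_trans) simp
 qed
 show ?thesis by (rule exI[of _ "nat (Max (insert 0 ?Z))"], intro ballI conjI allI impI; rule le) auto
qed

theorem gram_det_cyclotomic:
 "finite {e. 2 <= e \<and> deg_lam e n kappa lam ~= 0}
  \<and> gram_det n kappa lam = tt ^ len_lam n lam
     * (\<Prod>e\<in>{e. 2 <= e \<and> deg_lam e n kappa lam ~= 0}. cyclo_t e powi deg_lam e n kappa lam)"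
proof -
 obtain M where M: "\<And>A. A \<in> D ==> int (snd (snd A)) + 1 <= int M" "\<And>A m. A \<in> D ==> m < ell ==> ct A - kappa ! m <= int M"
  "\<And>A Q. A \<in> D ==> Q \<in> D ==> ct A - ct Q + 1 <= int M" using content_bound by meson
 have pos: "1 <= ct A - kappa ! m" if "A \<in> D" "m \<in> {fst A<..<ell}" for A m
 proof -
  obtain l r c where a: "A = (l, r, c)" by (metis prod_cases3)
  have "r < n" using that(1) part_length_le[OF mp, of l] length_lam a by (auto simp: diagram_iff)
  then show ?thesis using kappa_gap[of l m] that a by simp
 qed
 have QD: "Q \<in> D" "ct A - ct Q \<ge> 2" if "t \<in> S" "Q \<in> QQ t A" for t A Q
  using that IP_ct[of t A Q] by (auto simp: QQ_def IP_def)
 \<comment> \<open>\<open>H\<close> turns an exponent function into a product of cyclotomic powers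
   and sums into products, so the claim reduces to one node of one tableau.\<close>
 define H where "H f = (\<Prod>e\<in>{2..M}. cyclo_t e powi f e)" for f :: "nat => int"
 have nz: "e \<in> {2..M} ==> cyclo_t e ~= 0" for e using cyclo_t_nonzero[of e] by simp
 have H_add: "H (\<lambda>e. f e + g e) = H f * H g" for f g
  unfolding H_def prod.distrib[symmetric] by (intro prod.cong refl power_int_add) (use nz in blast)
 have H_diff: "H (\<lambda>e. f e - g e) = H f / H g" for f g
  unfolding H_def prod_dividef[symmetric] by (intro prod.cong refl power_int_diff) (use nz in blast)
 have H0: "H (\<lambda>e. 0) = 1" by (simp add: H_def)
 have H_sum: "H (\<lambda>e. \<Sum>i\<in>I. f i e) = (\<Prod>i\<in>I. H (f i))" for f and I :: "'i set"
  by (induction I rule: infinite_finite_induct) (simp_all add: H0 H_add)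
 have H_ind: "H (\<lambda>e. ind e d) = qint d" if "1 <= d" "d <= int M" for d
  unfolding H_def ind_def using qint_cyclo[OF that] by simp
 have H_dg: "ww t A = H (\<lambda>e. dg e t A)" if t: "t \<in> S" and A: "A \<in> D" for t A
 proof -
  have 1: "H (\<lambda>e. ind e (int (snd (snd A)) + 1)) = qint (int (snd (snd A)) + 1)"
   using M(1)[OF A] by (intro H_ind) simp_all
  have 2: "(\<Prod>m\<in>{fst A<..<ell}. H (\<lambda>e. ind e (ct A - kappa ! m))) = (\<Prod>m\<in>{fst A<..<ell}. qint (ct A - kappa ! m))"
   using M(2)[OF A] pos[OF A] by (intro prod.cong refl H_ind) simp_all
  have 3: "H (\<lambda>e. ind e (ct A - ct Q + 1) + ind e (ct A - ct Q - 1) - 2 * ind e (ct A - ct Q))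
    = qint (ct A - ct Q + 1) * qint (ct A - ct Q - 1) / (qint (ct A - ct Q) * qint (ct A - ct Q))" if q: "Q \<in> QQ t A" for Q
  proof -
   have "H (\<lambda>e. ind e (ct A - ct Q + 1)) = qint (ct A - ct Q + 1)" "H (\<lambda>e. ind e (ct A - ct Q - 1)) = qint (ct A - ct Q - 1)"
    "H (\<lambda>e. ind e (ct A - ct Q)) = qint (ct A - ct Q)"
    using M(3)[OF A QD(1)[OF t q]] QD(2)[OF t q] by (intro H_ind; simp)+
   then show ?thesis unfolding mult_2 H_diff H_add by simp
  qed
  show ?thesis unfolding dg_def ww_def H_add H_sum 1 2 using 3 by (simp cong: prod.cong)
 qed
 have "gram_det n kappa lam = tt ^ len_lam n lam * H (\<lambda>e. \<Sum>t\<in>S. \<Sum>A\<in>D. dg e t A)"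
  unfolding gram_det_ww H_sum using H_dg by (simp cong: prod.cong)
 also have "H (\<lambda>e. \<Sum>t\<in>S. \<Sum>A\<in>D. dg e t A) = (\<Prod>e\<in>{2..M}. cyclo_t e powi deg_lam e n kappa lam)"
  unfolding H_def by (intro prod.cong refl) (simp add: deg_lam_dg)
 finally have g: "gram_det n kappa lam = tt ^ len_lam n lam * (\<Prod>e\<in>{2..M}. cyclo_t e powi deg_lam e n kappa lam)" .
 \<comment> \<open>For \<open>e > M\<close> all arguments lie strictly between \<open>0\<close> and
   \<open>e\<close>, so every indicator vanishes and the degree is zero.\<close>
 have sub: "{e. 2 <= e \<and> deg_lam e n kappa lam ~= 0} \<subseteq> {2..M}"
 proof
  fix e assume "e \<in> {e. 2 <= e \<and> deg_lam e n kappa lam ~= 0}"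
  then have e: "2 <= e" "deg_lam e n kappa lam ~= 0" by simp_all
  have "e <= M"
  proof (rule ccontr)
   assume "\<not> e <= M"
   then have i0: "ind e d = 0" if "1 <= d" "d <= int M" for d
    using that zdvd_imp_le[of "int e" d] by (auto simp: ind_def)
   have "dg e t A = 0" if t: "t \<in> S" and A: "A \<in> D" for t A
   proof -
    have "ind e (int (snd (snd A)) + 1) = 0" using M(1)[OF A] by (intro i0) simp_all
    moreover have "(\<Sum>m\<in>{fst A<..<ell}. ind e (ct A - kappa ! m)) = 0"
     using M(2)[OF A] pos[OF A] by (intro sum.neutral ballI i0) simp_all
    moreover have "(\<Sum>Q\<in>QQ t A. ind e (ct A - ct Q + 1) + ind e (ct A - ct Q - 1) - 2 * ind e (ct A - ct Q)) = 0"
    proof (intro sum.neutral ballI)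
     fix Q assume q: "Q \<in> QQ t A"
     have "ind e (ct A - ct Q + 1) = 0" "ind e (ct A - ct Q - 1) = 0" "ind e (ct A - ct Q) = 0"
      using M(3)[OF A QD(1)[OF t q]] QD(2)[OF t q] by (intro i0; simp)+
     then show "ind e (ct A - ct Q + 1) + ind e (ct A - ct Q - 1) - 2 * ind e (ct A - ct Q) = 0" by simp
    qed
    ultimately show ?thesis by (simp add: dg_def)
   qed
   then show False using e deg_lam_dg[OF e(1)] by simp
  qed
  then show "e \<in> {2..M}" using e by simp
 qed
 have "(\<Prod>e\<in>{2..M}. cyclo_t e powi deg_lam e n kappa lam)
   = (\<Prod>e\<in>{e. 2 <= e \<and> deg_lam e n kappa lam ~= 0}. cyclo_t e powi deg_lam e n kappa lam)"
  by (rule prod.mono_neutral_right[OF _ sub]) auto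
 then show ?thesis using g finite_subset[OF sub] by simp
qed

end

theorem theorem3p13:
  fixes ell n :: nat and kappa :: "int list" and lam :: mpart
  assumes "ell \<ge> 1"
    and "multipartition ell n lam"
    and "length kappa = ell"
    and "\<forall>l. l + 1 < ell \<longrightarrow> kappa ! l - kappa ! (l + 1) > int n"
  shows "finite {e. 2 \<le> e \<and> deg_lam e n kappa lam \<noteq> 0}
    \<and> gram_det n kappa lam
        = tt ^ len_lam n lam
          * (\<Prod>e\<in>{e. 2 \<le> e \<and> deg_lam e n kappa lam \<noteq> 0}. cyclo_t e powi deg_lam e n kappa lam)"
proof -
  interpret seminormal ell n lam kappa by unfold_locales (use assms in auto)
  show ?thesis by (rule gram_det_cyclotomic)
qed

end
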